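(* Suppose $\limsup_{t\to\infty}Z(t)=\infty$ with probability $1$ or $K<\infty$. Then the sampling procedure described in the context stops with probability $1$, and its output is a sample value of $(\tau,\ Z^+(\tau-),\ Z^-(\tau),\ \Delta_Z(\tau))$ (that is, the output has the same distribution as this random vector), where $\tau=\tau^Z_a\wedge K$.
   Context: $Z$ is a real-valued Lévy process started at $0$ with bounded variation and non-positive drift, whose Lévy measure $\Pi$ satisfies $$\Pi(\mathbb R)=\infty,\qquad \int_{-\infty}^\infty(|x|\wedge1)\,\Pi(\mathrm dx)<\infty.$$ Constants $a>0$ and $0<K\le\infty$ are given; $\tau^Z_a=\inf\{t>0:Z(t)>a\}$ with $\inf\emptyset=\infty$. Decompose $Z=Z^+-Z^-$, where $Z^\pm$ are independent subordinators with Lévy measures $\Pi^+(\mathrm dx)=\mathbf 1\{x>0\}\Pi(\mathrm dx)$ and $\Pi^-(\mathrm dx)=\mathbf 1\{x>0\}\Pi(-\mathrm dx)$, respectively, with $Z^+$ having no drift. For a process $Y$, $\Delta_Y(t)=Y(t)-Y(t-)$. For $b>0$, $\tau^{Z^+}_b=\inf\{t>0:Z^+(t)>b\}$. Procedure. In each iteration the random quantities are sampled afresh, independently of the past given the current values of the variables. Initialization: set $T=H^+=H^-=0$, $A=K$, $b=a$. Step 1. Sample $(t,z^+,v)\sim(\tau^+,\ Z^+(\tau^+-),\ \Delta_{Z^+}(\tau^+))$, where $\tau^+=\tau^{Z^+}_b\wedge A$. Set $x=z^++v$. Step 2. Sample $z^-\sim Z^-(t)$ (independently, given $t$). Step 3.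 Update $T\leftarrow T+t$, $H^+\leftarrow H^++x$, $H^-\leftarrow H^-+z^-$. Step 4. If $x-z^-<b$ and $t<A$, then update $A\leftarrow A-t$, $b\leftarrow b+z^--x$, and go back to Step 1 to start a new independent iteration; else output $(T,H^+-v,H^-,v)$ and stop. *)

theory Defs
  imports "HOL-Probability.Probability"
begin

section \<open>Paths\<close>

text \<open>
  A process is a function \<open>X\<close> with \<open>X t \<omega>\<close> its value at time \<open>t\<close>. Time is real and only
  \<open>t \<ge> 0\<close> is meaningful. Times that may be infinite have type \<^typ>\<open>ennreal\<close>.
\<close>

definition cadlag :: "(real \<Rightarrow> real) \<Rightarrow> bool" where
  "cadlag f \<longleftrightarrow>
     (\<forall>t\<ge>0. (f \<longlongrightarrow> f t) (at_right t)) \<and> (\<forall>t>0. \<exists>l. (f \<longlongrightarrow> l) (at_left t))"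

text \<open>The value \<open>f(t-)\<close>, with the usual convention \<open>f(0-) = f(0)\<close>.\<close>

definition left_limit :: "(real \<Rightarrow> real) \<Rightarrow> real \<Rightarrow> real" where
  "left_limit f t = (if t \<le> 0 then f 0 else Lim (at_left t) f)"

definition jump :: "(real \<Rightarrow> real) \<Rightarrow> real \<Rightarrow> real" where
  "jump f t = f t - left_limit f t"

definition locally_bounded_variation :: "(real \<Rightarrow> real) \<Rightarrow> bool" where
  "locally_bounded_variation f \<longleftrightarrow>
     (\<forall>T. \<exists>C. \<forall>(t :: nat \<Rightarrow> real) n.
        mono t \<and> range t \<subseteq> {0..T} \<longrightarrow> (\<Sum>i<n. \<bar>f (t (Suc i)) - f (t i)\<bar>) \<le> C)"

text \<open>\<open>inf {t > 0. f t > b}\<close>; the infimum of the empty set in \<^typ>\<open>ennreal\<close> is \<open>\<infinity>\<close>.\<close>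

definition first_passage :: "(real \<Rightarrow> real) \<Rightarrow> real \<Rightarrow> ennreal" where
  "first_passage f b = (INF t\<in>{t. 0 < t \<and> f t > b}. ennreal t)"

section \<open>Levy processes\<close>

definition levy_process :: "'a measure \<Rightarrow> (real \<Rightarrow> 'a \<Rightarrow> real) \<Rightarrow> bool" where
  "levy_process M X \<longleftrightarrow>
     prob_space M \<and>
     (\<forall>t\<ge>0. X t \<in> borel_measurable M) \<and>
     (\<forall>\<omega>\<in>space M. X 0 \<omega> = 0 \<and> cadlag (\<lambda>t. X t \<omega>)) \<and>
     (\<forall>t :: nat \<Rightarrow> real. 0 \<le> t 0 \<and> mono t \<longrightarrow>
        prob_space.indep_vars M (\<lambda>_. borel) (\<lambda>i \<omega>. X (t (Suc i)) \<omega> - X (t i) \<omega>) UNIV) \<and>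
     (\<forall>s\<ge>0. \<forall>h\<ge>0. distr M borel (\<lambda>\<omega>. X (s + h) \<omega> - X s \<omega>) = distr M borel (X h))"

definition bounded_variation_process :: "'a measure \<Rightarrow> (real \<Rightarrow> 'a \<Rightarrow> real) \<Rightarrow> bool" where
  "bounded_variation_process M X \<longleftrightarrow> (\<forall>\<omega>\<in>space M. locally_bounded_variation (\<lambda>t. X t \<omega>))"

text \<open>
  Drift \<open>d\<close> and Levy measure \<open>\<nu>\<close> of a Levy process of bounded variation, read off from its
  Levy-Khintchine formula. As usual for such processes there is no Gaussian part and the small
  jumps are not compensated, so that \<open>d\<close> is the drift of the paths, that is,
  \<open>X(t) = d t + (sum of the jumps up to time t)\<close>.
\<close>

definition drift_levy_measure ::
    "'a measure \<Rightarrow> (real \<Rightarrow> 'a \<Rightarrow> real) \<Rightarrow> real \<Rightarrow> real measure \<Rightarrow> bool" where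
  "drift_levy_measure M X d \<nu> \<longleftrightarrow>
     sets \<nu> = sets borel \<and> emeasure \<nu> {0} = 0 \<and>
     (\<integral>\<^sup>+ x. ennreal (min \<bar>x\<bar> 1) \<partial>\<nu>) < \<infinity> \<and>
     (\<forall>t\<ge>0. \<forall>\<theta>. char (distr M borel (X t)) \<theta> =
        exp (complex_of_real t *
          (\<i> * complex_of_real (\<theta> * d) + (CLINT x|\<nu>. iexp (\<theta> * x) - 1))))"

definition subordinator :: "'a measure \<Rightarrow> (real \<Rightarrow> 'a \<Rightarrow> real) \<Rightarrow> bool" where
  "subordinator M X \<longleftrightarrow> levy_process M X \<and> (\<forall>\<omega>\<in>space M. mono_on {0..} (\<lambda>t. X t \<omega>))"

definition indep_processes ::
    "'a measure \<Rightarrow> (real \<Rightarrow> 'a \<Rightarrow> real) \<Rightarrow> (real \<Rightarrow> 'a \<Rightarrow> real) \<Rightarrow> bool" where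
  "indep_processes M X Y \<longleftrightarrow>
     prob_space.indep_var M
       (PiM {0..} (\<lambda>_. borel)) (\<lambda>\<omega>. \<lambda>t\<in>{0..}. X t \<omega>)
       (PiM {0..} (\<lambda>_. borel)) (\<lambda>\<omega>. \<lambda>t\<in>{0..}. Y t \<omega>)"

definition positive_part_measure :: "real measure \<Rightarrow> real measure" where
  "positive_part_measure \<nu> = density \<nu> (indicator {0<..})"

definition negative_part_measure :: "real measure \<Rightarrow> real measure" where
  "negative_part_measure \<nu> = density (distr \<nu> borel uminus) (indicator {0<..})"

section \<open>The sampling procedure\<close>

text \<open>
  A configuration \<open>(go, T, H\<^sup>+, H\<^sup>-, A, b, v)\<close> holds the variables of the procedure between two
  iterations. The flag \<open>go\<close> is \<^const>\<open>False\<close> once the procedure has stopped, and \<open>v\<close> is the value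
  sampled in the last iteration, which is needed for the output (its initial value is irrelevant).
\<close>

type_synonym config = "bool \<times> ennreal \<times> real \<times> real \<times> ennreal \<times> real \<times> real"

definition config_space :: "config measure" where
  "config_space = count_space UNIV \<Otimes>\<^sub>M borel \<Otimes>\<^sub>M borel \<Otimes>\<^sub>M borel \<Otimes>\<^sub>M borel \<Otimes>\<^sub>M borel \<Otimes>\<^sub>M borel"

definition initial_config :: "real \<Rightarrow> ennreal \<Rightarrow> config" where
  "initial_config a K = (True, 0, 0, 0, K, a, 0)"

fun running :: "config \<Rightarrow> bool" where
  "running (go, T, Hp, Hm, A, b, v) = go"

fun config_output :: "config \<Rightarrow> ennreal \<times> real \<times> real \<times> real" where
  "config_output (go, T, Hp, Hm, A, b, v) = (T, Hp - v, Hm, v)"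

text \<open>
  The law of \<open>(\<tau>, Y(\<tau>-), \<Delta>\<^sub>Y(\<tau>))\<close> for \<open>\<tau>\<close> the first passage time of \<open>Y\<close> above \<open>b\<close>, capped at \<open>A\<close>.
  Since \<open>enn2real \<infinity> = 0\<close>, the last two components have the dummy values
  \<open>Y(0)\<close> and \<open>0\<close> on the event \<open>\<tau> = \<infinity>\<close>.
\<close>

definition step1_law ::
    "'a measure \<Rightarrow> (real \<Rightarrow> 'a \<Rightarrow> real) \<Rightarrow> ennreal \<Rightarrow> real \<Rightarrow> (ennreal \<times> real \<times> real) measure" where
  "step1_law M Y A b = distr M (borel \<Otimes>\<^sub>M borel \<Otimes>\<^sub>M borel) (\<lambda>\<omega>.
     let \<tau> = min (first_passage (\<lambda>t. Y t \<omega>) b) A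
     in (\<tau>, left_limit (\<lambda>t. Y t \<omega>) (enn2real \<tau>), jump (\<lambda>t. Y t \<omega>) (enn2real \<tau>)))"

definition step2_law :: "'a measure \<Rightarrow> (real \<Rightarrow> 'a \<Rightarrow> real) \<Rightarrow> ennreal \<Rightarrow> real measure" where
  "step2_law M Y t = distr M borel (Y (enn2real t))"

text \<open>
  One iteration as a transition kernel. A stopped configuration stays put.
\<close>

fun iteration ::
    "'a measure \<Rightarrow> (real \<Rightarrow> 'a \<Rightarrow> real) \<Rightarrow> (real \<Rightarrow> 'a \<Rightarrow> real) \<Rightarrow> config \<Rightarrow> config measure" where
  "iteration M Zp Zm (go, T, Hp, Hm, A, b, v0) =
     (if \<not> go then return config_space (go, T, Hp, Hm, A, b, v0)
      else do {
        (t, zp, v) \<leftarrow> step1_law M Zp A b;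
        zm \<leftarrow> step2_law M Zm t;
        let x = zp + v;
        return config_space
          (if x - zm < b \<and> t < A
           then (True, T + t, Hp + x, Hm + zm, A - t, b + zm - x, v)
           else (False, T + t, Hp + x, Hm + zm, A, b, v))
      })"

text \<open>
  A run of the procedure, realised on an arbitrary probability space \<open>N\<close>: \<open>C n\<close> is the configuration
  after \<open>n\<close> iterations, and given the configurations \<open>C 0, \<dots>, C n\<close> the next one is sampled from
  \<open>iteration M Zp Zm (C n)\<close>. The history \<open>C 0, \<dots>, C n\<close> enters through the test sets \<open>B\<close>.
\<close>

definition procedure_run ::
    "'a measure \<Rightarrow> (real \<Rightarrow> 'a \<Rightarrow> real) \<Rightarrow> (real \<Rightarrow> 'a \<Rightarrow> real) \<Rightarrow> real \<Rightarrow> ennreal \<Rightarrow>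
     'w measure \<Rightarrow> (nat \<Rightarrow> 'w \<Rightarrow> config) \<Rightarrow> bool" where
  "procedure_run M Zp Zm a K N C \<longleftrightarrow>
     prob_space N \<and>
     (\<forall>n. C n \<in> measurable N config_space) \<and>
     (AE w in N. C 0 w = initial_config a K) \<and>
     (\<forall>n. \<forall>B\<in>sets (PiM {..n} (\<lambda>_. config_space)). \<forall>D\<in>sets config_space.
        emeasure N {w\<in>space N. (\<lambda>i\<in>{..n}. C i w) \<in> B \<and> C (Suc n) w \<in> D} =
        (\<integral>\<^sup>+ w. indicator B (\<lambda>i\<in>{..n}. C i w) * emeasure (iteration M Zp Zm (C n w)) D \<partial>N))"

definition stops :: "(nat \<Rightarrow> 'w \<Rightarrow> config) \<Rightarrow> 'w \<Rightarrow> bool" where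
  "stops C w \<longleftrightarrow> (\<exists>n. \<not> running (C n w))"

definition run_output :: "(nat \<Rightarrow> 'w \<Rightarrow> config) \<Rightarrow> 'w \<Rightarrow> ennreal \<times> real \<times> real \<times> real" where
  "run_output C w = config_output (C (LEAST n. \<not> running (C n w)) w)"

end

theory Submission
  imports Defs
begin

text \<open>
  Before the first passage of \<open>Zp\<close> over the level \<open>b\<close> the process \<open>Z = Zp - Zm\<close> does not exceed \<open>b\<close>. If it is below \<open>b\<close>
  also at that time \<open>t\<close>, the strong Markov property restarts the search with level \<open>b - Z t\<close> and horizon \<open>A - t\<close>;
  otherwise \<open>t\<close> is the passage time of \<open>Z\<close>, because \<open>Zp\<close> and \<open>Zm\<close> have no common jumps and \<open>Z\<close> does not rest on a
  level that it just hits. So an iteration preserves the conditional law of the final output, and only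
  termination remains.

  The clock \<open>T\<close> of a running procedure is at most \<open>\<tau> < \<infinity>\<close>, so it suffices that the expectation of \<open>exp (- T)\<close> on the
  event that the procedure still runs tends to \<open>0\<close>. If \<open>Zm\<close> rests at \<open>0\<close> with positive probability, each iteration
  gains a fixed factor. Otherwise the discounted probability that \<open>Z\<close> comes \<open>\<epsilon>\<close>-close to the level before exceeding it
  is a supermartingale, and only levels below \<open>\<epsilon>\<close> escape a fixed factor; as \<open>\<epsilon> \<rightarrow> 0\<close> its initial value tends to the
  probability of creeping over the level \<open>a\<close>. This probability is \<open>0\<close> by an argument of Kesten: \<open>Zp\<close> is a pure jump
  process, so the crept levels form a null set, while a positive creeping probability at one level would make
  creeping nearly certain at all multiples of suitable small levels.
\<close>

section \<open>Cadlag paths and first passage\<close>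

text \<open>Beyond regularity and monotonicity of their paths, the processes are known only through
  independence and characteristic functions, so the finer path properties have to be extracted
  analytically. That \<open>Zp\<close> moves by jumps alone is read off from truncated increments on
  fine grids. That \<open>Z\<close> does not jump onto a given level follows from a concentration
  bound for its law, which is where the infinite Levy measure enters. Laws of paths live on the
  product sigma-algebra over \<open>{0..}\<close>, where evaluation at a random time is not a
  measurable functional. Functionals of paths are therefore built from countably many coordinates
  (limits along grids, passage at rational times) and agree with the intended ones on paths that are
  regular enough. The danger for termination is not slow progress of the iterations as such, but
  their accumulation at a finite time while the remaining levels shrink to 0. Such an accumulation
  looks like a continuous passage over the original level, and this is how creeping comes
  in.\<close>

definition upper_grid :: "nat \<Rightarrow> real \<Rightarrow> real" where
  "upper_grid n t = (of_int \<lfloor>real (Suc n) * t\<rfloor> + 1) / real (Suc n)"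

text \<open>At positive times both grid points stay strictly on one side of \<open>t\<close>, so
  that along them a path tends to its right and its left limit. The clipping at 0 keeps the times
  nonnegative.\<close>

definition lower_grid :: "nat \<Rightarrow> real \<Rightarrow> real" where
  "lower_grid n t = max 0 ((of_int \<lceil>real (Suc n) * t\<rceil> - 1) / real (Suc n))"

lemma upper_grid_bounds: "t < upper_grid n t" "upper_grid n t \<le> t + 1 / real (Suc n)"
proof -
  have "real (Suc n) * t < of_int \<lfloor>real (Suc n) * t\<rfloor> + 1" by linarith
  then show "t < upper_grid n t"
    unfolding upper_grid_def by (simp add: field_simps)
  have "of_int \<lfloor>real (Suc n) * t\<rfloor> + 1 \<le> real (Suc n) * t + 1" by linarith
  then have "upper_grid n t \<le> (real (Suc n) * t + 1) / real (Suc n)"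
    unfolding upper_grid_def by (intro divide_right_mono) auto
  also have "\<dots> = t + 1 / real (Suc n)"
    by (simp add: add_divide_distrib)
  finally show "upper_grid n t \<le> t + 1 / real (Suc n)" .
qed

lemma lower_grid_bounds:
  assumes "0 < t"
  shows "lower_grid n t < t" "t - 1 / real (Suc n) \<le> lower_grid n t" "0 \<le> lower_grid n t"
proof -
  have "of_int \<lceil>real (Suc n) * t\<rceil> - 1 < real (Suc n) * t" by linarith
  then have "(of_int \<lceil>real (Suc n) * t\<rceil> - 1) / real (Suc n) < t"
    by (simp add: field_simps)
  with assms show "lower_grid n t < t"
    unfolding lower_grid_def by simp
  have "real (Suc n) * t - 1 \<le> of_int \<lceil>real (Suc n) * t\<rceil> - 1" by linarith
  then have "(real (Suc n) * t - 1) / real (Suc n) \<le> (of_int \<lceil>real (Suc n) * t\<rceil> - 1) / real (Suc n)"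
    by (intro divide_right_mono) auto
  moreover have "(real (Suc n) * t - 1) / real (Suc n) = t - 1 / real (Suc n)"
    by (simp add: diff_divide_distrib)
  ultimately show "t - 1 / real (Suc n) \<le> lower_grid n t"
    unfolding lower_grid_def by (simp add: le_max_iff_disj)
  show "0 \<le> lower_grid n t" unfolding lower_grid_def by simp
qed

lemma lower_grid_0 [simp]: "lower_grid n 0 = 0"
  by (simp add: lower_grid_def)

lemma filterlim_upper_grid: "filterlim (\<lambda>n. upper_grid n t) (at_right t) sequentially"
  unfolding filterlim_at
proof
  have "(\<lambda>n. t + 1 / real (Suc n)) \<longlonglongrightarrow> t + 0"
    by (intro tendsto_add tendsto_const LIMSEQ_Suc[OF lim_1_over_n])
  then show "(\<lambda>n. upper_grid n t) \<longlonglongrightarrow> t"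
    by - (rule tendsto_sandwich[of "\<lambda>_. t" _ _ "\<lambda>n. t + 1 / real (Suc n)"],
       auto intro!: always_eventually upper_grid_bounds(2) less_imp_le[OF upper_grid_bounds(1)] simp del: of_nat_Suc)
  show "\<forall>\<^sub>F n in sequentially. upper_grid n t \<in> {t<..} \<and> upper_grid n t \<noteq> t"
    using upper_grid_bounds(1)[of t] by (intro always_eventually) (auto dest: less_imp_neq[symmetric])
qed

lemma filterlim_lower_grid:
  assumes "0 < t"
  shows "filterlim (\<lambda>n. lower_grid n t) (at_left t) sequentially"
  unfolding filterlim_at
proof
  have "(\<lambda>n. t - 1 / real (Suc n)) \<longlonglongrightarrow> t - 0"
    by (intro tendsto_diff tendsto_const LIMSEQ_Suc[OF lim_1_over_n])
  then show "(\<lambda>n. lower_grid n t) \<longlonglongrightarrow> t"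
    by - (rule tendsto_sandwich[of "\<lambda>n. t - 1 / real (Suc n)" _ _ "\<lambda>n. t"],
       auto intro!: always_eventually lower_grid_bounds(2)[OF assms] less_imp_le[OF lower_grid_bounds(1)[OF assms]] simp del: of_nat_Suc)
  show "\<forall>\<^sub>F n in sequentially. lower_grid n t \<in> {..<t} \<and> lower_grid n t \<noteq> t"
    using lower_grid_bounds(1)[OF assms] by (intro always_eventually) (auto dest: less_imp_neq)
qed

text \<open>For a cadlag path this is just \<open>f t\<close>, and \<open>left_value\<close> is the
  left limit. The detour through countable grids makes both measurable in the path and in the time
  together, for paths in a product space and random times.\<close>

definition right_value :: "(real \<Rightarrow> 'b::t2_space) \<Rightarrow> real \<Rightarrow> 'b" where
  "right_value f t = lim (\<lambda>n. f (upper_grid n t))"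

definition left_value :: "(real \<Rightarrow> 'b::t2_space) \<Rightarrow> real \<Rightarrow> 'b" where
  "left_value f t = lim (\<lambda>n. f (lower_grid n t))"

lemma right_value_eq:
  assumes "(f \<longlongrightarrow> f t) (at_right t)"
  shows "right_value f t = f t"
  unfolding right_value_def using filterlim_compose[OF assms filterlim_upper_grid] by (rule limI)

lemma left_value_eq:
  assumes "0 < t" "(f \<longlongrightarrow> l) (at_left t)"
  shows "left_value f t = l"
  unfolding left_value_def using filterlim_compose[OF assms(2) filterlim_lower_grid[OF assms(1)]] by (rule limI)

lemma left_value_0: "left_value f 0 = f 0"
  unfolding left_value_def by simp

lemma left_limit_tendsto:
  assumes "cadlag f" "0 < t"
  shows "(f \<longlongrightarrow> left_limit f t) (at_left t)"
proof -
  obtain l where l: "(f \<longlongrightarrow> l) (at_left t)" using assms unfolding cadlag_def by blast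
  then have "Lim (at_left t) f = l" by (intro tendsto_Lim) auto
  with l assms show ?thesis by (simp add: left_limit_def)
qed

lemma left_limit_eqI:
  assumes "(f \<longlongrightarrow> l) (at_left t)" "0 < t"
  shows "left_limit f t = l"
  using assms by (simp add: left_limit_def tendsto_Lim)

lemma left_limit_0 [simp]: "left_limit f 0 = f 0"
  by (simp add: left_limit_def)

lemma cadlag_right: "cadlag f \<Longrightarrow> 0 \<le> t \<Longrightarrow> (f \<longlongrightarrow> f t) (at_right t)"
  by (simp add: cadlag_def)

lemma cadlag_diff:
  assumes "cadlag f" "cadlag g"
  shows "cadlag (\<lambda>t. f t - g t)"
  using assms unfolding cadlag_def by (blast intro: tendsto_diff)

lemma left_value_cadlag:
  assumes "cadlag f" "0 \<le> t"
  shows "left_value f t = left_limit f t"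
proof (cases "t = 0")
  case False
  with assms show ?thesis by (intro left_value_eq left_limit_tendsto) auto
qed (simp add: left_value_0)

lemma right_value_cadlag:
  assumes "cadlag f" "0 \<le> t"
  shows "right_value f t = f t"
  by (intro right_value_eq cadlag_right assms)

lemma left_limit_diff:
  assumes "cadlag f" "cadlag g" "0 \<le> t"
  shows "left_limit (\<lambda>t. f t - g t) t = left_limit f t - left_limit g t"
proof (cases "t = 0")
  case False
  with assms show ?thesis
    by (intro left_limit_eqI tendsto_diff left_limit_tendsto) auto
qed auto

text \<open>Only rational times are inspected, so that this version of \<open>first_passage\<close>
  is measurable on the product path space.\<close>

definition passage :: "real \<Rightarrow> (real \<Rightarrow> real) \<Rightarrow> ennreal" where
  "passage c f = (INF q\<in>{q\<in>\<rat>. 0 < q}. if c < f q then ennreal q else \<infinity>)"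

text \<open>One-sided continuity carries a strict passage at time \<open>t\<close> over to nearby
  rational times. Right-continuity is the case of the given processes; left-continuity is the case
  of the path of left limits that is seen after a creeping time.\<close>

lemma passage_eq_first_passage:
  assumes "(\<forall>t>0. (f \<longlongrightarrow> f t) (at_right t)) \<or> (\<forall>t>0. (f \<longlongrightarrow> f t) (at_left t))"
  shows "passage c f = first_passage f c"
proof (rule antisym)
  show "first_passage f c \<le> passage c f"
    unfolding passage_def first_passage_def
    by (intro INF_greatest) (auto intro!: INF_lower)
  show "passage c f \<le> first_passage f c"
    unfolding first_passage_def
  proof (intro INF_greatest)
    fix t assume t: "t \<in> {t. 0 < t \<and> c < f t}"
    show "passage c f \<le> ennreal t"
      using assms
    proof
      assume "\<forall>t>0. (f \<longlongrightarrow> f t) (at_right t)"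
      then have "\<forall>\<^sub>F s in at_right t. c < f s"
        using t by (intro order_tendstoD) auto
      then obtain b where b: "t < b" "\<And>s. t < s \<Longrightarrow> s < b \<Longrightarrow> c < f s"
        unfolding eventually_at_right[OF less_add_one] by auto
      show ?thesis
      proof (rule ennreal_le_epsilon)
        fix e :: real assume "0 < e"
        obtain q where q: "q \<in> \<rat>" "t < q" "q < min b (t + e)"
          using Rats_dense_in_real[of t "min b (t + e)"] b \<open>0 < e\<close> by auto
        have "passage c f \<le> ennreal q"
          unfolding passage_def using q t b by (intro INF_lower2[of q]) auto
        also have "\<dots> \<le> ennreal (t + e)"
          using q by (intro ennreal_leI) simp
        also have "\<dots> = ennreal t + ennreal e"
          using t \<open>0 < e\<close> by simp
        finally show "passage c f \<le> ennreal t + ennreal e" .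
      qed
    next
      assume "\<forall>t>0. (f \<longlongrightarrow> f t) (at_left t)"
      then have "\<forall>\<^sub>F s in at_left t. c < f s"
        using t by (intro order_tendstoD) auto
      then obtain b where b: "b < t" "\<And>s. b < s \<Longrightarrow> s < t \<Longrightarrow> c < f s"
        unfolding eventually_at_left[OF t[simplified, THEN conjunct1]] by auto
      obtain q where q: "q \<in> \<rat>" "max 0 b < q" "q < t"
        using Rats_dense_in_real[of "max 0 b" t] b t by auto
      have "passage c f \<le> ennreal q"
        unfolding passage_def using q t b by (intro INF_lower2[of q]) auto
      also have "\<dots> \<le> ennreal t" using q by (auto intro!: ennreal_leI)
      finally show ?thesis .
    qed
  qed
qed

lemma passage_cadlag: "cadlag f \<Longrightarrow> passage c f = first_passage f c"
  by (intro passage_eq_first_passage) (auto simp: cadlag_def)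

lemma first_passage_cong:
  "(\<And>t. 0 < t \<Longrightarrow> f t = g t) \<Longrightarrow> first_passage f c = first_passage g c"
  unfolding first_passage_def by (intro INF_cong) auto

lemma passage_cong:
  "(\<And>t. 0 < t \<Longrightarrow> f t = g t) \<Longrightarrow> passage c f = passage c g"
  unfolding passage_def by (intro INF_cong) auto

lemma first_passage_mono: "c \<le> c' \<Longrightarrow> first_passage f c \<le> first_passage f c'"
  unfolding first_passage_def by (intro INF_superset_mono) auto

lemma first_passage_less_iff:
  "first_passage f c < x \<longleftrightarrow> (\<exists>t>0. c < f t \<and> ennreal t < x)"
  unfolding first_passage_def by (auto simp: INF_less_iff)

lemma le_first_passage_iff:
  "x \<le> first_passage f c \<longleftrightarrow> (\<forall>t>0. c < f t \<longrightarrow> x \<le> ennreal t)"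
  unfolding first_passage_def by (auto simp: le_INF_iff)

lemma before_first_passage: "0 < t \<Longrightarrow> ennreal t < first_passage f c \<Longrightarrow> f t \<le> c"
  using le_first_passage_iff[of "first_passage f c" f c] by (meson not_le order_refl)

lemma first_passage_finite_iff: "first_passage f c < \<infinity> \<longleftrightarrow> (\<exists>t>0. c < f t)"
  by (auto simp: first_passage_less_iff)

lemma first_passage_right_cont:
  assumes "cadlag f" "0 \<le> t" "f t < c"
  shows "\<exists>d>0. \<forall>s\<in>{t..t+d}. f s < c"
proof -
  have "\<forall>\<^sub>F s in at_right t. f s < c"
    using assms by (intro order_tendstoD[OF cadlag_right]) auto
  then obtain b where "t < b" "\<And>s. t < s \<Longrightarrow> s < b \<Longrightarrow> f s < c"
    unfolding eventually_at_right[OF less_add_one] by auto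
  with assms(3) have "f s < c" if "s \<in> {t..t + (b - t)/2}" for s
    using that by (cases "s = t") (auto simp: field_simps)
  with \<open>t < b\<close> show ?thesis
    by (intro exI[of _ "(b - t)/2"]) auto
qed

text \<open>If \<open>f t\<close> were below \<open>c\<close>, right-continuity would keep the path
  below \<open>c\<close> for a while after \<open>t\<close> and so postpone the passage. Equality
  cannot be excluded: the passage time is defined by strict excess.\<close>

lemma at_first_passage:
  assumes "cadlag f" "first_passage f c = ennreal t" "0 \<le> t"
  shows "c \<le> f t"
proof (rule ccontr)
  assume "\<not> c \<le> f t"
  then obtain d where d: "0 < d" "\<forall>s\<in>{t..t+d}. f s < c"
    using first_passage_right_cont[OF assms(1,3), of c] by auto
  have "ennreal (t + d) \<le> first_passage f c"
    unfolding le_first_passage_iff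
  proof safe
    fix s assume s: "0 < s" "c < f s"
    have "\<not> s < t" using before_first_passage[of s f c] s assms(2) by (auto simp: ennreal_less_iff)
    moreover have "s \<notin> {t..t+d}" using d s by force
    ultimately have "t + d \<le> s" by auto
    then show "ennreal (t + d) \<le> ennreal s" by (rule ennreal_leI)
  qed
  then show False using assms d by (simp add: ennreal_le_iff2)
qed

text \<open>The restart identity behind every use of the Markov property at an intermediate time. It
  is purely order-theoretic and asks for no regularity of \<open>f\<close>.\<close>

lemma first_passage_shift:
  assumes "0 \<le> s" "\<And>t. 0 < t \<Longrightarrow> t \<le> s \<Longrightarrow> f t \<le> c"
  shows "first_passage f c = ennreal s + first_passage (\<lambda>t. f (s + t) - f s) (c - f s)"
proof (rule antisym)
  show "first_passage f c \<le> ennreal s + first_passage (\<lambda>t. f (s + t) - f s) (c - f s)"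
  proof -
    have "first_passage f c - ennreal s \<le> first_passage (\<lambda>t. f (s + t) - f s) (c - f s)"
      unfolding le_first_passage_iff
    proof safe
      fix t assume t: "0 < t" "c - f s < f (s + t) - f s"
      then have "first_passage f c \<le> ennreal (s + t)"
        unfolding first_passage_def using assms(1) by (intro INF_lower) auto
      also have "\<dots> = ennreal s + ennreal t" using t assms(1) by simp
      finally show "first_passage f c - ennreal s \<le> ennreal t"
        by (simp add: ennreal_minus_le_iff)
    qed
    then show ?thesis by (simp add: ennreal_minus_le_iff)
  qed
  show "ennreal s + first_passage (\<lambda>t. f (s + t) - f s) (c - f s) \<le> first_passage f c"
    unfolding le_first_passage_iff
  proof safe
    fix t assume t: "0 < t" "c < f t"
    with assms(2)[of t] have "s < t" by force
    then have "first_passage (\<lambda>t. f (s + t) - f s) (c - f s) \<le> ennreal (t - s)"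
      unfolding first_passage_def using t by (intro INF_lower) auto
    then have "ennreal s + first_passage (\<lambda>t. f (s + t) - f s) (c - f s) \<le> ennreal s + ennreal (t - s)"
      by (rule add_left_mono)
    also have "\<dots> = ennreal t" using \<open>s < t\<close> assms(1) by (simp flip: ennreal_plus)
    finally show "ennreal s + first_passage (\<lambda>t. f (s + t) - f s) (c - f s) \<le> ennreal t" .
  qed
qed

lemma first_passage_pos:
  assumes "cadlag f" "f 0 < c"
  shows "0 < first_passage f c"
proof -
  obtain d where d: "0 < d" "\<forall>s\<in>{0..0+d}. f s < c"
    using first_passage_right_cont[OF assms(1) _ assms(2)] by auto
  have "ennreal d \<le> first_passage f c"
    unfolding le_first_passage_iff
  proof safe
    fix t assume t: "0 < t" "c < f t"
    then have "t \<notin> {0..0 + d}" using d(2) by (metis not_less_iff_gr_or_eq)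
    then show "ennreal d \<le> ennreal t" using t by (intro ennreal_leI) auto
  qed
  moreover have "0 < ennreal d" using d by simp
  ultimately show ?thesis by (rule less_le_trans[rotated])
qed

lemma first_passage_0:
  assumes "cadlag f" "c < f 0"
  shows "first_passage f c = 0"
proof -
  have "cadlag (\<lambda>t. - f t)" using assms(1) unfolding cadlag_def by (blast intro: tendsto_minus)
  then obtain d where d: "0 < d" "\<forall>s\<in>{0..0+d}. - f s < - c"
    using first_passage_right_cont[of "\<lambda>t. - f t" 0 "-c"] assms(2) by auto
  have "first_passage f c \<le> 0"
  proof (rule ennreal_le_epsilon)
    fix e :: real assume "0 < e"
    then show "first_passage f c \<le> 0 + ennreal e"
      unfolding first_passage_def using d
      by (intro INF_lower2[of "min d e"]) (auto intro!: ennreal_leI)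
  qed
  then show ?thesis by simp
qed

section \<open>The Markov property of Levy processes\<close>

abbreviation paths :: "(real \<Rightarrow> 'b::topological_space) measure" where
  "paths \<equiv> PiM {0..} (\<lambda>_. borel)"

definition sample_path :: "(real \<Rightarrow> 'a \<Rightarrow> 'b) \<Rightarrow> 'a \<Rightarrow> real \<Rightarrow> 'b" where
  "sample_path X w = (\<lambda>t\<in>{0..}. X t w)"

definition post_path :: "(real \<Rightarrow> 'a \<Rightarrow> 'b::minus) \<Rightarrow> real \<Rightarrow> 'a \<Rightarrow> real \<Rightarrow> 'b" where
  "post_path X s w = (\<lambda>t\<in>{0..}. X (s + t) w - X s w)"

definition pre_path :: "(real \<Rightarrow> 'a \<Rightarrow> 'b) \<Rightarrow> real \<Rightarrow> 'a \<Rightarrow> real \<Rightarrow> 'b" where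
  "pre_path X s w = (\<lambda>t\<in>{0..s}. X t w)"

section \<open>The Markov property at a fixed time\<close>

lemma measurable_path [measurable (raw)]:
  "(\<And>t. 0 \<le> t \<Longrightarrow> X t \<in> borel_measurable M) \<Longrightarrow> sample_path X \<in> measurable M paths"
  unfolding sample_path_def by (intro measurable_restrict) auto

lemma measurable_pre:
  "(\<And>t. 0 \<le> t \<Longrightarrow> X t \<in> borel_measurable M) \<Longrightarrow> pre_path X s \<in> measurable M (PiM {0..s} (\<lambda>_. borel))"
  unfolding pre_path_def by (intro measurable_restrict) auto

lemma measurable_post:
  fixes X :: "real \<Rightarrow> 'a \<Rightarrow> 'b::{second_countable_topology, real_normed_vector}"
  shows "0 \<le> s \<Longrightarrow> (\<And>t. 0 \<le> t \<Longrightarrow> X t \<in> borel_measurable M) \<Longrightarrow> post_path X s \<in> measurable M paths"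
  unfolding post_path_def by (intro measurable_restrict borel_measurable_diff) auto

text \<open>Independence of increments is stated for infinite monotone sequences of times. A finite
  set of times is therefore extended to a sequence that is constantly \<open>s\<close> from some
  index on, to which later times can be attached.\<close>

lemma finite_times_enum:
  fixes s :: real
  assumes "finite J" "J \<subseteq> {0..s}" "0 \<le> s"
  obtains u :: "nat \<Rightarrow> real" and n where
    "mono u" "u 0 = 0" "J \<subseteq> u ` {..n}" "\<And>k. n \<le> k \<Longrightarrow> u k = s" "\<And>k. u k \<in> {0..s}"
proof -
  define xs where "xs = sorted_list_of_set (insert 0 (insert s J))"
  have set_xs: "set xs = insert 0 (insert s J)" and sorted: "sorted xs"
    unfolding xs_def using assms(1) by (simp_all only: set_sorted_list_of_set sorted_sorted_list_of_set finite_insert)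
  then have ne: "xs \<noteq> []" by auto
  define u where "u k = xs ! (min k (length xs - 1))" for k
  have range: "u k \<in> {0..s}" for k
  proof -
    have "u k \<in> set xs" unfolding u_def using ne by (intro nth_mem) (cases xs; auto)
    then show ?thesis using assms set_xs by auto
  qed
  have mono: "mono u"
    unfolding u_def using ne by (intro monoI sorted_nth_mono[OF sorted]) (cases xs; auto)+
  have ex: "\<exists>k\<le>length xs - 1. u k = x" if "x \<in> insert 0 (insert s J)" for x
  proof -
    from that obtain k where "k < length xs" "xs ! k = x"
      unfolding set_xs[symmetric] by (auto simp: in_set_conv_nth)
    then show ?thesis unfolding u_def by (intro exI[of _ k]) auto
  qed
  obtain k0 where "u k0 = 0" using ex[of 0] by auto
  then have 0: "u 0 = 0" using monoD[OF mono, of 0 k0] range[of 0] by auto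
  obtain k1 where "k1 \<le> length xs - 1" "u k1 = s" using ex[of s] by auto
  then have s: "u k = s" if "length xs - 1 \<le> k" for k
    using monoD[OF mono, of k1 k] range[of k] that by auto
  have "J \<subseteq> u ` {..length xs - 1}" using ex by fastforce
  with mono 0 s range show thesis by (intro that[of u "length xs - 1"])
qed

lemma levy_processD:
  assumes "levy_process M X"
  shows "prob_space M" "\<And>t. 0 \<le> t \<Longrightarrow> X t \<in> borel_measurable M"
    "\<And>w. w \<in> space M \<Longrightarrow> X 0 w = 0" "\<And>w. w \<in> space M \<Longrightarrow> cadlag (\<lambda>t. X t w)"
    "\<And>t :: nat \<Rightarrow> real. 0 \<le> t 0 \<Longrightarrow> mono t \<Longrightarrow>
        prob_space.indep_vars M (\<lambda>_. borel) (\<lambda>i w. X (t (Suc i)) w - X (t i) w) UNIV"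
    "\<And>s h. 0 \<le> s \<Longrightarrow> 0 \<le> h \<Longrightarrow> distr M borel (\<lambda>w. X (s + h) w - X s w) = distr M borel (X h)"
  using assms unfolding levy_process_def by auto

lemma levy_increments_law:
  fixes u :: "nat \<Rightarrow> real"
  assumes X: "levy_process M X" and u: "mono u" "0 \<le> u 0" "0 < m"
  shows "distr M (PiM {..<m} (\<lambda>_. borel)) (\<lambda>w. \<lambda>i\<in>{..<m}. X (u (Suc i)) w - X (u i) w) =
    PiM {..<m} (\<lambda>i. distr M borel (X (u (Suc i) - u i)))"
proof -
  note X = levy_processD[OF X]
  interpret prob_space M by fact
  have pos: "0 \<le> u i" for i using u(2) monoD[OF u(1), of 0 i] by auto
  have ind: "indep_vars (\<lambda>_. borel) (\<lambda>i w. X (u (Suc i)) w - X (u i) w) {..<m}"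
    by (rule indep_vars_subset[OF X(5)[OF u(2) u(1)]]) auto
  have rv: "random_variable borel (\<lambda>w. X (u (Suc i)) w - X (u i) w)" for i
    using X(2) pos by auto
  have "distr M (PiM {..<m} (\<lambda>_. borel)) (\<lambda>w. \<lambda>i\<in>{..<m}. X (u (Suc i)) w - X (u i) w) =
    PiM {..<m} (\<lambda>i. distr M borel (\<lambda>w. X (u (Suc i)) w - X (u i) w))"
    using indep_vars_iff_distr_eq_PiM'[of "{..<m}" "\<lambda>i w. X (u (Suc i)) w - X (u i) w" "\<lambda>_. borel"] ind u(3) rv
    by (auto simp: lessThan_empty_iff)
  also have "\<dots> = PiM {..<m} (\<lambda>i. distr M borel (X (u (Suc i) - u i)))"
  proof (rule PiM_cong)
    fix i
    show "distr M borel (\<lambda>w. X (u (Suc i)) w - X (u i) w) = distr M borel (X (u (Suc i) - u i))"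
      using X(6)[OF pos[of i], of "u (Suc i) - u i"] monoD[OF u(1), of i "Suc i"] by simp
  qed simp
  finally show ?thesis .
qed

text \<open>Values up to time \<open>s\<close> are partial sums of an initial block of increments,
  and displacements after \<open>s\<close> are partial sums of a later block. Disjoint blocks are
  independent, and by stationarity the later block has the law of a block that starts at time
  0.\<close>

lemma levy_finite_markov:
  fixes B C :: "real \<Rightarrow> real set"
  assumes X: "levy_process M X" and s: "0 \<le> s"
    and J: "finite J" "J \<subseteq> {0..s}" "\<And>j. j \<in> J \<Longrightarrow> B j \<in> sets borel"
    and I: "finite I" "I \<subseteq> {0..}" "\<And>i. i \<in> I \<Longrightarrow> C i \<in> sets borel"
  shows "measure M {w\<in>space M. (\<forall>j\<in>J. X j w \<in> B j) \<and> (\<forall>i\<in>I. X (s + i) w - X s w \<in> C i)} =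
     measure M {w\<in>space M. \<forall>j\<in>J. X j w \<in> B j} * measure M {w\<in>space M. \<forall>i\<in>I. X i w \<in> C i}"
proof -
  note LP = levy_processD[OF X]
  interpret prob_space M by fact
  obtain u :: "nat \<Rightarrow> real" and n where u: "mono u" "u 0 = 0" "J \<subseteq> u ` {..n}" "\<And>k. n \<le> k \<Longrightarrow> u k = s" "\<And>k. u k \<in> {0..s}"
    by (rule finite_times_enum[OF J(1,2) s]) blast
  have "I \<subseteq> {0..Max (insert 0 I)}" using I by auto
  moreover have "0 \<le> Max (insert 0 I)" using I by auto
  ultimately obtain v :: "nat \<Rightarrow> real" and m' where v: "mono v" "v 0 = 0" "I \<subseteq> v ` {..m'}" "\<And>k. v k \<in> {0..Max (insert 0 I)}"
    by (rule finite_times_enum[OF I(1), of "Max (insert 0 I)"]) blast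
  define m where "m = Suc m'"
  have v': "I \<subseteq> v ` {..<m}" "0 < m" unfolding m_def using v(3) by (auto simp: lessThan_Suc_atMost)
  \<comment> \<open>The two enumerations fit together at index \<open>n\<close>, because
    \<open>u n = s\<close> and \<open>v 0 = 0\<close>.\<close>
  define t where "t k = (if k < n then u k else s + v (k - n))" for k
  have mono_t: "mono t"
  proof (rule monoI)
    fix k l :: nat assume "k \<le> l"
    then show "t k \<le> t l"
      unfolding t_def using monoD[OF u(1), of k l] monoD[OF v(1), of "k - n" "l - n"] u(5)[of k] v(4)[of "l - n"]
      by (auto simp: not_less)
  qed
  have t0: "t 0 = 0" unfolding t_def using u(2) u(4)[of 0] v(2) by auto
  have tu: "t k = u k" if "k \<le> n" for k
    unfolding t_def using that u(4)[of n] v(2) by auto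
  have tv: "t (n + k) = s + v k" for k unfolding t_def by auto
  define D where "D i w = X (t (Suc i)) w - X (t i) w" for i w
  have ind: "indep_vars (\<lambda>_. borel) D UNIV"
    unfolding D_def using LP(5)[of t] t0 mono_t by auto
  have X_u: "X (u k) w = (\<Sum>i<k. D i w)" if "k \<le> n" "w \<in> space M" for k w
    using that LP(3) t0 tu[of k] sum_lessThan_telescope[of "\<lambda>i. X (t i) w" k] unfolding D_def by simp
  have X_v: "X (s + v k) w - X s w = (\<Sum>i<k. D (n + i) w)" for k w
    using tv[of k] tv[of 0] v(2) sum_lessThan_telescope[of "\<lambda>i. X (t (n + i)) w" k] unfolding D_def by simp
  have X_v': "X (v k) w = (\<Sum>i<k. X (v (Suc i)) w - X (v i) w)" if "w \<in> space M" for k w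
    using that v(2) LP(3) sum_lessThan_telescope[of "\<lambda>i. X (v i) w" k] by simp
  define ku where "ku j = (SOME k. k \<le> n \<and> u k = j)" for j
  have ku: "ku j \<le> n" "u (ku j) = j" if "j \<in> J" for j
  proof -
    have "\<exists>k\<le>n. u k = j" using u(3) that by auto
    from someI_ex[OF this] show "ku j \<le> n" "u (ku j) = j" unfolding ku_def by auto
  qed
  define kv where "kv i = (SOME k. k < m \<and> v k = i)" for i
  have kv: "kv i < m" "v (kv i) = i" if "i \<in> I" for i
  proof -
    have "\<exists>k<m. v k = i" using v'(1) that by auto
    from someI_ex[OF this] show "kv i < m" "v (kv i) = i" unfolding kv_def by auto
  qed
  define A1 where "A1 = {x \<in> space (PiM {..<n} (\<lambda>_. borel :: real measure)). \<forall>j\<in>J. (\<Sum>i<ku j. x i) \<in> B j}"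
  define A2 where "A2 = {x \<in> space (PiM {n..<n+m} (\<lambda>_. borel :: real measure)). \<forall>i\<in>I. (\<Sum>l<kv i. x (n + l)) \<in> C i}"
  define A3 where "A3 = {x \<in> space (PiM {..<m} (\<lambda>_. borel :: real measure)). \<forall>i\<in>I. (\<Sum>l<kv i. x l) \<in> C i}"
  have cylinder: "{x \<in> space (PiM L (\<lambda>_. borel :: real measure)). \<forall>j\<in>J. (\<Sum>i<k j. x (c + i)) \<in> B j} \<in> sets (PiM L (\<lambda>_. borel))"
    if "finite J" "\<And>j. j \<in> J \<Longrightarrow> B j \<in> sets borel" "\<And>j. j \<in> J \<Longrightarrow> {c..<c + k j} \<subseteq> L"
    for J :: "real set" and B and L :: "nat set" and k :: "real \<Rightarrow> nat" and c
  proof (rule sets.sets_Collect_finite_All[OF _ that(1)])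
    fix j assume j: "j \<in> J"
    have [measurable]: "B j \<in> sets borel" using that j by auto
    have "(\<lambda>x. \<Sum>i<k j. x (c + i)) \<in> borel_measurable (PiM L (\<lambda>_. borel :: real measure))"
      using that(3)[OF j] by (intro borel_measurable_sum measurable_component_singleton) auto
    then show "{x \<in> space (PiM L (\<lambda>_. borel :: real measure)). (\<Sum>i<k j. x (c + i)) \<in> B j} \<in> sets (PiM L (\<lambda>_. borel))"
      by measurable
  qed
  have "{x \<in> space (PiM {..<n} (\<lambda>_. borel :: real measure)). \<forall>j\<in>J. (\<Sum>i<ku j. x (0 + i)) \<in> B j} \<in> sets (PiM {..<n} (\<lambda>_. borel))"
    by (rule cylinder) (use J ku(1) in fastforce)+
  then have A1: "A1 \<in> sets (PiM {..<n} (\<lambda>_. borel))" by (simp add: A1_def)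
  have A2: "A2 \<in> sets (PiM {n..<n+m} (\<lambda>_. borel))"
    unfolding A2_def by (rule cylinder) (use I kv(1) in fastforce)+
  have "{x \<in> space (PiM {..<m} (\<lambda>_. borel :: real measure)). \<forall>i\<in>I. (\<Sum>l<kv i. x (0 + l)) \<in> C i} \<in> sets (PiM {..<m} (\<lambda>_. borel))"
    by (rule cylinder) (use I kv(1) in fastforce)+
  then have A3: "A3 \<in> sets (PiM {..<m} (\<lambda>_. borel))" by (simp add: A3_def)
  have iv: "indep_var (PiM {..<n} (\<lambda>_. borel)) (\<lambda>w. \<lambda>i\<in>{..<n}. D i w) (PiM {n..<n+m} (\<lambda>_. borel)) (\<lambda>w. \<lambda>i\<in>{n..<n+m}. D i w)"
    by (rule indep_var_restrict[OF ind]) auto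
  have *: "(\<lambda>i\<in>{..<n}. D i w) \<in> A1 \<longleftrightarrow> (\<forall>j\<in>J. X j w \<in> B j)" if "w \<in> space M" for w
  proof -
    have "(\<Sum>i<ku j. (\<lambda>i\<in>{..<n}. D i w) i) = X j w" if "j \<in> J" for j
      using X_u[OF ku(1)[OF that] \<open>w \<in> space M\<close>] ku[OF that] by (auto intro!: sum.cong)
    then show ?thesis unfolding A1_def by (simp add: space_PiM)
  qed
  have **: "(\<lambda>i\<in>{n..<n+m}. D i w) \<in> A2 \<longleftrightarrow> (\<forall>i\<in>I. X (s + i) w - X s w \<in> C i)" if "w \<in> space M" for w
  proof -
    have "(\<Sum>l<kv i. (\<lambda>i\<in>{n..<n+m}. D i w) (n + l)) = X (s + i) w - X s w" if "i \<in> I" for i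
      using X_v[of "kv i" w] kv[OF that] by (auto intro!: sum.cong)
    then show ?thesis unfolding A2_def by (simp add: space_PiM)
  qed
  have ***: "(\<lambda>i\<in>{..<m}. D (n + i) w) \<in> A3 \<longleftrightarrow> (\<forall>i\<in>I. X (s + i) w - X s w \<in> C i)" if "w \<in> space M" for w
  proof -
    have "(\<Sum>l<kv i. (\<lambda>i\<in>{..<m}. D (n + i) w) l) = X (s + i) w - X s w" if "i \<in> I" for i
      using X_v[of "kv i" w] kv[OF that] by (auto intro!: sum.cong)
    then show ?thesis unfolding A3_def by (simp add: space_PiM)
  qed
  have ****: "(\<lambda>i\<in>{..<m}. X (v (Suc i)) w - X (v i) w) \<in> A3 \<longleftrightarrow> (\<forall>i\<in>I. X i w \<in> C i)" if "w \<in> space M" for w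
  proof -
    have "(\<Sum>l<kv i. (\<lambda>i\<in>{..<m}. X (v (Suc i)) w - X (v i) w) l) = X i w" if "i \<in> I" for i
      using X_v'[OF \<open>w \<in> space M\<close>, of "kv i"] kv[OF that] by (auto intro!: sum.cong)
    then show ?thesis unfolding A3_def by (simp add: space_PiM)
  qed
  \<comment> \<open>Both blocks have as law the product of the same one-dimensional laws, which
    depend only on the lengths of the time intervals.\<close>
  have law: "distr M (PiM {..<m} (\<lambda>_. borel)) (\<lambda>w. \<lambda>i\<in>{..<m}. D (n + i) w)
    = distr M (PiM {..<m} (\<lambda>_. borel)) (\<lambda>w. \<lambda>i\<in>{..<m}. X (v (Suc i)) w - X (v i) w)"
  proof -
    have "mono (\<lambda>k. s + v k)" using v(1) by (simp add: mono_def)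
    from levy_increments_law[OF X this _ v'(2)] levy_increments_law[OF X v(1) _ v'(2)]
    show ?thesis using s v(2) unfolding D_def add_Suc_right[symmetric] tv by simp
  qed
  have rvD: "random_variable (PiM {..<m} (\<lambda>_. borel)) (\<lambda>w. \<lambda>i\<in>{..<m}. D (n + i) w)"
    using ind by (intro measurable_restrict) (auto simp: indep_vars_def2)
  have rvv: "random_variable (PiM {..<m} (\<lambda>_. borel)) (\<lambda>w. \<lambda>i\<in>{..<m}. X (v (Suc i)) w - X (v i) w)"
    using LP(2) v(4) by (intro measurable_restrict borel_measurable_diff) auto
  have "measure M {w\<in>space M. (\<forall>j\<in>J. X j w \<in> B j) \<and> (\<forall>i\<in>I. X (s + i) w - X s w \<in> C i)} =
    prob ((\<lambda>w. (\<lambda>i\<in>{..<n}. D i w, \<lambda>i\<in>{n..<n+m}. D i w)) -` (A1 \<times> A2) \<inter> space M)"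
    using * ** by (intro arg_cong[where f=prob]) auto
  also have "\<dots> = prob ((\<lambda>w. \<lambda>i\<in>{..<n}. D i w) -` A1 \<inter> space M) * prob ((\<lambda>w. \<lambda>i\<in>{n..<n+m}. D i w) -` A2 \<inter> space M)"
    by (rule indep_varD[OF iv A1 A2])
  also have "(\<lambda>w. \<lambda>i\<in>{..<n}. D i w) -` A1 \<inter> space M = {w\<in>space M. \<forall>j\<in>J. X j w \<in> B j}"
    using * by auto
  also have "prob ((\<lambda>w. \<lambda>i\<in>{n..<n+m}. D i w) -` A2 \<inter> space M) = prob ((\<lambda>w. \<lambda>i\<in>{..<m}. D (n + i) w) -` A3 \<inter> space M)"
    using ** *** by (intro arg_cong[where f=prob]) auto
  also have "\<dots> = measure (distr M (PiM {..<m} (\<lambda>_. borel)) (\<lambda>w. \<lambda>i\<in>{..<m}. D (n + i) w)) A3"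
    by (rule measure_distr[symmetric, OF rvD A3])
  also have "\<dots> = prob ((\<lambda>w. \<lambda>i\<in>{..<m}. X (v (Suc i)) w - X (v i) w) -` A3 \<inter> space M)"
    unfolding law by (rule measure_distr[OF rvv A3])
  also have "(\<lambda>w. \<lambda>i\<in>{..<m}. X (v (Suc i)) w - X (v i) w) -` A3 \<inter> space M = {w\<in>space M. \<forall>i\<in>I. X i w \<in> C i}"
    using **** by auto
  finally show ?thesis .
qed

text \<open>The generators are left arbitrary because two kinds occur below: cylinder sets for a
  single path, and rectangles for pairs of paths.\<close>

lemma (in prob_space) indep_var_generatorI:
  assumes rv: "X \<in> measurable M S" "Y \<in> measurable M T"
    and S: "sets S = sigma_sets (space S) E" "Int_stable E"
    and T: "sets T = sigma_sets (space T) F" "Int_stable F"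
    and prod: "\<And>A B. A \<in> E \<Longrightarrow> B \<in> F \<Longrightarrow>
      prob ((X -` A \<inter> space M) \<inter> (Y -` B \<inter> space M)) = prob (X -` A \<inter> space M) * prob (Y -` B \<inter> space M)"
  shows "indep_var S X T Y"
proof -
  have E: "E \<subseteq> sets S" and F: "F \<subseteq> sets T" using S T by auto
  let ?A = "{X -` A \<inter> space M |A. A \<in> E}" and ?B = "{Y -` B \<inter> space M |B. B \<in> F}"
  have stable: "Int_stable {f -` A \<inter> space M |A. A \<in> G}" if "Int_stable G" for f :: "'a \<Rightarrow> 'x" and G
  proof (rule Int_stableI)
    fix a b assume "a \<in> {f -` A \<inter> space M |A. A \<in> G}" "b \<in> {f -` A \<inter> space M |A. A \<in> G}"
    then obtain A B where AB: "A \<in> G" "B \<in> G" "a = f -` A \<inter> space M" "b = f -` B \<inter> space M" by blast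
    have "a \<inter> b = f -` (A \<inter> B) \<inter> space M" unfolding AB by auto
    moreover have "A \<inter> B \<in> G" using that AB(1,2) by (rule Int_stableD)
    ultimately show "a \<inter> b \<in> {f -` A \<inter> space M |A. A \<in> G}" by blast
  qed
  have "indep_set ?A ?B"
    unfolding indep_sets2_eq
  proof (intro conjI ballI)
    show "?A \<subseteq> events" "?B \<subseteq> events" using rv E F by (auto intro: measurable_sets)
    fix a b assume "a \<in> ?A" "b \<in> ?B"
    then show "prob (a \<inter> b) = prob a * prob b" using prod by auto
  qed
  then have ind: "indep_set (sigma_sets (space M) ?A) (sigma_sets (space M) ?B)"
    by (rule indep_set_sigma_sets[OF _ stable[OF S(2)] stable[OF T(2)]])
  have 1: "sigma_sets (space M) ?A = {X -` A \<inter> space M |A. A \<in> sets S}"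
    unfolding S(1) using rv(1) by (intro sigma_sets_vimage_commute[symmetric]) (auto dest: measurable_space)
  have 2: "sigma_sets (space M) ?B = {Y -` A \<inter> space M |A. A \<in> sets T}"
    unfolding T(1) using rv(2) by (intro sigma_sets_vimage_commute[symmetric]) (auto dest: measurable_space)
  have 3: "sigma_sets (space M) (sigma_sets (space M) ?A) = sigma_sets (space M) ?A"
    "sigma_sets (space M) (sigma_sets (space M) ?B) = sigma_sets (space M) ?B"
    by (intro sigma_sets_sigma_sets_eq; auto)+
  show ?thesis
    unfolding indep_var_eq using rv ind 1 2 3 by simp
qed

lemma (in prob_space) indep_var_PiMI:
  assumes rv: "X \<in> measurable M (PiM I S)" "Y \<in> measurable M (PiM J T)"
    and prod: "\<And>I' J' A B. finite I' \<Longrightarrow> I' \<subseteq> I \<Longrightarrow> finite J' \<Longrightarrow> J' \<subseteq> J \<Longrightarrow>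
      (\<And>i. i \<in> I' \<Longrightarrow> A i \<in> sets (S i)) \<Longrightarrow> (\<And>j. j \<in> J' \<Longrightarrow> B j \<in> sets (T j)) \<Longrightarrow>
      prob {w\<in>space M. (\<forall>i\<in>I'. X w i \<in> A i) \<and> (\<forall>j\<in>J'. Y w j \<in> B j)} =
      prob {w\<in>space M. \<forall>i\<in>I'. X w i \<in> A i} * prob {w\<in>space M. \<forall>j\<in>J'. Y w j \<in> B j}"
  shows "indep_var (PiM I S) X (PiM J T) Y"
proof (rule indep_var_generatorI[OF rv])
  show "sets (PiM I S) = sigma_sets (space (PiM I S)) (prod_algebra I S)"
    "sets (PiM J T) = sigma_sets (space (PiM J T)) (prod_algebra J T)"
    by (simp_all add: sets_PiM space_PiM)
  show "Int_stable (prod_algebra I S)" "Int_stable (prod_algebra J T)"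
    by (rule Int_stable_prod_algebra)+
  fix A B assume "A \<in> prod_algebra I S" "B \<in> prod_algebra J T"
  then obtain I' E J' F where
    A: "A = prod_emb I S I' (\<Pi>\<^sub>E j\<in>I'. E j)" "finite I'" "I' \<subseteq> I" "\<And>i. i \<in> I' \<Longrightarrow> E i \<in> sets (S i)" and
    B: "B = prod_emb J T J' (\<Pi>\<^sub>E j\<in>J'. F j)" "finite J'" "J' \<subseteq> J" "\<And>i. i \<in> J' \<Longrightarrow> F i \<in> sets (T i)"
    by (elim prod_algebraE) blast
  have X: "X -` A \<inter> space M = {w\<in>space M. \<forall>i\<in>I'. X w i \<in> E i}"
    using measurable_space[OF rv(1)] A(3) unfolding A(1) prod_emb_def space_PiM
    by (auto simp: PiE_iff)
  have Y: "Y -` B \<inter> space M = {w\<in>space M. \<forall>i\<in>J'. Y w i \<in> F i}"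
    using measurable_space[OF rv(2)] B(3) unfolding B(1) prod_emb_def space_PiM
    by (auto simp: PiE_iff)
  have "(X -` A \<inter> space M) \<inter> (Y -` B \<inter> space M) =
    {w\<in>space M. (\<forall>i\<in>I'. X w i \<in> E i) \<and> (\<forall>j\<in>J'. Y w j \<in> F j)}"
    unfolding X Y by auto
  then show "prob ((X -` A \<inter> space M) \<inter> (Y -` B \<inter> space M)) = prob (X -` A \<inter> space M) * prob (Y -` B \<inter> space M)"
    unfolding X Y using prod[OF A(2,3) B(2,3) A(4) B(4)] by simp
qed

lemma distr_PiM_eqI:
  assumes "finite_measure M" "X \<in> measurable M (PiM I S)" "Y \<in> measurable M (PiM I S)"
    and eq: "\<And>J A. finite J \<Longrightarrow> J \<subseteq> I \<Longrightarrow> (\<And>i. i \<in> J \<Longrightarrow> A i \<in> sets (S i)) \<Longrightarrow>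
      emeasure M {w\<in>space M. \<forall>i\<in>J. X w i \<in> A i} = emeasure M {w\<in>space M. \<forall>i\<in>J. Y w i \<in> A i}"
  shows "distr M (PiM I S) X = distr M (PiM I S) Y"
proof (rule measure_eqI_PiM_infinite)
  fix A J assume J: "finite J" "J \<subseteq> I" "\<And>i. i \<in> J \<Longrightarrow> A i \<in> sets (S i)"
  have sets: "prod_emb I S J (Pi\<^sub>E J A) \<in> sets (PiM I S)"
    using J by (intro sets_PiM_I) auto
  have X: "X -` prod_emb I S J (Pi\<^sub>E J A) \<inter> space M = {w\<in>space M. \<forall>i\<in>J. X w i \<in> A i}"
    using measurable_space[OF assms(2)] J(2) unfolding prod_emb_def space_PiM by (auto simp: PiE_iff)
  have Y: "Y -` prod_emb I S J (Pi\<^sub>E J A) \<inter> space M = {w\<in>space M. \<forall>i\<in>J. Y w i \<in> A i}"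
    using measurable_space[OF assms(3)] J(2) unfolding prod_emb_def space_PiM by (auto simp: PiE_iff)
  show "emeasure (distr M (PiM I S) X) (prod_emb I S J (Pi\<^sub>E J A)) = emeasure (distr M (PiM I S) Y) (prod_emb I S J (Pi\<^sub>E J A))"
    using eq[OF J] sets assms(2,3) by (simp add: emeasure_distr X Y)
qed (use assms in \<open>auto intro: finite_measure.finite_measure_distr\<close>)

lemma levy_markov:
  assumes X: "levy_process M X" and s: "0 \<le> s"
  shows "prob_space.indep_var M (PiM {0..s} (\<lambda>_. borel)) (pre_path X s) paths (post_path X s)"
    and "distr M paths (post_path X s) = distr M paths (sample_path X)"
proof -
  note LP = levy_processD[OF X]
  interpret prob_space M by fact
  have pre_path: "random_variable (PiM {0..s} (\<lambda>_. borel)) (pre_path X s)"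
    by (intro measurable_pre LP)
  have post_path: "random_variable paths (post_path X s)"
    by (intro measurable_post LP s)
  have sample_path: "random_variable paths (sample_path X)"
    by (intro measurable_path LP)
  have *: "(\<forall>i\<in>I. pre_path X s w i \<in> A i) \<longleftrightarrow> (\<forall>i\<in>I. X i w \<in> A i)" if "I \<subseteq> {0..s}" for I w and A :: "real \<Rightarrow> real set"
    using that unfolding pre_path_def by (auto simp: subset_eq)
  have **: "(\<forall>i\<in>I. post_path X s w i \<in> A i) \<longleftrightarrow> (\<forall>i\<in>I. X (s + i) w - X s w \<in> A i)" if "I \<subseteq> {0..}" for I w and A :: "real \<Rightarrow> real set"
    using that unfolding post_path_def by (auto simp: subset_eq)
  have ***: "(\<forall>i\<in>I. sample_path X w i \<in> A i) \<longleftrightarrow> (\<forall>i\<in>I. X i w \<in> A i)" if "I \<subseteq> {0..}" for I w and A :: "real \<Rightarrow> real set"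
    using that unfolding sample_path_def by (auto simp: subset_eq)
  have law: "prob {w\<in>space M. \<forall>i\<in>I. post_path X s w i \<in> A i} = prob {w\<in>space M. \<forall>i\<in>I. sample_path X w i \<in> A i}"
    if I: "finite I" "I \<subseteq> {0..}" "\<And>i. i \<in> I \<Longrightarrow> A i \<in> sets borel" for I and A :: "real \<Rightarrow> real set"
    using levy_finite_markov[OF X s _ _ _ I, of "{}"] unfolding **[OF I(2)] ***[OF I(2)] by (simp add: prob_space)
  show "indep_var (PiM {0..s} (\<lambda>_. borel)) (pre_path X s) paths (post_path X s)"
  proof (rule indep_var_PiMI[OF pre_path post_path])
    fix I J :: "real set" and A B :: "real \<Rightarrow> real set"
    assume I: "finite I" "I \<subseteq> {0..s}" and J: "finite J" "J \<subseteq> {0..}"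
      and "\<And>i. i \<in> I \<Longrightarrow> A i \<in> sets borel" "\<And>i. i \<in> J \<Longrightarrow> B i \<in> sets borel"
    then show "prob {w\<in>space M. (\<forall>i\<in>I. pre_path X s w i \<in> A i) \<and> (\<forall>j\<in>J. post_path X s w j \<in> B j)} =
      prob {w\<in>space M. \<forall>i\<in>I. pre_path X s w i \<in> A i} * prob {w\<in>space M. \<forall>j\<in>J. post_path X s w j \<in> B j}"
      using levy_finite_markov[OF X s, of I A J B] law[of J B] unfolding *[OF I(2)] **[OF J(2)] ***[OF J(2)] by simp
  qed
  show "distr M paths (post_path X s) = distr M paths (sample_path X)"
    using law by (intro distr_PiM_eqI post_path sample_path finite_measure_axioms) (simp add: emeasure_eq_measure)
qed

section \<open>Pairs of independent processes\<close>

definition joint :: "(real \<Rightarrow> 'a \<Rightarrow> 'b) \<Rightarrow> (real \<Rightarrow> 'a \<Rightarrow> 'c) \<Rightarrow> real \<Rightarrow> 'a \<Rightarrow> 'b \<times> 'c" where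
  "joint X Y t w = (X t w, Y t w)"

lemma measurable_zip:
  fixes I :: "real set"
  shows "(\<lambda>p. \<lambda>t\<in>I. (fst p t, snd p t)) \<in> measurable
    (PiM I (\<lambda>_. borel) \<Otimes>\<^sub>M PiM I (\<lambda>_. borel)) (PiM I (\<lambda>_. borel :: ('b::second_countable_topology \<times> 'c::second_countable_topology) measure))"
proof (rule measurable_restrict)
  fix i assume "i \<in> I"
  show "(\<lambda>p. (fst p i, snd p i)) \<in> borel_measurable (PiM I (\<lambda>_. borel :: 'b measure) \<Otimes>\<^sub>M PiM I (\<lambda>_. borel :: 'c measure))"
    by (intro borel_measurable_Pair measurable_compose[OF measurable_fst] measurable_compose[OF measurable_snd]
        measurable_component_singleton) fact+
qed

text \<open>Cutting both paths at \<open>s\<close> gives four independent pieces: the two processes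
  are independent, and within each the past is independent of the future. Regrouping the pieces by
  time instead of by process proves the claim.\<close>

lemma levy_pair_markov:
  assumes X: "levy_process M X" and Y: "levy_process M Y" and ind: "indep_processes M X Y" and s: "0 \<le> s"
  shows "prob_space.indep_var M (PiM {0..s} (\<lambda>_. borel)) (pre_path (joint X Y) s) paths (post_path (joint X Y) s)"
    and "distr M paths (post_path (joint X Y) s) = distr M paths (sample_path (joint X Y))"
proof -
  let ?pre = "\<lambda>w. (pre_path X s w, pre_path Y s w)" and ?post = "\<lambda>w. (post_path X s w, post_path Y s w)" and ?path = "\<lambda>w. (sample_path X w, sample_path Y w)"
  note LX = levy_processD[OF X]
  note LY = levy_processD[OF Y]
  interpret prob_space M by fact
  let ?P = "PiM {0..s} (\<lambda>_. borel :: real measure)"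
  let ?W = "paths :: (real \<Rightarrow> real) measure"
  let ?zip = "\<lambda>I p. \<lambda>t\<in>I. (fst p t, snd p t)"
  note preX = measurable_pre[where X=X and M=M and s=s, OF LX(2)] note preY = measurable_pre[where X=Y and M=M and s=s, OF LY(2)]
  note postX = measurable_post[where X=X and M=M and s=s, OF s LX(2)] note postY = measurable_post[where X=Y and M=M and s=s, OF s LY(2)]
  note pathX = measurable_path[where X=X and M=M, OF LX(2)] note pathY = measurable_path[where X=Y and M=M, OF LY(2)]
  have ind: "indep_var ?W (sample_path X) ?W (sample_path Y)"
    using ind unfolding indep_processes_def sample_path_def[abs_def] .
  \<comment> \<open>The cut is a measurable function of one whole path, so independence of the two
    whole paths passes on to their pairs of pieces.\<close>
  define cut where "cut f = ((\<lambda>t\<in>{0..s}. f t), (\<lambda>t\<in>{0..}. f (s + t) - f s))" for f :: "real \<Rightarrow> real"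
  have cut: "cut \<in> measurable ?W (?P \<Otimes>\<^sub>M ?W)"
    unfolding cut_def[abs_def] using s
    by (intro measurable_Pair measurable_restrict borel_measurable_diff measurable_component_singleton) auto
  have cut_path: "cut (sample_path Z w) = (pre_path Z s w, post_path Z s w)" for Z and w :: 'a
    unfolding cut_def sample_path_def pre_path_def post_path_def using s by (auto simp: fun_eq_iff)
  have ind_cut: "indep_var (?P \<Otimes>\<^sub>M ?W) (\<lambda>w. (pre_path X s w, post_path X s w)) (?P \<Otimes>\<^sub>M ?W) (\<lambda>w. (pre_path Y s w, post_path Y s w))"
    using indep_var_compose[OF ind cut cut] by (simp add: comp_def cut_path)
  have ind_pre: "indep_var ?P (pre_path X s) ?P (pre_path Y s)"
    using indep_var_compose[OF ind_cut measurable_fst measurable_fst] by (simp add: comp_def)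
  have ind_post: "indep_var ?W (post_path X s) ?W (post_path Y s)"
    using indep_var_compose[OF ind_cut measurable_snd measurable_snd] by (simp add: comp_def)
  have indep: "indep_var (?P \<Otimes>\<^sub>M ?P) ?pre (?W \<Otimes>\<^sub>M ?W) ?post"
  proof (rule indep_var_generatorI)
    show "sets (?P \<Otimes>\<^sub>M ?P) = sigma_sets (space (?P \<Otimes>\<^sub>M ?P)) {a \<times> b |a b. a \<in> sets ?P \<and> b \<in> sets ?P}"
      "sets (?W \<Otimes>\<^sub>M ?W) = sigma_sets (space (?W \<Otimes>\<^sub>M ?W)) {a \<times> b |a b. a \<in> sets ?W \<and> b \<in> sets ?W}"
      by (simp_all add: sets_pair_measure space_pair_measure)
    fix A B
    assume "A \<in> {a \<times> b |a b. a \<in> sets ?P \<and> b \<in> sets ?P}" "B \<in> {a \<times> b |a b. a \<in> sets ?W \<and> b \<in> sets ?W}"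
    then obtain A1 A2 B1 B2 where A: "A = A1 \<times> A2" "A1 \<in> sets ?P" "A2 \<in> sets ?P"
      and B: "B = B1 \<times> B2" "B1 \<in> sets ?W" "B2 \<in> sets ?W" by auto
    have 1: "prob ((\<lambda>w. (Z1 w, Z2 w)) -` (D1 \<times> D2) \<inter> space M) = prob (Z1 -` D1 \<inter> space M) * prob (Z2 -` D2 \<inter> space M)"
      if "indep_var S1 Z1 S2 Z2" "D1 \<in> sets S1" "D2 \<in> sets S2" for Z1 Z2 D1 D2 S1 S2
      using indep_varD[OF that] .
    have "prob ((?pre -` A \<inter> space M) \<inter> (?post -` B \<inter> space M))
      = prob ((\<lambda>w. ((pre_path X s w, post_path X s w), (pre_path Y s w, post_path Y s w))) -` ((A1 \<times> B1) \<times> (A2 \<times> B2)) \<inter> space M)"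
      unfolding A B by (intro arg_cong[where f=prob]) auto
    also have "\<dots> = prob ((\<lambda>w. (pre_path X s w, post_path X s w)) -` (A1 \<times> B1) \<inter> space M) *
        prob ((\<lambda>w. (pre_path Y s w, post_path Y s w)) -` (A2 \<times> B2) \<inter> space M)"
      using A B by (intro 1[OF ind_cut]) auto
    also have "\<dots> = prob (pre_path X s -` A1 \<inter> space M) * prob (post_path X s -` B1 \<inter> space M) *
      (prob (pre_path Y s -` A2 \<inter> space M) * prob (post_path Y s -` B2 \<inter> space M))"
      by (simp only: 1[OF levy_markov(1)[OF X s] A(2) B(2)] 1[OF levy_markov(1)[OF Y s] A(3) B(3)])
    also have "\<dots> = prob (?pre -` A \<inter> space M) * prob (?post -` B \<inter> space M)"
      by (simp only: 1[OF ind_pre A(2,3)] 1[OF ind_post B(2,3)] A(1) B(1) mult.assoc mult.left_commute mult.commute)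
    finally show "prob ((?pre -` A \<inter> space M) \<inter> (?post -` B \<inter> space M)) =
      prob (?pre -` A \<inter> space M) * prob (?post -` B \<inter> space M)" .
  qed (auto intro!: measurable_Pair preX preY postX postY Int_stable_pair_measure_generator)
  have zip_pre: "(\<lambda>w. ?zip {0..s} (pre_path X s w, pre_path Y s w)) = pre_path (joint X Y) s"
    unfolding pre_path_def joint_def by (auto simp: fun_eq_iff)
  have zip_post: "(\<lambda>w. ?zip {0..} (post_path X s w, post_path Y s w)) = post_path (joint X Y) s"
    unfolding post_path_def joint_def by (auto simp: fun_eq_iff)
  have zip_path: "(\<lambda>w. ?zip {0..} (sample_path X w, sample_path Y w)) = sample_path (joint X Y)"
    unfolding sample_path_def joint_def by (auto simp: fun_eq_iff)
  show "indep_var (PiM {0..s} (\<lambda>_. borel)) (pre_path (joint X Y) s) paths (post_path (joint X Y) s)"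
    using indep_var_compose[OF indep measurable_zip measurable_zip] unfolding comp_def zip_pre zip_post .
  have "distr M (?W \<Otimes>\<^sub>M ?W) ?post = distr M ?W (post_path X s) \<Otimes>\<^sub>M distr M ?W (post_path Y s)"
    using ind_post unfolding indep_var_distribution_eq by simp
  also have "\<dots> = distr M ?W (sample_path X) \<Otimes>\<^sub>M distr M ?W (sample_path Y)"
    using levy_markov(2)[OF X s] levy_markov(2)[OF Y s] by simp
  also have "\<dots> = distr M (?W \<Otimes>\<^sub>M ?W) ?path"
    using ind unfolding indep_var_distribution_eq by simp
  finally have "distr (distr M (?W \<Otimes>\<^sub>M ?W) ?post) paths (?zip {0..}) =
    distr (distr M (?W \<Otimes>\<^sub>M ?W) ?path) paths (?zip {0..})" by simp
  moreover have "distr (distr M (?W \<Otimes>\<^sub>M ?W) ?post) paths (?zip {0..}) =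
    distr M paths (post_path (joint X Y) s)"
    using distr_distr[OF measurable_zip measurable_Pair[OF postX postY]] by (simp only: comp_def zip_post)
  moreover have "distr (distr M (?W \<Otimes>\<^sub>M ?W) ?path) paths (?zip {0..}) =
    distr M paths (sample_path (joint X Y))"
    using distr_distr[OF measurable_zip measurable_Pair[OF pathX pathY]] by (simp only: comp_def zip_path)
  ultimately show "distr M paths (post_path (joint X Y) s) = distr M paths (sample_path (joint X Y))"
    by simp
qed

section \<open>Laws on path space and pointwise limits of paths\<close>

lemma sets_path_space_closed:
  "sets (paths :: (real \<Rightarrow> 'b::topological_space) measure) = sigma_sets (space paths)
    {{f \<in> space paths. \<forall>i\<in>I. f i \<in> C i} | I C. finite I \<and> I \<subseteq> {0..} \<and> (\<forall>i\<in>I. closed (C i :: 'b set))}"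
    (is "_ = sigma_sets ?O ?G")
proof
  have G: "?G \<subseteq> sets paths"
  proof safe
    fix I and C :: "real \<Rightarrow> 'b set" assume "finite I" "I \<subseteq> {0..}" "\<forall>i\<in>I. closed (C i)"
    then show "{f \<in> space paths. \<forall>i\<in>I. f i \<in> C i} \<in> sets paths"
      by (intro sets.sets_Collect_finite_All measurable_sets_Collect[OF measurable_component_singleton]) auto
  qed
  then show "sigma_sets ?O ?G \<subseteq> sets paths"
    by (rule sets.sigma_sets_subset)
  have sp: "space (sigma ?O ?G) = ?O" by (rule space_measure_of_conv)
  have ss: "sets (sigma ?O ?G) = sigma_sets ?O ?G" using G sets.space_closed by (intro sets_measure_of) auto
  have "(\<lambda>f i. f i) \<in> measurable (sigma ?O ?G) paths"
  proof (rule measurable_PiM_single')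
    fix i :: real assume i: "i \<in> {0..}"
    have "(borel :: 'b measure) = sigma UNIV (Collect closed)" by (rule borel_eq_closed)
    moreover have "(\<lambda>f. f i) \<in> measurable (sigma ?O ?G) (sigma UNIV (Collect closed))"
    proof (rule measurable_measure_of)
      fix C :: "'b set" assume "C \<in> Collect closed"
      then have "(\<lambda>f. f i) -` C \<inter> space (sigma ?O ?G) \<in> ?G"
        unfolding sp using i by (intro CollectI exI[of _ "{i}"] exI[of _ "\<lambda>_. C"]) auto
      then show "(\<lambda>f. f i) -` C \<inter> space (sigma ?O ?G) \<in> sets (sigma ?O ?G)"
        unfolding ss by (rule sigma_sets.Basic)
    qed auto
    ultimately show "(\<lambda>f. f i) \<in> borel_measurable (sigma ?O ?G)" by simp
  next
    show "(\<lambda>f i. f i) \<in> space (sigma ?O ?G) \<rightarrow> (\<Pi>\<^sub>E i\<in>{0..}. space borel)"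
      unfolding sp by (auto simp: space_PiM)
  qed
  then show "sets paths \<subseteq> sigma_sets ?O ?G"
  proof (intro subsetI)
    fix D assume m: "(\<lambda>f i. f i) \<in> measurable (sigma ?O ?G) (paths :: (real \<Rightarrow> 'b) measure)"
      and D: "D \<in> sets (paths :: (real \<Rightarrow> 'b) measure)"
    have "(\<lambda>f i. f i) -` D \<inter> space (sigma ?O ?G) = D"
      unfolding sp using sets.sets_into_space[OF D] by auto
    with measurable_sets[OF m D] show "D \<in> sigma_sets ?O ?G" unfolding ss by simp
  qed
qed

text \<open>Closed cylinders serve as test sets because their indicators are limits of continuous
  functions of finitely many coordinates, and such functions follow pointwise limits of
  paths.\<close>

lemma measure_eqI_path_space:
  fixes P Q :: "(real \<Rightarrow> 'b::topological_space) measure"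
  assumes sets: "sets P = sets paths" "sets Q = sets paths" and fin: "finite_measure P"
    and eq: "\<And>I C. finite I \<Longrightarrow> I \<subseteq> {0..} \<Longrightarrow> (\<And>i. i \<in> I \<Longrightarrow> closed (C i)) \<Longrightarrow>
      emeasure P {f \<in> space paths. \<forall>i\<in>I. f i \<in> C i} = emeasure Q {f \<in> space paths. \<forall>i\<in>I. f i \<in> C i}"
  shows "P = Q"
proof (rule measure_eqI_generator_eq)
  let ?G = "{{f \<in> space paths. \<forall>i\<in>I. f i \<in> C i} | I C. finite I \<and> I \<subseteq> {0..} \<and> (\<forall>i\<in>I. closed (C i :: 'b set))}"
  interpret finite_measure P by fact
  show "Int_stable ?G"
  proof (rule Int_stableI)
    fix a b assume "a \<in> ?G" "b \<in> ?G"
    then obtain I C J D where a: "a = {f \<in> space paths. \<forall>i\<in>I. f i \<in> C i}" "finite I" "I \<subseteq> {0..}" "\<forall>i\<in>I. closed (C i)"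
      and b: "b = {f \<in> space paths. \<forall>i\<in>J. f i \<in> D i}" "finite J" "J \<subseteq> {0..}" "\<forall>i\<in>J. closed (D i)"
      by blast
    define E where "E i = (if i \<in> I then C i else UNIV) \<inter> (if i \<in> J then D i else UNIV)" for i
    have "a \<inter> b = {f \<in> space paths. \<forall>i\<in>I \<union> J. f i \<in> E i}"
      unfolding a(1) b(1) E_def by auto
    moreover have "finite (I \<union> J)" "I \<union> J \<subseteq> {0..}" "\<forall>i\<in>I \<union> J. closed (E i)"
      using a b unfolding E_def by (auto intro!: closed_Int)
    ultimately show "a \<inter> b \<in> ?G" by blast
  qed
  show "?G \<subseteq> Pow (space paths)" by auto
  show "sets P = sigma_sets (space paths) ?G" "sets Q = sigma_sets (space paths) ?G"
    using sets sets_path_space_closed by simp_all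
  show "range (\<lambda>i::nat. space (paths :: (real \<Rightarrow> 'b) measure)) \<subseteq> ?G"
    by (intro image_subsetI CollectI exI[of _ "{}"] exI[of _ "\<lambda>_. UNIV"]) auto
  show "(\<Union>i::nat. space (paths :: (real \<Rightarrow> 'b) measure)) = space paths" by simp
  show "emeasure P (space paths) \<noteq> \<infinity>" by simp
  fix D assume "D \<in> ?G"
  then show "emeasure P D = emeasure Q D" using eq by auto
qed

text \<open>A continuous function of finitely many coordinates that equals 1 on the closed cylinder
  and vanishes at distance \<open>1 / m\<close> from some side. Since \<open>infdist\<close> to the
  empty set is 0, cylinders with an empty side are excluded from the convergence statement.\<close>

definition closed_approx :: "nat \<Rightarrow> real set \<Rightarrow> (real \<Rightarrow> 'b::metric_space set) \<Rightarrow> (real \<Rightarrow> 'b) \<Rightarrow> real" where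
  "closed_approx m I C f = (\<Prod>i\<in>I. max 0 (1 - real m * infdist (f i) (C i)))"

lemma closed_approx_bounds: "0 \<le> closed_approx m I C f" "closed_approx m I C f \<le> 1"
  unfolding closed_approx_def by (auto intro!: prod_nonneg prod_le_1 mult_nonneg_nonneg infdist_nonneg)

lemma closed_approx_measurable:
  assumes "finite I" "I \<subseteq> {0..}"
  shows "closed_approx m I C \<in> borel_measurable (paths :: (real \<Rightarrow> 'b::metric_space) measure)"
  unfolding closed_approx_def[abs_def]
proof (intro borel_measurable_prod)
  fix i assume "i \<in> I"
  then have "(\<lambda>f. f i) \<in> measurable (paths :: (real \<Rightarrow> 'b) measure) borel"
    using assms by (intro measurable_component_singleton) auto
  moreover have "(\<lambda>x. max 0 (1 - real m * infdist x (C i))) \<in> borel_measurable borel"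
    by (intro borel_measurable_continuous_onI continuous_intros)
  ultimately show "(\<lambda>f. max 0 (1 - real m * infdist (f i) (C i))) \<in> borel_measurable paths"
    by (rule measurable_compose)
qed

lemma closed_approx_tendsto:
  assumes "finite I" "\<And>i. i \<in> I \<Longrightarrow> closed (C i)" "\<And>i. i \<in> I \<Longrightarrow> C i \<noteq> {}"
  shows "(\<lambda>m. closed_approx m I C f) \<longlonglongrightarrow> (if \<forall>i\<in>I. f i \<in> C i then 1 else 0)"
proof (cases "\<forall>i\<in>I. f i \<in> C i")
  case True
  then show ?thesis by (simp add: closed_approx_def)
next
  case False
  then obtain i where i: "i \<in> I" "f i \<notin> C i" by auto
  have pos: "0 < infdist (f i) (C i)"
    using i assms(2,3)[OF i(1)] in_closed_iff_infdist_zero[of "C i" "f i"] infdist_nonneg[of "f i" "C i"] by simp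
  obtain m0 :: nat where m0: "1 / infdist (f i) (C i) < real m0"
    using reals_Archimedean2 by blast
  have "closed_approx m I C f = 0" if "m0 \<le> m" for m
  proof -
    have "1 / infdist (f i) (C i) \<le> real m" using m0 that by linarith
    then have "1 - real m * infdist (f i) (C i) \<le> 0" using pos by (simp add: field_simps)
    then have "max 0 (1 - real m * infdist (f i) (C i)) = 0" by simp
    then show ?thesis unfolding closed_approx_def using i(1) assms(1) by (auto intro!: prod_zero)
  qed
  then have "\<forall>\<^sub>F m in sequentially. closed_approx m I C f = 0"
    by (auto simp: eventually_sequentially)
  then have "(\<lambda>m. closed_approx m I C f) \<longlonglongrightarrow> 0" by (rule tendsto_eventually)
  then show ?thesis by (simp only: False if_False)
qed

lemma closed_approx_limit:
  assumes "\<And>i. i \<in> I \<Longrightarrow> (\<lambda>n. g n i) \<longlonglongrightarrow> h i"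
  shows "(\<lambda>n. closed_approx m I C (g n)) \<longlonglongrightarrow> closed_approx m I C h"
  unfolding closed_approx_def by (intro tendsto_intros assms)

text \<open>
  Both the passage from grid times to a general stopping time and the passage to the limit of an
  increasing sequence of stopping times are instances of the following lemma.
\<close>

lemma weighted_path_limit:
  fixes Y :: "'a \<Rightarrow> real \<Rightarrow> 'b::metric_space"
  assumes M: "prob_space M" and L: "prob_space L" "sets L = sets paths"
    and w [measurable]: "\<And>n. w n \<in> borel_measurable M" "v \<in> borel_measurable M"
    and w_bounds: "\<And>n x. x \<in> space M \<Longrightarrow> 0 \<le> w n x \<and> w n x \<le> (1::real)"
    and w_lim: "\<And>x. x \<in> space M \<Longrightarrow> (\<lambda>n. w n x) \<longlonglongrightarrow> v x"
    and Y [measurable]: "\<And>n. Yn n \<in> measurable M paths" "Y \<in> measurable M paths"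
    and Y_lim: "\<And>x t. x \<in> space M \<Longrightarrow> v x \<noteq> 0 \<Longrightarrow> 0 \<le> t \<Longrightarrow> (\<lambda>n. Yn n x t) \<longlonglongrightarrow> Y x t"
    and eq: "\<And>n D. D \<in> sets paths \<Longrightarrow>
      (\<integral>\<^sup>+x. ennreal (w n x) * indicator D (Yn n x) \<partial>M) = (\<integral>\<^sup>+x. ennreal (w n x) \<partial>M) * emeasure L D"
    and D: "D \<in> sets paths"
  shows "(\<integral>\<^sup>+x. ennreal (v x) * indicator D (Y x) \<partial>M) = (\<integral>\<^sup>+x. ennreal (v x) \<partial>M) * emeasure L D"
proof -
  let ?ca = closed_approx and ?V = "\<integral>\<^sup>+x. ennreal (v x) \<partial>M" and ?W = "\<lambda>n. (\<integral>\<^sup>+x. ennreal (w n x) \<partial>M)"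
  let ?PY = "distr (density M (\<lambda>x. ennreal (v x))) paths Y" and ?PYn = "\<lambda>n. distr (density M (\<lambda>x. ennreal (w n x))) paths (Yn n)"
  interpret M: prob_space M by fact
  interpret L: prob_space L by fact
  have [measurable_cong]: "sets L = sets paths" by fact
  have space_L: "space L = space paths" using L(2) by (rule sets_eq_imp_space_eq)
  have v_bounds: "0 \<le> v x" "v x \<le> 1" if "x \<in> space M" for x
    using LIMSEQ_le_const[OF w_lim[OF that], of 0] LIMSEQ_le_const2[OF w_lim[OF that], of 1] w_bounds[OF that] by auto
  have approx_n: "(\<integral>\<^sup>+x. ennreal (w n x) * ennreal (?ca m I C (Yn n x)) \<partial>M) =
    (?W n) * (\<integral>\<^sup>+f. ennreal (?ca m I C f) \<partial>L)"
    if I: "finite I" "I \<subseteq> {0..}" for n m I and C :: "real \<Rightarrow> 'b set"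
  proof -
    have [measurable]: "?ca m I C \<in> borel_measurable paths"
      by (rule closed_approx_measurable[OF I])
    \<comment> \<open>The hypothesis on sets says that the weighted law of the path is a multiple of
      \<open>L\<close>; in this form it applies to integrals of functions as well.\<close>
    have "?PYn n = scale_measure (?W n) L"
    proof (rule measure_eqI)
      fix D assume "D \<in> sets (?PYn n)"
      then have D [measurable]: "D \<in> sets paths" by simp
      have "emeasure (?PYn n) D =
        (\<integral>\<^sup>+x. ennreal (w n x) * indicator D (Yn n x) \<partial>M)"
        by (simp add: emeasure_distr emeasure_density, intro nn_integral_cong) (auto simp: indicator_def)
      then show "emeasure (?PYn n) D =
        emeasure (scale_measure (?W n) L) D"
        using eq[OF D] by simp
    qed (simp add: L)
    then have "(\<integral>\<^sup>+f. ennreal (?ca m I C f) \<partial>?PYn n) =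
      (\<integral>\<^sup>+f. ennreal (?ca m I C f) \<partial>scale_measure (?W n) L)" by simp
    then show ?thesis
      by (simp add: nn_integral_distr nn_integral_density nn_integral_scale_measure)
  qed
  have approx: "(\<integral>\<^sup>+x. ennreal (v x * ?ca m I C (Y x)) \<partial>M) =
    ?V * (\<integral>\<^sup>+f. ennreal (?ca m I C f) \<partial>L)"
    if I: "finite I" "I \<subseteq> {0..}" for m I and C :: "real \<Rightarrow> 'b set"
  proof (rule LIMSEQ_unique)
    have [measurable]: "?ca m I C \<in> borel_measurable paths"
      by (rule closed_approx_measurable[OF I])
    have one: "(\<integral>\<^sup>+x. 1 \<partial>M) < \<infinity>" by (simp add: M.emeasure_space_1)
    show "(\<lambda>n. \<integral>\<^sup>+x. ennreal (w n x * ?ca m I C (Yn n x)) \<partial>M) \<longlonglongrightarrow> (\<integral>\<^sup>+x. ennreal (v x * ?ca m I C (Y x)) \<partial>M)"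
    proof (rule nn_integral_dominated_convergence[where w="\<lambda>_. 1"])
      show "AE x in M. ennreal (w n x * ?ca m I C (Yn n x)) \<le> 1" for n
        using w_bounds[of _ n] closed_approx_bounds[of m I C]
        by (intro AE_I2) (auto intro!: mult_le_one simp: ennreal_le_1)
      show "AE x in M. (\<lambda>n. ennreal (w n x * ?ca m I C (Yn n x))) \<longlonglongrightarrow> ennreal (v x * ?ca m I C (Y x))"
      proof (intro AE_I2 tendsto_ennrealI)
        fix x assume x: "x \<in> space M"
        show "(\<lambda>n. w n x * ?ca m I C (Yn n x)) \<longlonglongrightarrow> v x * ?ca m I C (Y x)"
        \<comment> \<open>Where the limiting weight is 0 the paths may behave arbitrarily: the
          weights alone squeeze the product to 0.\<close>
        proof (cases "v x = 0")
          case True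
          have "(\<lambda>n. w n x * ?ca m I C (Yn n x)) \<longlonglongrightarrow> 0"
          proof (rule Lim_null_comparison)
            show "(\<lambda>n. w n x) \<longlonglongrightarrow> 0" using w_lim[OF x] True by simp
            show "\<forall>\<^sub>F n in sequentially. norm (w n x * ?ca m I C (Yn n x)) \<le> w n x"
              using w_bounds[OF x] closed_approx_bounds[of m I C]
              by (intro always_eventually) (auto simp: abs_mult intro!: mult_left_le)
          qed
          then show ?thesis using True by simp
        next
          case False
          have "(\<lambda>n. ?ca m I C (Yn n x)) \<longlonglongrightarrow> ?ca m I C (Y x)"
            using I by (intro closed_approx_limit Y_lim[OF x False]) auto
          then show ?thesis by (intro tendsto_mult w_lim[OF x])
        qed
      qed
    qed (use one in auto)
    have "(\<lambda>n. (?W n)) \<longlonglongrightarrow> ?V"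
    proof (rule nn_integral_dominated_convergence[where w="\<lambda>_. 1"])
      show "AE x in M. ennreal (w n x) \<le> 1" for n
        using w_bounds by (intro AE_I2) auto
      show "AE x in M. (\<lambda>n. ennreal (w n x)) \<longlonglongrightarrow> ennreal (v x)"
        using w_lim by (intro AE_I2 tendsto_ennrealI) auto
    qed (use one in auto)
    moreover have "(\<integral>\<^sup>+f. ennreal (?ca m I C f) \<partial>L) \<noteq> \<infinity>"
    proof -
      have "(\<integral>\<^sup>+f. ennreal (?ca m I C f) \<partial>L) \<le> (\<integral>\<^sup>+f. 1 \<partial>L)"
        using closed_approx_bounds by (intro nn_integral_mono) auto
      also have "\<dots> = 1" by (simp add: L.emeasure_space_1)
      finally show ?thesis by (auto simp: top_unique)
    qed
    ultimately have "(\<lambda>n. (?W n) * (\<integral>\<^sup>+f. ennreal (?ca m I C f) \<partial>L)) \<longlonglongrightarrow>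
        ?V * (\<integral>\<^sup>+f. ennreal (?ca m I C f) \<partial>L)"
      by (subst (1 2) mult.commute, intro ennreal_tendsto_cmult) (auto simp: top.not_eq_extremum)
    moreover have "(\<integral>\<^sup>+x. ennreal (w n x * ?ca m I C (Yn n x)) \<partial>M) =
        (\<integral>\<^sup>+x. ennreal (w n x) * ennreal (?ca m I C (Yn n x)) \<partial>M)" for n
      by (intro nn_integral_cong ennreal_mult closed_approx_bounds w_bounds[THEN conjunct1])
    ultimately show "(\<lambda>n. \<integral>\<^sup>+x. ennreal (w n x * ?ca m I C (Yn n x)) \<partial>M) \<longlonglongrightarrow>
       ?V * (\<integral>\<^sup>+f. ennreal (?ca m I C f) \<partial>L)"
      using approx_n[OF I] by simp
  qed
  have "?PY = scale_measure ?V L"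
  proof (rule measure_eqI_path_space)
    have "emeasure (density M (\<lambda>x. ennreal (v x))) (space M) \<le> (\<integral>\<^sup>+x. 1 \<partial>M)"
      unfolding emeasure_density[OF measurable_compose[OF w(2) measurable_ennreal] sets.top]
      by (intro nn_integral_mono) (simp add: v_bounds)
    then have "finite_measure (density M (\<lambda>x. ennreal (v x)))"
      by (intro finite_measureI) (auto simp: M.emeasure_space_1 top_unique)
    then show "finite_measure ?PY"
      by (rule finite_measure.finite_measure_distr) simp
  next
    fix I and C :: "real \<Rightarrow> 'b set" assume I: "finite I" "I \<subseteq> {0..}" and C: "\<And>i. i \<in> I \<Longrightarrow> closed (C i)"
    let ?D = "{f \<in> space paths. \<forall>i\<in>I. f i \<in> C i}"
    have D [measurable]: "?D \<in> sets paths"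
      using I C by (intro sets.sets_Collect_finite_All measurable_sets_Collect[OF measurable_component_singleton]) auto
    have [measurable]: "?ca m I C \<in> borel_measurable paths" for m
      by (rule closed_approx_measurable[OF I])
    have "emeasure ?PY ?D = (\<integral>\<^sup>+x. ennreal (v x) * indicator ?D (Y x) \<partial>M)"
      by (simp add: emeasure_distr emeasure_density, intro nn_integral_cong) (auto simp: indicator_def)
    also have "\<dots> = ?V * emeasure L ?D"
    \<comment> \<open>With an empty side the approximating functions do not tend to the indicator,
      but then the cylinder itself is empty.\<close>
    proof (cases "\<exists>i\<in>I. C i = {}")
      case True
      then have e: "?D = {}" by auto
      show ?thesis unfolding e by simp
    next
      case False
      have ind: "indicator ?D f = (if \<forall>i\<in>I. f i \<in> C i then 1 else 0 :: real)" if "f \<in> space paths" for f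
        using that by (simp add: indicator_def)
      have lim: "(\<lambda>m. ?ca m I C f) \<longlonglongrightarrow> indicator ?D f" if "f \<in> space paths" for f
        unfolding ind[OF that] using False by (intro closed_approx_tendsto I C) auto
      show ?thesis
      proof (rule LIMSEQ_unique)
        have "(\<lambda>m. \<integral>\<^sup>+x. ennreal (v x * ?ca m I C (Y x)) \<partial>M) \<longlonglongrightarrow> (\<integral>\<^sup>+x. ennreal (v x * indicator ?D (Y x)) \<partial>M)"
        proof (rule nn_integral_dominated_convergence[where w="\<lambda>_. 1"])
          show "AE x in M. ennreal (v x * ?ca m I C (Y x)) \<le> 1" for m
            using v_bounds closed_approx_bounds[of m I C]
            by (intro AE_I2) (auto intro!: mult_le_one simp: ennreal_le_1)
          show "AE x in M. (\<lambda>m. ennreal (v x * ?ca m I C (Y x))) \<longlonglongrightarrow> ennreal (v x * indicator ?D (Y x))"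
            by (intro AE_I2 tendsto_ennrealI tendsto_mult tendsto_const lim measurable_space[OF Y(2)])
        qed (auto simp: M.emeasure_space_1)
        moreover have "(\<integral>\<^sup>+x. ennreal (v x * indicator ?D (Y x)) \<partial>M) = (\<integral>\<^sup>+x. ennreal (v x) * indicator ?D (Y x) \<partial>M)"
          by (intro nn_integral_cong) (auto simp: indicator_def)
        ultimately show "(\<lambda>m. ?V * (\<integral>\<^sup>+f. ennreal (?ca m I C f) \<partial>L)) \<longlonglongrightarrow> (\<integral>\<^sup>+x. ennreal (v x) * indicator ?D (Y x) \<partial>M)"
          using approx[OF I] by simp
        have "(\<lambda>m. \<integral>\<^sup>+f. ennreal (?ca m I C f) \<partial>L) \<longlonglongrightarrow> (\<integral>\<^sup>+f. ennreal (indicator ?D f) \<partial>L)"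
        proof (rule nn_integral_dominated_convergence[where w="\<lambda>_. 1"])
          show "AE f in L. ennreal (?ca m I C f) \<le> 1" for m
            using closed_approx_bounds[of m I C] by (intro AE_I2) auto
          show "AE f in L. (\<lambda>m. ennreal (?ca m I C f)) \<longlonglongrightarrow> ennreal (indicator ?D f)"
            by (intro AE_I2 tendsto_ennrealI lim) (simp add: space_L)
        qed (auto simp: L.emeasure_space_1)
        moreover have "(\<integral>\<^sup>+f. ennreal (indicator ?D f) \<partial>L) = emeasure L ?D"
          by (simp add: ennreal_indicator)
        ultimately have lim_L: "(\<lambda>m. \<integral>\<^sup>+f. ennreal (?ca m I C f) \<partial>L) \<longlonglongrightarrow> emeasure L ?D" by simp
        show "(\<lambda>m. ?V * (\<integral>\<^sup>+f. ennreal (?ca m I C f) \<partial>L)) \<longlonglongrightarrow> ?V * emeasure L ?D"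
        proof (rule ennreal_tendsto_cmult[OF _ lim_L])
          have "?V \<le> (\<integral>\<^sup>+x. 1 \<partial>M)"
            using v_bounds by (intro nn_integral_mono) auto
          also have "\<dots> < top" by (simp add: M.emeasure_space_1)
          finally show "?V < top" .
        qed
      qed
    qed
    finally show "emeasure ?PY ?D =
        emeasure (scale_measure ?V L) ?D" by simp
  qed (simp_all add: L)
  then have "emeasure ?PY D =
    emeasure (scale_measure ?V L) D" by simp
  moreover have "emeasure ?PY D = (\<integral>\<^sup>+x. ennreal (v x) * indicator D (Y x) \<partial>M)"
    using D by (simp add: emeasure_distr emeasure_density, intro nn_integral_cong) (auto simp: indicator_def)
  ultimately show ?thesis by simp
qed

section \<open>The strong Markov property\<close>

text \<open>A random grid time takes only countably many values, so evaluation there is a countable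
  case distinction over fixed times.\<close>

lemma measurable_at_grid:
  fixes f :: "real \<Rightarrow> 'a \<Rightarrow> 'b"
  assumes f: "\<And>t. 0 \<le> t \<Longrightarrow> f t \<in> measurable N K" and T: "T \<in> borel_measurable N" "\<And>w. w \<in> space N \<Longrightarrow> 0 \<le> T w"
  shows "(\<lambda>w. f (upper_grid n (T w)) w) \<in> measurable N K"
proof -
  have [measurable]: "T \<in> borel_measurable N" by fact
  \<comment> \<open>The maximum makes every integer index yield a nonnegative time, as the
    hypothesis on \<open>f\<close> requires; it is inactive for the indices that occur.\<close>
  have "(\<lambda>w. f (of_int (max 0 \<lfloor>real (Suc n) * T w\<rfloor> + 1) / real (Suc n)) w) \<in> measurable N K"
  proof (rule measurable_compose_countable[where f="\<lambda>i. f (of_int (max 0 i + 1) / real (Suc n))" and g="\<lambda>w. \<lfloor>real (Suc n) * T w\<rfloor>"])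
    show "f (of_int (max 0 i + 1) / real (Suc n)) \<in> measurable N K" for i
      by (intro f) (auto intro!: divide_nonneg_nonneg)
  qed measurable
  moreover have "f (of_int (max 0 \<lfloor>real (Suc n) * T w\<rfloor> + 1) / real (Suc n)) w = f (upper_grid n (T w)) w"
    if "w \<in> space N" for w
  proof -
    have "0 \<le> \<lfloor>real (Suc n) * T w\<rfloor>" using T(2)[OF that] by simp
    then show ?thesis unfolding upper_grid_def by (simp add: max_def)
  qed
  ultimately show ?thesis by (simp cong: measurable_cong)
qed

text \<open>The filtration is a parameter and the state space a general normed space, since the pair
  \<open>(Zp, Zm)\<close> and its difference are both treated as Markov processes with respect to
  the history of the pair.\<close>

locale markov_process = prob_space M
  for M :: "'a measure" +
  fixes X :: "real \<Rightarrow> 'a \<Rightarrow> 'b::{second_countable_topology, real_normed_vector}"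
    and F :: "real \<Rightarrow> 'a measure"
  assumes space_F: "\<And>t. space (F t) = space M"
    and sets_F: "\<And>t. 0 \<le> t \<Longrightarrow> sets (F t) \<subseteq> sets M"
    and F_mono: "\<And>s t. 0 \<le> s \<Longrightarrow> s \<le> t \<Longrightarrow> sets (F s) \<subseteq> sets (F t)"
    and adapted: "\<And>t. 0 \<le> t \<Longrightarrow> X t \<in> borel_measurable (F t)"
    and right_cont: "\<And>w t. w \<in> space M \<Longrightarrow> 0 \<le> t \<Longrightarrow> ((\<lambda>t. X t w) \<longlongrightarrow> X t w) (at_right t)"
    and X_0: "\<And>w. w \<in> space M \<Longrightarrow> X 0 w = 0"
    and markov: "\<And>s A D. 0 \<le> s \<Longrightarrow> A \<in> sets (F s) \<Longrightarrow> D \<in> sets paths \<Longrightarrow>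
      emeasure M (A \<inter> (post_path X s -` D \<inter> space M)) = emeasure M A * emeasure (distr M paths (sample_path X)) D"
begin

abbreviation law :: "(real \<Rightarrow> 'b) measure" where
  "law \<equiv> distr M paths (sample_path X)"

lemma measurable_F: "0 \<le> t \<Longrightarrow> f \<in> measurable (F t) N \<Longrightarrow> f \<in> measurable M N"
  using sets_F[of t] space_F[of t] by (auto simp: measurable_def)

lemma X_measurable: "0 \<le> t \<Longrightarrow> X t \<in> borel_measurable M"
  using measurable_F[OF _ adapted] .

lemma adapted': "0 \<le> s \<Longrightarrow> s \<le> t \<Longrightarrow> X s \<in> borel_measurable (F t)"
  using adapted[of s] F_mono[of s t] space_F by (auto simp: measurable_def)

lemma sample_path_measurable: "sample_path X \<in> measurable M paths"
  by (intro measurable_path X_measurable)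

lemma prob_space_law: "prob_space law"
  by (intro prob_space_distr sample_path_measurable)

lemma X_grid_tendsto:
  assumes "w \<in> space M" "0 \<le> s" "0 \<le> t"
  shows "(\<lambda>n. X (upper_grid n s + t) w) \<longlonglongrightarrow> X (s + t) w"
proof -
  have "filterlim (\<lambda>x. x + t) (at_right (s + t)) (at_right s)"
    unfolding filterlim_at by (auto intro!: tendsto_eq_intros simp: eventually_at_filter)
  from filterlim_compose[OF filterlim_compose[OF right_cont this] filterlim_upper_grid] assms
  show ?thesis by auto
qed

lemma X_at_measurable:
  assumes N: "space N = space M" and X: "\<And>t. 0 \<le> t \<Longrightarrow> X t \<in> borel_measurable N"
    and T: "T \<in> borel_measurable N" "\<And>w. w \<in> space M \<Longrightarrow> 0 \<le> T w"
    and t: "0 \<le> t"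
  shows "(\<lambda>w. X (T w + t) w) \<in> borel_measurable N"
proof (rule borel_measurable_LIMSEQ_metric)
  show "(\<lambda>w. X (upper_grid n (T w) + t) w) \<in> borel_measurable N" for n
    using N T t by (intro measurable_at_grid[where f="\<lambda>s. X (s + t)"] X) auto
  show "(\<lambda>n. X (upper_grid n (T w) + t) w) \<longlonglongrightarrow> X (T w + t) w" if "w \<in> space N" for w
    using N T t that by (intro X_grid_tendsto) auto
qed

lemma post_at_measurable:
  assumes T: "T \<in> borel_measurable M" "\<And>w. w \<in> space M \<Longrightarrow> 0 \<le> T w"
  shows "(\<lambda>w. post_path X (T w) w) \<in> measurable M paths"
  unfolding post_path_def
proof (rule measurable_restrict)
  fix t :: real assume "t \<in> {0..}"
  then show "(\<lambda>w. X (T w + t) w - X (T w) w) \<in> borel_measurable M"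
    using X_at_measurable[OF refl X_measurable T, of t] X_at_measurable[OF refl X_measurable T, of 0] by simp
qed

text \<open>The strict inequality is essential: passage strictly above a level becomes visible only
  immediately afterwards, so these times need not be stopping times of a filtration that is not
  right-continuous.\<close>

definition optional_time :: "('a \<Rightarrow> ennreal) \<Rightarrow> bool" where
  "optional_time S \<longleftrightarrow> (\<forall>t\<ge>0. {w\<in>space M. S w < ennreal t} \<in> sets (F t))"

lemma optional_timeD: "optional_time S \<Longrightarrow> 0 \<le> t \<Longrightarrow> {w\<in>space M. S w < ennreal t} \<in> sets (F t)"
  by (simp add: optional_time_def)

lemma optional_time_measurable:
  assumes "optional_time S"
  shows "S \<in> borel_measurable M"
proof (rule borel_measurableI_less)
  fix y :: ennreal
  show "{w \<in> space M. S w < y} \<in> sets M"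
  proof (cases y)
    case (real r)
    then show ?thesis using optional_timeD[OF assms] sets_F by auto
  next
    case top
    have "S w < top \<longleftrightarrow> (\<exists>n::nat. S w < ennreal (real n))" for w
    proof
      assume "S w < top"
      then obtain r where "0 \<le> r" "S w = ennreal r" by (cases "S w") auto
      moreover obtain n :: nat where "r < real n" using reals_Archimedean2 by blast
      ultimately show "\<exists>n::nat. S w < ennreal (real n)" by (auto intro!: exI[of _ n] simp: ennreal_less_iff)
    qed (auto intro: less_trans)
    then have "{w \<in> space M. S w < y} = (\<Union>n::nat. {w \<in> space M. S w < ennreal (real n)})"
      using top by auto
    also have "\<dots> \<in> sets M"
    proof -
      have "{w \<in> space M. S w < ennreal (real n)} \<in> sets M" for n :: nat
        using optional_timeD[OF assms of_nat_0_le_iff] sets_F[OF of_nat_0_le_iff] by (rule subsetD[rotated])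
      then show ?thesis by (intro sets.countable_UN) auto
    qed
    finally show ?thesis .
  qed
qed

lemma enn2real_optional [measurable]: "optional_time S \<Longrightarrow> (\<lambda>w. enn2real (S w)) \<in> borel_measurable M"
  using optional_time_measurable by measurable

text \<open>On the cell where the time falls into \<open>[k/N, (k+1)/N)\<close> the grid point is
  the fixed time \<open>(k+1)/N\<close>, and the cell belongs to the history up to that time. The
  Markov property at fixed times is summed over the cells.\<close>

lemma strong_markov_grid:
  assumes S: "optional_time S"
    and A: "A \<in> sets M" "\<And>w. w \<in> A \<Longrightarrow> S w < \<infinity>" "\<And>t. 0 \<le> t \<Longrightarrow> A \<inter> {w\<in>space M. S w < ennreal t} \<in> sets (F t)"
    and D: "D \<in> sets paths"
  shows "emeasure M (A \<inter> ((\<lambda>w. post_path X (upper_grid n (enn2real (S w))) w) -` D \<inter> space M)) = emeasure M A * emeasure law D"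
proof -
  define N where "N = real (Suc n)"
  have N: "0 < N" unfolding N_def by simp
  define Ak where "Ak k = A \<inter> {w\<in>space M. S w < ennreal (real (Suc k) / N)} - {w\<in>space M. S w < ennreal (real k / N)}" for k
  have A_sub: "A \<subseteq> space M" using A(1) by (rule sets.sets_into_space)
  have S_real: "S w = ennreal (enn2real (S w))" if "w \<in> A" for w using A(2)[OF that] by (simp add: less_top)
  have Ak_iff: "w \<in> Ak k \<longleftrightarrow> w \<in> A \<and> \<lfloor>N * enn2real (S w)\<rfloor> = int k" for w k
  proof (cases "w \<in> A")
    case True
    have "w \<in> Ak k \<longleftrightarrow> enn2real (S w) < real (Suc k) / N \<and> real k / N \<le> enn2real (S w)"
    proof -
      obtain r where r: "0 \<le> r" "S w = ennreal r" using A(2)[OF True] by (cases "S w") auto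
      have "0 \<le> real k / N" "0 \<le> real (Suc k) / N" using N by auto
      then show ?thesis
        unfolding Ak_def using True A_sub r by (auto simp: ennreal_less_iff not_less simp del: of_nat_Suc)
    qed
    also have "\<dots> \<longleftrightarrow> \<lfloor>N * enn2real (S w)\<rfloor> = int k"
      using N by (auto simp: floor_eq_iff field_simps)
    finally show ?thesis using True by simp
  qed (auto simp: Ak_def)
  have Ak_F: "Ak k \<in> sets (F (real (Suc k) / N))" for k
  proof -
    have "{w\<in>space M. S w < ennreal (real k / N)} \<in> sets (F (real k / N))"
      using N by (intro optional_timeD[OF S]) auto
    moreover have "sets (F (real k / N)) \<subseteq> sets (F (real (Suc k) / N))"
      using N by (intro F_mono) (auto simp: field_simps)
    ultimately show ?thesis unfolding Ak_def using A(3)[of "real (Suc k) / N"] N by auto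
  qed
  then have Ak_M: "Ak k \<in> sets M" for k
    using sets_F[of "real (Suc k) / N"] N by auto
  have disj: "disjoint_family Ak" unfolding disjoint_family_on_def using Ak_iff by auto
  have union: "(\<Union>k. Ak k) = A"
  proof safe
    fix w assume "w \<in> A"
    moreover have "\<lfloor>N * enn2real (S w)\<rfloor> = int (nat \<lfloor>N * enn2real (S w)\<rfloor>)" using N by simp
    ultimately show "w \<in> (\<Union>k. Ak k)" using Ak_iff by blast
  qed (auto simp: Ak_def)
  have post: "post_path X t -` D \<inter> space M \<in> sets M" if "0 \<le> t" for t
    using that D by (intro measurable_sets[OF measurable_post] X_measurable) auto
  have grid: "upper_grid n (enn2real (S w)) = real (Suc k) / N" if "w \<in> Ak k" for w k
    using that unfolding Ak_iff upper_grid_def N_def by simp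
  have "A \<inter> ((\<lambda>w. post_path X (upper_grid n (enn2real (S w))) w) -` D \<inter> space M) =
    (\<Union>k. Ak k \<inter> (post_path X (real (Suc k) / N) -` D \<inter> space M))"
    unfolding union[symmetric] using grid by auto
  also have "emeasure M \<dots> = (\<Sum>k. emeasure M (Ak k \<inter> (post_path X (real (Suc k) / N) -` D \<inter> space M)))"
  proof (rule suminf_emeasure[symmetric])
    have "Ak k \<inter> (post_path X (real (Suc k) / N) -` D \<inter> space M) \<in> sets M" for k
      using N by (intro sets.Int[OF Ak_M post]) simp
    then show "range (\<lambda>k. Ak k \<inter> (post_path X (real (Suc k) / N) -` D \<inter> space M)) \<subseteq> sets M"
      by (rule image_subsetI)
    show "disjoint_family (\<lambda>k. Ak k \<inter> (post_path X (real (Suc k) / N) -` D \<inter> space M))"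
      using disj by (auto simp: disjoint_family_on_def)
  qed
  also have "\<dots> = (\<Sum>k. emeasure M (Ak k) * emeasure law D)"
    using markov[OF _ Ak_F D] N by simp
  also have "\<dots> = emeasure M A * emeasure law D"
    using suminf_emeasure[OF _ disj] Ak_M by (simp add: union image_subset_iff)
  finally show ?thesis .
qed

text \<open>The grid times decrease to \<open>S\<close>, and by right-continuity the paths after
  them converge pointwise to the path after \<open>S\<close>. The weight is the fixed indicator of
  \<open>A\<close> throughout.\<close>

lemma strong_markov_event:
  assumes S: "optional_time S"
    and A: "A \<in> sets M" "\<And>x. x \<in> A \<Longrightarrow> S x < \<infinity>" "\<And>t. 0 \<le> t \<Longrightarrow> A \<inter> {x\<in>space M. S x < ennreal t} \<in> sets (F t)"
    and D: "D \<in> sets paths"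
  shows "emeasure M (A \<inter> ((\<lambda>x. post_path X (enn2real (S x)) x) -` D \<inter> space M)) = emeasure M A * emeasure law D"
proof -
  have [measurable]: "(\<lambda>x. enn2real (S x)) \<in> borel_measurable M" using S by (rule enn2real_optional)
  have [measurable]: "A \<in> sets M" by fact
  have grid: "(\<lambda>x. post_path X (upper_grid n (enn2real (S x))) x) \<in> measurable M paths" for n
  proof (rule post_at_measurable)
    show "(\<lambda>x. upper_grid n (enn2real (S x))) \<in> borel_measurable M" unfolding upper_grid_def by measurable
    show "0 \<le> upper_grid n (enn2real (S x))" for x
      using upper_grid_bounds(1)[of "enn2real (S x)" n] enn2real_nonneg[of "S x"] by linarith
  qed
  have limit: "(\<lambda>x. post_path X (enn2real (S x)) x) \<in> measurable M paths"
    by (rule post_at_measurable) auto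
  have ind: "(\<integral>\<^sup>+x. ennreal (indicator A x) * indicator D (f x) \<partial>M) = emeasure M (A \<inter> (f -` D \<inter> space M))"
    if [measurable]: "f \<in> measurable M paths" for f
  proof -
    have "(\<integral>\<^sup>+x. ennreal (indicator A x) * indicator D (f x) \<partial>M) = (\<integral>\<^sup>+x. indicator (A \<inter> (f -` D \<inter> space M)) x \<partial>M)"
      by (intro nn_integral_cong) (auto simp: indicator_def)
    also have "\<dots> = emeasure M (A \<inter> (f -` D \<inter> space M))"
      using measurable_sets[OF that D] by (intro nn_integral_indicator) auto
    finally show ?thesis .
  qed
  have indA: "(\<integral>\<^sup>+x. ennreal (indicator A x) \<partial>M) = emeasure M A"
    by (simp add: ennreal_indicator)
  have "(\<integral>\<^sup>+x. ennreal (indicator A x) * indicator D (post_path X (enn2real (S x)) x) \<partial>M) =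
    (\<integral>\<^sup>+x. ennreal (indicator A x) \<partial>M) * emeasure law D"
  proof (rule weighted_path_limit[where w="\<lambda>_. indicator A" and Yn="\<lambda>n x. post_path X (upper_grid n (enn2real (S x))) x", OF prob_space_axioms prob_space_law _ _ _ _ _ grid limit _ _ D])
    fix x t assume "x \<in> space M" "0 \<le> (t::real)"
    then show "(\<lambda>n. post_path X (upper_grid n (enn2real (S x))) x t) \<longlonglongrightarrow> post_path X (enn2real (S x)) x t"
      unfolding post_path_def using X_grid_tendsto[of x "enn2real (S x)" t] X_grid_tendsto[of x "enn2real (S x)" 0]
      by (auto intro!: tendsto_diff)
  next
    fix n D assume D: "D \<in> sets (paths :: (real \<Rightarrow> 'b) measure)"
    show "(\<integral>\<^sup>+x. ennreal (indicator A x) * indicator D (post_path X (upper_grid n (enn2real (S x))) x) \<partial>M) =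
      (\<integral>\<^sup>+x. ennreal (indicator A x) \<partial>M) * emeasure law D"
    proof -
      have "(\<integral>\<^sup>+x. ennreal (indicator A x) * indicator D (post_path X (upper_grid n (enn2real (S x))) x) \<partial>M) =
         (\<integral>\<^sup>+x. indicator (A \<inter> ((\<lambda>x. post_path X (upper_grid n (enn2real (S x))) x) -` D \<inter> space M)) x \<partial>M)"
        by (intro nn_integral_cong) (auto simp: indicator_def)
      also have "\<dots> = emeasure M (A \<inter> ((\<lambda>x. post_path X (upper_grid n (enn2real (S x))) x) -` D \<inter> space M))"
        using measurable_sets[OF grid D] by (intro nn_integral_indicator) auto
      finally show ?thesis using strong_markov_grid[OF S A D, of n] indA by simp
    qed
  qed (auto simp: indicator_def)
  then show ?thesis using ind[OF limit] indA by simp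
qed

text \<open>Replacing the time by \<open>t\<close> off the event \<open>S w < t\<close> gives a time
  bounded by \<open>t\<close> that is measurable for \<open>F t\<close>, and the position at that
  time is then \<open>F t\<close>-measurable as well.\<close>

lemma optional_value_event:
  assumes S: "optional_time S" and B: "B \<in> sets (borel \<Otimes>\<^sub>M borel)"
    and t: "0 \<le> t"
  shows "{w\<in>space M. S w < ennreal t \<and> (enn2real (S w), X (enn2real (S w)) w) \<in> B} \<in> sets (F t)"
proof -
  have St: "{w\<in>space (F t). S w < ennreal t} \<in> sets (F t)"
    using optional_timeD[OF S t] by (simp add: space_F)
  define T where "T w = (if S w < ennreal t then enn2real (S w) else t)" for w
  have T_bounds: "0 \<le> T w" "T w \<le> t" for w
    unfolding T_def using t by (cases "S w"; auto simp: ennreal_less_iff)+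
  have T [measurable]: "T \<in> borel_measurable (F t)"
  proof (rule borel_measurableI_less)
    fix y
    show "{w \<in> space (F t). T w < y} \<in> sets (F t)"
    proof (cases "y \<le> t")
      case True
      show ?thesis
      proof (cases "0 \<le> y")
        case True
        have "T w < y \<longleftrightarrow> S w < ennreal y" for w
        proof
          assume "T w < y"
          then show "S w < ennreal y"
            using \<open>y \<le> t\<close> \<open>0 \<le> y\<close> unfolding T_def by (cases "S w") (auto simp: ennreal_less_iff split: if_splits)
        next
          assume a: "S w < ennreal y"
          have "S w < ennreal t" using a \<open>y \<le> t\<close> by (meson ennreal_leI less_le_trans)
          then show "T w < y" using a \<open>0 \<le> y\<close> unfolding T_def by (cases "S w") (auto simp: ennreal_less_iff)
        qed
        then have "{w \<in> space (F t). T w < y} = {w\<in>space M. S w < ennreal y}"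
          by (simp add: space_F)
        also have "\<dots> \<in> sets (F t)" using optional_timeD[OF S True] F_mono[OF True \<open>y \<le> t\<close>] by auto
        finally show ?thesis .
      next
        case False
        then have "\<not> T w < y" for w using T_bounds(1)[of w] by linarith
        then have "{w \<in> space (F t). T w < y} = {}" by auto
        then show ?thesis by (simp only: sets.empty_sets)
      qed
    next
      case False
      then have "T w < y" for w using T_bounds(2)[of w] by linarith
      then have "{w \<in> space (F t). T w < y} = space (F t)" by auto
      then show ?thesis by (simp only: sets.top)
    qed
  qed
  have X_T: "(\<lambda>w. X (T w) w) \<in> borel_measurable (F t)"
  proof (rule borel_measurable_LIMSEQ_metric)
    \<comment> \<open>Values beyond \<open>t\<close> are not \<open>F t\<close>-measurable, so the
      grid points are clipped. The clipping is eventually inactive if \<open>T w < t\<close>, and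
      always active if \<open>T w = t\<close>.\<close>
    show "(\<lambda>w. X (min t (upper_grid n (T w))) w) \<in> borel_measurable (F t)" for n
      using T_bounds t by (intro measurable_at_grid[where f="\<lambda>s. X (min t s)"] adapted' T) auto
    show "(\<lambda>n. X (min t (upper_grid n (T w))) w) \<longlonglongrightarrow> X (T w) w" if "w \<in> space (F t)" for w
    proof (cases "T w < t")
      case True
      have "\<forall>\<^sub>F n in sequentially. upper_grid n (T w) < t"
      proof -
        have "\<forall>\<^sub>F s in at_right (T w). s < t" using True unfolding eventually_at_right[OF True] by auto
        then show ?thesis using filterlim_upper_grid by (auto simp: filterlim_iff)
      qed
      then have "\<forall>\<^sub>F n in sequentially. X (upper_grid n (T w)) w = X (min t (upper_grid n (T w))) w"
        by eventually_elim auto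
      moreover have "(\<lambda>n. X (upper_grid n (T w)) w) \<longlonglongrightarrow> X (T w) w"
        using X_grid_tendsto[of w "T w" 0] that T_bounds by (simp add: space_F)
      ultimately show ?thesis by (rule Lim_transform_eventually[rotated])
    next
      case False
      then have "T w = t" using T_bounds(2)[of w] by simp
      then show ?thesis using upper_grid_bounds(1)[of t] by (simp add: min_absorb1 less_imp_le)
    qed
  qed
  have "{w\<in>space (F t). (T w, X (T w) w) \<in> B} \<in> sets (F t)"
    using measurable_sets[OF measurable_Pair[OF T X_T] B] by (simp add: vimage_def Int_def conj_commute)
  then have "{w\<in>space (F t). S w < ennreal t} \<inter> {w\<in>space (F t). (T w, X (T w) w) \<in> B} \<in> sets (F t)"
    using St by (rule sets.Int[rotated])
  also have "{w\<in>space (F t). S w < ennreal t} \<inter> {w\<in>space (F t). (T w, X (T w) w) \<in> B} =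
    {w\<in>space M. S w < ennreal t \<and> (enn2real (S w), X (enn2real (S w)) w) \<in> B}"
    by (auto simp: T_def space_F)
  finally show ?thesis .
qed

text \<open>Under \<open>M\<close> restricted to \<open>E\<close>, the joint law of (time, position)
  and of the path afterwards is a product measure: this need only be tested on rectangles, where it
  is the previous event form. Integration over the product gives the claim.\<close>

lemma strong_markov:
  assumes S: "optional_time S"
    and E: "E \<in> sets M" "\<And>w. w \<in> E \<Longrightarrow> S w < \<infinity>" "\<And>t. 0 \<le> t \<Longrightarrow> E \<inter> {w\<in>space M. S w < ennreal t} \<in> sets (F t)"
    and h: "h \<in> borel_measurable ((borel \<Otimes>\<^sub>M borel) \<Otimes>\<^sub>M paths)"
  shows "(\<integral>\<^sup>+w. indicator E w * h ((enn2real (S w), X (enn2real (S w)) w), post_path X (enn2real (S w)) w) \<partial>M) =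
    (\<integral>\<^sup>+w. indicator E w * (\<integral>\<^sup>+w'. h ((enn2real (S w), X (enn2real (S w)) w), sample_path X w') \<partial>M) \<partial>M)"
proof -
  define V where "V w = (enn2real (S w), X (enn2real (S w)) w)" for w
  define P where "P w = post_path X (enn2real (S w)) w" for w
  have S_meas: "(\<lambda>w. enn2real (S w)) \<in> borel_measurable M" using S by (rule enn2real_optional)
  have V [measurable]: "V \<in> measurable M (borel \<Otimes>\<^sub>M borel)"
    unfolding V_def using X_at_measurable[OF refl X_measurable S_meas, of 0] S_meas by (intro measurable_Pair) auto
  have P [measurable]: "P \<in> measurable M paths"
    unfolding P_def using S_meas by (intro post_at_measurable) auto
  have [measurable]: "E \<in> sets M" by fact
  note h[measurable]
  interpret law: prob_space law by (rule prob_space_law)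
  let ?ME = "density M (indicator E)"
  have finE: "finite_measure ?ME"
    by (intro finite_measureI) (simp add: emeasure_restricted)
  then have finV: "finite_measure (distr ?ME (borel \<Otimes>\<^sub>M borel) V)"
    by (rule finite_measure.finite_measure_distr) simp
  have "distr ?ME (borel \<Otimes>\<^sub>M borel) V \<Otimes>\<^sub>M law = distr ?ME ((borel \<Otimes>\<^sub>M borel) \<Otimes>\<^sub>M paths) (\<lambda>w. (V w, P w))"
  proof (rule pair_measure_eqI)
    show "sigma_finite_measure (distr ?ME (borel \<Otimes>\<^sub>M borel) V)"
      using finV by (rule finite_measure.axioms(1))
    show "sigma_finite_measure law" by (rule law.sigma_finite_measure_axioms)
    fix B D assume B: "B \<in> sets (distr ?ME (borel \<Otimes>\<^sub>M borel) V)" and D: "D \<in> sets law"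
    then have [measurable]: "B \<in> sets (borel \<Otimes>\<^sub>M borel)" "D \<in> sets paths" by auto
    let ?A = "E \<inter> (V -` B \<inter> space M)"
    have A: "?A \<in> sets M" by measurable
    have A_t: "?A \<inter> {w\<in>space M. S w < ennreal t} \<in> sets (F t)" if t: "0 \<le> t" for t
    proof -
      have "?A \<inter> {w\<in>space M. S w < ennreal t} = (E \<inter> {w\<in>space M. S w < ennreal t}) \<inter>
         {w\<in>space M. S w < ennreal t \<and> (enn2real (S w), X (enn2real (S w)) w) \<in> B}"
        unfolding V_def by auto
      also have "\<dots> \<in> sets (F t)"
        using B by (intro sets.Int E(3) optional_value_event S t) auto
      finally show ?thesis .
    qed
    have "emeasure (distr ?ME (borel \<Otimes>\<^sub>M borel) V) B = emeasure M ?A"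
      by (simp add: emeasure_distr emeasure_restricted)
    moreover have "emeasure (distr ?ME ((borel \<Otimes>\<^sub>M borel) \<Otimes>\<^sub>M paths) (\<lambda>w. (V w, P w))) (B \<times> D) =
        emeasure M (?A \<inter> (P -` D \<inter> space M))"
    proof -
      have "emeasure (distr ?ME ((borel \<Otimes>\<^sub>M borel) \<Otimes>\<^sub>M paths) (\<lambda>w. (V w, P w))) (B \<times> D) =
        emeasure M (E \<inter> ((\<lambda>w. (V w, P w)) -` (B \<times> D) \<inter> space M))"
        by (simp add: emeasure_distr emeasure_restricted)
      also have "E \<inter> ((\<lambda>w. (V w, P w)) -` (B \<times> D) \<inter> space M) = ?A \<inter> (P -` D \<inter> space M)" by auto
      finally show ?thesis .
    qed
    moreover have "emeasure M (?A \<inter> (P -` D \<inter> space M)) = emeasure M ?A * emeasure law D"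
      unfolding P_def using E(2) D by (intro strong_markov_event[OF S A _ A_t]) auto
    ultimately show "emeasure (distr ?ME (borel \<Otimes>\<^sub>M borel) V) B * emeasure law D =
        emeasure (distr ?ME ((borel \<Otimes>\<^sub>M borel) \<Otimes>\<^sub>M paths) (\<lambda>w. (V w, P w))) (B \<times> D)" by simp
  qed (simp cong: sets_pair_measure_cong)
  then have eq: "(\<integral>\<^sup>+x. h x \<partial>distr ?ME ((borel \<Otimes>\<^sub>M borel) \<Otimes>\<^sub>M paths) (\<lambda>w. (V w, P w))) =
    (\<integral>\<^sup>+x. h x \<partial>(distr ?ME (borel \<Otimes>\<^sub>M borel) V \<Otimes>\<^sub>M law))" by simp
  have h': "h \<in> borel_measurable (distr ?ME (borel \<Otimes>\<^sub>M borel) V \<Otimes>\<^sub>M law)"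
    using h by (simp cong: measurable_cong_sets sets_pair_measure_cong)
  have inner: "(\<lambda>x. \<integral>\<^sup>+f. h (x, f) \<partial>law) \<in> borel_measurable (borel \<Otimes>\<^sub>M borel)"
    using h by (intro law.borel_measurable_nn_integral) (simp cong: measurable_cong_sets sets_pair_measure_cong)
  have inner': "(\<integral>\<^sup>+f. h (x, f) \<partial>law) = (\<integral>\<^sup>+w'. h (x, sample_path X w') \<partial>M)" for x
    by (subst nn_integral_distr[OF sample_path_measurable]) (auto intro!: measurable_compose[OF measurable_Pair1' h] simp: space_pair_measure)
  have "(\<integral>\<^sup>+x. h x \<partial>distr ?ME ((borel \<Otimes>\<^sub>M borel) \<Otimes>\<^sub>M paths) (\<lambda>w. (V w, P w))) = (\<integral>\<^sup>+w. indicator E w * h (V w, P w) \<partial>M)"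
    by (simp add: nn_integral_distr nn_integral_density)
  moreover have "(\<integral>\<^sup>+x. h x \<partial>(distr ?ME (borel \<Otimes>\<^sub>M borel) V \<Otimes>\<^sub>M law)) = (\<integral>\<^sup>+x. (\<integral>\<^sup>+f. h (x, f) \<partial>law) \<partial>distr ?ME (borel \<Otimes>\<^sub>M borel) V)"
    by (rule law.nn_integral_fst[symmetric, OF h'])
  moreover have "(\<integral>\<^sup>+x. (\<integral>\<^sup>+f. h (x, f) \<partial>law) \<partial>distr ?ME (borel \<Otimes>\<^sub>M borel) V) = (\<integral>\<^sup>+w. indicator E w * (\<integral>\<^sup>+f. h (V w, f) \<partial>law) \<partial>M)"
    using inner by (simp add: nn_integral_distr nn_integral_density)
  ultimately show ?thesis using eq unfolding V_def P_def inner' by simp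
qed

end

section \<open>Measurable functionals of a path, and the history of a process\<close>

lemma measurable_at_lower_grid:
  fixes f :: "real \<Rightarrow> 'a \<Rightarrow> 'b"
  assumes f: "\<And>t. 0 \<le> t \<Longrightarrow> f t \<in> measurable N K" and T: "T \<in> borel_measurable N"
  shows "(\<lambda>w. f (lower_grid n (T w)) w) \<in> measurable N K"
proof -
  have [measurable]: "T \<in> borel_measurable N" by fact
  have "(\<lambda>w. f (max 0 ((of_int \<lceil>real (Suc n) * T w\<rceil> - 1) / real (Suc n))) w) \<in> measurable N K"
  proof (rule measurable_compose_countable[where f="\<lambda>i. f (max 0 ((of_int i - 1) / real (Suc n)))" and g="\<lambda>w. \<lceil>real (Suc n) * T w\<rceil>"])
    show "f (max 0 ((of_int i - 1) / real (Suc n))) \<in> measurable N K" for i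
      by (intro f) auto
  qed measurable
  then show ?thesis unfolding lower_grid_def .
qed

lemma path_component_measurable:
  "g \<in> measurable N paths \<Longrightarrow> 0 \<le> t \<Longrightarrow> (\<lambda>x. g x t) \<in> borel_measurable N"
  by (rule measurable_compose[OF _ measurable_component_singleton]) auto

lemma right_value_measurable:
  fixes g :: "'a \<Rightarrow> real \<Rightarrow> 'b::{banach, second_countable_topology}"
  assumes "g \<in> measurable N paths" "T \<in> borel_measurable N" "\<And>x. x \<in> space N \<Longrightarrow> 0 \<le> T x"
  shows "(\<lambda>x. right_value (g x) (T x)) \<in> borel_measurable N"
  unfolding right_value_def
  by (intro borel_measurable_lim_metric measurable_at_grid[where f="\<lambda>t x. g x t"] path_component_measurable assms)

lemma left_value_measurable:
  fixes g :: "'a \<Rightarrow> real \<Rightarrow> 'b::{banach, second_countable_topology}"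
  assumes "g \<in> measurable N paths" "T \<in> borel_measurable N"
  shows "(\<lambda>x. left_value (g x) (T x)) \<in> borel_measurable N"
  unfolding left_value_def
  by (intro borel_measurable_lim_metric measurable_at_lower_grid[where f="\<lambda>t x. g x t"] path_component_measurable assms)

lemma passage_measurable:
  assumes [measurable]: "g \<in> measurable N paths" "c \<in> borel_measurable N"
  shows "(\<lambda>x. passage (c x) (g x)) \<in> borel_measurable N"
  unfolding passage_def
proof (rule borel_measurable_INF)
  show "countable {q \<in> \<rat>. (0::real) < q}" using countable_rat by (rule countable_subset[rotated]) auto
  fix q :: real assume "q \<in> {q \<in> \<rat>. 0 < q}"
  then have [measurable]: "(\<lambda>x. g x q) \<in> borel_measurable N"
    by (intro path_component_measurable) auto
  show "(\<lambda>x. if c x < g x q then ennreal q else \<infinity>) \<in> borel_measurable N" by measurable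
qed

lemma passage_less_iff: "passage c f < x \<longleftrightarrow> (\<exists>q\<in>\<rat>. 0 < q \<and> c < f q \<and> ennreal q < x)"
  unfolding passage_def INF_less_iff by (auto split: if_splits)

lemma right_value_cong:
  "0 \<le> t \<Longrightarrow> (\<And>s. t < s \<Longrightarrow> f s = g s) \<Longrightarrow> right_value f t = right_value g t"
  unfolding right_value_def using upper_grid_bounds(1) by simp

lemma left_value_cong:
  "0 \<le> t \<Longrightarrow> (\<And>s. 0 \<le> s \<Longrightarrow> f s = g s) \<Longrightarrow> left_value f t = left_value g t"
  unfolding left_value_def by (simp add: lower_grid_def)

lemma cadlag_shift:
  assumes "cadlag f" "0 \<le> s"
  shows "cadlag (\<lambda>t. f (s + t) - c)"
  unfolding cadlag_def
proof safe
  fix t :: real assume t: "0 \<le> t"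
  have "filterlim (\<lambda>x. s + x) (at_right (s + t)) (at_right t)"
    unfolding filterlim_at by (auto intro!: tendsto_eq_intros simp: eventually_at_filter)
  with cadlag_right[OF assms(1), of "s + t"] assms(2) t have "((\<lambda>x. f (s + x)) \<longlongrightarrow> f (s + t)) (at_right t)"
    by (auto intro: filterlim_compose)
  then show "((\<lambda>t. f (s + t) - c) \<longlongrightarrow> f (s + t) - c) (at_right t)" by (intro tendsto_intros)
next
  fix t :: real assume t: "0 < t"
  have "filterlim (\<lambda>x. s + x) (at_left (s + t)) (at_left t)"
    unfolding filterlim_at by (auto intro!: tendsto_eq_intros simp: eventually_at_filter)
  with left_limit_tendsto[OF assms(1), of "s + t"] assms(2) t
  have "((\<lambda>x. f (s + x)) \<longlongrightarrow> left_limit f (s + t)) (at_left t)"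
    by (auto intro: filterlim_compose)
  then have "((\<lambda>t. f (s + t) - c) \<longlongrightarrow> left_limit f (s + t) - c) (at_left t)" by (intro tendsto_intros)
  then show "\<exists>l. ((\<lambda>t. f (s + t) - c) \<longlongrightarrow> l) (at_left t)" ..
qed

lemma left_limit_shift:
  assumes "cadlag f" "0 \<le> s" "0 < t"
  shows "left_limit (\<lambda>t. f (s + t) - c) t = left_limit f (s + t) - c"
proof (rule left_limit_eqI[OF _ assms(3)])
  have "filterlim (\<lambda>x. s + x) (at_left (s + t)) (at_left t)"
    unfolding filterlim_at by (auto intro!: tendsto_eq_intros simp: eventually_at_filter)
  with left_limit_tendsto[OF assms(1), of "s + t"] assms(2,3)
  have "((\<lambda>x. f (s + x)) \<longlongrightarrow> left_limit f (s + t)) (at_left t)"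
    by (auto intro: filterlim_compose)
  then show "((\<lambda>t. f (s + t) - c) \<longlongrightarrow> left_limit f (s + t) - c) (at_left t)" by (intro tendsto_intros)
qed

lemma passage_sample_path:
  "cadlag (\<lambda>t. X t w) \<Longrightarrow> passage c (sample_path X w) = first_passage (\<lambda>t. X t w) c"
  by (subst passage_cadlag[symmetric]) (auto intro!: passage_cong simp: sample_path_def)

definition past :: "'a measure \<Rightarrow> (real \<Rightarrow> 'a \<Rightarrow> 'b::topological_space) \<Rightarrow> real \<Rightarrow> 'a measure" where
  "past M X t = vimage_algebra (space M) (pre_path X t) (PiM {0..t} (\<lambda>_. borel))"

lemma space_past [simp]: "space (past M X t) = space M"
  by (simp add: past_def)

lemma pre_path_space: "pre_path X t \<in> space M \<rightarrow> space (PiM {0..t} (\<lambda>_. borel))"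
  by (auto simp: pre_path_def space_PiM)

lemma past_adapted: "0 \<le> s \<Longrightarrow> s \<le> t \<Longrightarrow> X s \<in> borel_measurable (past M X t)"
proof -
  assume s: "0 \<le> s" "s \<le> t"
  have "(\<lambda>w. pre_path X t w s) \<in> borel_measurable (past M X t)"
    unfolding past_def using s
    by (intro measurable_compose[OF measurable_vimage_algebra1[OF pre_path_space] measurable_component_singleton]) auto
  then show ?thesis using s by (simp add: pre_path_def)
qed

lemma past_sub:
  assumes "\<And>t. 0 \<le> t \<Longrightarrow> X t \<in> borel_measurable M"
  shows "sets (past M X t) \<subseteq> sets M"
  unfolding past_def sets_vimage_algebra2[OF pre_path_space]
  using measurable_pre[of X M t, OF assms] by auto

lemma past_mono:
  assumes "0 \<le> s" "s \<le> t"
  shows "sets (past M X s) \<subseteq> sets (past M X t)"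
proof -
  have "pre_path X s \<in> measurable (past M X t) (PiM {0..s} (\<lambda>_. borel))"
    unfolding pre_path_def using assms by (intro measurable_restrict past_adapted) auto
  then show ?thesis
    unfolding past_def[of M X s] sets_vimage_algebra2[OF pre_path_space]
    by (auto dest: measurable_sets)
qed

lemma markov_process_past:
  fixes X :: "real \<Rightarrow> 'a \<Rightarrow> 'b::{second_countable_topology, real_normed_vector}"
  assumes "prob_space M" and X: "\<And>t. 0 \<le> t \<Longrightarrow> X t \<in> borel_measurable M"
    and "\<And>w t. w \<in> space M \<Longrightarrow> 0 \<le> t \<Longrightarrow> ((\<lambda>t. X t w) \<longlongrightarrow> X t w) (at_right t)"
    and "\<And>w. w \<in> space M \<Longrightarrow> X 0 w = 0"
    and ind: "\<And>s. 0 \<le> s \<Longrightarrow> prob_space.indep_var M (PiM {0..s} (\<lambda>_. borel)) (pre_path X s) paths (post_path X s)"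
    and law: "\<And>s. 0 \<le> s \<Longrightarrow> distr M paths (post_path X s) = distr M paths (sample_path X)"
  shows "markov_process M X (past M X)"
proof -
  interpret prob_space M by fact
  show ?thesis
  proof
    fix s A D assume s: "0 \<le> (s::real)" and A: "A \<in> sets (past M X s)" and D: "D \<in> sets (paths :: (real \<Rightarrow> 'b) measure)"
    then obtain B where B: "B \<in> sets (PiM {0..s} (\<lambda>_. borel))" "A = pre_path X s -` B \<inter> space M"
      unfolding past_def sets_vimage_algebra2[OF pre_path_space] by auto
    have "A \<inter> (post_path X s -` D \<inter> space M) = (\<lambda>w. (pre_path X s w, post_path X s w)) -` (B \<times> D) \<inter> space M"
      unfolding B(2) by auto
    then have "prob (A \<inter> (post_path X s -` D \<inter> space M)) = prob A * prob (post_path X s -` D \<inter> space M)"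
      using indep_varD[OF ind[OF s] B(1) D] B(2) by simp
    moreover have "emeasure (distr M paths (sample_path X)) D = prob (post_path X s -` D \<inter> space M)"
      unfolding law[OF s, symmetric] using measurable_post[OF s X] D
      by (subst emeasure_distr) (auto simp: emeasure_eq_measure)
    ultimately show "emeasure M (A \<inter> (post_path X s -` D \<inter> space M)) = emeasure M A * emeasure (distr M paths (sample_path X)) D"
      by (simp add: emeasure_eq_measure ennreal_mult)
  next
    show "sets (past M X s) \<subseteq> sets (past M X t)" if "0 \<le> s" "s \<le> t" for s t
      using that by (rule past_mono)
    show "X t \<in> borel_measurable (past M X t)" if "0 \<le> t" for t
      using that order.refl by (rule past_adapted)
    show "sets (past M X t) \<subseteq> sets M" for t
      using X by (rule past_sub)
  qed (use assms in auto)
qed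

context markov_process
begin

text \<open>Increments of the image are images of increments, so the property is inherited with the
  same filtration. This is how the difference becomes a Markov process relative to the history of
  the pair.\<close>

lemma markov_process_image:
  fixes Y :: "real \<Rightarrow> 'a \<Rightarrow> 'c::{second_countable_topology, real_normed_vector}" and g :: "'b \<Rightarrow> 'c"
  assumes g: "continuous_on UNIV g" and lin: "\<And>x y. g (x - y) = g x - g y"
  shows "markov_process M (\<lambda>t w. g (X t w)) F"
proof
  have g_meas [measurable]: "g \<in> borel_measurable borel" using g by (rule borel_measurable_continuous_onI)
  fix s A D assume s: "0 \<le> (s::real)" and A: "A \<in> sets (F s)" and D: "D \<in> sets (paths :: (real \<Rightarrow> 'c) measure)"
  let ?g = "\<lambda>f. \<lambda>t\<in>{0..}. g (f t)"
  have g': "?g \<in> measurable paths paths"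
    by (intro measurable_restrict measurable_compose[OF _ g_meas] measurable_component_singleton) auto
  have 1: "post_path (\<lambda>t w. g (X t w)) s = (\<lambda>w. ?g (post_path X s w))"
    unfolding post_path_def by (auto simp: lin fun_eq_iff)
  have 2: "sample_path (\<lambda>t w. g (X t w)) = (\<lambda>w. ?g (sample_path X w))"
    unfolding sample_path_def by (auto simp: fun_eq_iff)
  have D': "?g -` D \<inter> space paths \<in> sets paths" using g' D by (rule measurable_sets)
  have "emeasure M (A \<inter> (post_path (\<lambda>t w. g (X t w)) s -` D \<inter> space M)) =
    emeasure M (A \<inter> (post_path X s -` (?g -` D \<inter> space paths) \<inter> space M))"
    unfolding 1 using measurable_space[OF measurable_post[OF s X_measurable]] by (intro arg_cong[where f="emeasure M"]) auto
  also have "\<dots> = emeasure M A * emeasure law (?g -` D \<inter> space paths)"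
    by (rule markov[OF s A D'])
  also have "emeasure law (?g -` D \<inter> space paths) = emeasure (distr law paths ?g) D"
    using g' D by (subst emeasure_distr) auto
  also have "distr law paths ?g = distr M paths (sample_path (\<lambda>t w. g (X t w)))"
    unfolding 2 by (subst distr_distr[OF g' sample_path_measurable]) (simp add: comp_def)
  finally show "emeasure M (A \<inter> (post_path (\<lambda>t w. g (X t w)) s -` D \<inter> space M)) =
    emeasure M A * emeasure (distr M paths (sample_path (\<lambda>t w. g (X t w)))) D" .
next
  have g0: "g 0 = 0" using lin[of 0 0] by simp
  show "g (X 0 w) = 0" if "w \<in> space M" for w using X_0[OF that] g0 by simp
  fix t :: real assume t: "0 \<le> t"
  have g_meas: "g \<in> borel_measurable borel" using g by (rule borel_measurable_continuous_onI)
  show "(\<lambda>w. g (X t w)) \<in> borel_measurable (F t)"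
    by (rule measurable_compose[OF adapted[OF t] g_meas])
  show "((\<lambda>t. g (X t w)) \<longlongrightarrow> g (X t w)) (at_right t)" if "w \<in> space M" for w
    using continuous_on_tendsto_compose[OF g right_cont[OF that t]] by auto
qed (use space_F sets_F F_mono in auto)

text \<open>By right-continuity, a passage before \<open>t\<close> shows at some rational time
  before \<open>t\<close>. Here \<open>Y\<close> is any adapted cadlag process, for instance one
  component of the pair.\<close>

lemma first_passage_optional:
  assumes Y: "\<And>t. 0 \<le> t \<Longrightarrow> Y t \<in> borel_measurable (F t)" and cad: "\<And>w. w \<in> space M \<Longrightarrow> cadlag (\<lambda>t. Y t w)"
  shows "optional_time (\<lambda>w. first_passage (\<lambda>t. Y t w) c)"
  unfolding optional_time_def
proof safe
  fix t :: real assume t: "0 \<le> t"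
  have "{w \<in> space M. first_passage (\<lambda>t. Y t w) c < ennreal t} = (\<Union>q\<in>{q\<in>\<rat>. 0 < q \<and> q < t}. {w \<in> space M. c < Y q w})"
  proof -
    have "first_passage (\<lambda>t. Y t w) c < ennreal t \<longleftrightarrow> (\<exists>q\<in>{q\<in>\<rat>. 0 < q \<and> q < t}. c < Y q w)" if "w \<in> space M" for w
      unfolding passage_cadlag[OF cad[OF that], symmetric] passage_less_iff by (auto simp: ennreal_less_iff)
    then show ?thesis by auto
  qed
  also have "\<dots> \<in> sets (F t)"
  proof (rule sets.countable_UN'')
    show "countable {q \<in> \<rat>. (0::real) < q \<and> q < t}" using countable_rat by (rule countable_subset[rotated]) auto
    fix q assume q: "q \<in> {q \<in> \<rat>. 0 < q \<and> q < t}"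
    then have [measurable]: "Y q \<in> borel_measurable (F q)" by (intro Y) auto
    have "{w \<in> space (F q). c < Y q w} \<in> sets (F q)" by measurable
    then show "{w \<in> space M. c < Y q w} \<in> sets (F t)" using F_mono[of q t] q by (auto simp: space_F)
  qed
  finally show "{w \<in> space M. first_passage (\<lambda>t. Y t w) c < ennreal t} \<in> sets (F t)" .
qed

end

section \<open>Fourier estimates for small increments\<close>

definition unif :: "real measure" where
  "unif = density lborel (indicator {0..1})"

lemma sets_unif [simp, measurable_cong]: "sets unif = sets borel"
  by (simp add: unif_def)

lemma space_unif [simp]: "space unif = UNIV"
  by (simp add: unif_def)

lemma prob_space_unif: "prob_space unif"
  by (rule prob_spaceI) (simp add: unif_def emeasure_restricted)

lemma AE_unif: "AE \<theta> in unif. 0 \<le> \<theta> \<and> \<theta> \<le> 1"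
  unfolding unif_def by (subst AE_density) (auto simp: indicator_def)

lemma integral_unif:
  fixes f :: "real \<Rightarrow> real"
  assumes "f \<in> borel_measurable borel"
  shows "(\<integral>\<theta>. f \<theta> \<partial>unif) = (\<integral>\<theta>. indicator {0..1} \<theta> *\<^sub>R f \<theta> \<partial>lborel)"
proof -
  have "unif = density lborel (\<lambda>\<theta>. ennreal (indicator {0..1} \<theta>))"
    unfolding unif_def by (intro density_cong) (auto simp: ennreal_indicator)
  then have "(\<integral>\<theta>. f \<theta> \<partial>unif) = (\<integral>\<theta>. f \<theta> \<partial>density lborel (\<lambda>\<theta>. ennreal (indicator {0..1} \<theta>)))"
    by (rule arg_cong[where f="\<lambda>M. integral\<^sup>L M f"])
  also have "\<dots> = (\<integral>\<theta>. indicator {0..1} \<theta> *\<^sub>R f \<theta> \<partial>lborel)"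
    using assms by (intro integral_density) auto
  finally show ?thesis .
qed

lemma integral_unif_FTC:
  fixes f F :: "real \<Rightarrow> real"
  assumes "\<And>x. (F has_real_derivative f x) (at x)" "continuous_on UNIV f"
  shows "(\<integral>\<theta>. f \<theta> \<partial>unif) = F 1 - F 0"
proof -
  have "f \<in> borel_measurable borel" using assms(2) by (rule borel_measurable_continuous_onI)
  then have "(\<integral>\<theta>. f \<theta> \<partial>unif) = (\<integral>\<theta>. indicator {0..1} \<theta> *\<^sub>R f \<theta> \<partial>lborel)"
    by (rule integral_unif)
  also have "\<dots> = F 1 - F 0"
  proof (rule integral_FTC_atLeastAtMost)
    show "(F has_vector_derivative f x) (at x within {0..1})" for x
      using assms(1)[of x] unfolding has_real_derivative_iff_has_vector_derivative
      by (rule has_vector_derivative_at_within)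
    show "continuous_on {0..1} f" using assms(2) by (rule continuous_on_subset) auto
  qed simp
  finally show ?thesis .
qed

lemma integrable_unif_bounded:
  fixes f :: "real \<Rightarrow> 'b::{banach, second_countable_topology}"
  assumes "f \<in> borel_measurable borel" "\<And>x. 0 \<le> x \<Longrightarrow> x \<le> 1 \<Longrightarrow> norm (f x) \<le> B"
  shows "integrable unif f"
proof -
  interpret prob_space unif by (rule prob_space_unif)
  show ?thesis
    using AE_unif assms by (intro integrable_const_bound[of _ B]) auto
qed

text \<open>For \<open>x \<noteq> 0\<close> the integral is the Fejer kernel
  \<open>2 * (1 - cos x) / x\<^sup>2\<close>, the Fourier transform of a triangle.\<close>

lemma triangle_kernel_nonneg: "0 \<le> (\<integral>\<theta>. 2 * (1 - \<theta>) * cos (\<theta> * x) \<partial>unif)"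
proof (cases "x = 0")
  case True
  have "(\<integral>\<theta>. 2 * (1 - \<theta>) * cos (\<theta> * 0) \<partial>unif) = (2 * 1 - 1 ^ 2) - (2 * 0 - 0 ^ 2)"
    by (rule integral_unif_FTC) (auto intro!: derivative_eq_intros continuous_intros simp: algebra_simps)
  then show ?thesis using True by simp
next
  case False
  let ?F = "\<lambda>\<theta>. 2 * (1 - \<theta>) * sin (\<theta> * x) / x - 2 * cos (\<theta> * x) / x\<^sup>2"
  have "(\<integral>\<theta>. 2 * (1 - \<theta>) * cos (\<theta> * x) \<partial>unif) = ?F 1 - ?F 0"
    using False
    by (intro integral_unif_FTC)
       (auto intro!: derivative_eq_intros continuous_intros simp: field_simps power2_eq_square)
  also have "\<dots> = 2 * (1 - cos x) / x\<^sup>2" by (simp add: field_simps diff_divide_distrib)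
  also have "\<dots> \<ge> 0" by (intro divide_nonneg_nonneg) auto
  finally show ?thesis .
qed

lemma cos_ge_half: "\<bar>x\<bar> \<le> 1 \<Longrightarrow> 1 / 2 \<le> cos (x::real)"
proof -
  assume "\<bar>x\<bar> \<le> 1"
  then have "\<bar>x\<bar> \<le> pi / 3" using pi_gt3 by simp
  then have "cos (pi / 3) \<le> cos \<bar>x\<bar>" using pi_gt3 by (intro cos_monotone_0_pi_le) auto
  then show ?thesis by (simp add: cos_60)
qed

text \<open>Since \<open>pi / 3\<close> exceeds 1, the cosine is at least \<open>1 / 2\<close> on
  the relevant range, so the integrand dominates \<open>1 - \<theta>\<close>, whose mean is
  \<open>1 / 2\<close>.\<close>

lemma triangle_kernel_ge:
  assumes "\<bar>x\<bar> \<le> 1"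
  shows "1 / 2 \<le> (\<integral>\<theta>. 2 * (1 - \<theta>) * cos (\<theta> * x) \<partial>unif)"
proof -
  have "(\<integral>\<theta>. (1 - \<theta>) \<partial>unif) = (1 - 1\<^sup>2 / 2) - (0 - 0\<^sup>2 / 2)"
    by (rule integral_unif_FTC) (auto intro!: derivative_eq_intros continuous_intros simp: algebra_simps)
  then have "1 / 2 = (\<integral>\<theta>. (1 - \<theta>) \<partial>unif)" by simp
  also have "\<dots> \<le> (\<integral>\<theta>. 2 * (1 - \<theta>) * cos (\<theta> * x) \<partial>unif)"
  proof (rule integral_mono_AE)
    show "integrable unif (\<lambda>\<theta>. 1 - \<theta>)"
      by (rule integrable_unif_bounded[where B=1]) auto
    have "\<bar>2 * (1 - \<theta>) * cos (\<theta> * x)\<bar> \<le> 2" if "0 \<le> \<theta>" "\<theta> \<le> 1" for \<theta>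
    proof -
      have "\<bar>(2 * (1 - \<theta>)) * cos (\<theta> * x)\<bar> \<le> 2 * 1"
        unfolding abs_mult using that by (intro mult_mono) auto
      then show ?thesis by simp
    qed
    then show "integrable unif (\<lambda>\<theta>. 2 * (1 - \<theta>) * cos (\<theta> * x))"
      by (intro integrable_unif_bounded[where B=2]) auto
    show "AE \<theta> in unif. 1 - \<theta> \<le> 2 * (1 - \<theta>) * cos (\<theta> * x)"
      using AE_unif
    proof eventually_elim
      case (elim \<theta>)
      have "\<bar>\<theta> * x\<bar> \<le> 1 * 1" unfolding abs_mult using elim assms by (intro mult_mono) auto
      then have "1 / 2 \<le> cos (\<theta> * x)" by (intro cos_ge_half) simp
      then have "2 * (1 - \<theta>) * (1 / 2) \<le> 2 * (1 - \<theta>) * cos (\<theta> * x)" using elim by (intro mult_left_mono) auto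
      then show ?case by simp
    qed
  qed
  finally show ?thesis .
qed

text \<open>A nonnegative kernel that is at least \<open>1 / 2\<close> on \<open>[-1, 1]\<close>
  dominates half of the indicator of the interval, and its integral against \<open>P\<close> turns
  into the characteristic function by Fubini. The constant 4 collects this factor 2 and the bound 2
  for the weight \<open>2 * (1 - \<theta>)\<close>.\<close>

lemma concentration_le_char:
  assumes "real_distribution P" and d: "0 < d"
  shows "measure P {y - d..y + d} \<le> 4 * (\<integral>\<theta>. cmod (char P (\<theta> / d)) \<partial>unif)"
proof -
  interpret P: real_distribution P by fact
  interpret U: prob_space unif by (rule prob_space_unif)
  interpret PU: pair_prob_space P unif ..
  let ?k = "\<lambda>x \<theta>. 2 * (1 - \<theta>) * cos (\<theta> * ((x - y) / d))"
  \<comment> \<open>Agrees with \<open>?k\<close> for \<open>\<theta>\<close> in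
    \<open>[0, 1]\<close>, where \<open>unif\<close> lives, but is bounded everywhere, which gives
    integrability on the product.\<close>
  let ?k' = "\<lambda>x \<theta>. 2 * (1 - max 0 (min 1 \<theta>)) * cos (\<theta> * ((x - y) / d))"
  have k_eq: "(\<integral>\<theta>. ?k x \<theta> \<partial>unif) = (\<integral>\<theta>. ?k' x \<theta> \<partial>unif)" for x
  proof (rule integral_cong_AE)
    show "AE \<theta> in unif. ?k x \<theta> = ?k' x \<theta>"
      using AE_unif by eventually_elim (simp add: min_def max_def)
  qed auto
  have k_bound: "norm (?k' x \<theta>) \<le> 2" for x \<theta>
  proof -
    have "\<bar>(2 * (1 - max 0 (min 1 \<theta>))) * cos (\<theta> * ((x - y) / d))\<bar> \<le> 2 * 1"
      unfolding abs_mult by (intro mult_mono) auto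
    then show ?thesis by simp
  qed
  have int_pair: "integrable (P \<Otimes>\<^sub>M unif) (\<lambda>(x, \<theta>). ?k' x \<theta>)"
    using k_bound by (intro PU.P.integrable_const_bound[of _ 2]) (auto simp del: norm_mult)
  have int_P: "integrable P (\<lambda>x. \<integral>\<theta>. ?k' x \<theta> \<partial>unif)"
    using PU.integrable_fst'[OF int_pair] by simp
  have "measure P {y - d..y + d} / 2 = (\<integral>x. indicator {y - d..y + d} x * (1 / 2) \<partial>P)"
    by simp
  also have "\<dots> \<le> (\<integral>x. (\<integral>\<theta>. ?k x \<theta> \<partial>unif) \<partial>P)"
  proof (rule integral_mono)
    show "integrable P (\<lambda>x. indicator {y - d..y + d} x * (1 / 2::real))"
      by (intro integrable_mult_left) (simp add: less_top[symmetric])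
    show "integrable P (\<lambda>x. \<integral>\<theta>. ?k x \<theta> \<partial>unif)" unfolding k_eq by (rule int_P)
    fix x
    show "indicator {y - d..y + d} x * (1 / 2) \<le> (\<integral>\<theta>. ?k x \<theta> \<partial>unif)"
    proof (cases "x \<in> {y - d..y + d}")
      case True
      then have "\<bar>(x - y) / d\<bar> \<le> 1" using d by (auto simp: abs_le_iff field_simps)
      from triangle_kernel_ge[OF this] True show ?thesis by simp
    qed (use triangle_kernel_nonneg[of "(x - y) / d"] in simp)
  qed
  also have "\<dots> = (\<integral>x. (\<integral>\<theta>. ?k' x \<theta> \<partial>unif) \<partial>P)" unfolding k_eq ..
  also have "\<dots> = (\<integral>\<theta>. (\<integral>x. ?k' x \<theta> \<partial>P) \<partial>unif)"
    by (rule PU.Fubini_integral[symmetric, OF int_pair])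
  also have "\<dots> \<le> (\<integral>\<theta>. 2 * cmod (char P (\<theta> / d)) \<partial>unif)"
  proof (rule integral_mono)
    show "integrable unif (\<lambda>\<theta>. \<integral>x. ?k' x \<theta> \<partial>P)"
      using PU.integrable_snd[OF int_pair] .
    have "(\<lambda>\<theta>. char P (\<theta> / d)) \<in> borel_measurable borel" by measurable
    then show "integrable unif (\<lambda>\<theta>. 2 * cmod (char P (\<theta> / d)))"
      using P.cmod_char_le_1 by (intro integrable_unif_bounded[where B=2]) auto
    fix \<theta>
    have int_c: "integrable P (\<lambda>x. iexp (\<theta> / d * x))" by (intro P.integrable_iexp) auto
    have "(\<integral>x. ?k' x \<theta> \<partial>P) = 2 * (1 - max 0 (min 1 \<theta>)) * (\<integral>x. cos (\<theta> * ((x - y) / d)) \<partial>P)"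
      by simp
    also have "(\<integral>x. cos (\<theta> * ((x - y) / d)) \<partial>P) = (\<integral>x. Re (iexp (- \<theta> * y / d) * iexp (\<theta> / d * x)) \<partial>P)"
    proof (rule Bochner_Integration.integral_cong[OF refl])
      fix x
      have "iexp (- \<theta> * y / d) * iexp (\<theta> / d * x) = iexp (\<theta> * ((x - y) / d))"
        by (simp add: exp_add[symmetric] algebra_simps diff_divide_distrib)
      then show "cos (\<theta> * ((x - y) / d)) = Re (iexp (- \<theta> * y / d) * iexp (\<theta> / d * x))"
        by (simp add: Re_exp)
    qed
    also have "\<dots> = Re (iexp (- \<theta> * y / d) * char P (\<theta> / d))"
      using int_c unfolding char_def by (subst integral_Re) (auto intro!: integrable_mult_right simp del: of_real_divide)
    also have "2 * (1 - max 0 (min 1 \<theta>)) * Re (iexp (- \<theta> * y / d) * char P (\<theta> / d)) \<le> 2 * cmod (char P (\<theta> / d))"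
    proof (rule order_trans[OF mult_left_mono mult_right_mono])
      show "Re (iexp (- \<theta> * y / d) * char P (\<theta> / d)) \<le> cmod (char P (\<theta> / d))"
        using complex_Re_le_cmod[of "iexp (- \<theta> * y / d) * char P (\<theta> / d)"] by (simp add: norm_mult)
    qed auto
    finally show "(\<integral>x. ?k' x \<theta> \<partial>P) \<le> 2 * cmod (char P (\<theta> / d))" .
  qed
  finally show ?thesis by simp
qed

section \<open>Averages of the modulus of a characteristic function\<close>

lemma exp_cos_period_integral_tendsto_0:
  "(\<lambda>n. \<integral>\<^sup>+u. ennreal (exp (- real n * (1 - cos u))) * indicator {0..<2 * pi} u \<partial>lborel) \<longlonglongrightarrow> 0"
proof -
  have "(\<lambda>n. \<integral>\<^sup>+u. ennreal (exp (- real n * (1 - cos u))) * indicator {0..<2 * pi} u \<partial>lborel) \<longlonglongrightarrow> (\<integral>\<^sup>+(u::real). 0 \<partial>lborel)"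
  proof (rule nn_integral_dominated_convergence[where w="indicator {0..<2 * pi}"])
    show "AE u in lborel. ennreal (exp (- real n * (1 - cos u))) * indicator {0..<2 * pi} u \<le> indicator {0..<2 * pi} u" for n
      by (intro AE_I2) (auto simp: indicator_def)
    show "AE u in lborel. (\<lambda>n. ennreal (exp (- real n * (1 - cos u))) * indicator {0..<2 * pi} u) \<longlonglongrightarrow> 0"
      using AE_lborel_singleton[of 0]
    proof eventually_elim
      case (elim u)
      show ?case
      proof (cases "u \<in> {0..<2 * pi}")
        case True
        have "cos u \<noteq> 1"
        proof
          assume "cos u = 1"
          then obtain k :: int where k: "u = real_of_int k * (2 * pi)" by (auto simp: cos_one_2pi_int)
          have "0 < u" using True elim by auto
          then have "0 < k" unfolding k by (simp add: zero_less_mult_iff)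
          then have "1 * (2 * pi) \<le> real_of_int k * (2 * pi)" by (intro mult_right_mono) auto
          then show False using k True by auto
        qed
        then have q: "0 \<le> exp (- (1 - cos u))" "exp (- (1 - cos u)) < 1" using cos_le_one[of u] \<open>cos u \<noteq> 1\<close> by (auto simp: less_le)
        have "(\<lambda>n. exp (- (1 - cos u)) ^ n) \<longlonglongrightarrow> 0" using q by (intro LIMSEQ_realpow_zero)
        then have "(\<lambda>n. exp (- real n * (1 - cos u))) \<longlonglongrightarrow> 0"
          by (simp add: exp_of_nat_mult[symmetric] algebra_simps)
        then have "(\<lambda>n. ennreal (exp (- real n * (1 - cos u)))) \<longlonglongrightarrow> ennreal 0" by (rule tendsto_ennrealI)
        then show ?thesis using True by simp
      qed simp
    qed
  qed auto
  then show ?thesis by simp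
qed

lemma nn_integral_exp_cos_scaled:
  fixes r :: real
  assumes r: "0 < r"
  shows "(\<integral>\<^sup>+\<theta>. ennreal (exp (- c * (1 - cos (\<theta> * r)))) * indicator {0..<2 * pi} (\<theta> * r - 2 * pi * real k) \<partial>lborel) =
    ennreal (1 / r) * (\<integral>\<^sup>+u. ennreal (exp (- c * (1 - cos u))) * indicator {0..<2 * pi} u \<partial>lborel)"
proof -
  have "(\<integral>\<^sup>+\<theta>. ennreal (exp (- c * (1 - cos (\<theta> * r)))) * indicator {0..<2 * pi} (\<theta> * r - 2 * pi * real k) \<partial>lborel) =
    ennreal \<bar>1 / r\<bar> * (\<integral>\<^sup>+u. ennreal (exp (- c * (1 - cos ((2 * pi * real k / r + 1 / r * u) * r)))) *
      indicator {0..<2 * pi} ((2 * pi * real k / r + 1 / r * u) * r - 2 * pi * real k) \<partial>lborel)"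
    using r by (intro nn_integral_real_affine) auto
  moreover have "cos ((2 * pi * real k / r + 1 / r * u) * r) = cos u" for u
  proof -
    have "(2 * pi * real k / r + 1 / r * u) * r = u + 2 * pi * real k" using r by (simp add: field_simps)
    moreover have "2 * pi * real k = 2 * real k * pi" by simp
    ultimately show ?thesis by (simp only: cos_add cos_2npi sin_2npi mult_1_right mult_zero_right diff_zero)
  qed
  moreover have "(2 * pi * real k / r + 1 / r * u) * r - 2 * pi * real k = u" for u
    using r by (simp add: field_simps)
  ultimately show ?thesis using r by simp
qed

text \<open>The point is uniformity in \<open>r\<close>: after rescaling, \<open>[0, r]\<close> is
  covered by at most \<open>r\<close> full periods of the cosine, each contributing
  \<open>1 / r\<close> times one fixed integral that vanishes for large \<open>n\<close>.\<close>

lemma exp_cos_integral_small: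
  assumes e: "0 < e"
  obtains n :: nat where "\<And>r. 2 * pi \<le> r \<Longrightarrow>
    (\<integral>\<^sup>+\<theta>. ennreal (exp (- real n * (1 - cos (\<theta> * r)))) \<partial>unif) \<le> ennreal e"
proof -
  let ?J = "\<lambda>n. \<integral>\<^sup>+u. ennreal (exp (- real n * (1 - cos u))) * indicator {0..<2 * pi} u \<partial>lborel"
  have "\<forall>\<^sub>F n in sequentially. ?J n < ennreal e"
    using e by (intro order_tendstoD(2)[OF exp_cos_period_integral_tendsto_0]) auto
  then obtain n where n: "?J n \<le> ennreal e"
    by (auto simp: eventually_sequentially intro: less_imp_le)
  have "(\<integral>\<^sup>+\<theta>. ennreal (exp (- real n * (1 - cos (\<theta> * r)))) \<partial>unif) \<le> ennreal e" if r: "2 * pi \<le> r" for r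
  proof -
    have r0: "0 < r" using r pi_gt_zero by linarith
    \<comment> \<open>The number of periods of length \<open>2 * pi\<close> that cover
      \<open>[0, r]\<close>. The bound \<open>2 * pi \<le> r\<close> makes it at most
      \<open>r\<close>.\<close>
    define N where "N = Suc (nat \<lfloor>r / (2 * pi)\<rfloor>)"
    let ?g = "\<lambda>\<theta>. ennreal (exp (- real n * (1 - cos (\<theta> * r))))"
    have "(\<integral>\<^sup>+\<theta>. ?g \<theta> \<partial>unif) = (\<integral>\<^sup>+\<theta>. indicator {0..1} \<theta> * ?g \<theta> \<partial>lborel)"
      unfolding unif_def by (subst nn_integral_density) auto
    also have "\<dots> \<le> (\<integral>\<^sup>+\<theta>. (\<Sum>k<N. ?g \<theta> * indicator {0..<2 * pi} (\<theta> * r - 2 * pi * real k)) \<partial>lborel)"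
    proof (rule nn_integral_mono)
      fix \<theta> :: real
      show "indicator {0..1} \<theta> * ?g \<theta> \<le> (\<Sum>k<N. ?g \<theta> * indicator {0..<2 * pi} (\<theta> * r - 2 * pi * real k))"
      proof (cases "\<theta> \<in> {0..1}")
        case True
        define k where "k = nat \<lfloor>\<theta> * r / (2 * pi)\<rfloor>"
        have nn: "0 \<le> \<lfloor>\<theta> * r / (2 * pi)\<rfloor>" using True r0 by (auto intro!: divide_nonneg_nonneg)
        then have k: "real k = of_int \<lfloor>\<theta> * r / (2 * pi)\<rfloor>" unfolding k_def by simp
        have le: "\<theta> * r / (2 * pi) \<le> r / (2 * pi)"
          using True r0 by (intro divide_right_mono) (auto simp: mult_left_le_one_le)
        have "k < N" unfolding k_def N_def using floor_mono[OF le] by (simp add: nat_mono less_Suc_eq_le)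
        have "real k \<le> \<theta> * r / (2 * pi)" "\<theta> * r / (2 * pi) < real k + 1" unfolding k by linarith+
        then have "\<theta> * r - 2 * pi * real k \<in> {0..<2 * pi}" by (simp add: field_simps)
        then have "indicator {0..1} \<theta> * ?g \<theta> \<le> ?g \<theta> * indicator {0..<2 * pi} (\<theta> * r - 2 * pi * real k)"
          using True by simp
        also have "\<dots> \<le> (\<Sum>k<N. ?g \<theta> * indicator {0..<2 * pi} (\<theta> * r - 2 * pi * real k))"
          using \<open>k < N\<close> by (intro member_le_sum) auto
        finally show ?thesis .
      qed simp
    qed
    also have "\<dots> = (\<Sum>k<N. ennreal (1 / r) * ?J n)"
      using nn_integral_exp_cos_scaled[OF r0, of "real n"] by (subst nn_integral_sum) auto
    also have "\<dots> = ennreal (real N / r) * ?J n"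
      using r0 by (simp add: ennreal_of_nat_eq_real_of_nat mult.assoc[symmetric] ennreal_mult[symmetric])
    also have "\<dots> \<le> 1 * ?J n"
    proof (rule mult_right_mono)
      have "real N \<le> r / (2 * pi) + 1" unfolding N_def using r0 by (simp add: of_nat_nat)
      also have "\<dots> \<le> r / 2 + r / 2"
      proof (intro add_mono)
        show "r / (2 * pi) \<le> r / 2" using r0 pi_gt3 by (intro divide_left_mono) auto
        show "1 \<le> r / 2" using r pi_gt3 by linarith
      qed
      finally have "real N / r \<le> 1" using r0 by (simp add: field_simps)
      then show "ennreal (real N / r) \<le> 1" by simp
    qed simp
    finally show ?thesis using n by simp
  qed
  then show thesis by (rule that)
qed

section \<open>Levy measures with integrable small jumps\<close>

locale levy_measure =
  fixes \<nu> :: "real measure"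
  assumes sets_nu [simp, measurable_cong]: "sets \<nu> = sets borel"
    and nu_0: "emeasure \<nu> {0} = 0"
    and nu_integral: "(\<integral>\<^sup>+ x. ennreal (min \<bar>x\<bar> 1) \<partial>\<nu>) < \<infinity>"
begin

lemma space_nu [simp]: "space \<nu> = UNIV"
  using sets_eq_imp_space_eq[OF sets_nu] by simp

lemma integrable_min: "integrable \<nu> (\<lambda>x. min \<bar>x\<bar> 1)"
  using nu_integral by (intro integrableI_nonneg) auto

lemma norm_iexp_minus_1_le: "norm (iexp (\<theta> * x) - 1) \<le> (2 + \<bar>\<theta>\<bar>) * min \<bar>x\<bar> 1"
proof (cases "\<bar>x\<bar> \<le> 1")
  case True
  have "norm (iexp (\<theta> * x) - 1) \<le> \<bar>\<theta> * x\<bar>"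
    using iexp_approx1[of "\<theta> * x" 0] by simp
  also have "\<dots> \<le> (2 + \<bar>\<theta>\<bar>) * \<bar>x\<bar>" unfolding abs_mult by (intro mult_right_mono) auto
  finally show ?thesis using True by (simp add: min_def)
next
  case False
  have "norm (iexp (\<theta> * x) - 1) \<le> norm (iexp (\<theta> * x)) + norm (1::complex)" by (rule norm_triangle_ineq4)
  also have "\<dots> \<le> (2 + \<bar>\<theta>\<bar>) * 1" by simp
  finally show ?thesis using False by (simp add: min_def)
qed

lemma integrable_iexp_minus_1: "integrable \<nu> (\<lambda>x. iexp (\<theta> * x) - 1)"
proof (rule Bochner_Integration.integrable_bound)
  show "integrable \<nu> (\<lambda>x. (2 + \<bar>\<theta>\<bar>) * min \<bar>x\<bar> 1)" using integrable_min by simp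
  show "AE x in \<nu>. norm (iexp (\<theta> * x) - 1) \<le> norm ((2 + \<bar>\<theta>\<bar>) * min \<bar>x\<bar> 1)"
    using norm_iexp_minus_1_le[of \<theta>] by (intro AE_I2) (auto intro: order_trans)
qed measurable

lemma outside_finite: "0 < e \<Longrightarrow> emeasure \<nu> {x. e \<le> \<bar>x\<bar>} < \<infinity>"
proof -
  assume e: "0 < e"
  have "ennreal (min e 1) * emeasure \<nu> {x. e \<le> \<bar>x\<bar>} = (\<integral>\<^sup>+x. ennreal (min e 1) * indicator {x. e \<le> \<bar>x\<bar>} x \<partial>\<nu>)"
    by (simp add: nn_integral_cmult_indicator)
  also have "\<dots> \<le> (\<integral>\<^sup>+ x. ennreal (min \<bar>x\<bar> 1) \<partial>\<nu>)"
    by (intro nn_integral_mono) (auto simp: indicator_def intro!: ennreal_leI)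
  also have "\<dots> < \<infinity>" by (rule nu_integral)
  finally show ?thesis using e by (auto simp: ennreal_mult_less_top less_top[symmetric] ennreal_mult_eq_top_iff)
qed

text \<open>All infinite mass sits near 0, and 0 itself carries none; so the mass outside a
  neighbourhood of 0 grows beyond any bound as the neighbourhood shrinks.\<close>

lemma outside_large:
  assumes inf: "emeasure \<nu> UNIV = \<infinity>" and c: "c < \<infinity>"
  obtains e where "0 < e" "c < emeasure \<nu> {x. e \<le> \<bar>x\<bar>}"
proof -
  have "(\<Union>n. {x::real. 1 / real (Suc n) \<le> \<bar>x\<bar>}) = UNIV - {0}"
  proof -
    have "\<exists>n. 1 / real (Suc n) \<le> \<bar>x\<bar>" if "x \<noteq> 0" for x :: real
    proof -
      from that have "0 < \<bar>x\<bar>" by simp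
      then show ?thesis using nat_approx_posE[of "\<bar>x\<bar>" thesis] by (meson less_imp_le nat_approx_posE)
    qed
    moreover have "\<not> 1 / real (Suc n) \<le> \<bar>0\<bar>" for n by simp
    ultimately show ?thesis by (auto simp del: of_nat_Suc)
  qed
  moreover have "emeasure \<nu> (UNIV - {0}) = \<infinity>"
    using inf nu_0 by (subst emeasure_Diff) auto
  moreover have "(SUP n. emeasure \<nu> {x. 1 / real (Suc n) \<le> \<bar>x\<bar>}) = emeasure \<nu> (\<Union>n. {x. 1 / real (Suc n) \<le> \<bar>x\<bar>})"
  proof (rule SUP_emeasure_incseq)
    show "incseq (\<lambda>n. {x::real. 1 / real (Suc n) \<le> \<bar>x\<bar>})"
    proof (rule incseq_SucI)
      fix n
      have "1 / real (Suc (Suc n)) \<le> 1 / real (Suc n)" by (intro divide_left_mono) auto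
      then show "{x::real. 1 / real (Suc n) \<le> \<bar>x\<bar>} \<subseteq> {x. 1 / real (Suc (Suc n)) \<le> \<bar>x\<bar>}"
        by (auto simp del: of_nat_Suc)
    qed
  qed auto
  ultimately have "(SUP n. emeasure \<nu> {x. 1 / real (Suc n) \<le> \<bar>x\<bar>}) = \<infinity>" by (simp only:)
  with c have "c < (SUP n. emeasure \<nu> {x. 1 / real (Suc n) \<le> \<bar>x\<bar>})" by (simp only:)
  then obtain n where "c < emeasure \<nu> {x. 1 / real (Suc n) \<le> \<bar>x\<bar>}" unfolding less_SUP_iff by auto
  then show thesis by (intro that[of "1 / real (Suc n)"]) auto
qed

text \<open>The real part is the integral of \<open>cos - 1\<close>, which is nonpositive and hence
  only grows when restricted to \<open>B\<close>. Jensen's inequality then replaces the exponential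
  of an average by an average of exponentials, to which bounds for each single jump size
  apply.\<close>

lemma exponent_Re_le:
  assumes s: "0 \<le> s" and B [measurable]: "B \<in> sets borel" and fin: "0 < emeasure \<nu> B" "emeasure \<nu> B < \<infinity>"
  shows "exp (s * Re (CLINT x|\<nu>. iexp (\<theta> * x) - 1)) \<le>
    (\<integral>x. exp (- (s * measure \<nu> B) * (1 - cos (\<theta> * x))) \<partial>uniform_measure \<nu> B)"
proof -
  interpret p: prob_space "uniform_measure \<nu> B" using fin by (intro prob_space_uniform_measure) auto
  have Re_eq: "Re (iexp (\<theta> * x) - 1) = cos (\<theta> * x) - 1" for x by (simp add: Re_exp)
  have int: "integrable \<nu> (\<lambda>x. cos (\<theta> * x) - 1)"
    using integrable_Re[OF integrable_iexp_minus_1[of \<theta>]] unfolding Re_eq .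
  have "Re (CLINT x|\<nu>. iexp (\<theta> * x) - 1) = (\<integral>x. cos (\<theta> * x) - 1 \<partial>\<nu>)"
    using integral_Re[OF integrable_iexp_minus_1[of \<theta>]] unfolding Re_eq by simp
  also have "\<dots> \<le> (\<integral>x. indicator B x * (cos (\<theta> * x) - 1) \<partial>\<nu>)"
  proof (rule integral_mono[OF int])
    have "B \<in> sets \<nu>" by simp
    then show "integrable \<nu> (\<lambda>x. indicator B x * (cos (\<theta> * x) - 1))"
      using integrable_real_mult_indicator[OF _ int] by (simp add: mult.commute)
  qed (auto simp: indicator_def)
  also have "(\<integral>x. indicator B x * (cos (\<theta> * x) - 1) \<partial>\<nu>) = measure \<nu> B * (\<integral>x. cos (\<theta> * x) - 1 \<partial>uniform_measure \<nu> B)"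
  proof -
    have m: "emeasure \<nu> B = ennreal (measure \<nu> B)"
      using fin by (intro emeasure_eq_ennreal_measure) (simp add: less_top[symmetric])
    have mpos: "0 < measure \<nu> B" using fin(1) unfolding m by simp
    have "indicator B x / emeasure \<nu> B = ennreal (indicator B x / measure \<nu> B)" for x
      unfolding m using mpos divide_ennreal[of 1 "measure \<nu> B"] by (cases "x \<in> B") simp_all
    then have "uniform_measure \<nu> B = density \<nu> (\<lambda>x. ennreal (indicator B x / measure \<nu> B))"
      unfolding uniform_measure_def by (simp only:)
    then have "(\<integral>x. cos (\<theta> * x) - 1 \<partial>uniform_measure \<nu> B) = (\<integral>x. cos (\<theta> * x) - 1 \<partial>density \<nu> (\<lambda>x. ennreal (indicator B x / measure \<nu> B)))"
      by (rule arg_cong[where f="\<lambda>M. integral\<^sup>L M (\<lambda>x. cos (\<theta> * x) - 1)"])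
    also have "\<dots> = (\<integral>x. (indicator B x / measure \<nu> B) *\<^sub>R (cos (\<theta> * x) - 1) \<partial>\<nu>)"
      by (intro integral_density) auto
    also have "\<dots> = (\<integral>x. indicator B x * (cos (\<theta> * x) - 1) / measure \<nu> B \<partial>\<nu>)"
      by (intro Bochner_Integration.integral_cong) auto
    also have "\<dots> = (\<integral>x. indicator B x * (cos (\<theta> * x) - 1) \<partial>\<nu>) / measure \<nu> B" by simp
    finally show ?thesis using mpos by (simp add: field_simps)
  qed
  finally have "s * Re (CLINT x|\<nu>. iexp (\<theta> * x) - 1) \<le> s * (measure \<nu> B * (\<integral>x. cos (\<theta> * x) - 1 \<partial>uniform_measure \<nu> B))"
    using s by (rule mult_left_mono)
  also have "\<dots> = (\<integral>x. - (s * measure \<nu> B) * (1 - cos (\<theta> * x)) \<partial>uniform_measure \<nu> B)"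
  proof -
    have "(\<lambda>x. - (s * measure \<nu> B) * (1 - cos (\<theta> * x))) = (\<lambda>x. (s * measure \<nu> B) * (cos (\<theta> * x) - 1))"
      by (auto simp: algebra_simps)
    then show ?thesis by (simp only: integral_mult_right_zero mult.assoc)
  qed
  finally have "exp (s * Re (CLINT x|\<nu>. iexp (\<theta> * x) - 1)) \<le> exp \<dots>" by simp
  also have "\<dots> \<le> (\<integral>x. exp (- (s * measure \<nu> B) * (1 - cos (\<theta> * x))) \<partial>uniform_measure \<nu> B)"
  proof (rule p.jensens_inequality[where I=UNIV])
    have nn: "0 \<le> s * measure \<nu> B" using s by simp
    have b1: "\<bar>(s * measure \<nu> B) * (1 - cos (\<theta> * x))\<bar> \<le> (s * measure \<nu> B) * 2" for x
      unfolding abs_mult using s nn cos_ge_minus_one[of "\<theta> * x"] cos_le_one[of "\<theta> * x"] by (intro mult_mono) auto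
    show "integrable (uniform_measure \<nu> B) (\<lambda>x. - (s * measure \<nu> B) * (1 - cos (\<theta> * x)))"
      using b1 by (intro p.integrable_const_bound[where B="(s * measure \<nu> B) * 2"]) auto
    show "integrable (uniform_measure \<nu> B) (\<lambda>x. exp (- (s * measure \<nu> B) * (1 - cos (\<theta> * x))))"
      using s nn by (intro p.integrable_const_bound[where B=1]) auto
    show "convex_on UNIV (exp :: real \<Rightarrow> real)" by (rule exp_convex)
  qed auto
  finally show ?thesis .
qed

end

lemma drift_levy_measureD:
  assumes "drift_levy_measure M X d \<nu>"
  shows "levy_measure \<nu>"
    "\<And>t \<theta>. 0 \<le> t \<Longrightarrow> char (distr M borel (X t)) \<theta> =
       exp (complex_of_real t * (\<i> * complex_of_real (\<theta> * d) + (CLINT x|\<nu>. iexp (\<theta> * x) - 1)))"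
  using assms unfolding drift_levy_measure_def levy_measure_def by auto

text \<open>Many jumps of size at least \<open>\<epsilon>\<close> occur up to time
  \<open>s0\<close>, and each blurs the law at the scale \<open>\<delta>\<close>. In terms of the
  characteristic function at \<open>\<theta> / \<delta>\<close>, its modulus is bounded by the mean
  of \<open>exp (- n * (1 - cos (\<theta> * r)))\<close> over
  \<open>r = \<bar>x\<bar> / \<delta>\<close>, which is small uniformly in \<open>s\<close> and
  \<open>y\<close>.\<close>

lemma levy_concentration:
  assumes X: "drift_levy_measure M X d \<nu>" and M: "prob_space M" and meas: "\<And>t. 0 \<le> t \<Longrightarrow> X t \<in> borel_measurable M"
    and inf: "emeasure \<nu> UNIV = \<infinity>" and s0: "0 < s0" and e: "0 < e"
  obtains \<delta> where "0 < \<delta>" "\<And>s y. s0 \<le> s \<Longrightarrow> measure M {w\<in>space M. \<bar>X s w - y\<bar> \<le> \<delta>} \<le> e"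
proof -
  interpret M: prob_space M by fact
  interpret levy_measure \<nu> using X by (rule drift_levy_measureD)
  interpret U: prob_space unif by (rule prob_space_unif)
  obtain n :: nat where n: "\<And>r. 2 * pi \<le> r \<Longrightarrow>
    (\<integral>\<^sup>+\<theta>. ennreal (exp (- real n * (1 - cos (\<theta> * r)))) \<partial>unif) \<le> ennreal (e / 4)"
    using exp_cos_integral_small[of "e / 4"] e by auto
  \<comment> \<open>The infinite Levy measure allows the expected number of jumps in
    \<open>B\<close> up to time \<open>s0\<close> to exceed \<open>n\<close>.\<close>
  obtain \<epsilon> where \<epsilon>: "0 < \<epsilon>" "ennreal (real n / s0) < emeasure \<nu> {x. \<epsilon> \<le> \<bar>x\<bar>}"
    using outside_large[OF inf, of "ennreal (real n / s0)"] by auto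
  define B where "B = {x::real. \<epsilon> \<le> \<bar>x\<bar>}"
  have B [measurable]: "B \<in> sets borel" unfolding B_def by measurable
  have B_fin: "0 < emeasure \<nu> B" "emeasure \<nu> B < \<infinity>"
    using outside_finite[OF \<epsilon>(1)] \<epsilon>(2) unfolding B_def by (auto intro: le_less_trans[rotated])
  interpret p: prob_space "uniform_measure \<nu> B" using B_fin by (intro prob_space_uniform_measure) auto
  interpret pU: pair_prob_space "uniform_measure \<nu> B" unif ..
  have AE_B: "AE x in uniform_measure \<nu> B. \<epsilon> \<le> \<bar>x\<bar>"
    using B_fin by (intro AE_uniform_measureI) (auto simp: B_def)
  have mB: "real n / s0 \<le> measure \<nu> B"
  proof -
    have "emeasure \<nu> B = ennreal (measure \<nu> B)"
      using B_fin by (intro emeasure_eq_ennreal_measure) (simp add: less_top[symmetric])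
    then show ?thesis using \<epsilon>(2) s0 unfolding B_def[symmetric] by (simp add: ennreal_less_iff)
  qed
  \<comment> \<open>Chosen so that \<open>\<bar>x\<bar> / \<delta> \<ge> 2 * pi\<close> whenever
    \<open>\<bar>x\<bar> \<ge> \<epsilon>\<close>, the range in which the averaged estimate is
    uniform.\<close>
  define \<delta> where "\<delta> = \<epsilon> / (2 * pi)"
  have \<delta>: "0 < \<delta>" unfolding \<delta>_def using \<epsilon> by simp
  have "measure M {w\<in>space M. \<bar>X s w - y\<bar> \<le> \<delta>} \<le> e" if s: "s0 \<le> s" for s y
  proof -
    have s_pos: "0 \<le> s" using s s0 by simp
    have [measurable]: "X s \<in> borel_measurable M" using s_pos by (rule meas)
    let ?P = "distr M borel (X s)"
    have P: "real_distribution ?P" by (rule M.real_distribution_distr) simp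
    then interpret P: real_distribution ?P .
    have sn: "real n \<le> s * measure \<nu> B"
    proof -
      have "real n = s0 * (real n / s0)" using s0 by simp
      also have "\<dots> \<le> s * measure \<nu> B" using s s0 mB by (intro mult_mono) auto
      finally show ?thesis .
    qed
    have cmod_le: "ennreal (cmod (char ?P (\<theta> / \<delta>))) \<le> (\<integral>\<^sup>+x. ennreal (exp (- real n * (1 - cos (\<theta> * (\<bar>x\<bar> / \<delta>))))) \<partial>uniform_measure \<nu> B)" for \<theta>
    proof -
      have "cmod (char ?P (\<theta> / \<delta>)) = exp (s * Re (CLINT x|\<nu>. iexp (\<theta> / \<delta> * x) - 1))"
        unfolding drift_levy_measureD(2)[OF X s_pos] norm_exp_eq_Re by simp
      also have "\<dots> \<le> (\<integral>x. exp (- (s * measure \<nu> B) * (1 - cos (\<theta> / \<delta> * x))) \<partial>uniform_measure \<nu> B)"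
        by (rule exponent_Re_le[OF s_pos B B_fin])
      also have "\<dots> \<le> (\<integral>x. exp (- real n * (1 - cos (\<theta> * (\<bar>x\<bar> / \<delta>)))) \<partial>uniform_measure \<nu> B)"
      proof (rule integral_mono)
        show "integrable (uniform_measure \<nu> B) (\<lambda>x. exp (- (s * measure \<nu> B) * (1 - cos (\<theta> / \<delta> * x))))"
          using s_pos by (intro p.integrable_const_bound[where B=1]) auto
        show "integrable (uniform_measure \<nu> B) (\<lambda>x. exp (- real n * (1 - cos (\<theta> * (\<bar>x\<bar> / \<delta>)))))"
          by (intro p.integrable_const_bound[where B=1]) auto
        fix x
        have "cos (\<theta> / \<delta> * x) = cos (\<theta> * (\<bar>x\<bar> / \<delta>))"
          by (cases "0 \<le> x") (auto simp: cos_minus[of "\<theta> * x / \<delta>", symmetric] simp del: cos_minus)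
        then show "exp (- (s * measure \<nu> B) * (1 - cos (\<theta> / \<delta> * x))) \<le> exp (- real n * (1 - cos (\<theta> * (\<bar>x\<bar> / \<delta>))))"
          using sn by (simp add: mult_right_mono)
      qed
      finally have "ennreal (cmod (char ?P (\<theta> / \<delta>))) \<le> ennreal (\<integral>x. exp (- real n * (1 - cos (\<theta> * (\<bar>x\<bar> / \<delta>)))) \<partial>uniform_measure \<nu> B)"
        by (rule ennreal_leI)
      also have "\<dots> = (\<integral>\<^sup>+x. ennreal (exp (- real n * (1 - cos (\<theta> * (\<bar>x\<bar> / \<delta>))))) \<partial>uniform_measure \<nu> B)"
        by (intro nn_integral_eq_integral[symmetric] p.integrable_const_bound[where B=1]) auto
      finally show ?thesis .
    qed
    have "ennreal (\<integral>\<theta>. cmod (char ?P (\<theta> / \<delta>)) \<partial>unif) = (\<integral>\<^sup>+\<theta>. ennreal (cmod (char ?P (\<theta> / \<delta>))) \<partial>unif)"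
    proof (intro nn_integral_eq_integral[symmetric] U.integrable_const_bound[where B=1])
      have "(\<lambda>\<theta>. char ?P (\<theta> / \<delta>)) \<in> borel_measurable borel" by measurable
      then show "(\<lambda>\<theta>. cmod (char ?P (\<theta> / \<delta>))) \<in> borel_measurable unif" by simp
    qed (auto simp: P.cmod_char_le_1)
    also have "\<dots> \<le> (\<integral>\<^sup>+\<theta>. (\<integral>\<^sup>+x. ennreal (exp (- real n * (1 - cos (\<theta> * (\<bar>x\<bar> / \<delta>))))) \<partial>uniform_measure \<nu> B) \<partial>unif)"
      by (intro nn_integral_mono cmod_le)
    also have "\<dots> = (\<integral>\<^sup>+x. (\<integral>\<^sup>+\<theta>. ennreal (exp (- real n * (1 - cos (\<theta> * (\<bar>x\<bar> / \<delta>))))) \<partial>unif) \<partial>uniform_measure \<nu> B)"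
      by (rule pU.Fubini') measurable
    also have "\<dots> \<le> (\<integral>\<^sup>+x. ennreal (e / 4) \<partial>uniform_measure \<nu> B)"
    proof (rule nn_integral_mono_AE)
      show "AE x in uniform_measure \<nu> B. (\<integral>\<^sup>+\<theta>. ennreal (exp (- real n * (1 - cos (\<theta> * (\<bar>x\<bar> / \<delta>))))) \<partial>unif) \<le> ennreal (e / 4)"
        using AE_B
      proof eventually_elim
        case (elim x)
        show ?case using elim \<epsilon>(1) unfolding \<delta>_def by (intro n) (simp add: field_simps)
      qed
    qed
    also have "\<dots> = ennreal (e / 4)" using p.emeasure_space_1 by simp
    finally have "(\<integral>\<theta>. cmod (char ?P (\<theta> / \<delta>)) \<partial>unif) \<le> e / 4" using e by simp
    moreover have "measure ?P {y - \<delta>..y + \<delta>} \<le> 4 * (\<integral>\<theta>. cmod (char ?P (\<theta> / \<delta>)) \<partial>unif)"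
      by (rule concentration_le_char[OF P \<delta>])
    moreover have "measure ?P {y - \<delta>..y + \<delta>} = measure M {w\<in>space M. \<bar>X s w - y\<bar> \<le> \<delta>}"
      by (subst measure_distr) (auto intro!: arg_cong[where f="measure M"] simp: abs_le_iff)
    ultimately show ?thesis by simp
  qed
  with \<delta> show thesis by (rule that)
qed

section \<open>Truncated increments of a process without drift\<close>

lemma norm_exp_minus_1_le:
  assumes "Re w \<le> 0"
  shows "cmod (exp w - 1) \<le> cmod w"
proof -
  have "cmod (exp w - exp 0) \<le> 1 * cmod (w - 0)"
  proof (rule field_differentiable_bound[where S="{z. Re z \<le> 0}"])
    show "convex {z. Re z \<le> 0}" by (rule convex_halfspace_Re_le)
    show "(exp has_field_derivative exp z) (at z within {z. Re z \<le> 0})" for z :: complex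
      by (rule DERIV_subset[OF DERIV_exp]) auto
  qed (use assms in auto)
  then show ?thesis by simp
qed

lemma exp_increment_tendsto:
  "(\<lambda>n. of_nat (Suc n) * (exp (z / of_nat (Suc n)) - 1)) \<longlonglongrightarrow> (z::complex)"
proof (cases "z = 0")
  case False
  have "((\<lambda>h. (exp (0 + h) - exp 0) / h) \<longlongrightarrow> exp (0::complex)) (at 0)"
    using DERIV_exp[of "0::complex"] unfolding DERIV_def .
  moreover have "filterlim (\<lambda>n. z / of_nat (Suc n)) (at (0::complex)) sequentially"
    unfolding filterlim_at using False
    by (auto intro!: always_eventually LIMSEQ_Suc[OF lim_const_over_n] simp del: of_nat_Suc)
  ultimately have "(\<lambda>n. (exp (0 + z / of_nat (Suc n)) - exp 0) / (z / of_nat (Suc n))) \<longlonglongrightarrow> exp (0::complex)"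
    by (rule filterlim_compose)
  then have "(\<lambda>n. z * ((exp (0 + z / of_nat (Suc n)) - exp 0) / (z / of_nat (Suc n)))) \<longlonglongrightarrow> z * 1"
    by (intro tendsto_mult tendsto_const) simp
  then show ?thesis using False by (simp del: of_nat_Suc add: mult.commute)
qed simp

text \<open>The term \<open>1 - cos\<close> alone is only quadratic for small \<open>u\<close>, too
  little to control \<open>min u 1\<close>. The sine supplies the linear part, which has the right
  sign because \<open>u\<close> is nonnegative. For \<open>u \<ge> 1\<close> the bound is
  \<open>cos u + sin u \<le> 3 / 2\<close>; for smaller \<open>u\<close> it is
  \<open>\<theta> * u / 2 \<le> sin (\<theta> * u)\<close>.\<close>

lemma sin_cos_kernel:
  assumes u: "0 \<le> u"
  shows "min u 1 / 4 \<le> (\<integral>\<theta>. sin (\<theta> * u) + (1 - cos (\<theta> * u)) \<partial>unif)"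
proof (cases "u = 0")
  case False
  then have u: "0 < u" using u by simp
  let ?F = "\<lambda>\<theta>. - cos (\<theta> * u) / u + \<theta> - sin (\<theta> * u) / u"
  have "(\<integral>\<theta>. sin (\<theta> * u) + (1 - cos (\<theta> * u)) \<partial>unif) = ?F 1 - ?F 0"
    using u by (intro integral_unif_FTC)
       (auto intro!: derivative_eq_intros continuous_intros simp: field_simps)
  also have "\<dots> = (u + 1 - (cos u + sin u)) / u" using u by (simp add: field_simps)
  finally have eq: "(\<integral>\<theta>. sin (\<theta> * u) + (1 - cos (\<theta> * u)) \<partial>unif) = (u + 1 - (cos u + sin u)) / u" .
  show ?thesis
  proof (cases "1 \<le> u")
    case True
    have "(cos u + sin u)\<^sup>2 \<le> (3/2)\<^sup>2"
    proof -
      have "0 \<le> (cos u - sin u)\<^sup>2" by simp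
      then have "2 * (cos u * sin u) \<le> (cos u)\<^sup>2 + (sin u)\<^sup>2" by (simp add: power2_diff)
      then have "2 * (cos u * sin u) \<le> 1" by simp
      moreover have "(cos u + sin u)\<^sup>2 = 1 + 2 * (cos u * sin u)" by (simp add: power2_sum)
      ultimately show ?thesis by (simp add: power2_eq_square[of "3/2::real"])
    qed
    then have "cos u + sin u \<le> 3 / 2" by (rule power2_le_imp_le) simp
    then show ?thesis unfolding eq using True by (simp add: field_simps)
  next
    case False
    have "(\<integral>\<theta>. \<theta> * (u / 2) \<partial>unif) = 1\<^sup>2 * (u / 4) - 0\<^sup>2 * (u / 4)"
      by (rule integral_unif_FTC) (auto intro!: derivative_eq_intros continuous_intros)
    also have "\<dots> = u / 4" by simp
    finally have "u / 4 = (\<integral>\<theta>. \<theta> * (u / 2) \<partial>unif)" by (rule sym)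
    also have "\<dots> \<le> (\<integral>\<theta>. sin (\<theta> * u) + (1 - cos (\<theta> * u)) \<partial>unif)"
    proof (rule integral_mono_AE)
      show "integrable unif (\<lambda>\<theta>. \<theta> * (u / 2))"
        using u by (intro integrable_unif_bounded[where B="1 * (u/2)"]) (auto simp: abs_mult intro!: mult_right_mono)
      have "\<bar>sin (\<theta> * u) + (1 - cos (\<theta> * u))\<bar> \<le> 3" for \<theta>
        using sin_ge_minus_one[of "\<theta> * u"] sin_le_one[of "\<theta> * u"] cos_ge_minus_one[of "\<theta> * u"] cos_le_one[of "\<theta> * u"] by linarith
      then show "integrable unif (\<lambda>\<theta>. sin (\<theta> * u) + (1 - cos (\<theta> * u)))"
        by (intro integrable_unif_bounded[where B=3]) auto
      show "AE \<theta> in unif. \<theta> * (u / 2) \<le> sin (\<theta> * u) + (1 - cos (\<theta> * u))"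
        using AE_unif
      proof eventually_elim
        case (elim \<theta>)
        have t: "0 \<le> \<theta> * u" "\<theta> * u \<le> 1" using elim u False by (auto simp: mult_le_one)
        have "\<theta> * u / 2 \<le> sin (\<theta> * u)"
        proof (cases "\<theta> * u = 0")
          case False
          with t(1) have "0 < \<theta> * u" by linarith
          then obtain z where z: "0 < z" "z < \<theta> * u" "sin (\<theta> * u) - sin 0 = (\<theta> * u - 0) * cos z"
            using MVT2[of 0 "\<theta> * u" sin cos] by (auto simp: DERIV_sin)
          have "1 / 2 \<le> cos z" using z t by (intro cos_ge_half) auto
          then have "\<theta> * u * (1 / 2) \<le> \<theta> * u * cos z" using t by (intro mult_left_mono) auto
          then show ?thesis using z by simp
        qed auto
        then show ?case using cos_le_one[of "\<theta> * u"] by linarith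
      qed
    qed
    finally show ?thesis using False by (simp add: min_def)
  qed
qed simp

lemma (in levy_measure) integrable_min_scaled: "integrable \<nu> (\<lambda>x. min \<bar>x\<bar> e)" if "0 < e"
proof (rule Bochner_Integration.integrable_bound)
  show "integrable \<nu> (\<lambda>x. max 1 e * min \<bar>x\<bar> 1)" using integrable_min by simp
  show "AE x in \<nu>. norm (min \<bar>x\<bar> e) \<le> norm (max 1 e * min \<bar>x\<bar> 1)"
  proof (intro AE_I2)
    fix x
    have "min \<bar>x\<bar> e \<le> max 1 e * min \<bar>x\<bar> 1"
    proof (cases "\<bar>x\<bar> \<le> 1")
      case True
      have "1 * \<bar>x\<bar> \<le> max 1 e * \<bar>x\<bar>" by (intro mult_right_mono) auto
      then show ?thesis using True by simp
    qed (use that in auto)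
    then show "norm (min \<bar>x\<bar> e) \<le> norm (max 1 e * min \<bar>x\<bar> 1)" using that by simp
  qed
qed measurable

lemma (in levy_measure) integral_min_tendsto_0:
  "(\<lambda>n. \<integral>x. min \<bar>x\<bar> (1 / real (Suc n)) \<partial>\<nu>) \<longlonglongrightarrow> 0"
proof -
  have "(\<lambda>n. \<integral>x. min \<bar>x\<bar> (1 / real (Suc n)) \<partial>\<nu>) \<longlonglongrightarrow> (\<integral>x. 0 \<partial>\<nu>)"
  proof (rule integral_dominated_convergence[where w="\<lambda>x. min \<bar>x\<bar> 1"])
    show "AE x in \<nu>. (\<lambda>n. min \<bar>x\<bar> (1 / real (Suc n))) \<longlonglongrightarrow> 0"
    proof (intro AE_I2)
      fix x :: real
      have "(\<lambda>n. min \<bar>x\<bar> (1 / real (Suc n))) \<longlonglongrightarrow> min \<bar>x\<bar> 0"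
        by (intro tendsto_min tendsto_const LIMSEQ_Suc[OF lim_1_over_n])
      then show "(\<lambda>n. min \<bar>x\<bar> (1 / real (Suc n))) \<longlonglongrightarrow> 0" by simp
    qed
    show "AE x in \<nu>. norm (min \<bar>x\<bar> (1 / real (Suc n))) \<le> min \<bar>x\<bar> 1" for n
    proof (intro AE_I2)
      fix x :: real
      have "\<bar>min \<bar>x\<bar> c\<bar> \<le> min \<bar>x\<bar> 1" if "0 \<le> c" "c \<le> 1" for c
        using that by (auto simp: min_def)
      then show "norm (min \<bar>x\<bar> (1 / real (Suc n))) \<le> min \<bar>x\<bar> 1" unfolding real_norm_def by simp
    qed
  qed (use integrable_min in auto)
  then show ?thesis by simp
qed

text \<open>The absence of drift enters only here: the right-hand side vanishes as \<open>e \<rightarrow> 0\<close>.\<close>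

lemma driftless_small_increments:
  assumes X: "drift_levy_measure M X 0 \<nu>" and M: "prob_space M"
    and meas: "\<And>t. 0 \<le> t \<Longrightarrow> X t \<in> borel_measurable M"
    and pos: "\<And>t y. 0 \<le> t \<Longrightarrow> y \<in> space M \<Longrightarrow> 0 \<le> X t y"
    and T: "0 \<le> T" and e: "0 < e" and \<eta>: "0 < \<eta>"
  shows "\<forall>\<^sub>F n in sequentially. real (Suc n) * (\<integral>y. min (X (T / real (Suc n)) y) e \<partial>M) \<le>
    16 * T * (\<integral>x. min \<bar>x\<bar> e \<partial>\<nu>) + \<eta>"
proof -
  interpret M: prob_space M by fact
  interpret levy_measure \<nu> using X by (rule drift_levy_measureD)
  interpret U: prob_space unif by (rule prob_space_unif)
  interpret MU: pair_prob_space M unif ..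
  define I where "I \<theta> = (CLINT x|\<nu>. iexp (\<theta> * x) - 1)" for \<theta>
  \<comment> \<open>\<open>z \<theta>\<close> is the characteristic exponent at time
    \<open>T\<close> and frequency \<open>\<theta> / e\<close>, and \<open>\<phi> n\<close> the
    characteristic function of an increment over time \<open>T / (n + 1)\<close>, so that
    \<open>(n + 1) * (\<phi> n - 1)\<close> tends to \<open>z\<close>. The frequency is scaled by
    \<open>e\<close> to match the truncation.\<close>
  define z where "z \<theta> = complex_of_real T * I (\<theta> / e)" for \<theta>
  define \<phi> where "\<phi> n \<theta> = exp (z \<theta> / of_nat (Suc n))" for n \<theta>
  define B where "B = T * (2 / e * (\<integral>x. min \<bar>x\<bar> e \<partial>\<nu>))"
  have I_Re: "Re (I \<theta>) \<le> 0" for \<theta>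
  proof -
    have "Re (I \<theta>) = (\<integral>x. Re (iexp (\<theta> * x) - 1) \<partial>\<nu>)"
      unfolding I_def using integrable_iexp_minus_1 by (rule integral_Re[symmetric])
    also have "\<dots> \<le> (\<integral>x. 0 \<partial>\<nu>)"
      by (intro integral_mono integrable_Re integrable_iexp_minus_1) (auto simp: Re_exp)
    also have "\<dots> = 0" by simp
    finally show ?thesis .
  qed
  have z_norm: "cmod (z \<theta>) \<le> B" if \<theta>: "0 \<le> \<theta>" "\<theta> \<le> 1" for \<theta>
  proof -
    have "cmod (I (\<theta> / e)) \<le> (\<integral>x. cmod (iexp (\<theta> / e * x) - 1) \<partial>\<nu>)" unfolding I_def by (rule integral_norm_bound)
    also have "\<dots> \<le> (\<integral>x. 2 / e * min \<bar>x\<bar> e \<partial>\<nu>)"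
    proof (rule integral_mono)
      fix x
      have 1: "cmod (iexp (\<theta> / e * x) - 1) \<le> \<bar>\<theta> / e * x\<bar>" using iexp_approx1[of "\<theta> / e * x" 0] by simp
      have "\<bar>\<theta> / e * x\<bar> \<le> 2 / e * \<bar>x\<bar>" unfolding abs_mult using \<theta> e by (intro mult_right_mono) (auto intro: divide_right_mono)
      moreover have "cmod (iexp (\<theta> / e * x) - 1) \<le> 2"
        using norm_triangle_ineq4[of "iexp (\<theta> / e * x)" 1] by simp
      ultimately show "cmod (iexp (\<theta> / e * x) - 1) \<le> 2 / e * min \<bar>x\<bar> e"
        using 1 e by (auto simp: min_def)
      show "integrable \<nu> (\<lambda>x. cmod (iexp (\<theta> / e * x) - 1))" by (rule integrable_norm[OF integrable_iexp_minus_1])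
    qed (use integrable_min_scaled[OF e] in auto)
    also have "\<dots> = 2 / e * (\<integral>x. min \<bar>x\<bar> e \<partial>\<nu>)" by simp
    finally show ?thesis
      unfolding z_def B_def norm_mult using T by (intro mult_mono) auto
  qed
  have z_Re: "Re (z \<theta>) \<le> 0" for \<theta> unfolding z_def using I_Re[of "\<theta> / e"] T by (simp add: mult_nonneg_nonpos)
  have char: "char (distr M borel (X (T / real (Suc n)))) (\<theta> / e) = \<phi> n \<theta>" for n \<theta>
    unfolding \<phi>_def z_def I_def using T
    by (subst drift_levy_measureD(2)[OF X]) (auto simp del: of_nat_Suc)
  have \<phi>_meas [measurable]: "\<phi> n \<in> borel_measurable borel" for n
  proof -
    have [measurable]: "X (T / real (Suc n)) \<in> borel_measurable M" using T by (intro meas) auto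
    interpret P: real_distribution "distr M borel (X (T / real (Suc n)))" by (rule M.real_distribution_distr) measurable
    have "(\<lambda>\<theta>. char (distr M borel (X (T / real (Suc n)))) (\<theta> / e)) \<in> borel_measurable borel" by measurable
    then show ?thesis unfolding char .
  qed
  \<comment> \<open>Up to the factor \<open>n + 1\<close> this is the mean of the kernel
    \<open>sin + (1 - cos)\<close> at frequency \<open>\<theta> / e\<close>; it stays bounded in
    \<open>n\<close> because \<open>exp\<close> is Lipschitz with constant 1 on the left
    half-plane.\<close>
  define D where "D n \<theta> = real (Suc n) * (Im (\<phi> n \<theta>) + (1 - Re (\<phi> n \<theta>)))" for n \<theta>
  have D_eq: "D n \<theta> = Im (of_nat (Suc n) * (\<phi> n \<theta> - 1)) - Re (of_nat (Suc n) * (\<phi> n \<theta> - 1))" for n \<theta>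
    unfolding D_def by (simp add: algebra_simps)
  have D_meas [measurable]: "D n \<in> borel_measurable borel" for n
  proof -
    have "(\<lambda>\<theta>. Im (\<phi> n \<theta>)) \<in> borel_measurable borel" "(\<lambda>\<theta>. Re (\<phi> n \<theta>)) \<in> borel_measurable borel"
      by (intro measurable_compose[OF \<phi>_meas]; measurable)+
    then show ?thesis unfolding D_def[abs_def] by measurable
  qed
  have incr_norm: "cmod (of_nat (Suc n) * (\<phi> n \<theta> - 1)) \<le> cmod (z \<theta>)" for n \<theta>
  proof -
    have "cmod (\<phi> n \<theta> - 1) \<le> cmod (z \<theta> / of_nat (Suc n))"
      unfolding \<phi>_def using z_Re[of \<theta>] by (intro norm_exp_minus_1_le) (simp add: Re_divide_of_nat divide_nonpos_pos del: of_nat_Suc)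
    also have "\<dots> = cmod (z \<theta>) / real (Suc n)" unfolding norm_divide norm_of_nat ..
    finally have "real (Suc n) * cmod (\<phi> n \<theta> - 1) \<le> cmod (z \<theta>)" by (simp add: field_simps del: of_nat_Suc)
    then show ?thesis unfolding norm_mult norm_of_nat .
  qed
  have D_norm: "\<bar>D n \<theta>\<bar> \<le> 2 * B" if "0 \<le> \<theta>" "\<theta> \<le> 1" for n \<theta>
    using incr_norm[of n \<theta>] z_norm[OF that] abs_Re_le_cmod[of "of_nat (Suc n) * (\<phi> n \<theta> - 1)"] abs_Im_le_cmod[of "of_nat (Suc n) * (\<phi> n \<theta> - 1)"]
    unfolding D_eq by linarith
  have D_lim: "(\<lambda>n. D n \<theta>) \<longlonglongrightarrow> Im (z \<theta>) - Re (z \<theta>)" for \<theta>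
    unfolding D_eq \<phi>_def by (intro tendsto_diff tendsto_Im tendsto_Re exp_increment_tendsto)
  have lim_meas: "(\<lambda>\<theta>. Im (z \<theta>) - Re (z \<theta>)) \<in> borel_measurable borel"
    using D_lim by (rule borel_measurable_LIMSEQ_real) simp
  have "(\<lambda>n. \<integral>\<theta>. D n \<theta> \<partial>unif) \<longlonglongrightarrow> (\<integral>\<theta>. Im (z \<theta>) - Re (z \<theta>) \<partial>unif)"
  proof (rule integral_dominated_convergence[where w="\<lambda>_. 2 * B"])
    show "AE \<theta> in unif. norm (D n \<theta>) \<le> 2 * B" for n
      using AE_unif by eventually_elim (simp add: D_norm)
  qed (use D_lim lim_meas in auto)
  moreover have "(\<integral>\<theta>. Im (z \<theta>) - Re (z \<theta>) \<partial>unif) \<le> 4 * T / e * (\<integral>x. min \<bar>x\<bar> e \<partial>\<nu>)"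
  proof -
    have bound: "Im (z \<theta>) - Re (z \<theta>) \<le> 2 * B" if "0 \<le> \<theta>" "\<theta> \<le> 1" for \<theta>
      using z_norm[OF that] abs_Re_le_cmod[of "z \<theta>"] abs_Im_le_cmod[of "z \<theta>"] by linarith
    have "integrable unif (\<lambda>\<theta>. Im (z \<theta>) - Re (z \<theta>))"
    proof (rule integrable_unif_bounded[OF lim_meas])
      fix \<theta> :: real assume \<theta>: "0 \<le> \<theta>" "\<theta> \<le> 1"
      show "norm (Im (z \<theta>) - Re (z \<theta>)) \<le> 2 * B"
        using z_norm[OF \<theta>] abs_Re_le_cmod[of "z \<theta>"] abs_Im_le_cmod[of "z \<theta>"] unfolding real_norm_def by linarith
    qed
    then have "(\<integral>\<theta>. Im (z \<theta>) - Re (z \<theta>) \<partial>unif) \<le> (\<integral>\<theta>. 2 * B \<partial>unif)"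
    proof (intro integral_mono_AE)
      show "AE \<theta> in unif. Im (z \<theta>) - Re (z \<theta>) \<le> 2 * B"
        using AE_unif by (rule AE_mp) (intro AE_I2 impI bound, auto)
    qed auto
    then show ?thesis using U.prob_space by (simp add: B_def)
  qed
  ultimately have ev: "\<forall>\<^sub>F n in sequentially. (\<integral>\<theta>. D n \<theta> \<partial>unif) < 4 * T / e * (\<integral>x. min \<bar>x\<bar> e \<partial>\<nu>) + \<eta> / (4 * e)"
    using \<eta> e by (intro order_tendstoD(2)) (auto intro: le_less_trans)
  have bound: "real (Suc n) * (\<integral>y. min (X (T / real (Suc n)) y) e \<partial>M) \<le> 4 * e * (\<integral>\<theta>. D n \<theta> \<partial>unif)" for n
  proof -
    define Y where "Y = X (T / real (Suc n))"
    have [measurable]: "Y \<in> borel_measurable M" unfolding Y_def using T by (intro meas) auto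
    have Y_pos: "0 \<le> Y y" if "y \<in> space M" for y unfolding Y_def using T that by (intro pos) auto
    let ?k = "\<lambda>y \<theta>. sin (\<theta> * (Y y / e)) + (1 - cos (\<theta> * (Y y / e)))"
    have k_bound: "norm (?k y \<theta>) \<le> 3" for y \<theta>
      using sin_ge_minus_one[of "\<theta> * (Y y / e)"] sin_le_one[of "\<theta> * (Y y / e)"]
        cos_ge_minus_one[of "\<theta> * (Y y / e)"] cos_le_one[of "\<theta> * (Y y / e)"] unfolding real_norm_def by linarith
    have int_pair: "integrable (M \<Otimes>\<^sub>M unif) (\<lambda>(y, \<theta>). ?k y \<theta>)"
      using k_bound by (intro MU.P.integrable_const_bound[of _ 3]) (auto simp del: real_norm_def)
    have "(\<integral>y. min (Y y) e \<partial>M) \<le> (\<integral>y. 4 * e * (\<integral>\<theta>. ?k y \<theta> \<partial>unif) \<partial>M)"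
    proof (rule integral_mono)
      show "integrable M (\<lambda>y. min (Y y) e)"
        using Y_pos e by (intro M.integrable_const_bound[of _ e]) (auto simp: min_def)
      show "integrable M (\<lambda>y. 4 * e * (\<integral>\<theta>. ?k y \<theta> \<partial>unif))"
        using MU.integrable_fst'[OF int_pair] by simp
      fix y assume y: "y \<in> space M"
      have "min (Y y / e) 1 / 4 \<le> (\<integral>\<theta>. ?k y \<theta> \<partial>unif)"
        using Y_pos[OF y] e by (intro sin_cos_kernel) auto
      then have "4 * e * (min (Y y / e) 1 / 4) \<le> 4 * e * (\<integral>\<theta>. ?k y \<theta> \<partial>unif)"
        using e by (intro mult_left_mono) auto
      moreover have "4 * e * (min (Y y / e) 1 / 4) = min (Y y) e" using e by (auto simp: min_def field_simps)
      ultimately show "min (Y y) e \<le> 4 * e * (\<integral>\<theta>. ?k y \<theta> \<partial>unif)" by simp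
    qed
    also have "\<dots> = 4 * e * (\<integral>y. (\<integral>\<theta>. ?k y \<theta> \<partial>unif) \<partial>M)" by simp
    also have "(\<integral>y. (\<integral>\<theta>. ?k y \<theta> \<partial>unif) \<partial>M) = (\<integral>\<theta>. (\<integral>y. ?k y \<theta> \<partial>M) \<partial>unif)"
      by (rule MU.Fubini_integral[symmetric, OF int_pair])
    also have "\<dots> = (\<integral>\<theta>. Im (\<phi> n \<theta>) + (1 - Re (\<phi> n \<theta>)) \<partial>unif)"
    proof (rule Bochner_Integration.integral_cong[OF refl])
      fix \<theta>
      have int: "integrable M (\<lambda>y. iexp (\<theta> / e * Y y))"
        by (intro M.integrable_const_bound[of _ 1]) auto
      have char_eq: "\<phi> n \<theta> = (CLINT y|M. iexp (\<theta> / e * Y y))"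
        unfolding char[symmetric] char_def Y_def[symmetric] by (subst integral_distr) auto
      have "Im (\<phi> n \<theta>) = (\<integral>y. sin (\<theta> * (Y y / e)) \<partial>M)"
        unfolding char_eq integral_Im[OF int, symmetric] by (simp add: Im_exp)
      moreover have "Re (\<phi> n \<theta>) = (\<integral>y. cos (\<theta> * (Y y / e)) \<partial>M)"
        unfolding char_eq integral_Re[OF int, symmetric] by (simp add: Re_exp)
      moreover have "integrable M (\<lambda>y. sin (\<theta> * (Y y / e)))" "integrable M (\<lambda>y. cos (\<theta> * (Y y / e)))"
        by (intro M.integrable_const_bound[of _ 1]; auto)+
      ultimately show "(\<integral>y. ?k y \<theta> \<partial>M) = Im (\<phi> n \<theta>) + (1 - Re (\<phi> n \<theta>))"
        using M.prob_space by simp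
    qed
    finally have "real (Suc n) * (\<integral>y. min (Y y) e \<partial>M) \<le> real (Suc n) * (4 * e * (\<integral>\<theta>. Im (\<phi> n \<theta>) + (1 - Re (\<phi> n \<theta>)) \<partial>unif))"
      by (intro mult_left_mono) auto
    also have "\<dots> = 4 * e * (real (Suc n) * (\<integral>\<theta>. Im (\<phi> n \<theta>) + (1 - Re (\<phi> n \<theta>)) \<partial>unif))"
      by (simp only: mult.left_commute mult.assoc)
    also have "real (Suc n) * (\<integral>\<theta>. Im (\<phi> n \<theta>) + (1 - Re (\<phi> n \<theta>)) \<partial>unif) = (\<integral>\<theta>. D n \<theta> \<partial>unif)"
      unfolding D_def by (rule integral_mult_right_zero[symmetric])
    finally show ?thesis unfolding Y_def .
  qed
  from ev show ?thesis
  proof eventually_elim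
    case (elim n)
    \<comment> \<open>The constant 16 is the factor 4 of the kernel estimate times the factor 4 in
      \<open>2 * B\<close>; the powers of \<open>e\<close> cancel.\<close>
    have "4 * e * (\<integral>\<theta>. D n \<theta> \<partial>unif) \<le> 4 * e * (4 * T / e * (\<integral>x. min \<bar>x\<bar> e \<partial>\<nu>) + \<eta> / (4 * e))"
      using elim e by (intro mult_left_mono) auto
    also have "\<dots> = 16 * T * (\<integral>x. min \<bar>x\<bar> e \<partial>\<nu>) + \<eta>" using e by (simp add: field_simps)
    finally show ?case using bound[of n] by linarith
  qed
qed

section \<open>Paths of driftless subordinators\<close>

text \<open>\<open>jump_cover f a b k e\<close>: \<open>[a, b]\<close> is cut into \<open>k\<close> pieces, and \<open>e\<close> is the total growth of \<open>f\<close>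
  inside the pieces, that is, not counting its jumps at their right end points.\<close>

inductive jump_cover :: "(real \<Rightarrow> real) \<Rightarrow> real \<Rightarrow> real \<Rightarrow> nat \<Rightarrow> real \<Rightarrow> bool" for f where
  single: "a < b \<Longrightarrow> jump_cover f a b 1 (left_limit f b - f a)"
| join: "jump_cover f a m k e \<Longrightarrow> jump_cover f m b l e' \<Longrightarrow> jump_cover f a b (k + l) (e + e')"

lemma left_limit_mono_bounds:
  assumes f: "cadlag f" "mono_on {0..} f" and ab: "0 \<le> a" "a < b"
  shows "f a \<le> left_limit f b" "left_limit f b \<le> f b"
proof -
  have "(f \<longlongrightarrow> left_limit f b) (at_left b)" using f ab by (intro left_limit_tendsto) auto
  moreover have "\<forall>\<^sub>F s in at_left b. s \<in> {a<..<b}" using ab(2) by (rule eventually_at_left_real)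
  then have "\<forall>\<^sub>F s in at_left b. f a \<le> f s" "\<forall>\<^sub>F s in at_left b. f s \<le> f b"
    by (eventually_elim; use ab in \<open>auto intro!: mono_onD[OF f(2)]\<close>)+
  ultimately show "f a \<le> left_limit f b" "left_limit f b \<le> f b"
    by (auto intro: tendsto_lowerbound tendsto_upperbound)
qed

text \<open>Each time has a neighbourhood in which the path varies little on either side of it. An
  interval below the Lebesgue number of this cover lies in one such neighbourhood, so a single cut
  at the centre, if it is inside, isolates the only large jump.\<close>

lemma jump_cover_local:
  assumes f: "cadlag f" "mono_on {0..} f" and T: "0 \<le> T" and e: "0 < e"
  obtains \<delta> where "0 < \<delta>" "\<And>a b. 0 \<le> a \<Longrightarrow> a < b \<Longrightarrow> b \<le> T \<Longrightarrow> b - a < \<delta> \<Longrightarrow> \<exists>k e'. e' \<le> e \<and> jump_cover f a b k e'"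
proof -
  have "\<exists>d>0. (\<forall>s\<in>{t..<t+d}. f s \<le> f t + e / 2) \<and> (0 < t \<longrightarrow> (\<forall>s\<in>{t-d<..<t}. left_limit f t - e / 2 \<le> f s))" if t: "t \<in> {0..T}" for t
  proof -
    have "\<forall>\<^sub>F s in at_right t. f s < f t + e / 2"
      using f t e by (intro order_tendstoD[OF cadlag_right]) auto
    then obtain d1 where d1: "t < d1" "\<And>s. t < s \<Longrightarrow> s < d1 \<Longrightarrow> f s < f t + e / 2"
      unfolding eventually_at_right[OF less_add_one] by auto
    have right: "f s \<le> f t + e / 2" if "s \<in> {t..<d1}" for s
      using that d1(2)[of s] e by (cases "s = t") auto
    show ?thesis
    proof (cases "0 < t")
      case True
      have "\<forall>\<^sub>F s in at_left t. left_limit f t - e / 2 < f s"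
        using f True e by (intro order_tendstoD[OF left_limit_tendsto]) auto
      then obtain d2 where d2: "d2 < t" "\<And>s. d2 < s \<Longrightarrow> s < t \<Longrightarrow> left_limit f t - e / 2 < f s"
        unfolding eventually_at_left[OF True] by auto
      then have "left_limit f t - e / 2 \<le> f s" if "d2 < s" "s < t" for s using that by (simp add: less_imp_le)
      then show ?thesis using right d1(1) d2(1)
        by (intro exI[of _ "min (d1 - t) (t - d2)"]) (auto simp: min_def split: if_splits)
    next
      case False
      then show ?thesis using right d1(1) by (intro exI[of _ "d1 - t"]) auto
    qed
  qed
  then obtain d where d: "\<And>t. t \<in> {0..T} \<Longrightarrow> 0 < d t"
    "\<And>t s. t \<in> {0..T} \<Longrightarrow> s \<in> {t..<t + d t} \<Longrightarrow> f s \<le> f t + e / 2"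
    "\<And>t s. t \<in> {0..T} \<Longrightarrow> 0 < t \<Longrightarrow> s \<in> {t - d t<..<t} \<Longrightarrow> left_limit f t - e / 2 \<le> f s"
    by metis
  have cover: "{0..T} \<subseteq> \<Union>((\<lambda>t. ball t (d t)) ` {0..T})" using d(1) by auto
  obtain \<delta> where \<delta>: "0 < \<delta>" "\<And>x. x \<in> {0..T} \<Longrightarrow> \<exists>G\<in>(\<lambda>t. ball t (d t)) ` {0..T}. ball x \<delta> \<subseteq> G"
    by (rule Heine_Borel_lemma[OF compact_Icc cover]) auto
  show thesis
  proof (rule that[OF \<delta>(1)])
    fix a b assume ab: "0 \<le> a" "a < b" "b \<le> T" "b - a < \<delta>"
    then obtain t where t: "t \<in> {0..T}" "ball a \<delta> \<subseteq> ball t (d t)" using \<delta>(2)[of a] by auto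
    have "a \<in> ball t (d t)" "b \<in> ball t (d t)" using t(2) \<delta>(1) ab by (auto simp: dist_real_def subset_eq)
    then have near: "\<bar>t - a\<bar> < d t" "\<bar>t - b\<bar> < d t" by (auto simp: dist_real_def)
    \<comment> \<open>If the centre is not in the interior, no cut is made. A jump at the right end
      \<open>b\<close> is harmless, since the growth is measured up to the left limit.\<close>
    consider "t \<le> a" | "a < t" "t < b" | "b \<le> t" by linarith
    then show "\<exists>k e'. e' \<le> e \<and> jump_cover f a b k e'"
    proof cases
      case 1
      have "f b \<le> f t + e / 2" using 1 near ab by (intro d(2)[OF t(1)]) auto
      moreover have "f t \<le> f a" using 1 t by (intro mono_onD[OF f(2)]) auto
      ultimately have "left_limit f b - f a \<le> e" using left_limit_mono_bounds[OF f ab(1,2)] e by linarith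
      then show ?thesis using single[OF ab(2)] by blast
    next
      case 2
      have "f b \<le> f t + e / 2" using 2 near ab by (intro d(2)[OF t(1)]) auto
      moreover have "left_limit f t - e / 2 \<le> f a" using 2 near ab by (intro d(3)[OF t(1)]) auto
      moreover have "left_limit f b \<le> f b" using 2 t by (intro left_limit_mono_bounds[OF f, of t]) auto
      ultimately have "(left_limit f t - f a) + (left_limit f b - f t) \<le> e" by linarith
      then show ?thesis using join[OF single[OF 2(1)] single[OF 2(2)]] by blast
    next
      case 3
      have "left_limit f t - e / 2 \<le> f a" using 3 near ab by (intro d(3)[OF t(1)]) auto
      moreover have "left_limit f b \<le> left_limit f t"
      proof (cases "b = t")
        case False
        then have "b < t" using 3 by simp
        then show ?thesis using left_limit_mono_bounds(2)[OF f ab(1,2)] left_limit_mono_bounds(1)[OF f, of b t] ab by auto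
      qed simp
      ultimately have "left_limit f b - f a \<le> e" using e by linarith
      then show ?thesis using single[OF ab(2)] by blast
    qed
  qed
qed

text \<open>A cell with small growth is kept whole at the cost of its growth; any other cell is cut
  around its jump at a cost of at most \<open>e\<close>. Hence the truncated increments.\<close>

lemma jump_cover_grid:
  assumes f: "cadlag f" "mono_on {0..} f" and h: "0 < h" and m: "0 < m" and e: "0 < e"
    and small: "\<And>a b. 0 \<le> a \<Longrightarrow> a < b \<Longrightarrow> b \<le> real m * h \<Longrightarrow> b - a \<le> h \<Longrightarrow> \<exists>k e'. e' \<le> e \<and> jump_cover f a b k e'"
  shows "\<exists>k e'. e' \<le> (\<Sum>i<m. min (f (real (Suc i) * h) - f (real i * h)) e) \<and> jump_cover f 0 (real m * h) k e'"
proof -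
  have piece: "\<exists>k e'. e' \<le> min (f (real (Suc i) * h) - f (real i * h)) e \<and> jump_cover f (real i * h) (real (Suc i) * h) k e'" if "i < m" for i
  proof (cases "f (real (Suc i) * h) - f (real i * h) \<le> e")
    case True
    have lt: "real i * h < real (Suc i) * h" using h by simp
    have "left_limit f (real (Suc i) * h) - f (real i * h) \<le> f (real (Suc i) * h) - f (real i * h)"
      using left_limit_mono_bounds(2)[OF f _ lt] h by simp
    then show ?thesis using True single[OF lt] by (metis min_absorb1)
  next
    case False
    have le: "real (Suc i) * h \<le> real m * h" using that h by (intro mult_right_mono) auto
    have "\<exists>k e'. e' \<le> e \<and> jump_cover f (real i * h) (real (Suc i) * h) k e'"
      using h le by (intro small) (auto simp: algebra_simps)
    then show ?thesis using False by (simp add: min_def del: of_nat_Suc)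
  qed
  have "\<exists>k e'. e' \<le> (\<Sum>i<Suc j. min (f (real (Suc i) * h) - f (real i * h)) e) \<and> jump_cover f 0 (real (Suc j) * h) k e'" if "Suc j \<le> m" for j
    using that
  proof (induction j)
    case 0
    then show ?case using piece[of 0] by simp
  next
    case (Suc j)
    then obtain k e' where 1: "e' \<le> (\<Sum>i<Suc j. min (f (real (Suc i) * h) - f (real i * h)) e)" "jump_cover f 0 (real (Suc j) * h) k e'"
      by auto
    obtain l e'' where 2: "e'' \<le> min (f (real (Suc (Suc j)) * h) - f (real (Suc j) * h)) e"
      "jump_cover f (real (Suc j) * h) (real (Suc (Suc j)) * h) l e''"
      using piece[of "Suc j"] Suc.prems by auto
    have "e' + e'' \<le> (\<Sum>i<Suc (Suc j). min (f (real (Suc i) * h) - f (real i * h)) e)"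
      using 1(1) 2(1) by (subst sum.lessThan_Suc) linarith
    then show ?case using join[OF 1(2) 2(2)] by blast
  qed
  from this[of "m - 1"] show ?thesis using m by simp
qed

lemma subordinatorD:
  assumes "subordinator M X"
  shows "levy_process M X" "\<And>w. w \<in> space M \<Longrightarrow> mono_on {0..} (\<lambda>t. X t w)"
    "\<And>t w. 0 \<le> t \<Longrightarrow> w \<in> space M \<Longrightarrow> 0 \<le> X t w"
    "\<And>s t w. 0 \<le> s \<Longrightarrow> s \<le> t \<Longrightarrow> w \<in> space M \<Longrightarrow> X s w \<le> X t w"
proof -
  show 1: "levy_process M X" and 2: "\<And>w. w \<in> space M \<Longrightarrow> mono_on {0..} (\<lambda>t. X t w)"
    using assms unfolding subordinator_def by auto
  show mono: "X s w \<le> X t w" if "0 \<le> s" "s \<le> t" "w \<in> space M" for s t w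
    using mono_onD[OF 2[OF that(3)], of s t] that by auto
  show "0 \<le> X t w" if "0 \<le> t" "w \<in> space M" for t w
    using mono[of 0 t w] levy_processD(3)[OF 1 that(2)] that by simp
qed

text \<open>The expected sum of increments truncated at \<open>e j\<close> is bounded by
  \<open>K j\<close> on all fine grids. By Fatou the limit inferior over the grids has expectation
  at most \<open>K j\<close>, and since \<open>K j\<close> tends to 0 its infimum over
  \<open>j\<close> vanishes almost surely.\<close>

lemma AE_jump_cover_at:
  assumes X: "subordinator M X" and char: "drift_levy_measure M X 0 \<nu>" and T: "0 < T"
  shows "AE w in M. \<forall>\<eta>>0. \<exists>k e'. e' < \<eta> \<and> jump_cover (\<lambda>t. X t w) 0 T k e'"
proof -
  note LX = levy_processD[OF subordinatorD(1)[OF X]]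
  interpret prob_space M by fact
  interpret levy_measure \<nu> using char by (rule drift_levy_measureD)
  define e where "e j = 1 / real (Suc j)" for j
  have e: "0 < e j" for j unfolding e_def by simp
  define h where "h n = T / real (Suc n)" for n
  have h: "0 < h n" "real (Suc n) * h n = T" for n unfolding h_def using T by (auto simp del: of_nat_Suc)
  define S where "S j n w = (\<Sum>i<Suc n. min (X (real (Suc i) * h n) w - X (real i * h n) w) (e j))" for j n w
  have [measurable]: "X (real i * h n) \<in> borel_measurable M" for i n using LX(2)[of "real i * h n"] h[of n] by simp
  have S_meas [measurable]: "S j n \<in> borel_measurable M" for j n unfolding S_def by measurable
  have incr_nonneg: "0 \<le> X (real (Suc i) * h n) w - X (real i * h n) w" if "w \<in> space M" for i n w
    using subordinatorD(4)[OF X _ _ that, of "real i * h n" "real (Suc i) * h n"] h[of n] by (simp add: mult_right_mono)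
  have int_incr: "integrable M (\<lambda>w. min (X (real (Suc i) * h n) w - X (real i * h n) w) (e j))" for i n j
    using incr_nonneg[of _ i n] e[of j] by (intro integrable_const_bound[of _ "e j"]) (auto simp: min_def simp del: of_nat_Suc)
  have S_integral: "(\<integral>w. S j n w \<partial>M) = real (Suc n) * (\<integral>w. min (X (h n) w) (e j) \<partial>M)" for j n
  proof -
    have "(\<integral>w. min (X (real (Suc i) * h n) w - X (real i * h n) w) (e j) \<partial>M) = (\<integral>w. min (X (h n) w) (e j) \<partial>M)" for i
    proof -
      have law: "distr M borel (\<lambda>w. X (real i * h n + h n) w - X (real i * h n) w) = distr M borel (X (h n))"
        using h(1)[of n] by (intro LX(6)) auto
      have eq: "real (Suc i) * h n = real i * h n + h n" by (simp add: algebra_simps)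
      have [measurable]: "X (h n) \<in> borel_measurable M" "X (real i * h n + h n) \<in> borel_measurable M" using LX(2) h(1)[of n] by auto
      have "(\<integral>w. min (X (real (Suc i) * h n) w - X (real i * h n) w) (e j) \<partial>M) =
         (\<integral>x. min x (e j) \<partial>distr M borel (\<lambda>w. X (real i * h n + h n) w - X (real i * h n) w))"
        unfolding eq by (subst integral_distr) auto
      also have "\<dots> = (\<integral>w. min (X (h n) w) (e j) \<partial>M)"
        unfolding law by (subst integral_distr) auto
      finally show ?thesis .
    qed
    then show ?thesis unfolding S_def using int_incr by (subst Bochner_Integration.integral_sum) (auto simp del: of_nat_Suc sum.lessThan_Suc)
  qed
  define K where "K j = 16 * T * (\<integral>x. min \<bar>x\<bar> (e j) \<partial>\<nu>) + e j" for j
  have K_lim: "K \<longlonglongrightarrow> 0"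
  proof -
    have "K \<longlonglongrightarrow> 16 * T * 0 + 0"
      unfolding K_def[abs_def] e_def
      by (intro tendsto_add tendsto_mult tendsto_const integral_min_tendsto_0 LIMSEQ_Suc[OF lim_1_over_n])
    then show ?thesis by simp
  qed
  define G where "G j w = liminf (\<lambda>n. ennreal (S j n w))" for j w
  have [measurable]: "G j \<in> borel_measurable M" for j unfolding G_def by measurable
  have G_int: "(\<integral>\<^sup>+w. G j w \<partial>M) \<le> ennreal (K j)" for j
  proof -
    have "(\<integral>\<^sup>+w. G j w \<partial>M) \<le> liminf (\<lambda>n. \<integral>\<^sup>+w. ennreal (S j n w) \<partial>M)"
      unfolding G_def by (rule nn_integral_liminf) measurable
    also have "\<dots> \<le> ennreal (K j)"
    proof (rule Liminf_le)
      have "\<forall>\<^sub>F n in sequentially. real (Suc n) * (\<integral>w. min (X (T / real (Suc n)) w) (e j) \<partial>M) \<le> K j"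
        unfolding K_def using T e by (intro driftless_small_increments[OF char prob_space_axioms LX(2) subordinatorD(3)[OF X]]) auto
      then show "\<forall>\<^sub>F n in sequentially. (\<integral>\<^sup>+w. ennreal (S j n w) \<partial>M) \<le> ennreal (K j)"
      proof eventually_elim
        case (elim n)
        have "(\<integral>\<^sup>+w. ennreal (S j n w) \<partial>M) = ennreal (\<integral>w. S j n w \<partial>M)"
        proof (rule nn_integral_eq_integral)
          show "integrable M (S j n)" unfolding S_def[abs_def] using int_incr by (intro Bochner_Integration.integrable_sum) auto
          show "AE w in M. 0 \<le> S j n w"
            unfolding S_def using incr_nonneg e[of j] by (intro AE_I2 sum_nonneg) (auto simp: min_def simp del: of_nat_Suc)
        qed
        then show ?case using elim unfolding S_integral h_def by (simp add: ennreal_leI del: of_nat_Suc)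
      qed
    qed simp
    finally show ?thesis .
  qed
  have "(\<integral>\<^sup>+w. (INF j. G j w) \<partial>M) \<le> ennreal (K j)" for j
    using G_int[of j] by (rule order_trans[rotated]) (auto intro!: nn_integral_mono INF_lower)
  then have "(\<integral>\<^sup>+w. (INF j. G j w) \<partial>M) \<le> ennreal 0"
    by (intro LIMSEQ_le_const[OF tendsto_ennrealI[OF K_lim]]) auto
  then have "(\<integral>\<^sup>+w. (INF j. G j w) \<partial>M) = 0" by simp
  then have "AE w in M. (INF j. G j w) = 0"
    by (subst (asm) nn_integral_0_iff_AE) auto
  then show ?thesis
  proof (rule AE_mp, intro AE_I2 impI allI)
    fix w and \<eta> :: real assume w: "w \<in> space M" and inf: "(INF j. G j w) = 0" and \<eta>: "0 < \<eta>"
    then have "(INF j. G j w) < ennreal \<eta>" by simp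
    then obtain j where j: "G j w < ennreal \<eta>" unfolding INF_less_iff by auto
    obtain \<delta> where \<delta>: "0 < \<delta>" "\<And>a b. 0 \<le> a \<Longrightarrow> a < b \<Longrightarrow> b \<le> T \<Longrightarrow> b - a < \<delta> \<Longrightarrow> \<exists>k e'. e' \<le> e j \<and> jump_cover (\<lambda>t. X t w) a b k e'"
      using jump_cover_local[OF LX(4)[OF w] subordinatorD(2)[OF X w] less_imp_le[OF T] e[of j]] by blast
    have "\<forall>\<^sub>F n in sequentially. h n < \<delta>"
    proof -
      have "h \<longlonglongrightarrow> 0" unfolding h_def[abs_def] using LIMSEQ_Suc[OF lim_const_over_n[of T]] by simp
      then show ?thesis using \<delta>(1) by (intro order_tendstoD)
    qed
    \<comment> \<open>A limit inferior below \<open>\<eta>\<close> makes the sums small infinitely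
      often, hence also on some grid that is fine enough for the local covers.\<close>
    moreover have "\<exists>\<^sub>F n in sequentially. ennreal (S j n w) < ennreal \<eta>"
    proof (rule ccontr)
      assume "\<not> ?thesis"
      then have "\<forall>\<^sub>F n in sequentially. ennreal \<eta> \<le> ennreal (S j n w)" by (simp add: not_frequently not_less)
      then have "ennreal \<eta> \<le> G j w" unfolding G_def by (rule Liminf_bounded)
      then show False using j by simp
    qed
    ultimately obtain n where n: "h n < \<delta>" "ennreal (S j n w) < ennreal \<eta>"
      using frequently_ex[OF frequently_eventually_conj] by blast
    have "\<exists>k e'. e' \<le> S j n w \<and> jump_cover (\<lambda>t. X t w) 0 (real (Suc n) * h n) k e'"
      unfolding S_def
      by (rule jump_cover_grid[OF LX(4)[OF w] subordinatorD(2)[OF X w] h(1) _ e])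
         (use n(1) \<delta>(2) in \<open>auto simp only: h(2) zero_less_Suc\<close>)
    moreover have "S j n w < \<eta>" using n(2) \<eta> by (cases "0 \<le> S j n w") (auto simp: ennreal_less_iff)
    ultimately show "\<exists>k e'. e' < \<eta> \<and> jump_cover (\<lambda>t. X t w) 0 T k e'" unfolding h(2) by (meson le_less_trans)
  qed
qed

lemma AE_jump_cover:
  assumes X: "subordinator M X" and char: "drift_levy_measure M X 0 \<nu>"
  shows "AE w in M. \<forall>n. \<forall>\<eta>>0. \<exists>k e'. e' < \<eta> \<and> jump_cover (\<lambda>t. X t w) 0 (real (Suc n)) k e'"
  unfolding AE_all_countable using AE_jump_cover_at[OF X char] by simp

section \<open>Levels passed continuously\<close>

definition crept :: "(real \<Rightarrow> real) \<Rightarrow> real \<Rightarrow> real \<Rightarrow> bool" where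
  "crept f u \<sigma> \<longleftrightarrow> 0 < \<sigma> \<and> (\<forall>s\<in>{0..<\<sigma>}. f s \<le> u) \<and> left_limit f \<sigma> = u"

lemma card_multiples_in_interval:
  fixes y :: real
  assumes y: "0 < y" and e: "0 \<le> e"
  shows "finite {j::nat. real j * y \<in> {A..A + e}}" "real (card {j::nat. real j * y \<in> {A..A + e}}) * y \<le> e + y"
proof -
  let ?S = "{j::nat. real j * y \<in> {A..A + e}}"
  have "?S \<subseteq> {..nat \<lceil>(A + e) / y\<rceil>}"
  proof
    fix j assume "j \<in> ?S"
    then have "real j \<le> (A + e) / y" using y by (simp add: field_simps)
    then show "j \<in> {..nat \<lceil>(A + e) / y\<rceil>}" by (simp add: le_nat_iff le_ceiling_iff)
  qed
  then show fin: "finite ?S" by (rule finite_subset) simp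
  show "real (card ?S) * y \<le> e + y"
  proof (cases "?S = {}")
    case False
    have "?S \<subseteq> {Min ?S..Max ?S}" using fin by auto
    then have "card ?S \<le> card {Min ?S..Max ?S}" by (intro card_mono) auto
    then have "real (card ?S) \<le> real (Suc (Max ?S) - Min ?S)" by simp
    also have "Min ?S \<le> Max ?S" using fin False by (meson Max_in Min_le)
    then have "real (Suc (Max ?S) - Min ?S) = real (Max ?S) - real (Min ?S) + 1" by linarith
    finally have "real (card ?S) * y \<le> (real (Max ?S) - real (Min ?S) + 1) * y" using y by (intro mult_right_mono) auto
    moreover have "real (Max ?S) * y \<le> A + e" using Max_in[OF fin False] by auto
    moreover have "A \<le> real (Min ?S) * y" using Min_in[OF fin False] by auto
    ultimately show ?thesis by (simp add: algebra_simps)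
  next
    case True
    show ?thesis unfolding True using y e by simp
  qed
qed

text \<open>In one piece starting at \<open>a\<close>, a crept level is at least the value of the
  difference at \<open>a\<close> and exceeds it by at most the inner growth of \<open>f\<close>,
  because the growth of \<open>g\<close> only lowers the path. So the crept levels lie in
  \<open>k\<close> intervals of total length \<open>e\<close>; counting multiples of
  \<open>y\<close> replaces Lebesgue measure, with one extra multiple for each interval.\<close>

lemma crept_levels_count:
  assumes f: "cadlag f" "mono_on {0..} f" and g: "cadlag g" "mono_on {0..} g" and y: "0 < y"
    and "jump_cover f a b k e" "0 \<le> a"
  shows "finite {j::nat. \<exists>\<sigma>. \<sigma> \<in> {a<..b} \<and> crept (\<lambda>t. f t - g t) (real j * y) \<sigma>} \<and>
    real (card {j::nat. \<exists>\<sigma>. \<sigma> \<in> {a<..b} \<and> crept (\<lambda>t. f t - g t) (real j * y) \<sigma>}) * y \<le> e + real k * y \<and> a < b"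
  using assms(6,7)
proof (induction rule: jump_cover.induct)
  case (single a b)
  let ?Z = "\<lambda>t. f t - g t"
  let ?e = "left_limit f b - f a"
  have "{j::nat. \<exists>\<sigma>. \<sigma> \<in> {a<..b} \<and> crept ?Z (real j * y) \<sigma>} \<subseteq> {j. real j * y \<in> {?Z a..?Z a + ?e}}"
  proof safe
    fix j :: nat and \<sigma> assume \<sigma>: "\<sigma> \<in> {a<..b}" and c: "crept ?Z (real j * y) \<sigma>"
    have "?Z a \<le> real j * y" using c \<sigma> single unfolding crept_def by auto
    moreover have "real j * y \<le> ?Z a + ?e"
    proof -
      have "real j * y = left_limit f \<sigma> - left_limit g \<sigma>"
        using c \<sigma> single left_limit_diff[OF f(1) g(1), of \<sigma>] unfolding crept_def by auto
      moreover have "g a \<le> left_limit g \<sigma>" using \<sigma> single by (intro left_limit_mono_bounds[OF g]) auto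
      moreover have "left_limit f \<sigma> \<le> left_limit f b"
      proof (cases "\<sigma> = b")
        case False
        then have "left_limit f \<sigma> \<le> f \<sigma>" "f \<sigma> \<le> left_limit f b"
          using \<sigma> single left_limit_mono_bounds(2)[OF f, of a \<sigma>] left_limit_mono_bounds(1)[OF f, of \<sigma> b] by auto
        then show ?thesis by simp
      qed simp
      ultimately show ?thesis by simp
    qed
    ultimately show "real j * y \<in> {?Z a..?Z a + ?e}" by simp
  qed
  moreover have "0 \<le> ?e" using left_limit_mono_bounds(1)[OF f] single by simp
  note cnt = card_multiples_in_interval[OF y this, of "?Z a"]
  ultimately have "finite {j::nat. \<exists>\<sigma>. \<sigma> \<in> {a<..b} \<and> crept ?Z (real j * y) \<sigma>}"
    "card {j::nat. \<exists>\<sigma>. \<sigma> \<in> {a<..b} \<and> crept ?Z (real j * y) \<sigma>} \<le> card {j. real j * y \<in> {?Z a..?Z a + ?e}}"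
    using cnt(1) by (auto intro: finite_subset card_mono)
  moreover from this(2) have "real (card {j::nat. \<exists>\<sigma>. \<sigma> \<in> {a<..b} \<and> crept ?Z (real j * y) \<sigma>}) * y \<le> real (card {j. real j * y \<in> {?Z a..?Z a + ?e}}) * y"
    using y by (intro mult_right_mono) auto
  ultimately show ?case using cnt(2) single(1) by simp
next
  case (join a m k e b l e')
  let ?S = "\<lambda>a b. {j::nat. \<exists>\<sigma>. \<sigma> \<in> {a<..b} \<and> crept (\<lambda>t. f t - g t) (real j * y) \<sigma>}"
  have 1: "finite (?S a m)" "real (card (?S a m)) * y \<le> e + real k * y" "a < m" using join by auto
  then have 2: "finite (?S m b)" "real (card (?S m b)) * y \<le> e' + real l * y" "m < b" using join by auto
  have S: "?S a b \<subseteq> ?S a m \<union> ?S m b" by force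
  then have "finite (?S a b)" using 1 2 by (auto intro: finite_subset)
  moreover have "real (card (?S a b)) * y \<le> real (card (?S a m) + card (?S m b)) * y"
    using y card_mono[OF _ S] card_Un_le[of "?S a m" "?S m b"] 1 2 by (intro mult_right_mono) auto
  ultimately show ?case using 1 2 by (simp add: algebra_simps)
qed

section \<open>Creeping\<close>

definition approach :: "nat \<Rightarrow> real \<Rightarrow> (real \<Rightarrow> real) \<Rightarrow> ennreal" where
  "approach n u f = passage (u - 1 / real (Suc n)) f"

definition creep_time :: "real \<Rightarrow> (real \<Rightarrow> real) \<Rightarrow> ennreal" where
  "creep_time u f = (SUP n. approach n u f)"

text \<open>The level \<open>u\<close> is approached continuously from below exactly if the passage times over
  \<open>u - 1 / (n + 1)\<close> never reach their supremum. The exponential weight discards the paths for which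
  this supremum is infinite.\<close>

definition creep_weight :: "real \<Rightarrow> (real \<Rightarrow> real) \<Rightarrow> real" where
  "creep_weight u f =
     (if (\<forall>n. approach n u f < creep_time u f) \<and> creep_time u f < \<infinity> then exp (- enn2real (creep_time u f)) else 0)"

text \<open>The condition says that the path does not jump over the whole remaining gap: at the
  approach time it is within \<open>1 / (n + 1)\<close> of the level and still below it, see
  \<open>approach_less_creep_time_iff\<close>.\<close>

definition approach_weight :: "nat \<Rightarrow> real \<Rightarrow> (real \<Rightarrow> real) \<Rightarrow> real" where
  "approach_weight n u f = (if approach n u f < creep_time u f then exp (- enn2real (approach n u f)) else 0)"

lemma weight_bounds:
  "0 \<le> creep_weight u f" "creep_weight u f \<le> 1" "0 \<le> approach_weight n u f" "approach_weight n u f \<le> 1"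
  by (auto simp: creep_weight_def approach_weight_def)

lemma inverse_Suc_antimono: "n \<le> m \<Longrightarrow> 1 / real (Suc m) \<le> 1 / real (Suc n)"
  by (intro divide_left_mono) auto

lemma passage_mono: "c \<le> c' \<Longrightarrow> passage c f \<le> passage c' f"
  unfolding passage_def by (intro INF_mono) (auto intro: order_trans)

lemma incseq_approach: "incseq (\<lambda>n. approach n u f)"
  unfolding approach_def by (intro monoI passage_mono) (use inverse_Suc_antimono in force)

lemma approach_le_creep_time: "approach n u f \<le> creep_time u f"
  unfolding creep_time_def by (rule SUP_upper) simp

lemma approach_tendsto: "(\<lambda>n. approach n u f) \<longlonglongrightarrow> creep_time u f"
  unfolding creep_time_def by (rule LIMSEQ_SUP[OF incseq_approach])

text \<open>If the approach times never reach their supremum, the exponentials converge, and to 0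
  when the supremum is infinite. Otherwise the times are eventually equal to the supremum and the
  weights are eventually 0.\<close>

lemma approach_weight_tendsto: "(\<lambda>n. approach_weight n u f) \<longlonglongrightarrow> creep_weight u f"
proof (cases "\<forall>n. approach n u f < creep_time u f")
  case True
  then have w: "approach_weight n u f = exp (- enn2real (approach n u f))" for n by (simp add: approach_weight_def)
  have fin: "approach n u f < \<infinity>" for n using True[rule_format, of n] by (rule less_le_trans) simp
  show ?thesis
  proof (cases "creep_time u f")
    case (real r)
    then have "(\<lambda>n. approach n u f) \<longlonglongrightarrow> ennreal r" using approach_tendsto[of u f] by simp
    then have "(\<lambda>n. enn2real (approach n u f)) \<longlonglongrightarrow> enn2real (creep_time u f)"
      using real by (simp add: tendsto_enn2real)
    then have "(\<lambda>n. exp (- enn2real (approach n u f))) \<longlonglongrightarrow> exp (- enn2real (creep_time u f))"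
      by (intro tendsto_exp tendsto_minus)
    then show ?thesis unfolding w using True real by (simp add: creep_weight_def)
  next
    case top
    have "filterlim (\<lambda>n. enn2real (approach n u f)) at_top sequentially"
      unfolding filterlim_at_top
    proof
      fix Z
      have "\<forall>\<^sub>F n in sequentially. ennreal (max 0 Z) < approach n u f"
        using top approach_tendsto[of u f] by (intro order_tendstoD) (auto simp: less_top)
      then show "\<forall>\<^sub>F n in sequentially. Z \<le> enn2real (approach n u f)"
      proof eventually_elim
        case (elim n)
        then show ?case using fin[of n] by (cases "0 \<le> Z"; cases "approach n u f") (auto simp: ennreal_less_iff)
      qed
    qed
    then have "((\<lambda>n. exp (- enn2real (approach n u f))) \<longlongrightarrow> 0) sequentially"
      by (intro filterlim_compose[OF exp_at_bot] filterlim_compose[OF filterlim_uminus_at_bot_at_top])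
    then show ?thesis unfolding w using top by (simp add: creep_weight_def)
  qed
next
  case False
  then obtain n where n: "approach n u f = creep_time u f" using approach_le_creep_time[of _ u f] by (auto simp: less_le)
  have "approach_weight m u f = 0" if "n \<le> m" for m
  proof -
    have "creep_time u f \<le> approach m u f" using incseqD[OF incseq_approach that, of u f] n by simp
    then show ?thesis by (simp add: approach_weight_def not_less[symmetric])
  qed
  then have "\<forall>\<^sub>F m in sequentially. approach_weight m u f = 0" by (auto simp: eventually_sequentially)
  then have "(\<lambda>m. approach_weight m u f) \<longlonglongrightarrow> 0" by (rule tendsto_eventually)
  moreover have "creep_weight u f = 0" using False by (auto simp: creep_weight_def)
  ultimately show ?thesis by simp
qed

lemma approach_measurable:
  assumes [measurable]: "g \<in> measurable N paths" "u \<in> borel_measurable N"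
  shows "(\<lambda>x. approach n (u x) (g x)) \<in> borel_measurable N"
  unfolding approach_def by (intro passage_measurable) measurable

lemma creep_time_measurable:
  assumes "g \<in> measurable N paths" "u \<in> borel_measurable N"
  shows "(\<lambda>x. creep_time (u x) (g x)) \<in> borel_measurable N"
  unfolding creep_time_def using approach_measurable[OF assms] by measurable

lemma approach_weight_measurable:
  assumes "g \<in> measurable N paths" "u \<in> borel_measurable N"
  shows "(\<lambda>x. approach_weight n (u x) (g x)) \<in> borel_measurable N"
  unfolding approach_weight_def using approach_measurable[OF assms] creep_time_measurable[OF assms] by measurable

lemma creep_weight_measurable:
  assumes "g \<in> measurable N paths" "u \<in> borel_measurable N"
  shows "(\<lambda>x. creep_weight (u x) (g x)) \<in> borel_measurable N"
  using approach_weight_tendsto approach_weight_measurable[OF assms] by (rule borel_measurable_LIMSEQ_real)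

text \<open>Creeping depends on the approach times only through their tail, so a common time shift
  from some index \<open>m0\<close> on is enough. For smaller indices the path before the shift may
  already be close to the level.\<close>

lemma creep_weight_shift:
  assumes s: "0 \<le> s" and shift: "\<And>m. m0 \<le> m \<Longrightarrow> approach m u f = ennreal s + approach m v g"
  shows "creep_weight u f = exp (- s) * creep_weight v g"
proof -
  have tail: "(SUP m. approach m w h) = (SUP m. approach (m + m0) w h)" for w h
  proof (rule antisym)
    show "(SUP m. approach m w h) \<le> (SUP m. approach (m + m0) w h)"
      by (intro SUP_mono) (auto intro!: exI incseqD[OF incseq_approach, OF le_add1])
    show "(SUP m. approach (m + m0) w h) \<le> (SUP m. approach m w h)" by (intro SUP_mono) auto
  qed
  have time: "creep_time u f = ennreal s + creep_time v g"
  proof -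
    have "incseq (\<lambda>m. approach (m + m0) v g)" using incseq_approach[of v g] by (simp add: mono_def)
    then have "(SUP m. ennreal s + approach (m + m0) v g) = (SUP m::nat. ennreal s) + (SUP m. approach (m + m0) v g)"
      by (intro ennreal_SUP_add) auto
    then show ?thesis unfolding creep_time_def tail[of u] tail[of v] by (simp add: shift)
  qed
  have all: "(\<forall>n. approach n w h < creep_time w h) \<longleftrightarrow> (\<forall>n\<ge>m0. approach n w h < creep_time w h)" for w h
    using incseqD[OF incseq_approach, of _ "max _ m0" w h] by (meson le_less_trans max.cobounded1 max.cobounded2)
  have "(\<forall>n. approach n u f < creep_time u f) \<longleftrightarrow> (\<forall>n. approach n v g < creep_time v g)"
  proof -
    have "(\<forall>n\<ge>m0. approach n u f < creep_time u f) \<longleftrightarrow> (\<forall>n\<ge>m0. approach n v g < creep_time v g)"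
      unfolding time by (simp add: shift ennreal_add_left_cancel_less)
    then show ?thesis using all[of u f] all[of v g] by argo
  qed
  moreover have "creep_time u f < \<infinity> \<longleftrightarrow> creep_time v g < \<infinity>" unfolding time by simp
  moreover have "enn2real (creep_time u f) = s + enn2real (creep_time v g)" if "creep_time v g < \<infinity>"
    unfolding time using s that by (simp add: enn2real_plus)
  ultimately show ?thesis unfolding creep_weight_def by (auto simp: exp_diff exp_minus field_simps)
qed

lemma approach_cadlag: "cadlag f \<Longrightarrow> approach n u f = first_passage f (u - 1 / real (Suc n))"
  by (simp add: approach_def passage_cadlag)

text \<open>If the path is at or above \<open>u\<close> at the approach time, all closer approaches
  have happened as well. If it is still below \<open>u\<close>, right-continuity keeps it below some
  closer threshold for a while, so that a closer approach comes strictly later.\<close>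

lemma approach_less_creep_time_iff:
  assumes f: "cadlag f" "f 0 = 0" and u: "0 < u" and \<rho>: "approach n u f = ennreal \<rho>" "0 \<le> \<rho>"
  shows "approach n u f < creep_time u f \<longleftrightarrow> f \<rho> < u"
proof
  assume "approach n u f < creep_time u f"
  then obtain m where "approach n u f < approach m u f"
    unfolding creep_time_def less_SUP_iff by auto
  then have "ennreal \<rho> < first_passage f (u - 1 / real (Suc m))"
    unfolding \<rho>(1) approach_cadlag[OF f(1), of m] .
  then have "f \<rho> \<le> u - 1 / real (Suc m)" if "0 < \<rho>" using before_first_passage[OF that] by blast
  moreover have "u - 1 / real (Suc m) < u" by simp
  ultimately show "f \<rho> < u" using f(2) u \<rho>(2) by (cases "\<rho> = 0") (simp, linarith)
next
  assume "f \<rho> < u"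
  then obtain m' where m': "1 / real (Suc m') < u - f \<rho>" by (metis diff_gt_0_iff_gt nat_approx_posE)
  define m where "m = max n m'"
  have m: "f \<rho> < u - 1 / real (Suc m)" "1 / real (Suc m) \<le> 1 / real (Suc n)"
    using m' inverse_Suc_antimono[of m' m] inverse_Suc_antimono[of n m] unfolding m_def by auto
  obtain d where d: "0 < d" "\<forall>s\<in>{\<rho>..\<rho>+d}. f s < u - 1 / real (Suc m)"
    using first_passage_right_cont[OF f(1) \<rho>(2) m(1)] by auto
  have "ennreal (\<rho> + d) \<le> first_passage f (u - 1 / real (Suc m))"
    unfolding le_first_passage_iff
  proof safe
    fix t assume t: "0 < t" "u - 1 / real (Suc m) < f t"
    have "f t \<le> u - 1 / real (Suc n)" if "t < \<rho>"
      using before_first_passage[of t f "u - 1 / real (Suc n)"] t(1) that \<rho>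
      unfolding approach_cadlag[OF f(1)] by (simp add: ennreal_less_iff)
    with t m(2) have "\<not> t < \<rho>" by force
    moreover have "t \<notin> {\<rho>..\<rho>+d}" using d(2) t(2) by (meson less_asym)
    ultimately show "ennreal (\<rho> + d) \<le> ennreal t" by (intro ennreal_leI) auto
  qed
  moreover have "ennreal \<rho> < ennreal (\<rho> + d)" using d(1) \<rho>(2) by (simp add: ennreal_less_iff)
  ultimately have "approach n u f < approach m u f" unfolding \<rho>(1) approach_cadlag[OF f(1), of m] by (rule less_le_trans[rotated])
  then show "approach n u f < creep_time u f" using approach_le_creep_time by (rule less_le_trans)
qed

lemma creep_weight_crept:
  assumes f: "cadlag f" "f 0 = 0" and u: "0 < u" and w: "creep_weight u f \<noteq> 0"
  obtains \<sigma> where "0 < \<sigma>" "creep_time u f = ennreal \<sigma>" "creep_weight u f = exp (- \<sigma>)" "crept f u \<sigma>"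
    "filterlim (\<lambda>n. enn2real (approach n u f)) (at_left \<sigma>) sequentially"
proof -
  have lt: "approach n u f < creep_time u f" and fin: "creep_time u f < \<infinity>" for n
    using w by (auto simp: creep_weight_def split: if_splits)
  obtain \<sigma> where \<sigma>: "0 \<le> \<sigma>" "creep_time u f = ennreal \<sigma>" using fin by (cases "creep_time u f") auto
  define a where "a n = enn2real (approach n u f)" for n
  have a: "approach n u f = ennreal (a n)" "0 \<le> a n" "a n < \<sigma>" for n
  proof -
    have "approach n u f < \<infinity>" using lt[of n] by (rule less_le_trans) simp
    then show 1: "approach n u f = ennreal (a n)" "0 \<le> a n" unfolding a_def by (auto simp: less_top)
    show "a n < \<sigma>" using lt[of n] 1 unfolding \<sigma>(2) by (simp add: ennreal_less_iff)
  qed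
  have a_lim: "a \<longlonglongrightarrow> \<sigma>"
    using tendsto_enn2real[OF approach_tendsto[of u f, unfolded \<sigma>(2)] \<sigma>(1)] unfolding a_def[abs_def] .
  have filt: "filterlim a (at_left \<sigma>) sequentially"
    unfolding filterlim_at using a_lim a(3) by (auto intro!: always_eventually dest: less_imp_neq)
  have pos: "0 < \<sigma>" using a(2,3)[of 0] by linarith
  have before: "f s \<le> u" if s: "s \<in> {0..<\<sigma>}" for s
  proof (cases "s = 0")
    case False
    have "\<forall>\<^sub>F n in sequentially. s < a n" using s by (intro order_tendstoD[OF a_lim]) auto
    then obtain n where "s < a n" by (auto simp: eventually_sequentially)
    then have "ennreal s < first_passage f (u - 1 / real (Suc n))"
      using a(1)[of n] s unfolding approach_cadlag[OF f(1)] by (simp add: ennreal_less_iff)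
    then have "f s \<le> u - 1 / real (Suc n)" using False s by (intro before_first_passage) auto
    moreover have "0 \<le> 1 / real (Suc n)" by simp
    ultimately show ?thesis by linarith
  qed (use f u in simp)
  have "left_limit f \<sigma> = u"
  proof (rule LIMSEQ_unique)
    show "(\<lambda>n. f (a n)) \<longlonglongrightarrow> left_limit f \<sigma>"
      by (rule filterlim_compose[OF left_limit_tendsto[OF f(1) pos] filt])
    have "(\<lambda>n. u - 1 / real (Suc n)) \<longlonglongrightarrow> u - 0"
      by (intro tendsto_diff tendsto_const LIMSEQ_Suc[OF lim_1_over_n])
    then have lim: "(\<lambda>n. u - 1 / real (Suc n)) \<longlonglongrightarrow> u" by simp
    show "(\<lambda>n. f (a n)) \<longlonglongrightarrow> u"
    proof (rule tendsto_sandwich[OF _ _ lim tendsto_const])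
      show "\<forall>\<^sub>F n in sequentially. u - 1 / real (Suc n) \<le> f (a n)"
        using at_first_passage[OF f(1) a(1)[unfolded approach_cadlag[OF f(1)]] a(2)] by (intro always_eventually allI)
      show "\<forall>\<^sub>F n in sequentially. f (a n) \<le> u" using before a(2,3) by (intro always_eventually allI) auto
    qed
  qed
  then have "crept f u \<sigma>" unfolding crept_def using pos before by auto
  moreover have "creep_weight u f = exp (- \<sigma>)" unfolding creep_weight_def using lt fin \<sigma> by simp
  ultimately show thesis using pos \<sigma>(2) filt unfolding a_def[abs_def] by (intro that[of \<sigma>]) auto
qed

lemma creep_weight_restart:
  assumes f: "cadlag f" "f 0 = 0" and u: "0 < u" and \<rho>: "approach n u f = ennreal \<rho>" "0 \<le> \<rho>" and lt: "f \<rho> < u"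
  shows "creep_weight u f = exp (- \<rho>) * creep_weight (u - f \<rho>) (\<lambda>t. f (\<rho> + t) - f \<rho>)" "u - f \<rho> \<le> 1 / real (Suc n)"
proof -
  obtain m' where m': "1 / real (Suc m') < u - f \<rho>" using lt by (metis diff_gt_0_iff_gt nat_approx_posE)
  show "creep_weight u f = exp (- \<rho>) * creep_weight (u - f \<rho>) (\<lambda>t. f (\<rho> + t) - f \<rho>)"
  proof (rule creep_weight_shift[OF \<rho>(2), of "max n m'"])
    fix m assume m: "max n m' \<le> m"
    have le: "f t \<le> u - 1 / real (Suc m)" if t: "0 < t" "t \<le> \<rho>" for t
    proof (cases "t = \<rho>")
      case True
      then show ?thesis using m' inverse_Suc_antimono[of m' m] m by auto
    next
      case False
      then have "f t \<le> u - 1 / real (Suc n)"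
        using t \<rho> unfolding approach_cadlag[OF f(1)] by (intro before_first_passage) (auto simp: ennreal_less_iff)
      then show ?thesis using inverse_Suc_antimono[of n m] m by auto
    qed
    show "approach m u f = ennreal \<rho> + approach m (u - f \<rho>) (\<lambda>t. f (\<rho> + t) - f \<rho>)"
      unfolding approach_cadlag[OF f(1)] approach_cadlag[OF cadlag_shift[OF f(1) \<rho>(2)]]
      by (subst first_passage_shift[OF \<rho>(2) le]) (auto simp: algebra_simps)
  qed
  show "u - f \<rho> \<le> 1 / real (Suc n)"
    using at_first_passage[OF f(1) \<rho>(1)[unfolded approach_cadlag[OF f(1)]] \<rho>(2)] by linarith
qed

lemma left_limit_left_cont:
  assumes f: "cadlag f" and t: "0 < t"
  shows "((\<lambda>s. left_limit f s) \<longlongrightarrow> left_limit f t) (at_left t)"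
proof (rule tendstoI)
  fix e :: real assume e: "0 < e"
  have "\<forall>\<^sub>F s in at_left t. dist (f s) (left_limit f t) < e / 2"
    using e by (intro tendstoD[OF left_limit_tendsto[OF f t]]) simp
  then obtain b where b: "b < t" "\<And>s. b < s \<Longrightarrow> s < t \<Longrightarrow> dist (f s) (left_limit f t) < e / 2"
    unfolding eventually_at_left[OF t] by auto
  have "dist (left_limit f s) (left_limit f t) < e" if s: "max 0 b < s" "s < t" for s
  proof -
    have "((\<lambda>r. dist (f r) (left_limit f t)) \<longlongrightarrow> dist (left_limit f s) (left_limit f t)) (at_left s)"
      using s by (intro tendsto_dist left_limit_tendsto[OF f] tendsto_const) auto
    moreover have "\<forall>\<^sub>F r in at_left s. dist (f r) (left_limit f t) \<le> e / 2"
      using eventually_at_left_real[OF s(1)]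
    proof eventually_elim
      case (elim r)
      then have "dist (f r) (left_limit f t) < e / 2" using s by (intro b(2)) auto
      then show ?case by (rule less_imp_le)
    qed
    ultimately have "dist (left_limit f s) (left_limit f t) \<le> e / 2" by (intro tendsto_upperbound) auto
    then show ?thesis using e by simp
  qed
  moreover have "max 0 b < t" using b(1) t by simp
  ultimately show "\<forall>\<^sub>F s in at_left t. dist (left_limit f s) (left_limit f t) < e"
    unfolding eventually_at_left[OF \<open>max 0 b < t\<close>] by blast
qed

text \<open>After creeping over \<open>x\<close> at time \<open>\<sigma>\<close>, the relevant
  continuation is the path of left limits, for this is what the paths after the approach times
  converge to. A path and its left limits exceed a level strictly for the first time
  simultaneously.\<close>

lemma creep_weight_add:
  assumes f: "cadlag f" "f 0 = 0" and x: "0 < x" and y: "0 < y" and \<sigma>: "crept f x \<sigma>"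
    and g: "\<And>t. 0 < t \<Longrightarrow> g t = left_limit f (\<sigma> + t) - x"
  shows "creep_weight (x + y) f = exp (- \<sigma>) * creep_weight y g"
proof -
  have pos: "0 < \<sigma>" using \<sigma> by (simp add: crept_def)
  obtain m0 where m0: "1 / real (Suc m0) < y" using y nat_approx_posE by blast
  have fp_g: "passage c g = first_passage g c" for c
  proof (rule passage_eq_first_passage, rule disjI2, safe)
    fix t :: real assume t: "0 < t"
    have "filterlim (\<lambda>s. \<sigma> + s) (at_left (\<sigma> + t)) (at_left t)"
      unfolding filterlim_at by (auto intro!: tendsto_eq_intros simp: eventually_at_filter)
    with left_limit_left_cont[OF f(1), of "\<sigma> + t"] pos t
    have "((\<lambda>s. left_limit f (\<sigma> + s) - x) \<longlongrightarrow> left_limit f (\<sigma> + t) - x) (at_left t)"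
      by (intro tendsto_diff tendsto_const) (auto intro: filterlim_compose)
    moreover have "\<forall>\<^sub>F s in at_left t. left_limit f (\<sigma> + s) - x = g s"
      using eventually_at_left_real[OF t] by eventually_elim (simp add: g)
    ultimately show "(g \<longlongrightarrow> g t) (at_left t)" unfolding g[OF t] by (rule Lim_transform_eventually)
  qed
  have fp: "first_passage f (x + c) = ennreal \<sigma> + first_passage g c" if c: "0 < c" for c
  proof (rule antisym)
    have "first_passage f (x + c) - ennreal \<sigma> \<le> first_passage g c"
      unfolding le_first_passage_iff
    proof safe
      fix t assume t: "0 < t" "c < g t"
      then have "\<forall>\<^sub>F s in at_left (\<sigma> + t). x + c < f s"
        using pos by (intro order_tendstoD[OF left_limit_tendsto[OF f(1)]]) (auto simp: g)
      moreover have "\<forall>\<^sub>F s in at_left (\<sigma> + t). s \<in> {0<..<\<sigma> + t}" using pos t by (intro eventually_at_left_real) auto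
      ultimately have "\<forall>\<^sub>F s in at_left (\<sigma> + t). x + c < f s \<and> s \<in> {0<..<\<sigma> + t}" by eventually_elim simp
      then obtain s where s: "x + c < f s" "s \<in> {0<..<\<sigma> + t}" using eventually_happens'[OF trivial_limit_at_left_real] by blast
      then have "first_passage f (x + c) \<le> ennreal s" unfolding first_passage_def by (intro INF_lower) auto
      also have "\<dots> \<le> ennreal (\<sigma> + t)" using s by (intro ennreal_leI) auto
      also have "\<dots> = ennreal \<sigma> + ennreal t" using pos t by simp
      finally show "first_passage f (x + c) - ennreal \<sigma> \<le> ennreal t" by (simp add: ennreal_minus_le_iff)
    qed
    then show "first_passage f (x + c) \<le> ennreal \<sigma> + first_passage g c" by (simp add: ennreal_minus_le_iff)
    show "ennreal \<sigma> + first_passage g c \<le> first_passage f (x + c)"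
      unfolding le_first_passage_iff
    proof safe
      fix t assume t: "0 < t" "x + c < f t"
      have "\<sigma> \<le> t"
      proof (rule ccontr)
        assume "\<not> \<sigma> \<le> t"
        then have "f t \<le> x" using \<sigma> t(1) unfolding crept_def by auto
        then show False using t(2) c by simp
      qed
      \<comment> \<open>An intermediate value keeps the inequality strict, since passing to left
        limits only preserves weak inequalities.\<close>
      obtain c' where c': "x + c < c'" "c' < f t" using dense[OF t(2)] by blast
      have "\<forall>\<^sub>F s in at_right t. c' < f s" using f t c' by (intro order_tendstoD[OF cadlag_right]) auto
      then obtain b where b: "t < b" "\<And>s. t < s \<Longrightarrow> s < b \<Longrightarrow> c' < f s"
        unfolding eventually_at_right[OF less_add_one] by auto
      show "ennreal \<sigma> + first_passage g c \<le> ennreal t"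
      proof (rule ennreal_le_epsilon)
        fix e :: real assume e: "0 < e"
        define s where "s = min ((t + b) / 2) (t + e)"
        have s: "t < s" "s < b" "s \<le> t + e" using b(1) e unfolding s_def by (auto simp: min_def)
        have "c' \<le> left_limit f s"
        proof (rule tendsto_lowerbound[OF left_limit_tendsto[OF f(1)]])
          show "\<forall>\<^sub>F r in at_left s. c' \<le> f r"
            using eventually_at_left_real[OF s(1)] s(2) by (auto elim!: eventually_mono intro!: less_imp_le b(2))
        qed (use s t in auto)
        then have "c < g (s - \<sigma>)" using c' s \<open>\<sigma> \<le> t\<close> by (subst g) auto
        then have "first_passage g c \<le> ennreal (s - \<sigma>)"
          unfolding first_passage_def using s \<open>\<sigma> \<le> t\<close> by (intro INF_lower) auto
        then have "ennreal \<sigma> + first_passage g c \<le> ennreal \<sigma> + ennreal (s - \<sigma>)" by (rule add_left_mono)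
        also have "\<dots> = ennreal s" using pos s \<open>\<sigma> \<le> t\<close> by (subst ennreal_plus[symmetric]) auto
        also have "\<dots> \<le> ennreal (t + e)" using s by (intro ennreal_leI)
        also have "\<dots> = ennreal t + ennreal e" using t e by simp
        finally show "ennreal \<sigma> + first_passage g c \<le> ennreal t + ennreal e" .
      qed
    qed
  qed
  show ?thesis
  proof (rule creep_weight_shift[OF less_imp_le[OF pos], of m0])
    fix m assume "m0 \<le> m"
    then have "0 < y - 1 / real (Suc m)" using m0 inverse_Suc_antimono[of m0 m] by linarith
    from fp[OF this] show "approach m (x + y) f = ennreal \<sigma> + approach m y g"
      unfolding approach_cadlag[OF f(1)] unfolding approach_def fp_g by (simp add: algebra_simps)
  qed
qed

lemma creep_weight_cong: "(\<And>t. 0 < t \<Longrightarrow> f t = g t) \<Longrightarrow> creep_weight u f = creep_weight u g"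
  using passage_cong[of f g] unfolding creep_weight_def creep_time_def approach_def by simp

lemma approach_weight_cong: "(\<And>t. 0 < t \<Longrightarrow> f t = g t) \<Longrightarrow> approach_weight n u f = approach_weight n u g"
  using passage_cong[of f g] unfolding approach_weight_def creep_time_def approach_def by simp

lemma approach_weight_real:
  assumes f: "cadlag f" "f 0 = 0" and u: "0 < u" and \<rho>: "approach n u f = ennreal \<rho>" "0 \<le> \<rho>"
  shows "approach_weight n u f = (if f \<rho> < u then exp (- \<rho>) else 0)"
  using approach_less_creep_time_iff[OF assms] \<rho> by (simp add: approach_weight_def)

section \<open>The difference of two independent subordinators\<close>

locale levy_difference =
  fixes M :: "'a measure" and Zp Zm :: "real \<Rightarrow> 'a \<Rightarrow> real"
  assumes Zp: "subordinator M Zp" and Zm: "subordinator M Zm" and indep: "indep_processes M Zp Zm"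
begin

text \<open>A separate definition, because the given process is assumed to agree with the difference
  only at nonnegative times and on the sample space.\<close>

definition Z :: "real \<Rightarrow> 'a \<Rightarrow> real" where
  "Z t w = Zp t w - Zm t w"

abbreviation "hist \<equiv> past M (joint Zp Zm)"

lemmas LP = levy_processD[OF subordinatorD(1)[OF Zp]] and LM = levy_processD[OF subordinatorD(1)[OF Zm]]

sublocale prob_space M by (rule LP(1))

sublocale pair: markov_process M "joint Zp Zm" hist
proof (rule markov_process_past)
  show "prob_space M" by (rule LP(1))
  show "joint Zp Zm t \<in> borel_measurable M" if "0 \<le> t" for t
    unfolding joint_def[abs_def] using LP(2)[OF that] LM(2)[OF that] by (rule borel_measurable_Pair)
  show "((\<lambda>t. joint Zp Zm t w) \<longlongrightarrow> joint Zp Zm t w) (at_right t)" if "w \<in> space M" "0 \<le> t" for t w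
    unfolding joint_def using LP(4) LM(4) that by (intro tendsto_Pair cadlag_right) auto
  show "joint Zp Zm 0 w = 0" if "w \<in> space M" for w
    using LP(3)[OF that] LM(3)[OF that] by (simp add: joint_def zero_prod_def)
qed (use levy_pair_markov[OF subordinatorD(1)[OF Zp] subordinatorD(1)[OF Zm] indep] in auto)

sublocale diff: markov_process M Z hist
proof -
  have "continuous_on UNIV (\<lambda>p. fst p - snd p :: real)" by (intro continuous_intros)
  moreover have "(\<lambda>t w. fst (joint Zp Zm t w) - snd (joint Zp Zm t w)) = Z" by (intro ext) (simp add: Z_def joint_def)
  ultimately show "markov_process M Z hist"
    using pair.markov_process_image[of "\<lambda>p. fst p - snd p"] by simp
qed

lemma Z_cadlag: "w \<in> space M \<Longrightarrow> cadlag (\<lambda>t. Z t w)"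
  unfolding Z_def using LP(4) LM(4) by (intro cadlag_diff) auto

lemma Z_0: "w \<in> space M \<Longrightarrow> Z 0 w = 0"
  by (rule diff.X_0)

lemma Zp_adapted: "0 \<le> t \<Longrightarrow> Zp t \<in> borel_measurable (hist t)"
proof -
  assume t: "0 \<le> t"
  have "fst \<in> borel_measurable (borel :: (real \<times> real) measure)" by (intro borel_measurable_continuous_onI continuous_intros)
  from measurable_compose[OF pair.adapted[OF t] this] show ?thesis by (simp add: joint_def)
qed

lemma Z_passage_optional: "diff.optional_time (\<lambda>w. first_passage (\<lambda>t. Z t w) c)"
  by (intro diff.first_passage_optional diff.adapted Z_cadlag)

text \<open>Not the creeping probability itself but the expectation of
  \<open>exp (- \<sigma>)\<close> over the creeping paths; it vanishes exactly if creeping over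
  \<open>u\<close> has probability 0.\<close>

definition creep_prob :: "real \<Rightarrow> real" where
  "creep_prob u = (\<integral>w. creep_weight u (\<lambda>t. Z t w) \<partial>M)"

definition approach_prob :: "nat \<Rightarrow> real \<Rightarrow> real" where
  "approach_prob n u = (\<integral>w. approach_weight n u (\<lambda>t. Z t w) \<partial>M)"

lemma creep_weight_sample_path: "creep_weight u (sample_path Z w) = creep_weight u (\<lambda>t. Z t w)"
  by (rule creep_weight_cong) (simp add: sample_path_def)

lemma approach_weight_sample_path: "approach_weight n u (sample_path Z w) = approach_weight n u (\<lambda>t. Z t w)"
  by (rule approach_weight_cong) (simp add: sample_path_def)

lemma creep_weight_Z_measurable [measurable]: "(\<lambda>w. creep_weight u (\<lambda>t. Z t w)) \<in> borel_measurable M"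
  using creep_weight_measurable[OF diff.sample_path_measurable, of "\<lambda>_. u"] by (simp add: creep_weight_sample_path)

lemma approach_weight_Z_measurable [measurable]: "(\<lambda>w. approach_weight n u (\<lambda>t. Z t w)) \<in> borel_measurable M"
  using approach_weight_measurable[OF diff.sample_path_measurable, of "\<lambda>_. u"] by (simp add: approach_weight_sample_path)

lemma weight_integrable:
  "integrable M (\<lambda>w. creep_weight u (\<lambda>t. Z t w))" "integrable M (\<lambda>w. approach_weight n u (\<lambda>t. Z t w))"
  by (intro integrable_const_bound[of _ 1]; simp add: weight_bounds)+

lemma nn_creep_prob: "(\<integral>\<^sup>+w. ennreal (creep_weight u (\<lambda>t. Z t w)) \<partial>M) = ennreal (creep_prob u)"
  unfolding creep_prob_def by (intro nn_integral_eq_integral weight_integrable) (simp add: weight_bounds)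

lemma nn_approach_prob: "(\<integral>\<^sup>+w. ennreal (approach_weight n u (\<lambda>t. Z t w)) \<partial>M) = ennreal (approach_prob n u)"
  unfolding approach_prob_def by (intro nn_integral_eq_integral weight_integrable) (simp add: weight_bounds)

lemma creep_prob_bounds: "0 \<le> creep_prob u" "creep_prob u \<le> 1"
proof -
  show "0 \<le> creep_prob u" unfolding creep_prob_def by (intro integral_nonneg_AE) (simp add: weight_bounds)
  have "creep_prob u \<le> (\<integral>w. 1 \<partial>M)"
    unfolding creep_prob_def by (intro integral_mono weight_integrable) (auto simp: weight_bounds)
  then show "creep_prob u \<le> 1" by (simp add: prob_space)
qed

lemma approach_prob_tendsto: "(\<lambda>n. approach_prob n u) \<longlonglongrightarrow> creep_prob u"
  unfolding creep_prob_def approach_prob_def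
  by (rule integral_dominated_convergence[where w="\<lambda>_. 1"])
     (auto simp: weight_bounds intro!: approach_weight_tendsto)

lemma approach_eq_passage: "w \<in> space M \<Longrightarrow> approach n u (\<lambda>t. Z t w) = first_passage (\<lambda>t. Z t w) (u - 1 / real (Suc n))"
  by (rule approach_cadlag[OF Z_cadlag])

text \<open>The strong Markov property at the passage over \<open>u - 1 / (n + 1)\<close>,
  restricted to the event that this passage happens and does not reach \<open>u\<close>. On exactly
  that event the approach weight is nonzero.\<close>

lemma approach_markov:
  assumes u: "0 < u" and h: "h \<in> borel_measurable (borel \<Otimes>\<^sub>M paths)"
  shows "(\<integral>\<^sup>+y. ennreal (approach_weight n u (\<lambda>t. Z t y)) *
      h (u - Z (enn2real (approach n u (\<lambda>t. Z t y))) y, post_path Z (enn2real (approach n u (\<lambda>t. Z t y))) y) \<partial>M) =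
    (\<integral>\<^sup>+y. ennreal (approach_weight n u (\<lambda>t. Z t y)) *
      (\<integral>\<^sup>+y'. h (u - Z (enn2real (approach n u (\<lambda>t. Z t y))) y, sample_path Z y') \<partial>M) \<partial>M)"
proof -
  define S where "S y = first_passage (\<lambda>t. Z t y) (u - 1 / real (Suc n))" for y
  have S: "diff.optional_time S" unfolding S_def by (rule Z_passage_optional)
  define E where "E = {y\<in>space M. S y < \<infinity> \<and> Z (enn2real (S y)) y < u}"
  have S_meas [measurable]: "S \<in> borel_measurable M" using S by (rule diff.optional_time_measurable)
  have [measurable]: "(\<lambda>y. Z (enn2real (S y)) y) \<in> borel_measurable M"
    using diff.X_at_measurable[OF refl diff.X_measurable, of "\<lambda>y. enn2real (S y)" 0] by simp
  have E: "E \<in> sets M" unfolding E_def by measurable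
  have E_t: "E \<inter> {y\<in>space M. S y < ennreal t} \<in> sets (hist t)" if t: "0 \<le> t" for t
  proof -
    have "{p \<in> space (borel \<Otimes>\<^sub>M borel :: (real \<times> real) measure). snd p < u} \<in> sets (borel \<Otimes>\<^sub>M borel)" by measurable
    then have "{p :: real \<times> real. snd p < u} \<in> sets (borel \<Otimes>\<^sub>M borel)" by (simp add: space_pair_measure)
    from diff.optional_value_event[OF S this t]
    have "{y\<in>space M. S y < ennreal t \<and> Z (enn2real (S y)) y < u} \<in> sets (hist t)" by simp
    also have "{y\<in>space M. S y < ennreal t \<and> Z (enn2real (S y)) y < u} = E \<inter> {y\<in>space M. S y < ennreal t}"
      unfolding E_def by (auto intro: less_trans)
    finally show ?thesis .
  qed
  \<comment> \<open>The discount depends only on the time, so it can be absorbed into the function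
    of (time, position) and path.\<close>
  define h' where "h' p = ennreal (exp (- fst (fst p))) * h (u - snd (fst p), snd p)" for p :: "(real \<times> real) \<times> (real \<Rightarrow> real)"
  have h': "h' \<in> borel_measurable ((borel \<Otimes>\<^sub>M borel) \<Otimes>\<^sub>M paths)"
    unfolding h'_def
  proof (intro borel_measurable_times_ennreal measurable_compose[OF _ h])
    show "(\<lambda>p. (u - snd (fst p), snd p)) \<in> measurable ((borel \<Otimes>\<^sub>M borel) \<Otimes>\<^sub>M paths) (borel \<Otimes>\<^sub>M paths)" by measurable
  qed measurable
  have w: "indicator E y * (ennreal (exp (- enn2real (S y))) * x) = ennreal (approach_weight n u (\<lambda>t. Z t y)) * x"
    if y: "y \<in> space M" for y x
  proof (cases "S y")
    case (real r)
    then show ?thesis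
      using approach_weight_real[OF Z_cadlag[OF y] Z_0[OF y] u, of n r] y
      unfolding approach_eq_passage[OF y] S_def[symmetric] E_def by (auto simp: indicator_def)
  next
    case top
    then show ?thesis
      using y unfolding approach_weight_def approach_eq_passage[OF y] S_def[symmetric] E_def by (simp add: indicator_def)
  qed
  have "(\<integral>\<^sup>+y. indicator E y * h' ((enn2real (S y), Z (enn2real (S y)) y), post_path Z (enn2real (S y)) y) \<partial>M) =
    (\<integral>\<^sup>+y. indicator E y * (\<integral>\<^sup>+y'. h' ((enn2real (S y), Z (enn2real (S y)) y), sample_path Z y') \<partial>M) \<partial>M)"
    by (rule diff.strong_markov[OF S E _ E_t h']) (auto simp: E_def)
  moreover have "(\<integral>\<^sup>+y. indicator E y * h' ((enn2real (S y), Z (enn2real (S y)) y), post_path Z (enn2real (S y)) y) \<partial>M) =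
    (\<integral>\<^sup>+y. ennreal (approach_weight n u (\<lambda>t. Z t y)) * h (u - Z (enn2real (S y)) y, post_path Z (enn2real (S y)) y) \<partial>M)"
    by (intro nn_integral_cong) (simp add: h'_def w)
  moreover have "(\<integral>\<^sup>+y. indicator E y * (\<integral>\<^sup>+y'. h' ((enn2real (S y), Z (enn2real (S y)) y), sample_path Z y') \<partial>M) \<partial>M) =
    (\<integral>\<^sup>+y. ennreal (approach_weight n u (\<lambda>t. Z t y)) * (\<integral>\<^sup>+y'. h (u - Z (enn2real (S y)) y, sample_path Z y') \<partial>M) \<partial>M)"
  proof (intro nn_integral_cong)
    fix y assume y: "y \<in> space M"
    have "(\<lambda>y'. h (u - Z (enn2real (S y)) y, sample_path Z y')) \<in> borel_measurable M"
      using diff.sample_path_measurable by (intro measurable_compose[OF _ h] measurable_Pair) auto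
    then have "(\<integral>\<^sup>+y'. h' ((enn2real (S y), Z (enn2real (S y)) y), sample_path Z y') \<partial>M) =
      ennreal (exp (- enn2real (S y))) * (\<integral>\<^sup>+y'. h (u - Z (enn2real (S y)) y, sample_path Z y') \<partial>M)"
      unfolding h'_def by (simp add: nn_integral_cmult)
    then show "indicator E y * (\<integral>\<^sup>+y'. h' ((enn2real (S y), Z (enn2real (S y)) y), sample_path Z y') \<partial>M) =
      ennreal (approach_weight n u (\<lambda>t. Z t y)) * (\<integral>\<^sup>+y'. h (u - Z (enn2real (S y)) y, sample_path Z y') \<partial>M)"
      using w[OF y] by simp
  qed
  ultimately show ?thesis
    using approach_eq_passage by (simp add: S_def cong: nn_integral_cong_simp)
qed

text \<open>To creep over \<open>u\<close>, the path has to come close without overshooting and then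
  creep over the remaining gap, which is at most \<open>1 / (n + 1)\<close>.\<close>

lemma creep_prob_le:
  assumes u: "0 < u" and q: "0 \<le> q" "\<And>y. 0 < y \<Longrightarrow> y \<le> 1 / real (Suc n) \<Longrightarrow> creep_prob y \<le> q"
  shows "creep_prob u \<le> q * approach_prob n u"
proof -
  let ?S = "\<lambda>x. enn2real (approach n u (\<lambda>t. Z t x))"
  let ?w = "\<lambda>x. ennreal (approach_weight n u (\<lambda>t. Z t x))"
  have real: "approach n u (\<lambda>t. Z t x) = ennreal (?S x)" "Z (?S x) x < u"
    if x: "x \<in> space M" and lt: "approach n u (\<lambda>t. Z t x) < creep_time u (\<lambda>t. Z t x)" for x
  proof -
    show 1: "approach n u (\<lambda>t. Z t x) = ennreal (?S x)" using less_le_trans[OF lt, of top] by simp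
    show "Z (?S x) x < u"
      using approach_less_creep_time_iff[OF Z_cadlag[OF x] Z_0[OF x] u 1] lt by simp
  qed
  have h: "(\<lambda>(y, f). ennreal (creep_weight y f)) \<in> borel_measurable (borel \<Otimes>\<^sub>M paths)"
    using creep_weight_measurable[of snd "borel \<Otimes>\<^sub>M paths" fst] by (simp add: case_prod_beta')
  have "ennreal (creep_prob u) = (\<integral>\<^sup>+x. ennreal (creep_weight u (\<lambda>t. Z t x)) \<partial>M)" by (simp add: nn_creep_prob)
  also have "\<dots> \<le> (\<integral>\<^sup>+x. ?w x * ennreal (creep_weight (u - Z (?S x) x) (post_path Z (?S x) x)) \<partial>M)"
  proof (rule nn_integral_mono)
    fix x assume x: "x \<in> space M"
    show "ennreal (creep_weight u (\<lambda>t. Z t x)) \<le> ?w x * ennreal (creep_weight (u - Z (?S x) x) (post_path Z (?S x) x))"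
    proof (cases "approach n u (\<lambda>t. Z t x) < creep_time u (\<lambda>t. Z t x)")
      case True
      have "creep_weight u (\<lambda>t. Z t x) = exp (- ?S x) * creep_weight (u - Z (?S x) x) (\<lambda>t. Z (?S x + t) x - Z (?S x) x)"
        by (rule creep_weight_restart(1)[OF Z_cadlag[OF x] Z_0[OF x] u real(1)[OF x True] _ real(2)[OF x True]]) simp
      also have "creep_weight (u - Z (?S x) x) (\<lambda>t. Z (?S x + t) x - Z (?S x) x) = creep_weight (u - Z (?S x) x) (post_path Z (?S x) x)"
        by (rule creep_weight_cong) (simp add: post_path_def)
      finally show ?thesis using True by (simp add: approach_weight_def ennreal_mult weight_bounds)
    next
      case False
      then have "creep_weight u (\<lambda>t. Z t x) = 0" unfolding creep_weight_def by auto
      then show ?thesis by simp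
    qed
  qed
  also have "\<dots> = (\<integral>\<^sup>+x. ?w x * (\<integral>\<^sup>+x'. ennreal (creep_weight (u - Z (?S x) x) (sample_path Z x')) \<partial>M) \<partial>M)"
    using approach_markov[OF u h, of n] by simp
  also have "\<dots> \<le> (\<integral>\<^sup>+x. ennreal q * ?w x \<partial>M)"
  proof (rule nn_integral_mono)
    fix x assume x: "x \<in> space M"
    show "?w x * (\<integral>\<^sup>+x'. ennreal (creep_weight (u - Z (?S x) x) (sample_path Z x')) \<partial>M) \<le> ennreal q * ?w x"
    proof (cases "approach n u (\<lambda>t. Z t x) < creep_time u (\<lambda>t. Z t x)")
      case True
      have "u - Z (?S x) x \<le> 1 / real (Suc n)"
        by (rule creep_weight_restart(2)[OF Z_cadlag[OF x] Z_0[OF x] u real(1)[OF x True] _ real(2)[OF x True]]) simp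
      then have "creep_prob (u - Z (?S x) x) \<le> q" using real(2)[OF x True] by (intro q(2)) auto
      then show ?thesis unfolding creep_weight_sample_path nn_creep_prob by (subst mult.commute) (intro mult_right_mono ennreal_leI, auto)
    qed (simp add: approach_weight_def)
  qed
  also have "\<dots> = ennreal (q * approach_prob n u)"
    using q(1) by (simp add: nn_integral_cmult nn_approach_prob ennreal_mult approach_prob_def integral_nonneg_AE weight_bounds)
  finally show ?thesis using q(1) by (subst (asm) ennreal_le_iff) (auto simp: approach_prob_def weight_bounds)
qed

end

section \<open>Creeping over the sum of two levels\<close>

context levy_difference
begin

text \<open>The limit of the paths after the approach times: the path of left limits beyond the
  creeping time, seen from level \<open>x\<close>. Like every such path it starts at 0, and it is
  written with \<open>left_value\<close> to be measurable.\<close>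

definition creep_path :: "real \<Rightarrow> 'a \<Rightarrow> real \<Rightarrow> real" where
  "creep_path x w = (\<lambda>t\<in>{0..}. if t = 0 then 0 else
     left_value (sample_path Z w) (enn2real (creep_time x (sample_path Z w)) + t) - x)"

lemma creep_path_measurable: "creep_path x \<in> measurable M paths"
  unfolding creep_path_def[abs_def]
proof (rule measurable_restrict)
  fix t :: real
  have [measurable]: "(\<lambda>w. creep_time x (sample_path Z w)) \<in> borel_measurable M"
    using creep_time_measurable[OF diff.sample_path_measurable, of "\<lambda>_. x"] by simp
  have [measurable]: "(\<lambda>w. left_value (sample_path Z w) (enn2real (creep_time x (sample_path Z w)) + t)) \<in> borel_measurable M"
    by (intro left_value_measurable diff.sample_path_measurable) measurable
  show "(\<lambda>w. if t = 0 then 0 else left_value (sample_path Z w) (enn2real (creep_time x (sample_path Z w)) + t) - x) \<in> borel_measurable M"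
    by measurable
qed

lemma creep_path_eq:
  assumes "w \<in> space M" "creep_time x (\<lambda>t. Z t w) = ennreal \<sigma>" "0 < \<sigma>" "0 < t"
  shows "creep_path x w t = left_limit (\<lambda>t. Z t w) (\<sigma> + t) - x"
proof -
  have "creep_time x (sample_path Z w) = creep_time x (\<lambda>t. Z t w)"
    unfolding creep_time_def approach_def by (intro SUP_cong passage_cong) (auto simp: sample_path_def)
  moreover have "left_value (sample_path Z w) (\<sigma> + t) = left_value (\<lambda>t. Z t w) (\<sigma> + t)"
    using assms by (intro left_value_cong) (auto simp: sample_path_def)
  ultimately show ?thesis
    unfolding creep_path_def using assms left_value_cadlag[OF Z_cadlag, of w "\<sigma> + t"] by simp
qed

text \<open>The strong Markov property at the approach times passes to the limit because these times increase
  strictly to the creeping time.\<close>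

lemma creep_markov:
  assumes x: "0 < x" and D: "D \<in> sets paths"
  shows "(\<integral>\<^sup>+y. ennreal (creep_weight x (\<lambda>t. Z t y)) * indicator D (creep_path x y) \<partial>M) =
    ennreal (creep_prob x) * emeasure diff.law D"
proof -
  let ?a = "\<lambda>n y. enn2real (approach n x (\<lambda>t. Z t y))"
  have a_meas: "?a n \<in> borel_measurable M" for n
    using diff.enn2real_optional[OF Z_passage_optional] by (simp add: approach_eq_passage cong: measurable_cong)
  have post_meas: "(\<lambda>y. post_path Z (?a n y) y) \<in> measurable M paths" for n
    by (intro diff.post_at_measurable a_meas) simp
  have "(\<integral>\<^sup>+y. ennreal (creep_weight x (\<lambda>t. Z t y)) * indicator D (creep_path x y) \<partial>M) =
    (\<integral>\<^sup>+y. ennreal (creep_weight x (\<lambda>t. Z t y)) \<partial>M) * emeasure diff.law D"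
  proof (rule weighted_path_limit[where w="\<lambda>n y. approach_weight n x (\<lambda>t. Z t y)" and Yn="\<lambda>n y. post_path Z (?a n y) y"])
    fix y and t :: real assume y: "y \<in> space M" and w: "creep_weight x (\<lambda>t. Z t y) \<noteq> 0" and t: "0 \<le> t"
    obtain \<sigma> where \<sigma>: "0 < \<sigma>" "creep_time x (\<lambda>t. Z t y) = ennreal \<sigma>" "crept (\<lambda>t. Z t y) x \<sigma>"
      "filterlim (\<lambda>n. ?a n y) (at_left \<sigma>) sequentially"
      using creep_weight_crept[OF Z_cadlag[OF y] Z_0[OF y] x w] by metis
    show "(\<lambda>n. post_path Z (?a n y) y t) \<longlonglongrightarrow> creep_path x y t"
    proof (cases "t = 0")
      case False
      have "filterlim (\<lambda>s. s + t) (at_left (\<sigma> + t)) (at_left \<sigma>)"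
        unfolding filterlim_at by (auto intro!: tendsto_eq_intros simp: eventually_at_filter)
      from filterlim_compose[OF filterlim_compose[OF left_limit_tendsto[OF Z_cadlag[OF y]] this] \<sigma>(4)]
      have "(\<lambda>n. Z (?a n y + t) y) \<longlonglongrightarrow> left_limit (\<lambda>t. Z t y) (\<sigma> + t)" using \<sigma>(1) t by simp
      moreover have "(\<lambda>n. Z (?a n y) y) \<longlonglongrightarrow> left_limit (\<lambda>t. Z t y) \<sigma>"
        by (rule filterlim_compose[OF left_limit_tendsto[OF Z_cadlag[OF y] \<sigma>(1)] \<sigma>(4)])
      ultimately have "(\<lambda>n. Z (?a n y + t) y - Z (?a n y) y) \<longlonglongrightarrow> left_limit (\<lambda>t. Z t y) (\<sigma> + t) - x"
        using \<sigma>(3) unfolding crept_def by (intro tendsto_diff) auto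
      then show ?thesis using creep_path_eq[OF y \<sigma>(2,1), of t] t False by (simp add: post_path_def)
    qed (simp add: post_path_def creep_path_def)
  next
    fix n and D :: "(real \<Rightarrow> real) set" assume D: "D \<in> sets paths"
    have "(\<lambda>p :: real \<times> (real \<Rightarrow> real). indicator D (snd p) :: ennreal) \<in> borel_measurable (borel \<Otimes>\<^sub>M paths)"
      by (rule measurable_compose[OF measurable_snd borel_measurable_indicator[OF D]])
    from approach_markov[OF x this, of n]
    have "(\<integral>\<^sup>+y. ennreal (approach_weight n x (\<lambda>t. Z t y)) * indicator D (post_path Z (?a n y) y) \<partial>M) =
      (\<integral>\<^sup>+y. ennreal (approach_weight n x (\<lambda>t. Z t y)) * (\<integral>\<^sup>+y'. indicator D (sample_path Z y') \<partial>M) \<partial>M)" by simp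
    also have "(\<integral>\<^sup>+y'. indicator D (sample_path Z y') \<partial>M) = emeasure diff.law D"
      using D by (subst nn_integral_distr[OF diff.sample_path_measurable, symmetric]) auto
    finally show "(\<integral>\<^sup>+y. ennreal (approach_weight n x (\<lambda>t. Z t y)) * indicator D (post_path Z (?a n y) y) \<partial>M) =
      (\<integral>\<^sup>+y. ennreal (approach_weight n x (\<lambda>t. Z t y)) \<partial>M) * emeasure diff.law D"
      by (simp add: nn_integral_multc)
  qed (auto simp: weight_bounds prob_space_axioms diff.prob_space_law D intro!: post_meas creep_path_measurable approach_weight_tendsto)
  then show ?thesis by (simp add: nn_creep_prob)
qed

text \<open>Given that the path creeps over \<open>x\<close>, the path beyond is independent of that
  weight and distributed like \<open>Z\<close>, and the discounts multiply. The case distinction is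
  needed because a path may jump over \<open>x\<close> and still creep over
  \<open>x + y\<close>.\<close>

lemma creep_prob_mult:
  assumes x: "0 < x" and y: "0 < y"
  shows "(\<integral>\<^sup>+u. (if creep_weight x (\<lambda>t. Z t u) = 0 then 0 else ennreal (creep_weight (x + y) (\<lambda>t. Z t u))) \<partial>M) =
    ennreal (creep_prob x * creep_prob y)"
proof -
  let ?w = "\<lambda>u. ennreal (creep_weight x (\<lambda>t. Z t u))"
  have cw [measurable]: "(\<lambda>f. ennreal (creep_weight y f)) \<in> borel_measurable paths"
    using creep_weight_measurable[of "\<lambda>f. f" paths "\<lambda>_. y"] by simp
  note [measurable] = creep_path_measurable
  have "distr (density M ?w) paths (creep_path x) = scale_measure (ennreal (creep_prob x)) diff.law"
  proof (rule measure_eqI)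
    fix D assume "D \<in> sets (distr (density M ?w) paths (creep_path x))"
    then have D [measurable]: "D \<in> sets paths" by simp
    have "emeasure (distr (density M ?w) paths (creep_path x)) D = (\<integral>\<^sup>+u. ?w u * indicator D (creep_path x u) \<partial>M)"
      by (simp add: emeasure_distr emeasure_density, intro nn_integral_cong) (auto simp: indicator_def)
    then show "emeasure (distr (density M ?w) paths (creep_path x)) D = emeasure (scale_measure (ennreal (creep_prob x)) diff.law) D"
      using creep_markov[OF x D] by simp
  qed simp
  then have "(\<integral>\<^sup>+f. ennreal (creep_weight y f) \<partial>distr (density M ?w) paths (creep_path x)) =
    (\<integral>\<^sup>+f. ennreal (creep_weight y f) \<partial>scale_measure (ennreal (creep_prob x)) diff.law)" by simp
  moreover have "(\<integral>\<^sup>+f. ennreal (creep_weight y f) \<partial>distr (density M ?w) paths (creep_path x)) =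
    (\<integral>\<^sup>+u. ?w u * ennreal (creep_weight y (creep_path x u)) \<partial>M)"
    by (simp add: nn_integral_distr nn_integral_density)
  moreover have "(\<integral>\<^sup>+f. ennreal (creep_weight y f) \<partial>scale_measure (ennreal (creep_prob x)) diff.law) = ennreal (creep_prob x * creep_prob y)"
    using creep_prob_bounds
    by (simp add: nn_integral_scale_measure nn_integral_distr[OF diff.sample_path_measurable] creep_weight_sample_path nn_creep_prob ennreal_mult)
  moreover have "?w u * ennreal (creep_weight y (creep_path x u)) =
    (if creep_weight x (\<lambda>t. Z t u) = 0 then 0 else ennreal (creep_weight (x + y) (\<lambda>t. Z t u)))" if u: "u \<in> space M" for u
  proof (cases "creep_weight x (\<lambda>t. Z t u) = 0")
    case False
    obtain \<sigma> where \<sigma>: "0 < \<sigma>" "creep_time x (\<lambda>t. Z t u) = ennreal \<sigma>" "creep_weight x (\<lambda>t. Z t u) = exp (- \<sigma>)" "crept (\<lambda>t. Z t u) x \<sigma>"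
      using creep_weight_crept[OF Z_cadlag[OF u] Z_0[OF u] x False] by metis
    have "creep_weight (x + y) (\<lambda>t. Z t u) = exp (- \<sigma>) * creep_weight y (creep_path x u)"
      by (rule creep_weight_add[OF Z_cadlag[OF u] Z_0[OF u] x y \<sigma>(4) creep_path_eq[OF u \<sigma>(2,1)]])
    then show ?thesis using False by (simp add: \<sigma>(3) ennreal_mult weight_bounds)
  qed simp
  ultimately show ?thesis by (simp cong: nn_integral_cong_simp)
qed

text \<open>Creeping over \<open>x\<close> and then over a further \<open>y\<close> is one way to
  creep over \<open>x + y\<close>. Paths that do not creep over \<open>x\<close> contribute at most
  the missing mass \<open>1 - creep_prob x\<close>, which also covers the discount of those that
  do.\<close>

lemma creep_prob_add:
  assumes x: "0 < x" and y: "0 < y"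
  shows "creep_prob x * creep_prob y \<le> creep_prob (x + y)" "creep_prob (x + y) \<le> 1 - creep_prob x + creep_prob x * creep_prob y"
proof -
  let ?c = "\<lambda>x w. creep_weight x (\<lambda>t. Z t w)"
  have "ennreal (creep_prob x * creep_prob y) \<le> (\<integral>\<^sup>+w. ennreal (?c (x + y) w) \<partial>M)"
    unfolding creep_prob_mult[OF x y, symmetric] by (intro nn_integral_mono) auto
  then show "creep_prob x * creep_prob y \<le> creep_prob (x + y)"
    using creep_prob_bounds by (simp add: nn_creep_prob)
  have "ennreal (creep_prob (x + y)) = (\<integral>\<^sup>+w. ennreal (?c (x + y) w) \<partial>M)" by (simp add: nn_creep_prob)
  also have "\<dots> \<le> (\<integral>\<^sup>+w. (if ?c x w = 0 then 0 else ennreal (?c (x + y) w)) + ennreal (1 - ?c x w) \<partial>M)"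
    by (intro nn_integral_mono) (auto simp: weight_bounds)
  also have "\<dots> = ennreal (creep_prob x * creep_prob y) + ennreal (\<integral>w. 1 - ?c x w \<partial>M)"
  proof (subst nn_integral_add)
    have "(\<integral>\<^sup>+w. ennreal (1 - ?c x w) \<partial>M) = ennreal (\<integral>w. 1 - ?c x w \<partial>M)"
      using weight_integrable by (intro nn_integral_eq_integral) (auto simp: weight_bounds)
    then show "(\<integral>\<^sup>+w. (if ?c x w = 0 then 0 else ennreal (?c (x + y) w)) \<partial>M) + (\<integral>\<^sup>+w. ennreal (1 - ?c x w) \<partial>M) =
      ennreal (creep_prob x * creep_prob y) + ennreal (\<integral>w. 1 - ?c x w \<partial>M)"
      by (simp only: creep_prob_mult[OF x y])
  qed auto
  also have "(\<integral>w. 1 - ?c x w \<partial>M) = 1 - creep_prob x"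
    using weight_integrable by (simp add: creep_prob_def prob_space)
  also have "ennreal (creep_prob x * creep_prob y) + ennreal (1 - creep_prob x) = ennreal (1 - creep_prob x + creep_prob x * creep_prob y)"
    using creep_prob_bounds by (subst ennreal_plus[symmetric]) (auto simp: add.commute)
  finally show "creep_prob (x + y) \<le> 1 - creep_prob x + creep_prob x * creep_prob y"
    using creep_prob_bounds by (subst (asm) ennreal_le_iff) (auto intro!: add_nonneg_nonneg mult_nonneg_nonneg)
qed

end

text \<open>If creeping has positive probability at one level, it is nearly certain at suitable arbitrarily
  small levels (\<open>creep_prob_near_1\<close>), and by the two inequalities for \<open>creep_prob (x + y)\<close> then at all
  multiples of such a level up to a fixed height. For a driftless process this contradicts the fact that
  the crept levels form a null set.\<close>

locale driftless_levy_difference = levy_difference +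
  fixes \<nu>p :: "real measure"
  assumes Zp_char: "drift_levy_measure M Zp 0 \<nu>p"
begin

text \<open>If all small levels had \<open>creep_prob\<close> at most \<open>q < 1\<close>, then
  approaching first would give \<open>creep_prob x \<le> q * approach_prob n x\<close>. In the limit
  \<open>creep_prob x \<le> q * creep_prob x\<close>, which is impossible for a positive
  value.\<close>

lemma creep_prob_near_1:
  assumes x: "0 < x" "0 < creep_prob x" and e: "0 < e" and d: "0 < d"
  obtains y where "0 < y" "y \<le> d" "1 - e < creep_prob y"
proof (rule ccontr)
  note witness = that
  assume neg: "\<not> thesis"
  have small: "creep_prob y \<le> 1 - e" if "0 < y" "y \<le> d" for y using witness[OF that] neg by (meson not_less)
  define q where "q = max 0 (1 - e)"
  obtain n0 where n0: "1 / real (Suc n0) < d" using d nat_approx_posE by blast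
  have "creep_prob x \<le> q * approach_prob n x" if "n0 \<le> n" for n
  proof (rule creep_prob_le[OF x(1)])
    fix y assume "0 < y" "y \<le> 1 / real (Suc n)"
    then show "creep_prob y \<le> q" using small[of y] n0 inverse_Suc_antimono[OF that] unfolding q_def by linarith
  qed (simp add: q_def)
  then have "creep_prob x \<le> q * creep_prob x"
    by (intro LIMSEQ_le_const[OF tendsto_mult[OF tendsto_const approach_prob_tendsto]]) auto
  then have "1 \<le> q" using x(2) by simp
  then show False using e unfolding q_def by simp
qed

text \<open>A Riemann sum over the lattice of mesh \<open>y j\<close>. Levels crept up to time
  \<open>n + 1\<close> are few by the covers of \<open>Zp\<close>, and later ones have weight at
  most \<open>exp (- (n + 1))\<close>. So the sum stands in for the statement that the crept levels
  form a null set.\<close>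

lemma AE_creep_fraction_tendsto:
  assumes x: "0 < x" and y: "\<And>j. 0 < y j" "y \<longlonglongrightarrow> 0"
  shows "AE w in M. (\<lambda>j. y j * (\<Sum>k\<in>{k. 0 < k \<and> real k * y j < x}. creep_weight (real k * y j) (\<lambda>t. Z t w))) \<longlonglongrightarrow> 0"
  using AE_jump_cover[OF Zp Zp_char]
proof (rule AE_mp, intro AE_I2 impI)
  fix w assume w: "w \<in> space M"
    and cover: "\<forall>n. \<forall>\<eta>>0. \<exists>k e'. e' < \<eta> \<and> jump_cover (\<lambda>t. Zp t w) 0 (real (Suc n)) k e'"
  let ?K = "\<lambda>j. {k::nat. 0 < k \<and> real k * y j < x}"
  let ?c = "\<lambda>j k. creep_weight (real k * y j) (\<lambda>t. Z t w)"
  have K: "finite (?K j)" "real (card (?K j)) * y j \<le> x + y j" for j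
  proof -
    note cnt = card_multiples_in_interval[OF y(1)[of j] less_imp_le[OF x], of 0]
    have sub: "?K j \<subseteq> {k. real k * y j \<in> {0..0 + x}}" using y(1)[of j] by auto
    then show "finite (?K j)" using cnt(1) by (rule finite_subset)
    have "real (card (?K j)) * y j \<le> real (card {k. real k * y j \<in> {0..0 + x}}) * y j"
      using card_mono[OF cnt(1) sub] y(1)[of j] by (intro mult_right_mono) auto
    then show "real (card (?K j)) * y j \<le> x + y j" using cnt(2) by linarith
  qed
  show "(\<lambda>j. y j * (\<Sum>k\<in>?K j. ?c j k)) \<longlonglongrightarrow> 0"
  proof (rule LIMSEQ_I)
    fix r :: real assume r: "0 < r"
    have "((\<lambda>n. exp (- real (Suc n))) \<longlonglongrightarrow> 0)"
      by (intro filterlim_compose[OF exp_at_bot] filterlim_compose[OF filterlim_uminus_at_bot_at_top]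
          filterlim_compose[OF filterlim_real_sequentially] filterlim_Suc)
    then have "\<forall>\<^sub>F n in sequentially. exp (- real (Suc n)) < r / (4 * (x + 1))"
      using r x by (intro order_tendstoD) auto
    then obtain n where n: "exp (- real (Suc n)) < r / (4 * (x + 1))" by (auto simp: eventually_sequentially)
    \<comment> \<open>The number \<open>m\<close> of pieces is fixed before the mesh is refined, so
      that the error \<open>m * y j\<close> from counting instead of measuring disappears.\<close>
    obtain m e where m: "e < r / 4" "jump_cover (\<lambda>t. Zp t w) 0 (real (Suc n)) m e"
      using cover r by (meson divide_pos_pos zero_less_numeral)
    have "\<forall>\<^sub>F j in sequentially. y j < min 1 (r / (4 * (real m + 1)))"
      using r by (intro order_tendstoD[OF y(2)]) auto
    then obtain j0 where j0: "\<And>j. j0 \<le> j \<Longrightarrow> y j < min 1 (r / (4 * (real m + 1)))" by (auto simp: eventually_sequentially)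
    have "norm (y j * (\<Sum>k\<in>?K j. ?c j k) - 0) < r" if "j0 \<le> j" for j
    proof -
      define C where "C = {k::nat. \<exists>\<sigma>. \<sigma> \<in> {0<..real (Suc n)} \<and> crept (\<lambda>t. Zp t w - Zm t w) (real k * y j) \<sigma>}"
      have C: "finite C" "real (card C) * y j \<le> e + real m * y j"
        using crept_levels_count[OF LP(4)[OF w] subordinatorD(2)[OF Zp w] LM(4)[OF w] subordinatorD(2)[OF Zm w] y(1)[of j] m(2)]
        unfolding C_def by auto
      have bound: "?c j k \<le> (if k \<in> C then 1 else exp (- real (Suc n)))" if k: "k \<in> ?K j" for k
      proof (cases "?c j k = 0 \<or> k \<in> C")
        case False
        have "0 < real k * y j" using k y(1)[of j] by simp
        then obtain \<sigma> where \<sigma>: "0 < \<sigma>" "?c j k = exp (- \<sigma>)" "crept (\<lambda>t. Z t w) (real k * y j) \<sigma>"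
          using creep_weight_crept[OF Z_cadlag[OF w] Z_0[OF w], of "real k * y j"] False by metis
        then have "\<not> \<sigma> \<le> real (Suc n)" using False unfolding C_def Z_def by auto
        then show ?thesis using False \<sigma>(2) by simp
      qed (use weight_bounds in auto)
      have "(\<Sum>k\<in>?K j. ?c j k) \<le> (\<Sum>k\<in>?K j. (if k \<in> C then 1 else 0) + exp (- real (Suc n)))"
      proof (rule sum_mono)
        fix k assume "k \<in> ?K j"
        from bound[OF this] show "?c j k \<le> (if k \<in> C then 1 else 0) + exp (- real (Suc n))"
          using exp_ge_zero[of "- real (Suc n)"] by (smt (verit))
      qed
      also have "\<dots> = real (card (?K j \<inter> C)) + real (card (?K j)) * exp (- real (Suc n))"
        using K(1) by (simp add: sum.distrib sum.If_cases)
      also have "\<dots> \<le> real (card C) + real (card (?K j)) * exp (- real (Suc n))"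
        using card_mono[OF C(1), of "?K j \<inter> C"] by simp
      finally have "y j * (\<Sum>k\<in>?K j. ?c j k) \<le> y j * (real (card C) + real (card (?K j)) * exp (- real (Suc n)))"
        using y(1)[of j] by (intro mult_left_mono) auto
      also have "\<dots> = real (card C) * y j + (real (card (?K j)) * y j) * exp (- real (Suc n))" by (simp add: algebra_simps)
      also have "\<dots> \<le> (e + real m * y j) + (x + y j) * exp (- real (Suc n))"
        using C(2) K(2) by (intro add_mono mult_right_mono) auto
      also have "\<dots> < r / 4 + r / 4 + r / 4"
      proof (intro add_strict_mono m(1))
        have "real m * y j \<le> real m * (r / (4 * (real m + 1)))" using j0[OF \<open>j0 \<le> j\<close>] by (intro mult_left_mono) auto
        also have "\<dots> < r / 4" using r by (simp add: field_simps)
        finally show "real m * y j < r / 4" .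
        have "(x + y j) * exp (- real (Suc n)) \<le> (x + 1) * exp (- real (Suc n))" using j0[OF \<open>j0 \<le> j\<close>] by (intro mult_right_mono) auto
        also have "\<dots> < (x + 1) * (r / (4 * (x + 1)))" using n x by (intro mult_strict_left_mono) auto
        also have "\<dots> = r / 4" using x by (simp add: field_simps)
        finally show "(x + y j) * exp (- real (Suc n)) < r / 4" .
      qed
      finally have "y j * (\<Sum>k\<in>?K j. ?c j k) < r" using r by linarith
      moreover have "0 \<le> y j * (\<Sum>k\<in>?K j. ?c j k)" using y(1)[of j] by (intro mult_nonneg_nonneg sum_nonneg weight_bounds) auto
      ultimately show ?thesis by simp
    qed
    then show "\<exists>no. \<forall>j\<ge>no. norm (y j * (\<Sum>k\<in>?K j. ?c j k) - 0) < r" by blast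
  qed
qed

theorem creep_prob_eq_0:
  assumes "0 < x"
  shows "creep_prob x = 0"
proof (rule ccontr)
  assume "creep_prob x \<noteq> 0"
  then have pos: "0 < creep_prob x" using creep_prob_bounds(1)[of x] by simp
  note near = creep_prob_near_1[OF assms pos]
  obtain z where z: "0 < z" "49 / 50 < creep_prob z" using near[of "1 / 50" 1] by auto
  \<comment> \<open>For \<open>p = creep_prob u\<close> and \<open>q = creep_prob (z - u)\<close>
    the upper inequality in both orders forces \<open>p\<close> and \<open>q\<close> to be close,
    and then \<open>p * (1 - p) < 1 / 25\<close>. Strictly between \<open>1 / 10\<close> and
    \<open>9 / 10\<close> this product would be at least \<open>9 / 100\<close>.\<close>
  have dichotomy: "creep_prob u \<le> 1 / 10 \<or> 9 / 10 \<le> creep_prob u" if u: "0 < u" "u < z" for u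
  proof -
    let ?p = "creep_prob u" and ?q = "creep_prob (z - u)"
    have 1: "creep_prob z \<le> 1 - ?p + ?p * ?q" "creep_prob z \<le> 1 - ?q + ?q * ?p"
      using creep_prob_add(2)[of u "z - u"] creep_prob_add(2)[of "z - u" u] u by auto
    moreover have "?p * ?q \<le> ?p" "?p * ?q \<le> ?q" using creep_prob_bounds by (auto intro: mult_left_le mult_left_le_one_le)
    moreover have "?q * ?p = ?p * ?q" by simp
    ultimately have "\<bar>?p - ?q\<bar> < 1 / 50" using z(2) unfolding abs_less_iff by linarith
    then have "?q \<le> ?p + 1 / 50" by linarith
    then have "?p * ?q \<le> ?p * (?p + 1 / 50)" using creep_prob_bounds by (intro mult_left_mono) auto
    then have "?p * (1 - ?p) < 1 / 50 + ?p * (1 / 50)" using 1(1) z(2) by (simp add: algebra_simps)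
    also have "\<dots> \<le> 1 / 25" using creep_prob_bounds(2)[of u] by simp
    finally have le: "?p * (1 - ?p) < 1 / 25" .
    show ?thesis
    proof (rule ccontr)
      assume "\<not> ?thesis"
      then have "0 \<le> (?p - 1 / 10) * (9 / 10 - ?p)" by (intro mult_nonneg_nonneg) auto
      then have "9 / 100 \<le> ?p * (1 - ?p)" by (simp add: algebra_simps)
      then show False using le by simp
    qed
  qed
  have "\<exists>y. 0 < y \<and> y \<le> min (z / 2) (1 / real (Suc j)) \<and> 49 / 50 < creep_prob y" for j
    using near[of "1 / 50" "min (z / 2) (1 / real (Suc j))"] z(1) by force
  then obtain y where y: "\<And>j. 0 < y j" "\<And>j. y j \<le> min (z / 2) (1 / real (Suc j))" "\<And>j. 49 / 50 < creep_prob (y j)"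
    by metis
  have multiples: "9 / 10 \<le> creep_prob (real (Suc k) * y j)" if "real (Suc k) * y j < z" for k j
    using that
  proof (induction k)
    case 0
    then show ?case using y(3)[of j] by simp
  next
    case (Suc k)
    have lt: "real (Suc k) * y j < z" using Suc.prems y(1)[of j] by (simp add: algebra_simps)
    \<comment> \<open>One small step loses at most a factor \<open>49 / 50\<close>, which is not
      enough to cross the forbidden range, so the dichotomy restores the bound
      \<open>9 / 10\<close>.\<close>
    have "9 / 10 * (49 / 50) \<le> creep_prob (real (Suc k) * y j) * creep_prob (y j)"
      using Suc.IH[OF lt] y(3)[of j] by (intro mult_mono) auto
    also have "\<dots> \<le> creep_prob (real (Suc k) * y j + y j)" using y(1)[of j] by (intro creep_prob_add) auto
    also have "real (Suc k) * y j + y j = real (Suc (Suc k)) * y j" by (simp add: algebra_simps)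
    finally show ?case using dichotomy[OF _ Suc.prems] y(1)[of j] by force
  qed
  let ?K = "\<lambda>j. {k::nat. 0 < k \<and> real k * y j < z}"
  let ?f = "\<lambda>j \<omega>. y j * (\<Sum>k\<in>?K j. creep_weight (real k * y j) (\<lambda>t. Z t \<omega>))"
  have y_lim: "y \<longlonglongrightarrow> 0"
    by (rule tendsto_sandwich[OF _ _ tendsto_const LIMSEQ_Suc[OF lim_1_over_n]])
       (use y(1,2) in \<open>auto intro!: always_eventually less_imp_le\<close>)
  have K: "finite (?K j)" "real (card (?K j)) * y j \<le> 2 * z" "z / 4 \<le> real (card (?K j)) * y j" for j
  proof -
    note cnt = card_multiples_in_interval[OF y(1)[of j] less_imp_le[OF z(1)], of 0]
    have sub: "?K j \<subseteq> {k. real k * y j \<in> {0..0 + z}}" using y(1)[of j] by auto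
    then show fin: "finite (?K j)" using cnt(1) by (rule finite_subset)
    have "real (card (?K j)) * y j \<le> real (card {k. real k * y j \<in> {0..0 + z}}) * y j"
      using card_mono[OF cnt(1) sub] y(1)[of j] by (intro mult_right_mono) auto
    then show "real (card (?K j)) * y j \<le> 2 * z" using cnt(2) y(2)[of j] z(1) by linarith
    define m where "m = nat \<lfloor>z / (2 * y j)\<rfloor>"
    have "0 \<le> z / (2 * y j)" using z(1) y(1)[of j] by simp
    then have m: "real m \<le> z / (2 * y j)" "z / (2 * y j) < real m + 1" unfolding m_def by linarith+
    have "1 \<le> z / (2 * y j)" using y(1,2)[of j] by (simp add: field_simps)
    then have "1 \<le> real m" unfolding m_def by (simp add: le_nat_iff le_floor_iff)
    \<comment> \<open>Counting the multiples up to \<open>z / 2\<close> is enough for the crude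
      lower bound \<open>z / 4\<close>.\<close>
    have "{1..m} \<subseteq> ?K j"
    proof
      fix k assume "k \<in> {1..m}"
      then have "0 < k" "real k * y j \<le> real m * y j" using y(1)[of j] by (auto intro: mult_right_mono)
      moreover have "real m * y j \<le> z / 2" using m(1) y(1)[of j] by (simp add: field_simps)
      ultimately show "k \<in> ?K j" using z(1) by auto
    qed
    from card_mono[OF fin this] have "real m * y j \<le> real (card (?K j)) * y j" using y(1)[of j] by (intro mult_right_mono) auto
    moreover have "z / 2 \<le> (real m + 1) * y j" using m(2) y(1)[of j] by (simp add: field_simps)
    moreover have "(real m + 1) * y j \<le> (2 * real m) * y j" using \<open>1 \<le> real m\<close> y(1)[of j] by (intro mult_right_mono) auto
    ultimately show "z / 4 \<le> real (card (?K j)) * y j" by linarith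
  qed
  have "(\<lambda>j. \<integral>\<omega>. ?f j \<omega> \<partial>M) \<longlonglongrightarrow> (\<integral>\<omega>. 0 \<partial>M)"
  proof (rule integral_dominated_convergence[where w="\<lambda>_. 2 * z"])
    show "AE \<omega> in M. (\<lambda>j. ?f j \<omega>) \<longlonglongrightarrow> 0" by (rule AE_creep_fraction_tendsto[OF z(1) y(1) y_lim])
    show "AE \<omega> in M. norm (?f j \<omega>) \<le> 2 * z" for j
    proof (intro AE_I2)
      fix \<omega>
      have "(\<Sum>k\<in>?K j. creep_weight (real k * y j) (\<lambda>t. Z t \<omega>)) \<le> real (card (?K j)) * 1" by (rule sum_bounded_above) (rule weight_bounds)
      then have "?f j \<omega> \<le> y j * real (card (?K j))" using y(1)[of j] by (intro mult_left_mono) auto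
      moreover have "0 \<le> ?f j \<omega>" using y(1)[of j] by (intro mult_nonneg_nonneg sum_nonneg weight_bounds) auto
      ultimately show "norm (?f j \<omega>) \<le> 2 * z" using K(2)[of j] by (simp add: mult.commute)
    qed
  qed auto
  \<comment> \<open>The constant \<open>1 / 5\<close> lies below \<open>9 / 10 * (1 / 4)\<close>,
    the share enforced by the lower bounds for \<open>creep_prob\<close> and for the number of
    multiples.\<close>
  then have "\<forall>\<^sub>F j in sequentially. (\<integral>\<omega>. ?f j \<omega> \<partial>M) < z / 5" using z(1) by (intro order_tendstoD) auto
  then obtain j where j: "(\<integral>\<omega>. ?f j \<omega> \<partial>M) < z / 5" by (auto simp: eventually_sequentially)
  have "(\<integral>\<omega>. ?f j \<omega> \<partial>M) = y j * (\<Sum>k\<in>?K j. creep_prob (real k * y j))"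
    unfolding creep_prob_def using weight_integrable by (simp add: Bochner_Integration.integral_sum)
  also have "\<dots> \<ge> y j * (\<Sum>k\<in>?K j. 9 / 10)"
  proof (intro mult_left_mono sum_mono)
    fix k assume "k \<in> ?K j"
    then show "9 / 10 \<le> creep_prob (real k * y j)" using multiples[of "k - 1" j] by simp
  qed (use y(1)[of j] in simp)
  finally have "9 / 10 * (real (card (?K j)) * y j) \<le> (\<integral>\<omega>. ?f j \<omega> \<partial>M)" by (simp add: algebra_simps)
  then show False using j K(3)[of j] z(1) by linarith
qed

end

section \<open>Touching a level\<close>

lemma positive_part_infinite_or_negative:
  assumes "levy_measure \<nu>" "emeasure \<nu> UNIV = \<infinity>"
  shows "emeasure (positive_part_measure \<nu>) UNIV = \<infinity> \<or> emeasure (negative_part_measure \<nu>) UNIV = \<infinity>"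
proof -
  interpret levy_measure \<nu> by fact
  have pos: "emeasure (positive_part_measure \<nu>) UNIV = emeasure \<nu> {0<..}"
    unfolding positive_part_measure_def by (subst emeasure_restricted) auto
  have "emeasure (negative_part_measure \<nu>) UNIV = emeasure (distr \<nu> borel uminus) {0<..}"
    unfolding negative_part_measure_def by (subst emeasure_restricted) auto
  also have "\<dots> = emeasure \<nu> {..<0}"
    by (subst emeasure_distr) (auto intro!: arg_cong[where f="emeasure \<nu>"])
  finally have neg: "emeasure (negative_part_measure \<nu>) UNIV = emeasure \<nu> {..<0}" .
  have "emeasure \<nu> UNIV \<le> emeasure \<nu> {0<..} + (emeasure \<nu> {..<0} + emeasure \<nu> {0})"
  proof -
    have "emeasure \<nu> UNIV \<le> emeasure \<nu> ({0<..} \<union> ({..<0} \<union> {0}))" by (intro emeasure_mono) auto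
    also have "\<dots> \<le> emeasure \<nu> {0<..} + emeasure \<nu> ({..<0} \<union> {0})" by (intro emeasure_subadditive) auto
    also have "\<dots> \<le> emeasure \<nu> {0<..} + (emeasure \<nu> {..<0} + emeasure \<nu> {0})" by (intro add_left_mono emeasure_subadditive) auto
    finally show ?thesis .
  qed
  then show ?thesis using assms(2) nu_0 unfolding pos neg by (auto simp: top_unique)
qed

lemma levy_no_atom:
  assumes X: "drift_levy_measure M X d \<nu>" and M: "prob_space M" and meas: "\<And>t. 0 \<le> t \<Longrightarrow> X t \<in> borel_measurable M"
    and inf: "emeasure \<nu> UNIV = \<infinity>" and s: "0 < s"
  shows "measure M {w\<in>space M. X s w = y} = 0"
proof -
  interpret prob_space M by fact
  have [measurable]: "X s \<in> borel_measurable M" using s by (intro meas) simp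
  have "measure M {w\<in>space M. X s w = y} \<le> e" if "0 < e" for e
  proof -
    obtain \<delta> where \<delta>: "0 < \<delta>" "\<And>s' y. s \<le> s' \<Longrightarrow> measure M {w\<in>space M. \<bar>X s' w - y\<bar> \<le> \<delta>} \<le> e"
      using levy_concentration[OF X M meas inf s \<open>0 < e\<close>] by blast
    have "measure M {w\<in>space M. X s w = y} \<le> measure M {w\<in>space M. \<bar>X s w - y\<bar> \<le> \<delta>}"
      using \<delta>(1) by (intro finite_measure_mono) auto
    then show ?thesis using \<delta>(2)[of s y] by simp
  qed
  from this[of "measure M {w\<in>space M. X s w = y} / 2"] show ?thesis
    using measure_nonneg[of M "{w\<in>space M. X s w = y}"] by (cases "measure M {w\<in>space M. X s w = y} = 0") linarith+
qed

lemma subordinator_AE_pos: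
  assumes X: "subordinator M X" and zero: "\<And>t. 0 < t \<Longrightarrow> measure M {w\<in>space M. X t w = 0} = 0"
  shows "AE w in M. \<forall>t>0. 0 < X t w"
proof -
  note LX = levy_processD[OF subordinatorD(1)[OF X]]
  interpret prob_space M by fact
  have "AE w in M. \<forall>n. X (1 / real (Suc n)) w \<noteq> 0"
  proof (subst AE_all_countable, intro allI)
    fix n
    have [measurable]: "X (1 / real (Suc n)) \<in> borel_measurable M" by (intro LX) auto
    have "emeasure M {w\<in>space M. X (1 / real (Suc n)) w = 0} = 0"
      using zero[of "1 / real (Suc n)"] by (simp add: emeasure_eq_measure)
    then show "AE w in M. X (1 / real (Suc n)) w \<noteq> 0"
      by (intro AE_I'[of "{w\<in>space M. X (1 / real (Suc n)) w = 0}"]) (auto simp: null_sets_def simp del: of_nat_Suc)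
  qed
  then show ?thesis
  proof (rule AE_mp, intro AE_I2 impI allI)
    fix w t assume w: "w \<in> space M" and n0: "\<forall>n. X (1 / real (Suc n)) w \<noteq> 0" and t: "0 < (t::real)"
    obtain n where n: "1 / real (Suc n) < t" using t nat_approx_posE by blast
    have "0 \<le> X (1 / real (Suc n)) w" by (rule subordinatorD(3)[OF X _ w]) simp
    moreover have "X (1 / real (Suc n)) w \<le> X t w" using n by (intro subordinatorD(4)[OF X _ _ w]) auto
    ultimately show "0 < X t w" using n0[rule_format, of n] by simp
  qed
qed

text \<open>A nondecreasing path is at 0 at time \<open>s + t\<close> exactly if it is at 0 at time
  \<open>s\<close> and does not move afterwards. So the probability of resting at 0 is
  multiplicative in time, and its roots at \<open>t0 / (n + 1)\<close> tend to 1 once it is positive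
  at \<open>t0\<close>.\<close>

lemma subordinator_zero_prob:
  assumes X: "subordinator M X" and t0: "0 < t0" and pos: "0 < measure M {w\<in>space M. X t0 w = 0}"
  shows "(\<lambda>n. measure M {w\<in>space M. X (t0 / real (Suc n)) w = 0}) \<longlonglongrightarrow> 1"
    "AE w in M. \<exists>n. X (t0 / real (Suc n)) w = 0"
proof -
  note LX = levy_processD[OF subordinatorD(1)[OF X]]
  interpret prob_space M by fact
  define u where "u t = measure M {w\<in>space M. X t w = 0}" for t
  have u_add: "u (s + t) = u s * u t" if st: "0 \<le> s" "0 \<le> t" for s t
  proof -
    have "X (s + t) w = 0 \<longleftrightarrow> X s w = 0 \<and> X (s + t) w - X s w = 0" if "w \<in> space M" for w
      using subordinatorD(3)[OF X st(1) that] subordinatorD(4)[OF X st(1) _ that, of "s + t"] st by auto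
    then have "u (s + t) = measure M {w\<in>space M. (\<forall>j\<in>{s}. X j w \<in> {0}) \<and> (\<forall>i\<in>{t}. X (s + i) w - X s w \<in> {0})}"
      unfolding u_def by (intro arg_cong[where f="measure M"]) auto
    also have "\<dots> = u s * u t"
      unfolding u_def using st
      by (subst levy_finite_markov[OF subordinatorD(1)[OF X] st(1)]) auto
    finally show ?thesis .
  qed
  have u_0: "u 0 = 1" unfolding u_def using LX(3) prob_space by (simp cong: conj_cong)
  have u_pow: "u (real n * t) = u t ^ n" if "0 \<le> t" for n t
  proof (induction n)
    case (Suc n)
    have "real (Suc n) * t = t + real n * t" by (simp add: algebra_simps)
    then show ?case using u_add[of t "real n * t"] that Suc by simp
  qed (simp add: u_0)
  have u_mono: "u t \<le> u s" if "0 \<le> s" "s \<le> t" for s t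
  proof -
    have [measurable]: "X s \<in> borel_measurable M" using that by (intro LX) auto
    show ?thesis unfolding u_def
    proof (rule finite_measure_mono)
      show "{w\<in>space M. X t w = 0} \<subseteq> {w\<in>space M. X s w = 0}"
        using subordinatorD(3)[OF X that(1)] subordinatorD(4)[OF X that] by force
    qed measurable
  qed
  have u_le: "u t \<le> 1" "0 \<le> u t" for t unfolding u_def by auto
  show lim: "(\<lambda>n. measure M {w\<in>space M. X (t0 / real (Suc n)) w = 0}) \<longlonglongrightarrow> 1"
    unfolding u_def[symmetric]
  proof (rule LIMSEQ_I)
    fix r :: real assume r: "0 < r"
    define q where "q = max 0 (1 - r)"
    have "(\<lambda>n. q ^ n) \<longlonglongrightarrow> 0" using r unfolding q_def by (intro LIMSEQ_realpow_zero) auto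
    then have "\<forall>\<^sub>F n in sequentially. q ^ n < u t0" using pos unfolding u_def by (intro order_tendstoD) auto
    then obtain N where N: "\<And>n. N \<le> n \<Longrightarrow> q ^ n < u t0" by (auto simp: eventually_sequentially)
    have "norm (u (t0 / real (Suc n)) - 1) < r" if "N \<le> n" for n
    proof -
      have "u t0 = u (t0 / real (Suc n)) ^ Suc n" using u_pow[of "t0 / real (Suc n)" "Suc n"] t0 by simp
      then have "q ^ Suc n < u (t0 / real (Suc n)) ^ Suc n" using N[of "Suc n"] that by simp
      then have "q < u (t0 / real (Suc n))" using u_le(2) by (rule power_less_imp_less_base)
      then show ?thesis using u_le(1)[of "t0 / real (Suc n)"] unfolding q_def by simp
    qed
    then show "\<exists>no. \<forall>n\<ge>no. norm (u (t0 / real (Suc n)) - 1) < r" by blast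
  qed
  let ?U = "{w\<in>space M. \<exists>n. X (t0 / real (Suc n)) w = 0}"
  have [measurable]: "X (t0 / real (Suc n)) \<in> borel_measurable M" for n using t0 by (intro LX) auto
  have "u (t0 / real (Suc n)) \<le> prob ?U" for n
    unfolding u_def by (rule finite_measure_mono) (auto simp del: of_nat_Suc)
  then have "1 \<le> prob ?U" using LIMSEQ_le_const2[OF lim] unfolding u_def by blast
  then have "prob ?U = 1" using prob_le_1[of ?U] by linarith
  then show "AE w in M. \<exists>n. X (t0 / real (Suc n)) w = 0"
    by (subst (asm) prob_eq_1) (auto elim: eventually_mono simp del: of_nat_Suc)
qed

section \<open>Jumps at fixed and at independent times\<close>

lemma levy_small_time_prob_tendsto_0:
  assumes X: "subordinator M X" and e: "0 < e"
  shows "(\<lambda>n. measure M {x\<in>space M. e \<le> X (1 / real (Suc n)) x}) \<longlonglongrightarrow> 0"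
proof -
  note LX = levy_processD[OF subordinatorD(1)[OF X]]
  interpret prob_space M by fact
  have [measurable]: "X (1 / real (Suc n)) \<in> borel_measurable M" for n by (intro LX) auto
  have "(\<lambda>n. \<integral>x. indicat_real {x\<in>space M. e \<le> X (1 / real (Suc n)) x} x \<partial>M) \<longlonglongrightarrow> (\<integral>x. 0 \<partial>M)"
  proof (rule integral_dominated_convergence[where w="\<lambda>_. 1"])
    show "AE x in M. (\<lambda>n. indicat_real {x\<in>space M. e \<le> X (1 / real (Suc n)) x} x) \<longlonglongrightarrow> 0"
    proof (intro AE_I2)
      fix x assume x: "x \<in> space M"
      have "filterlim (\<lambda>n. 1 / real (Suc n)) (at_right 0) sequentially"
        unfolding filterlim_at by (auto intro!: always_eventually LIMSEQ_Suc[OF lim_1_over_n] simp del: of_nat_Suc)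
      from filterlim_compose[OF cadlag_right[OF LX(4)[OF x]] this]
      have "(\<lambda>n. X (1 / real (Suc n)) x) \<longlonglongrightarrow> 0" using LX(3)[OF x] by simp
      then have "\<forall>\<^sub>F n in sequentially. X (1 / real (Suc n)) x < e" using e by (intro order_tendstoD)
      then have "\<forall>\<^sub>F n in sequentially. indicat_real {x\<in>space M. e \<le> X (1 / real (Suc n)) x} x = 0"
        by eventually_elim (simp add: indicator_def)
      then show "(\<lambda>n. indicat_real {x\<in>space M. e \<le> X (1 / real (Suc n)) x} x) \<longlonglongrightarrow> 0" by (rule tendsto_eventually)
    qed
  qed (auto simp del: of_nat_Suc)
  then show ?thesis by (simp del: of_nat_Suc)
qed

text \<open>By monotonicity a jump at \<open>t\<close> is contained in the increment over every
  interval ending at \<open>t\<close>. Such increments have the law of \<open>X\<close> at small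
  times, which is rarely large. The maximum with 0 only guards intervals longer than
  \<open>t\<close>.\<close>

lemma subordinator_no_fixed_jump:
  assumes X: "subordinator M X" and t: "0 < t"
  shows "AE w in M. left_limit (\<lambda>t. X t w) t = X t w"
proof -
  note LX = levy_processD[OF subordinatorD(1)[OF X]]
  interpret prob_space M by fact
  have mono: "mono_on {0..} (\<lambda>t. X t w)" if "w \<in> space M" for w using that by (rule subordinatorD(2)[OF X])
  have Xt [measurable]: "X t \<in> borel_measurable M" using t by (intro LX) simp
  have Xn [measurable]: "X (max 0 (t - 1 / real (Suc n))) \<in> borel_measurable M" for n by (intro LX) simp
  have "AE w in M. \<forall>j. \<exists>n. X t w - X (max 0 (t - 1 / real (Suc n))) w < 1 / real (Suc j)"
  proof (subst AE_all_countable, intro allI)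
    fix j
    let ?B = "{w\<in>space M. \<forall>n. 1 / real (Suc j) \<le> X t w - X (max 0 (t - 1 / real (Suc n))) w}"
    have "prob ?B \<le> measure M {w\<in>space M. 1 / real (Suc j) \<le> X (1 / real (Suc n)) w}" if n: "1 / real (Suc n) \<le> t" for n
    proof -
      have law: "distr M borel (\<lambda>w. X ((t - 1 / real (Suc n)) + 1 / real (Suc n)) w - X (t - 1 / real (Suc n)) w) = distr M borel (X (1 / real (Suc n)))"
        using n by (intro LX(6)) auto
      have [measurable]: "X (1 / real (Suc n)) \<in> borel_measurable M" "X (t - 1 / real (Suc n)) \<in> borel_measurable M" using n by (auto intro!: LX(2))
      have "prob ?B \<le> measure M {w\<in>space M. X t w - X (t - 1 / real (Suc n)) w \<in> {1 / real (Suc j)..}}"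
      proof (rule finite_measure_mono)
        have "max 0 (t - 1 / real (Suc n)) = t - 1 / real (Suc n)" using n by simp
        then show "?B \<subseteq> {w\<in>space M. X t w - X (t - 1 / real (Suc n)) w \<in> {1 / real (Suc j)..}}" by (auto dest!: spec[of _ n])
      qed measurable
      also have "\<dots> = measure (distr M borel (\<lambda>w. X ((t - 1 / real (Suc n)) + 1 / real (Suc n)) w - X (t - 1 / real (Suc n)) w)) {1 / real (Suc j)..}"
        by (subst measure_distr) (auto intro!: arg_cong[where f="measure M"] simp del: of_nat_Suc)
      also have "\<dots> = measure M {w\<in>space M. 1 / real (Suc j) \<le> X (1 / real (Suc n)) w}"
        unfolding law by (subst measure_distr) (auto intro!: arg_cong[where f="measure M"] simp del: of_nat_Suc)
      finally show ?thesis .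
    qed
    moreover obtain n0 where "1 / real (Suc n0) < t" using t nat_approx_posE by blast
    then have "1 / real (Suc n) \<le> t" if "n0 \<le> n" for n using inverse_Suc_antimono[OF that] by linarith
    ultimately have "prob ?B \<le> 0"
      by (intro LIMSEQ_le_const[OF levy_small_time_prob_tendsto_0[OF X, of "1 / real (Suc j)"]]) auto
    then have "emeasure M ?B = 0" by (simp add: emeasure_eq_measure measure_le_0_iff)
    then show "AE w in M. \<exists>n. X t w - X (max 0 (t - 1 / real (Suc n))) w < 1 / real (Suc j)"
      by (intro AE_I'[of ?B]) (auto simp: null_sets_def not_less simp del: of_nat_Suc)
  qed
  then show ?thesis
  proof (rule AE_mp, intro AE_I2 impI)
    fix w assume w: "w \<in> space M" and small: "\<forall>j. \<exists>n. X t w - X (max 0 (t - 1 / real (Suc n))) w < 1 / real (Suc j)"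
    have le: "left_limit (\<lambda>t. X t w) t \<le> X t w" using left_limit_mono_bounds(2)[OF LX(4)[OF w] mono[OF w], of 0 t] t by simp
    show "left_limit (\<lambda>t. X t w) t = X t w"
    proof (rule ccontr)
      assume "left_limit (\<lambda>t. X t w) t \<noteq> X t w"
      then obtain j where j: "1 / real (Suc j) < X t w - left_limit (\<lambda>t. X t w) t" using le by (metis diff_gt_0_iff_gt less_le nat_approx_posE)
      obtain n where "X t w - X (max 0 (t - 1 / real (Suc n))) w < 1 / real (Suc j)" using small by blast
      moreover have "X (max 0 (t - 1 / real (Suc n))) w \<le> left_limit (\<lambda>t. X t w) t"
        using t by (intro left_limit_mono_bounds(1)[OF LX(4)[OF w] mono[OF w]]) auto
      ultimately show False using j by linarith
    qed
  qed
qed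

lemma indep_processes_nn_integral:
  assumes ind: "indep_processes M X Y" and pX: "sample_path X \<in> measurable M paths" and pY: "sample_path Y \<in> measurable M paths"
    and M: "prob_space M" and h: "h \<in> borel_measurable (paths \<Otimes>\<^sub>M paths)"
  shows "(\<integral>\<^sup>+w. h (sample_path X w, sample_path Y w) \<partial>M) = (\<integral>\<^sup>+w. (\<integral>\<^sup>+w'. h (sample_path X w, sample_path Y w') \<partial>M) \<partial>M)"
proof -
  interpret prob_space M by fact
  interpret LYs: prob_space "distr M paths (sample_path Y)" by (rule prob_space_distr[OF pY])
  have "sets (distr M paths (sample_path X) \<Otimes>\<^sub>M distr M paths (sample_path Y)) = sets (paths \<Otimes>\<^sub>M paths)"
    by (intro sets_pair_measure_cong) simp_all
  from measurable_cong_sets[OF this refl, of borel] h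
  have h': "h \<in> borel_measurable (distr M paths (sample_path X) \<Otimes>\<^sub>M distr M paths (sample_path Y))" by simp
  have "(\<integral>\<^sup>+w. h (sample_path X w, sample_path Y w) \<partial>M) =
    (\<integral>\<^sup>+p. h p \<partial>distr M (paths \<Otimes>\<^sub>M paths) (\<lambda>w. (sample_path X w, sample_path Y w)))"
    using h by (subst nn_integral_distr) (auto intro: measurable_Pair pX pY)
  also have "distr M (paths \<Otimes>\<^sub>M paths) (\<lambda>w. (sample_path X w, sample_path Y w)) =
      distr M paths (sample_path X) \<Otimes>\<^sub>M distr M paths (sample_path Y)"
    using ind unfolding indep_processes_def sample_path_def[abs_def] indep_var_distribution_eq by metis
  also have "(\<integral>\<^sup>+p. h p \<partial>(distr M paths (sample_path X) \<Otimes>\<^sub>M distr M paths (sample_path Y))) =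
    (\<integral>\<^sup>+f. (\<integral>\<^sup>+g. h (f, g) \<partial>distr M paths (sample_path Y)) \<partial>distr M paths (sample_path X))"
    by (intro LYs.nn_integral_fst[symmetric] h')
  also have "\<dots> = (\<integral>\<^sup>+w. (\<integral>\<^sup>+g. h (sample_path X w, g) \<partial>distr M paths (sample_path Y)) \<partial>M)"
    by (intro nn_integral_distr pX LYs.borel_measurable_nn_integral) (use h' in simp)
  also have "\<dots> = (\<integral>\<^sup>+w. (\<integral>\<^sup>+w'. h (sample_path X w, sample_path Y w') \<partial>M) \<partial>M)"
    using measurable_space[OF pX] by (intro nn_integral_cong nn_integral_distr pY) (simp add: measurable_compose[OF measurable_Pair1' h])
  finally show ?thesis .
qed

text \<open>By independence the passage time of \<open>X\<close> acts on \<open>Y\<close> like a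
  fixed time, and \<open>Y\<close> has no fixed jumps.\<close>

lemma indep_subordinator_no_common_jump:
  assumes X: "levy_process M X" and Y: "subordinator M Y" and ind: "indep_processes M X Y" and c: "0 < c"
  shows "AE w in M. first_passage (\<lambda>t. X t w) c < \<infinity> \<longrightarrow>
    left_limit (\<lambda>t. Y t w) (enn2real (first_passage (\<lambda>t. X t w) c)) = Y (enn2real (first_passage (\<lambda>t. X t w) c)) w"
proof -
  note LX = levy_processD[OF X] and LY = levy_processD[OF subordinatorD(1)[OF Y]]
  interpret prob_space M by fact
  have pX [measurable]: "sample_path X \<in> measurable M paths" and pY [measurable]: "sample_path Y \<in> measurable M paths"
    by (intro measurable_path LX LY; assumption)+
  define T where "T f = enn2real (passage c f)" for f
  have T_meas [measurable]: "T \<in> borel_measurable paths"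
    unfolding T_def using passage_measurable[of "\<lambda>f. f" paths "\<lambda>_. c"] by simp
  \<comment> \<open>Phrased by grid limits, to be an event of the product path space to which
    independence applies. An infinite passage time becomes time 0, where the convention for left
    limits excludes a jump.\<close>
  define bad :: "(real \<Rightarrow> real) \<times> (real \<Rightarrow> real) \<Rightarrow> bool"
    where "bad = (\<lambda>p. left_value (snd p) (T (fst p)) \<noteq> right_value (snd p) (T (fst p)))"
  have bad_meas: "Measurable.pred (paths \<Otimes>\<^sub>M paths) bad"
  proof -
    have T1: "(\<lambda>p. T (fst p)) \<in> borel_measurable (paths \<Otimes>\<^sub>M paths)" by measurable
    have [measurable]: "(\<lambda>p. left_value (snd p) (T (fst p)) :: real) \<in> borel_measurable (paths \<Otimes>\<^sub>M paths)"
      by (rule left_value_measurable[OF measurable_snd T1])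
    have [measurable]: "(\<lambda>p. right_value (snd p) (T (fst p)) :: real) \<in> borel_measurable (paths \<Otimes>\<^sub>M paths)"
      by (rule right_value_measurable[OF measurable_snd T1]) (simp add: T_def)
    show ?thesis unfolding bad_def by measurable
  qed
  have ev: "left_value (sample_path Y w) t = left_limit (\<lambda>t. Y t w) t" "right_value (sample_path Y w) t = Y t w"
    if "w \<in> space M" "0 \<le> t" for w t
    using left_value_cong[OF that(2), of "sample_path Y w" "\<lambda>t. Y t w"] right_value_cong[OF that(2), of "sample_path Y w" "\<lambda>t. Y t w"]
      left_value_cadlag[OF LY(4)[OF that(1)] that(2)] right_value_cadlag[OF LY(4)[OF that(1)] that(2)] that(2)
    by (auto simp: sample_path_def)
  let ?bad = "indicator {p \<in> space (paths \<Otimes>\<^sub>M paths). bad p} :: _ \<Rightarrow> ennreal"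
  have "(\<integral>\<^sup>+w. ?bad (sample_path X w, sample_path Y w) \<partial>M) = (\<integral>\<^sup>+w. (\<integral>\<^sup>+w'. ?bad (sample_path X w, sample_path Y w') \<partial>M) \<partial>M)"
    using bad_meas by (intro indep_processes_nn_integral ind pX pY LX(1)) auto
  also have "\<dots> = (\<integral>\<^sup>+w. 0 \<partial>M)"
  proof (intro nn_integral_cong)
    fix w
    let ?t = "T (sample_path X w)"
    have "AE w' in M. left_limit (\<lambda>t. Y t w') ?t = Y ?t w'"
      using subordinator_no_fixed_jump[OF Y, of ?t] by (cases "?t = 0") (auto simp: left_limit_def T_def less_le)
    then have "(\<integral>\<^sup>+w'. ?bad (sample_path X w, sample_path Y w') \<partial>M) = (\<integral>\<^sup>+w'. 0 \<partial>M)"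
    proof (intro nn_integral_cong_AE, elim AE_mp, intro AE_I2 impI)
      fix w' assume "w' \<in> space M" "left_limit (\<lambda>t. Y t w') ?t = Y ?t w'"
      then show "?bad (sample_path X w, sample_path Y w') = 0"
        using ev[of w' ?t] by (simp add: bad_def T_def)
    qed
    then show "(\<integral>\<^sup>+w'. ?bad (sample_path X w, sample_path Y w') \<partial>M) = 0" by simp
  qed
  finally have "(\<integral>\<^sup>+w. ?bad (sample_path X w, sample_path Y w) \<partial>M) = 0" by simp
  moreover have "?bad \<in> borel_measurable (paths \<Otimes>\<^sub>M paths)" using bad_meas by auto
  ultimately have "AE w in M. ?bad (sample_path X w, sample_path Y w) = 0"
    by (subst nn_integral_0_iff_AE[symmetric]) (auto intro: measurable_compose measurable_Pair pX pY)
  then have "AE w in M. \<not> bad (sample_path X w, sample_path Y w)"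
    by (rule AE_mp, intro AE_I2 impI)
      (use measurable_space[OF pX] measurable_space[OF pY] in \<open>auto simp: space_pair_measure indicator_def split: if_splits\<close>)
  then show ?thesis
  proof (rule AE_mp, intro AE_I2 impI)
    fix w assume w: "w \<in> space M" and nb: "\<not> bad (sample_path X w, sample_path Y w)"
    then show "left_limit (\<lambda>t. Y t w) (enn2real (first_passage (\<lambda>t. X t w) c)) = Y (enn2real (first_passage (\<lambda>t. X t w) c)) w"
      unfolding bad_def T_def using ev[OF w] passage_sample_path[of X w c, OF LX(4)[OF w]] by simp
  qed
qed

lemma borel_measurable_fst_real [measurable]: "fst \<in> borel_measurable (borel :: (real \<times> real) measure)"
  and borel_measurable_snd_real [measurable]: "snd \<in> borel_measurable (borel :: (real \<times> real) measure)"
  by (intro borel_measurable_continuous_onI continuous_intros)+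

lemma (in markov_process) optional_time_const: "optional_time (\<lambda>_. c)"
  unfolding optional_time_def using sets.top[of "F _"] by (auto simp: space_F)

section \<open>Jumps of the difference onto a fixed level\<close>

context levy_difference
begin

lemma Z_measurable [measurable]: "0 \<le> t \<Longrightarrow> Z t \<in> borel_measurable M"
  by (rule diff.X_measurable)

lemma first_passage_Z_ge:
  assumes "w \<in> space M"
  shows "first_passage (\<lambda>t. Zp t w) c \<le> first_passage (\<lambda>t. Z t w) c"
  unfolding le_first_passage_iff
proof (intro allI impI)
  fix t assume t: "0 < t" "c < Z t w"
  then have "c < Zp t w" using subordinatorD(3)[OF Zm _ assms, of t] by (simp add: Z_def)
  with t(1) show "first_passage (\<lambda>t. Zp t w) c \<le> ennreal t" unfolding first_passage_def by (auto intro: INF_lower)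
qed

text \<open>For a given increment after \<open>s\<close>, ending near \<open>b\<close> requires
  \<open>Z s\<close> to lie in an interval of radius \<open>\<delta>\<close>, which has probability
  at most \<open>q\<close>. The increment is independent of \<open>Z s\<close>, so the two bounds
  multiply.\<close>

lemma increment_hits_level:
  assumes s: "0 \<le> s" "0 \<le> h" and q: "0 \<le> q" "\<And>y. prob {w\<in>space M. \<bar>Z s w - y\<bar> \<le> \<delta>} \<le> q"
  shows "prob {w\<in>space M. \<epsilon> \<le> Zp (s + h) w - Zp s w \<and> \<bar>Z (s + h) w - b\<bar> \<le> \<delta>} \<le> q * prob {w\<in>space M. \<epsilon> \<le> Zp h w}"
proof -
  have [measurable]: "Zp s \<in> borel_measurable M" "Zp h \<in> borel_measurable M" "Zm h \<in> borel_measurable M" "Zp (s + h) \<in> borel_measurable M" "Zm (s + h) \<in> borel_measurable M"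
    "Z s \<in> borel_measurable M" "Z (s + h) \<in> borel_measurable M" using s by (auto intro!: LP LM Z_measurable)
  let ?E = "{w\<in>space M. \<epsilon> \<le> Zp (s + h) w - Zp s w \<and> \<bar>Z (s + h) w - b\<bar> \<le> \<delta>}"
  let ?F = "{w\<in>space M. \<epsilon> \<le> Zp h w}"
  define g :: "(real \<times> real \<times> real) \<times> (real \<Rightarrow> real \<times> real) \<Rightarrow> ennreal" where
    "g p = of_bool (\<epsilon> \<le> fst (snd p h) \<and> \<bar>fst (snd (fst p)) - snd (snd (fst p)) + (fst (snd p h) - snd (snd p h)) - b\<bar> \<le> \<delta>)" for p
  have comp [measurable]: "(\<lambda>p. snd p h) \<in> borel_measurable ((borel \<Otimes>\<^sub>M borel) \<Otimes>\<^sub>M (paths :: (real \<Rightarrow> real \<times> real) measure))"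
    using s(2) by (intro measurable_compose[OF measurable_snd measurable_component_singleton]) simp
  have g: "g \<in> borel_measurable ((borel \<Otimes>\<^sub>M borel) \<Otimes>\<^sub>M paths)"
    unfolding g_def by measurable
  have "emeasure M ?E = (\<integral>\<^sup>+w. indicator (space M) w * g ((enn2real (ennreal s), joint Zp Zm (enn2real (ennreal s)) w), post_path (joint Zp Zm) (enn2real (ennreal s)) w) \<partial>M)"
  proof -
    have "emeasure M ?E = (\<integral>\<^sup>+w. indicator ?E w \<partial>M)" by (rule nn_integral_indicator[symmetric]) measurable
    also have "\<dots> = (\<integral>\<^sup>+w. indicator (space M) w * g ((s, joint Zp Zm s w), post_path (joint Zp Zm) s w) \<partial>M)"
      using s by (intro nn_integral_cong) (auto simp: g_def post_path_def joint_def Z_def indicator_def)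
    finally show ?thesis using s by simp
  qed
  also have "\<dots> = (\<integral>\<^sup>+w. indicator (space M) w * (\<integral>\<^sup>+w'. g ((enn2real (ennreal s), joint Zp Zm (enn2real (ennreal s)) w), sample_path (joint Zp Zm) w') \<partial>M) \<partial>M)"
  proof (rule pair.strong_markov[OF pair.optional_time_const _ _ _ g])
    fix t :: real assume t: "0 \<le> t"
    have "{w\<in>space M. ennreal s < ennreal t} \<subseteq> space M" by blast
    then show "space M \<inter> {w\<in>space M. ennreal s < ennreal t} \<in> sets (hist t)"
      using pair.optional_timeD[OF pair.optional_time_const t, of "ennreal s"] by (simp only: Int_absorb1)
  qed simp_all
  also have "\<dots> = (\<integral>\<^sup>+w. (\<integral>\<^sup>+w'. of_bool (\<epsilon> \<le> Zp h w' \<and> \<bar>Z s w + Z h w' - b\<bar> \<le> \<delta>) \<partial>M) \<partial>M)"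
    using s by (auto intro!: nn_integral_cong simp: g_def sample_path_def joint_def Z_def)
  \<comment> \<open>The order of integration is exchanged to fix the increment and average over the
    past, where concentration applies.\<close>
  also have "\<dots> = (\<integral>\<^sup>+w'. (\<integral>\<^sup>+w. of_bool (\<epsilon> \<le> Zp h w' \<and> \<bar>Z s w + Z h w' - b\<bar> \<le> \<delta>) \<partial>M) \<partial>M)"
  proof -
    interpret PP: pair_prob_space M M ..
    show ?thesis using s by (intro PP.Fubini') measurable
  qed
  also have "\<dots> \<le> (\<integral>\<^sup>+w'. ennreal q * indicator ?F w' \<partial>M)"
  proof (intro nn_integral_mono)
    fix w' assume w': "w' \<in> space M"
    have "(\<integral>\<^sup>+w. of_bool (\<epsilon> \<le> Zp h w' \<and> \<bar>Z s w + Z h w' - b\<bar> \<le> \<delta>) \<partial>M) \<le>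
      (\<integral>\<^sup>+w. indicator ?F w' * indicator {w\<in>space M. \<bar>Z s w - (b - Z h w')\<bar> \<le> \<delta>} w \<partial>M)"
      using w' by (intro nn_integral_mono) (auto simp: indicator_def algebra_simps)
    also have "\<dots> = indicator ?F w' * emeasure M {w\<in>space M. \<bar>Z s w - (b - Z h w')\<bar> \<le> \<delta>}"
      by (subst nn_integral_cmult) auto
    also have "\<dots> \<le> indicator ?F w' * ennreal q"
      using q(2)[of "b - Z h w'"] by (intro mult_left_mono) (auto simp: emeasure_eq_measure ennreal_leI)
    finally show "(\<integral>\<^sup>+w. of_bool (\<epsilon> \<le> Zp h w' \<and> \<bar>Z s w + Z h w' - b\<bar> \<le> \<delta>) \<partial>M) \<le> ennreal q * indicator ?F w'"
      by (simp add: mult.commute)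
  qed
  also have "\<dots> = ennreal (q * prob ?F)"
    using q(1) by (subst nn_integral_cmult) (auto simp: emeasure_eq_measure ennreal_mult)
  finally show ?thesis using q(1) by (simp add: emeasure_eq_measure)
qed

end

locale infinite_levy_difference = driftless_levy_difference M Zp Zm "positive_part_measure \<nu>"
  for M :: "'a measure" and Zp Zm :: "real \<Rightarrow> 'a \<Rightarrow> real" and \<nu> :: "real measure" +
  fixes d dm :: real
  assumes Zm_char: "drift_levy_measure M Zm dm (negative_part_measure \<nu>)"
    and Z_char: "drift_levy_measure M Z d \<nu>"
    and infinite: "emeasure \<nu> UNIV = \<infinity>"
begin

text \<open>A jump of size \<open>\<ge> \<epsilon>\<close> onto the level \<open>b\<close> is visible on every fine grid; each grid interval contributes
  at most \<open>q\<close> times the expected number of large increments, where \<open>q\<close> bounds the concentration of the past value.\<close>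

lemma AE_no_large_jump_onto_level:
  assumes s0: "0 < s0" and T: "0 < T" and \<epsilon>: "0 < \<epsilon>"
  shows "AE w in M. \<not> (\<exists>\<theta>. 2 * s0 \<le> \<theta> \<and> \<theta> < T \<and> left_limit (\<lambda>t. Zp t w) \<theta> + \<epsilon> \<le> Zp \<theta> w \<and> Z \<theta> w = b)"
proof -
  define h where "h n = T / real (Suc n)" for n
  have h: "0 < h n" "real (Suc n) * h n = T" for n using T unfolding h_def by (auto simp del: of_nat_Suc)
  \<comment> \<open>Bounds the expected number of grid increments of size at least
    \<open>\<epsilon>\<close>, by Markov's inequality and the estimate of truncated increments with
    slack 1.\<close>
  define cst where "cst = (16 * T * (\<integral>x. min \<bar>x\<bar> \<epsilon> \<partial>positive_part_measure \<nu>) + 1) / \<epsilon>"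
  define q :: "nat \<Rightarrow> real" where "q i = 1 / real (Suc i)" for i
  have q: "0 < q i" for i unfolding q_def by simp
  have "\<exists>\<delta>>0. \<forall>s\<ge>s0. \<forall>y. prob {w\<in>space M. \<bar>Z s w - y\<bar> \<le> \<delta>} \<le> q i" for i
    using levy_concentration[OF Z_char prob_space_axioms diff.X_measurable infinite s0 q[of i]] by metis
  then obtain \<delta> where \<delta>: "\<And>i. 0 < \<delta> i" "\<And>i s y. s0 \<le> s \<Longrightarrow> prob {w\<in>space M. \<bar>Z s w - y\<bar> \<le> \<delta> i} \<le> q i" by metis
  have [measurable]: "Zp (real k * h n + h n) \<in> borel_measurable M" "Zp (real k * h n) \<in> borel_measurable M"
    "Z (real k * h n + h n) \<in> borel_measurable M" "Zp (h n) \<in> borel_measurable M" for k n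
    using h(1)[of n] by (auto intro!: LP Z_measurable add_nonneg_nonneg mult_nonneg_nonneg)
  define Ek where "Ek i n k = {w\<in>space M. \<epsilon> \<le> Zp (real k * h n + h n) w - Zp (real k * h n) w \<and> \<bar>Z (real k * h n + h n) w - b\<bar> \<le> \<delta> i}" for i n k
  have Ek [measurable]: "Ek i n k \<in> sets M" for i n k unfolding Ek_def by measurable
  define E where "E i n = (\<Union>k\<in>{k. k < Suc n \<and> s0 \<le> real k * h n}. Ek i n k)" for i n
  have E [measurable]: "E i n \<in> sets M" for i n unfolding E_def by measurable
  have E_le: "prob (E i n) \<le> real (Suc n) * (q i * prob {w\<in>space M. \<epsilon> \<le> Zp (h n) w})" for i n
  proof -
    have "prob (E i n) \<le> (\<Sum>k\<in>{k. k < Suc n \<and> s0 \<le> real k * h n}. prob (Ek i n k))"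
      unfolding E_def by (intro finite_measure_subadditive_finite) auto
    also have "\<dots> \<le> (\<Sum>k\<in>{k. k < Suc n \<and> s0 \<le> real k * h n}. q i * prob {w\<in>space M. \<epsilon> \<le> Zp (h n) w})"
    proof (intro sum_mono)
      fix k assume "k \<in> {k. k < Suc n \<and> s0 \<le> real k * h n}"
      then show "prob (Ek i n k) \<le> q i * prob {w\<in>space M. \<epsilon> \<le> Zp (h n) w}"
        unfolding Ek_def using h(1)[of n] q[of i] s0
        by (intro increment_hits_level \<delta>(2)) auto
    qed
    also have "\<dots> \<le> (\<Sum>k\<in>{..<Suc n}. q i * prob {w\<in>space M. \<epsilon> \<le> Zp (h n) w})"
      using q[of i] by (intro sum_mono2) auto
    finally show ?thesis by simp
  qed
  have small: "\<forall>\<^sub>F n in sequentially. real (Suc n) * prob {w\<in>space M. \<epsilon> \<le> Zp (h n) w} \<le> cst"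
    using driftless_small_increments[OF Zp_char prob_space_axioms LP(2) subordinatorD(3)[OF Zp] less_imp_le[OF T] \<epsilon> zero_less_one]
  proof (rule eventually_mono, simp_all only:)
    fix n
    assume elim: "real (Suc n) * (\<integral>w. min (Zp (T / real (Suc n)) w) \<epsilon> \<partial>M) \<le> 16 * T * (\<integral>x. min \<bar>x\<bar> \<epsilon> \<partial>positive_part_measure \<nu>) + 1"
    have nn: "0 \<le> Zp (h n) w" if "w \<in> space M" for w using h(1)[of n] that by (intro subordinatorD(3)[OF Zp]) auto
    have "prob {w\<in>space M. \<epsilon> \<le> min (Zp (h n) w) \<epsilon>} \<le> (\<integral>w. min (Zp (h n) w) \<epsilon> \<partial>M) / \<epsilon>"
      using \<epsilon> nn by (intro integral_Markov_inequality_measure[where A="{}"] integrable_const_bound[of _ \<epsilon>]) auto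
    moreover have "{w\<in>space M. \<epsilon> \<le> min (Zp (h n) w) \<epsilon>} = {w\<in>space M. \<epsilon> \<le> Zp (h n) w}" by auto
    ultimately have "real (Suc n) * prob {w\<in>space M. \<epsilon> \<le> Zp (h n) w} \<le> real (Suc n) * ((\<integral>w. min (Zp (h n) w) \<epsilon> \<partial>M) / \<epsilon>)"
      by (intro mult_left_mono) auto
    also have "\<dots> = (real (Suc n) * (\<integral>w. min (Zp (h n) w) \<epsilon> \<partial>M)) / \<epsilon>" by simp
    also have "\<dots> \<le> cst" unfolding cst_def using elim \<epsilon> unfolding h_def by (intro divide_right_mono) auto
    finally show "real (Suc n) * prob {w\<in>space M. \<epsilon> \<le> Zp (h n) w} \<le> cst" .
  qed
  \<comment> \<open>A jump onto the level is seen on all sufficiently fine grids, for every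
    tolerance \<open>\<delta> i\<close>. Intersecting over the grids costs nothing in the estimate,
    and letting \<open>q i\<close> tend to 0 makes the event null.\<close>
  define G where "G i m = (\<Inter>n\<in>{m..}. E i n)" for i m
  have G [measurable]: "G i m \<in> sets M" for i m unfolding G_def by measurable
  have G_le: "prob (G i m) \<le> cst * q i" for i m
  proof -
    obtain n where n: "m \<le> n" "real (Suc n) * prob {w\<in>space M. \<epsilon> \<le> Zp (h n) w} \<le> cst"
      using small unfolding eventually_sequentially by (meson nle_le)
    have "prob (G i m) \<le> prob (E i n)" using n(1) unfolding G_def by (intro finite_measure_mono) auto
    also have "\<dots> \<le> q i * (real (Suc n) * prob {w\<in>space M. \<epsilon> \<le> Zp (h n) w})" using E_le[of i n] by (simp add: algebra_simps)
    also have "\<dots> \<le> cst * q i" using mult_left_mono[OF n(2) less_imp_le[OF q[of i]]] by (simp add: mult.commute)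
    finally show ?thesis .
  qed
  have "prob (\<Inter>i. \<Union>m. G i m) = 0"
  proof -
    have U_le: "prob (\<Union>m. G i m) \<le> cst * q i" for i
    proof -
      have "(\<lambda>m. prob (G i m)) \<longlonglongrightarrow> prob (\<Union>m. G i m)"
        by (intro finite_Lim_measure_incseq) (auto simp: incseq_def G_def)
      then show ?thesis by (rule LIMSEQ_le_const2) (use G_le in auto)
    qed
    have "prob (\<Inter>i. \<Union>m. G i m) \<le> cst * q i" for i
      using finite_measure_mono[of "\<Inter>i. \<Union>m. G i m" "\<Union>m. G i m"] U_le[of i] by (auto intro: order_trans)
    moreover have "(\<lambda>i. cst * q i) \<longlonglongrightarrow> cst * 0"
      unfolding q_def using LIMSEQ_Suc[OF lim_1_over_n] by (intro tendsto_mult tendsto_const)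
    ultimately have "prob (\<Inter>i. \<Union>m. G i m) \<le> 0" by (intro LIMSEQ_le_const[of "\<lambda>i. cst * q i" 0]) auto
    then show ?thesis using measure_nonneg[of M "\<Inter>i. \<Union>m. G i m"] by linarith
  qed
  then have null: "(\<Inter>i. \<Union>m. G i m) \<in> null_sets M" by (auto simp: null_sets_def emeasure_eq_measure)
  show ?thesis
  proof (rule AE_I'[OF null], rule subsetI)
    fix w assume "w \<in> {w\<in>space M. \<not> \<not> (\<exists>\<theta>. 2 * s0 \<le> \<theta> \<and> \<theta> < T \<and> left_limit (\<lambda>t. Zp t w) \<theta> + \<epsilon> \<le> Zp \<theta> w \<and> Z \<theta> w = b)}"
    then obtain \<theta> where w: "w \<in> space M" and \<theta>: "2 * s0 \<le> \<theta>" "\<theta> < T" "left_limit (\<lambda>t. Zp t w) \<theta> + \<epsilon> \<le> Zp \<theta> w" "Z \<theta> w = b" by auto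
    have mono: "mono_on {0..} (\<lambda>t. Zp t w)" using w by (rule subordinatorD(2)[OF Zp])
    have h_lim: "h \<longlonglongrightarrow> 0" unfolding h_def using tendsto_mult[OF tendsto_const[of T] LIMSEQ_Suc[OF lim_1_over_n]] by simp
    have "\<exists>m. w \<in> G i m" for i
    proof -
      have "\<forall>\<^sub>F s in at_right \<theta>. dist (Z s w) b < \<delta> i"
        using cadlag_right[OF Z_cadlag[OF w], of \<theta>] \<theta>(1,4) s0 \<delta>(1) by (intro tendstoD) auto
      then obtain c where c: "\<theta> < c" "\<And>s. \<theta> < s \<Longrightarrow> s < c \<Longrightarrow> dist (Z s w) b < \<delta> i" unfolding eventually_at_right_field by blast
      have "\<forall>\<^sub>F n in sequentially. h n < min s0 (c - \<theta>)" using h_lim s0 c(1) by (intro order_tendstoD) auto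
      then obtain m where m: "\<And>n. m \<le> n \<Longrightarrow> h n < min s0 (c - \<theta>)" by (auto simp: eventually_sequentially)
      have "w \<in> E i n" if "m \<le> n" for n
      proof -
        \<comment> \<open>The cell \<open>(k * h, (k + 1) * h]\<close> containing
          \<open>\<theta>\<close>, closed on the right so that the jump at \<open>\<theta>\<close>
          belongs to its increment.\<close>
        define k where "k = nat (\<lceil>\<theta> / h n\<rceil> - 1)"
        have "0 < \<theta> / h n" using \<theta>(1) s0 h(1)[of n] by auto
        then have "0 < \<lceil>\<theta> / h n\<rceil>" by simp
        then have "real k < \<theta> / h n" "\<theta> / h n \<le> real k + 1" unfolding k_def by linarith+
        then have k: "real k * h n < \<theta>" "\<theta> \<le> real k * h n + h n" using h(1)[of n] by (auto simp: field_simps)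
        have "real k * h n < real (Suc n) * h n" using k(1) \<theta>(2) h(2)[of n] by simp
        then have "k < Suc n" using h(1)[of n] by (simp only: mult_less_cancel_right_pos of_nat_less_iff)
        moreover have "s0 \<le> real k * h n" using m[OF that] k(2) \<theta>(1) by simp
        moreover have "Zp (real k * h n) w \<le> left_limit (\<lambda>t. Zp t w) \<theta>"
          using k(1) h(1)[of n] by (intro left_limit_mono_bounds(1)[OF LP(4)[OF w] mono]) auto
        moreover have "Zp \<theta> w \<le> Zp (real k * h n + h n) w"
          using k(2) \<theta>(1) s0 by (intro subordinatorD(4)[OF Zp _ _ w]) auto
        moreover have "\<bar>Z (real k * h n + h n) w - b\<bar> \<le> \<delta> i"
        proof (cases "\<theta> = real k * h n + h n")
          case True
          then show ?thesis using \<theta>(4) \<delta>(1)[of i] by simp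
        next
          case False
          then show ?thesis using c(2)[of "real k * h n + h n"] k m[OF that] by (simp add: dist_real_def)
        qed
        ultimately show ?thesis unfolding E_def Ek_def using w \<theta>(3) by auto
      qed
      then show ?thesis unfolding G_def by auto
    qed
    then show "w \<in> (\<Inter>i. \<Union>m. G i m)" by auto
  qed
qed

end

context levy_difference
begin

lemma Zp_optional: "pair.optional_time (\<lambda>w. first_passage (\<lambda>t. Zp t w) c)"
  by (intro pair.first_passage_optional Zp_adapted LP(4))

lemma left_limit_Zp_le:
  assumes "w \<in> space M" "0 < \<theta>" "ennreal \<theta> \<le> first_passage (\<lambda>t. Zp t w) b"
  shows "left_limit (\<lambda>t. Zp t w) \<theta> \<le> b"
proof (rule tendsto_upperbound[OF left_limit_tendsto[OF LP(4)[OF assms(1)] assms(2)]])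
  have "Zp t w \<le> b" if "t \<in> {0<..<\<theta>}" for t
  proof -
    have "ennreal t < ennreal \<theta>" using that by (intro ennreal_lessI) auto
    then show ?thesis using before_first_passage[of t "\<lambda>t. Zp t w" b] that assms(3) by auto
  qed
  then show "\<forall>\<^sub>F t in at_left \<theta>. Zp t w \<le> b"
    using eventually_at_left_real[OF assms(2)] by (rule eventually_mono[rotated])
qed simp

end

context infinite_levy_difference
begin

text \<open>If \<open>Zm\<close> rests at 0 with positive probability, its law has an atom, so its
  Levy measure is finite. The infinite mass is then on the positive side, and \<open>Zp\<close>
  leaves 0 immediately.\<close>

lemma positivity_cases:
  obtains (negative) "AE w in M. \<forall>t>0. 0 < Zm t w"
  | (positive) t0 where "0 < t0" "0 < prob {w\<in>space M. Zm t0 w = 0}" "AE w in M. \<forall>t>0. 0 < Zp t w"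
proof (cases "\<forall>t>0. prob {w\<in>space M. Zm t w = 0} = 0")
  case True
  then show thesis using subordinator_AE_pos[OF Zm] negative by simp
next
  case False
  then obtain t0 where t0: "0 < t0" "prob {w\<in>space M. Zm t0 w = 0} \<noteq> 0" by auto
  then have "emeasure (negative_part_measure \<nu>) UNIV \<noteq> \<infinity>"
    using levy_no_atom[OF Zm_char prob_space_axioms LM(2)] by blast
  then have inf: "emeasure (positive_part_measure \<nu>) UNIV = \<infinity>"
    using positive_part_infinite_or_negative[OF _ infinite] drift_levy_measureD(1)[OF Z_char] by blast
  have "AE w in M. \<forall>t>0. 0 < Zp t w"
    using levy_no_atom[OF Zp_char prob_space_axioms LP(2) inf] by (intro subordinator_AE_pos[OF Zp])
  then show thesis using t0 by (intro positive[of t0]) (auto simp: less_le)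
qed

text \<open>Just before the passage \<open>Zp\<close> is at most \<open>b\<close>. Ending with
  \<open>Z = b\<close> while \<open>Zm\<close> is positive forces \<open>Zp\<close> above
  \<open>b\<close>, hence a genuine jump of \<open>Zp\<close> that puts \<open>Z\<close> exactly on
  \<open>b\<close>. Countably many jump sizes and time windows exhaust all cases.\<close>

lemma AE_no_touching:
  assumes b: "0 < b" and pos: "AE w in M. \<forall>t>0. 0 < Zm t w"
  shows "AE w in M. first_passage (\<lambda>t. Zp t w) b < \<infinity> \<longrightarrow> Z (enn2real (first_passage (\<lambda>t. Zp t w) b)) w \<noteq> b"
proof -
  let ?r = "\<lambda>i. 1 / real (Suc i)"
  have "AE w in M. \<forall>i j. \<not> (\<exists>\<theta>. 2 * ?r i \<le> \<theta> \<and> \<theta> < real (Suc i) \<and> left_limit (\<lambda>t. Zp t w) \<theta> + ?r j \<le> Zp \<theta> w \<and> Z \<theta> w = b)"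
    by (subst AE_all_countable, intro allI)+ (rule AE_no_large_jump_onto_level, auto)
  with pos AE_space show ?thesis
  proof eventually_elim
    case (elim w)
    show ?case
    proof (intro impI notI)
      assume fin: "first_passage (\<lambda>t. Zp t w) b < \<infinity>" and level: "Z (enn2real (first_passage (\<lambda>t. Zp t w) b)) w = b"
      obtain \<theta> where \<theta>: "first_passage (\<lambda>t. Zp t w) b = ennreal \<theta>" "0 \<le> \<theta>"
        using fin by (cases "first_passage (\<lambda>t. Zp t w) b") auto
      have "0 < ennreal \<theta>" using first_passage_pos[OF LP(4)[OF elim(2)], of b] LP(3)[OF elim(2)] b \<theta> by simp
      then have \<theta>_pos: "0 < \<theta>" by simp
      have "left_limit (\<lambda>t. Zp t w) \<theta> \<le> b" using \<theta> by (intro left_limit_Zp_le[OF elim(2) \<theta>_pos]) simp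
      moreover have "b < Zp \<theta> w" using level elim(1) \<theta> \<theta>_pos by (auto simp: Z_def)
      ultimately obtain j where j: "left_limit (\<lambda>t. Zp t w) \<theta> + ?r j \<le> Zp \<theta> w"
        using nat_approx_posE[of "Zp \<theta> w - left_limit (\<lambda>t. Zp t w) \<theta>"] by (smt (verit))
      obtain i1 where i1: "?r i1 < \<theta> / 2" using nat_approx_posE[of "\<theta> / 2"] \<theta>_pos by auto
      obtain i2 where i2: "\<theta> < real i2" using reals_Archimedean2 by blast
      define i where "i = max i1 i2"
      have "?r i \<le> ?r i1" by (rule inverse_Suc_antimono) (simp add: i_def)
      then have "2 * ?r i \<le> \<theta>" using i1 by simp
      moreover have "\<theta> < real (Suc i)" using i2 by (auto simp: i_def)
      ultimately show False using elim(3) j level \<theta> by (metis enn2real_ennreal)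
    qed
  qed
qed

text \<open>Either touching has probability 0, or \<open>Zm\<close> rests for a short time after the
  passage while \<open>Zp\<close> grows at once, so that \<open>Z\<close> exceeds the level
  immediately after hitting it.\<close>

lemma AE_passage_at_level:
  assumes b: "0 < b"
  shows "AE w in M. first_passage (\<lambda>t. Zp t w) b < \<infinity> \<and> Z (enn2real (first_passage (\<lambda>t. Zp t w) b)) w = b \<longrightarrow>
    first_passage (\<lambda>t. Z t w) b = first_passage (\<lambda>t. Zp t w) b"
proof (cases rule: positivity_cases)
  case negative
  with AE_no_touching[OF b this] show ?thesis by eventually_elim auto
next
  case (positive t0)
  let ?S = "\<lambda>w. first_passage (\<lambda>t. Zp t w) b"
  \<comment> \<open>A countable form of the immediate growth of \<open>Zp\<close> and the initial
    rest of \<open>Zm\<close>, to be an event for the path after the passage. By monotonicity one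
    zero of the second component yields rest on a whole interval.\<close>
  define good :: "(real \<Rightarrow> real \<times> real) \<Rightarrow> bool" where
    "good f \<longleftrightarrow> (\<exists>n. snd (f (t0 / real (Suc n))) = 0) \<and> (\<forall>n. 0 < fst (f (t0 / real (Suc n))))" for f
  have t0n: "0 < t0 / real (Suc n)" for n using positive(1) by simp
  have good_meas: "Measurable.pred paths good"
  proof -
    have [measurable]: "(\<lambda>f. f (t0 / real (Suc n))) \<in> borel_measurable (paths :: (real \<Rightarrow> real \<times> real) measure)" for n
      using t0n[of n] by (intro path_component_measurable) auto
    show ?thesis unfolding good_def by measurable
  qed
  have S_meas [measurable]: "?S \<in> borel_measurable M" by (intro pair.optional_time_measurable Zp_optional)
  let ?E = "{w\<in>space M. ?S w < \<infinity>}" and ?D = "{f\<in>space paths. \<not> good f}"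
  have D: "?D \<in> sets paths" using good_meas by measurable
  have "emeasure M (?E \<inter> ((\<lambda>w. post_path (joint Zp Zm) (enn2real (?S w)) w) -` ?D \<inter> space M)) = emeasure M ?E * emeasure pair.law ?D"
  proof (rule pair.strong_markov_event[OF Zp_optional _ _ _ D])
    fix t :: real assume t: "0 \<le> t"
    have "?E \<inter> {w\<in>space M. ?S w < ennreal t} = {w\<in>space M. ?S w < ennreal t}" by (auto intro: less_trans)
    then show "?E \<inter> {w\<in>space M. ?S w < ennreal t} \<in> sets (hist t)"
      using pair.optional_timeD[OF Zp_optional t] by simp
  qed auto
  also have "emeasure pair.law ?D = emeasure M {w\<in>space M. \<not> good (sample_path (joint Zp Zm) w)}"
    using measurable_space[OF pair.sample_path_measurable]
    by (subst emeasure_distr[OF pair.sample_path_measurable D]) (auto intro!: arg_cong[where f="emeasure M"])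
  also have "\<dots> = 0"
  proof (rule emeasure_eq_0_AE)
    show "AE w in M. \<not> \<not> good (sample_path (joint Zp Zm) w)"
      using subordinator_zero_prob(2)[OF Zm positive(1,2)] positive(3)
      by eventually_elim (use t0n in \<open>auto simp: good_def sample_path_def joint_def less_imp_le simp del: of_nat_Suc\<close>)
  qed
  finally have "?E \<inter> ((\<lambda>w. post_path (joint Zp Zm) (enn2real (?S w)) w) -` ?D \<inter> space M) \<in> null_sets M"
    using measurable_sets[OF pair.post_at_measurable[OF pair.enn2real_optional[OF Zp_optional]] D]
    by (intro null_setsI) auto
  then show ?thesis
  proof (rule AE_I', intro subsetI, clarsimp)
    fix w assume w: "w \<in> space M" and fin: "?S w < top" and level: "Z (enn2real (?S w)) w = b"
      and ne: "first_passage (\<lambda>t. Z t w) b \<noteq> ?S w"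
    obtain \<theta> where \<theta>: "?S w = ennreal \<theta>" "0 \<le> \<theta>" using fin by (cases "?S w") auto
    let ?P = "post_path (joint Zp Zm) \<theta> w"
    have "\<not> good ?P"
    proof
      assume good: "good ?P"
      then obtain n where n: "snd (?P (t0 / real (Suc n))) = 0" unfolding good_def by blast
      have close: "first_passage (\<lambda>t. Z t w) b \<le> ennreal \<theta> + ennreal e" if e: "0 < e" for e
      proof -
        obtain k where k: "1 / real (Suc k) < e / t0" using nat_approx_posE[of "e / t0"] e positive(1) by auto
        define m where "m = max n k"
        let ?h = "t0 / real (Suc m)"
        have h: "0 < ?h" "?h \<le> t0 / real (Suc n)" "?h < e"
        proof -
          show "0 < ?h" by (rule t0n)
          have "1 / real (Suc m) \<le> 1 / real (Suc n)" "1 / real (Suc m) \<le> 1 / real (Suc k)"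
            unfolding m_def by (intro inverse_Suc_antimono; simp)+
          then have "1 / real (Suc m) \<le> 1 / real (Suc n)" "1 / real (Suc m) < e / t0" using k by linarith+
          from mult_left_mono[OF this(1), of t0] mult_strict_left_mono[OF this(2), of t0]
          have "t0 * (1 / real (Suc m)) \<le> t0 * (1 / real (Suc n))" "t0 * (1 / real (Suc m)) < t0 * (e / t0)"
            using positive(1) by auto
          then show "?h \<le> t0 / real (Suc n)" "?h < e" using positive(1) by auto
        qed
        have "Zp \<theta> w < Zp (\<theta> + ?h) w"
          using good h(1) unfolding good_def by (auto simp: post_path_def joint_def dest!: spec[of _ m] simp del: of_nat_Suc)
        moreover have "Zm (\<theta> + ?h) w \<le> Zm (\<theta> + t0 / real (Suc n)) w"
          using \<theta>(2) h(1,2) by (intro subordinatorD(4)[OF Zm _ _ w]) auto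
        moreover have "Zm (\<theta> + t0 / real (Suc n)) w = Zm \<theta> w"
          using n t0n[of n] by (simp add: post_path_def joint_def del: of_nat_Suc)
        ultimately have "b < Z (\<theta> + ?h) w" using level \<theta> by (simp add: Z_def)
        then have "first_passage (\<lambda>t. Z t w) b \<le> ennreal (\<theta> + ?h)"
          unfolding first_passage_def using \<theta>(2) h(1) by (intro INF_lower) auto
        also have "\<dots> \<le> ennreal \<theta> + ennreal e" using \<theta>(2) h e by (simp add: ennreal_plus[symmetric] ennreal_leI del: ennreal_plus)
        finally show ?thesis .
      qed
      have "first_passage (\<lambda>t. Z t w) b \<le> ennreal \<theta>" by (rule ennreal_le_epsilon) (rule close)
      then show False using ne first_passage_Z_ge[OF w, of b] \<theta> by simp
    qed
    then show "post_path (joint Zp Zm) (enn2real (?S w)) w \<in> space paths \<and> \<not> good (post_path (joint Zp Zm) (enn2real (?S w)) w)"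
      using \<theta> by (simp add: post_path_def[abs_def] space_PiM)
  qed
qed

end

section \<open>The jump chain of the procedure\<close>

type_synonym result = "ennreal \<times> real \<times> real \<times> real"

abbreviation result_space :: "result measure" where
  "result_space \<equiv> borel \<Otimes>\<^sub>M borel \<Otimes>\<^sub>M borel \<Otimes>\<^sub>M borel"

fun elapsed :: "config \<Rightarrow> ennreal" where "elapsed (go, T, Hp, Hm, A, b, v) = T"
fun up_total :: "config \<Rightarrow> real" where "up_total (go, T, Hp, Hm, A, b, v) = Hp"
fun down_total :: "config \<Rightarrow> real" where "down_total (go, T, Hp, Hm, A, b, v) = Hm"
fun remaining :: "config \<Rightarrow> ennreal" where "remaining (go, T, Hp, Hm, A, b, v) = A"
fun level :: "config \<Rightarrow> real" where "level (go, T, Hp, Hm, A, b, v) = b"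
fun last_jump :: "config \<Rightarrow> real" where "last_jump (go, T, Hp, Hm, A, b, v) = v"

lemma config_measurable [measurable]:
  "Measurable.pred config_space running"
  "elapsed \<in> borel_measurable config_space" "up_total \<in> borel_measurable config_space"
  "down_total \<in> borel_measurable config_space" "remaining \<in> borel_measurable config_space"
  "level \<in> borel_measurable config_space" "last_jump \<in> borel_measurable config_space"
proof -
  have eq: "running = fst" "elapsed = (\<lambda>c. fst (snd c))" "up_total = (\<lambda>c. fst (snd (snd c)))"
    "down_total = (\<lambda>c. fst (snd (snd (snd c))))" "remaining = (\<lambda>c. fst (snd (snd (snd (snd c)))))"
    "level = (\<lambda>c. fst (snd (snd (snd (snd (snd c))))))" "last_jump = (\<lambda>c. snd (snd (snd (snd (snd (snd c))))))"
    by (auto simp: fun_eq_iff)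
  show "Measurable.pred config_space running"
    "elapsed \<in> borel_measurable config_space" "up_total \<in> borel_measurable config_space"
    "down_total \<in> borel_measurable config_space" "remaining \<in> borel_measurable config_space"
    "level \<in> borel_measurable config_space" "last_jump \<in> borel_measurable config_space"
    unfolding eq config_space_def by measurable
qed

lemma config_measurableI [measurable (raw)]:
  assumes "Measurable.pred N g" "t \<in> borel_measurable N" "hp \<in> borel_measurable N" "hm \<in> borel_measurable N"
    "A \<in> borel_measurable N" "b \<in> borel_measurable N" "v \<in> borel_measurable N"
  shows "(\<lambda>x. (g x, t x, hp x, hm x, A x, b x, v x)) \<in> measurable N config_space"
  unfolding config_space_def using assms by measurable

lemma space_config_space [simp]: "space config_space = UNIV"
  by (simp add: config_space_def space_pair_measure)

definition update :: "config \<Rightarrow> ennreal \<Rightarrow> real \<Rightarrow> real \<Rightarrow> real \<Rightarrow> config" where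
  "update c t zp v zm = (if zp + v - zm < level c \<and> t < remaining c
     then (True, elapsed c + t, up_total c + (zp + v), down_total c + zm, remaining c - t, level c + zm - (zp + v), v)
     else (False, elapsed c + t, up_total c + (zp + v), down_total c + zm, remaining c, level c, v))"

lemma update_measurable [measurable (raw)]:
  assumes [measurable]: "c \<in> measurable N config_space" "t \<in> borel_measurable N" "zp \<in> borel_measurable N" "v \<in> borel_measurable N" "zm \<in> borel_measurable N"
  shows "(\<lambda>x. update (c x) (t x) (zp x) (v x) (zm x)) \<in> measurable N config_space"
  unfolding update_def by measurable

section \<open>One iteration as a function of the paths\<close>

context levy_difference
begin

definition lap :: "config \<Rightarrow> 'a \<Rightarrow> ennreal" where
  "lap c w = min (first_passage (\<lambda>t. Zp t w) (level c)) (remaining c)"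

text \<open>The time, the jump and the value of \<open>Zm\<close> are all read from the same sample
  point, so that iterations can be compared path by path with the process \<open>Z\<close>.\<close>

definition step :: "config \<Rightarrow> 'a \<Rightarrow> config" where
  "step c w = (if running c then update c (lap c w) (left_limit (\<lambda>t. Zp t w) (enn2real (lap c w)))
     (jump (\<lambda>t. Zp t w) (enn2real (lap c w))) (Zm (enn2real (lap c w)) w) else c)"

lemma sample_paths_measurable [measurable]:
  "sample_path Zp \<in> measurable M paths" "sample_path Zm \<in> measurable M paths"
  by (intro measurable_path LP(2) LM(2); assumption)+

lemma sample_path_values:
  assumes "w \<in> space M" "0 \<le> t"
  shows "right_value (sample_path Zp w) t = Zp t w" "right_value (sample_path Zm w) t = Zm t w"
    "left_value (sample_path Zp w) t = left_limit (\<lambda>t. Zp t w) t" "left_value (sample_path Zm w) t = left_limit (\<lambda>t. Zm t w) t"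
proof -
  show "right_value (sample_path Zp w) t = Zp t w" "right_value (sample_path Zm w) t = Zm t w"
    using right_value_cadlag[OF LP(4)[OF assms(1)] assms(2)] right_value_cadlag[OF LM(4)[OF assms(1)] assms(2)]
      right_value_cong[OF assms(2), of "sample_path Zp w" "\<lambda>t. Zp t w"] right_value_cong[OF assms(2), of "sample_path Zm w" "\<lambda>t. Zm t w"] assms(2)
    by (auto simp: sample_path_def)
  show "left_value (sample_path Zp w) t = left_limit (\<lambda>t. Zp t w) t" "left_value (sample_path Zm w) t = left_limit (\<lambda>t. Zm t w) t"
    using left_value_cadlag[OF LP(4)[OF assms(1)] assms(2)] left_value_cadlag[OF LM(4)[OF assms(1)] assms(2)]
      left_value_cong[OF assms(2), of "sample_path Zp w" "\<lambda>t. Zp t w"] left_value_cong[OF assms(2), of "sample_path Zm w" "\<lambda>t. Zm t w"]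
    by (auto simp: sample_path_def)
qed

text \<open>The same update as a functional of two separate paths: measurable, and open to
  independence because the paths of \<open>Zp\<close> and \<open>Zm\<close> may come from different
  sample points.\<close>

definition path_step :: "config \<Rightarrow> (real \<Rightarrow> real) \<Rightarrow> (real \<Rightarrow> real) \<Rightarrow> config" where
  "path_step c f g = (let t = min (passage (level c) f) (remaining c); r = enn2real t
     in update c t (left_value f r) (right_value f r - left_value f r) (right_value g r))"

lemma path_step_measurable:
  assumes c [measurable]: "c \<in> measurable N config_space" and f: "f \<in> measurable N paths" and g: "g \<in> measurable N paths"
  shows "(\<lambda>x. path_step (c x) (f x) (g x)) \<in> measurable N config_space"
proof -
  have [measurable]: "(\<lambda>x. passage (level (c x)) (f x)) \<in> borel_measurable N"
    by (intro passage_measurable f) measurable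
  have [measurable]: "(\<lambda>x. enn2real (min (passage (level (c x)) (f x)) (remaining (c x)))) \<in> borel_measurable N" (is "?r \<in> _") by measurable
  have [measurable]: "(\<lambda>x. left_value (f x) (?r x)) \<in> borel_measurable N" by (intro left_value_measurable f) measurable
  have [measurable]: "(\<lambda>x. right_value (f x) (?r x)) \<in> borel_measurable N" "(\<lambda>x. right_value (g x) (?r x)) \<in> borel_measurable N"
    by (intro right_value_measurable f g; simp)+
  show ?thesis unfolding path_step_def Let_def by measurable
qed

lemma step_eq_path_step:
  "w \<in> space M \<Longrightarrow> running c \<Longrightarrow> step c w = path_step c (sample_path Zp w) (sample_path Zm w)"
  unfolding step_def path_step_def lap_def Let_def
  by (simp add: passage_sample_path[where X=Zp, OF LP(4)] sample_path_values jump_def)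

lemma step_measurable: "(\<lambda>p. step (fst p) (snd p)) \<in> measurable (config_space \<Otimes>\<^sub>M M) config_space"
proof -
  have "(\<lambda>p. if running (fst p) then path_step (fst p) (sample_path Zp (snd p)) (sample_path Zm (snd p)) else fst p)
      \<in> measurable (config_space \<Otimes>\<^sub>M M) config_space"
    by (intro measurable_If path_step_measurable measurable_compose[OF measurable_snd sample_paths_measurable(1)]
        measurable_compose[OF measurable_snd sample_paths_measurable(2)]) measurable
  then show ?thesis
    by (rule measurable_cong[THEN iffD1, rotated]) (auto simp: space_pair_measure step_eq_path_step, simp add: step_def)
qed

lemma step_measurable_snd [measurable]: "step c \<in> measurable M config_space"
  using measurable_compose[OF measurable_Pair1' step_measurable, of c] by simp

lemma Zm_value_measurable: "(\<lambda>p. Zm (enn2real (fst p)) (snd p)) \<in> borel_measurable (borel \<Otimes>\<^sub>M M)"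
proof -
  have "(\<lambda>p. right_value (sample_path Zm (snd p)) (enn2real (fst p))) \<in> borel_measurable (borel \<Otimes>\<^sub>M M)"
    by (intro right_value_measurable measurable_compose[OF measurable_snd sample_paths_measurable(2)]) auto
  then show ?thesis
    by (rule measurable_cong[THEN iffD1, rotated]) (auto simp: space_pair_measure sample_path_values)
qed

text \<open>Since the two subordinators are independent, both steps of an iteration may be read off from one path of the pair.\<close>

lemma iteration_eq_distr: "iteration M Zp Zm c = distr M config_space (step c)"
proof (cases "running c")
  case False
  then show ?thesis
    using distr_const[of c config_space] by (cases c) (simp add: step_def[abs_def] return_def)
next
  case True
  let ?L = "borel \<Otimes>\<^sub>M borel \<Otimes>\<^sub>M borel :: (ennreal \<times> real \<times> real) measure"
  let ?S = "\<lambda>w. (lap c w, left_limit (\<lambda>t. Zp t w) (enn2real (lap c w)), jump (\<lambda>t. Zp t w) (enn2real (lap c w)))"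
  let ?k = "\<lambda>(t, zp, v). step2_law M Zm t \<bind> (\<lambda>zm. return config_space (update c t zp v zm))"
  have S: "?S \<in> measurable M ?L"
  proof -
    have "(\<lambda>w. passage (level c) (sample_path Zp w)) \<in> borel_measurable M" by (intro passage_measurable) measurable
    then have t [measurable]: "lap c \<in> borel_measurable M"
      unfolding lap_def[abs_def] by (simp add: passage_sample_path[where X=Zp, OF LP(4)] cong: measurable_cong)
    have "(\<lambda>w. left_value (sample_path Zp w) (enn2real (lap c w))) \<in> borel_measurable M"
      "(\<lambda>w. right_value (sample_path Zp w) (enn2real (lap c w))) \<in> borel_measurable M"
      by (intro left_value_measurable right_value_measurable sample_paths_measurable; simp)+
    then have [measurable]: "(\<lambda>w. left_limit (\<lambda>t. Zp t w) (enn2real (lap c w))) \<in> borel_measurable M"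
      "(\<lambda>w. Zp (enn2real (lap c w)) w) \<in> borel_measurable M"
      by (simp_all add: sample_path_values cong: measurable_cong)
    show ?thesis unfolding jump_def by measurable
  qed
  have iter: "iteration M Zp Zm c = distr M ?L ?S \<bind> ?k"
    using True by (cases c) (simp add: step1_law_def Let_def update_def lap_def case_prod_beta' cong: if_cong)
  have law2 [measurable]: "(\<lambda>x. step2_law M Zm (fst x)) \<in> measurable ?L (subprob_algebra borel)"
    unfolding step2_law_def
    by (rule measurable_compose[OF measurable_fst], rule measurable_distr2[where M=M])
       (use Zm_value_measurable prob_space_axioms in \<open>auto simp: case_prod_beta' space_subprob_algebra intro: prob_space_imp_subprob_space\<close>)
  have k: "?k \<in> measurable ?L (subprob_algebra config_space)"
    unfolding case_prod_beta' by measurable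
  show ?thesis
  proof (rule measure_eqI)
    show "sets (iteration M Zp Zm c) = sets (distr M config_space (step c))"
      unfolding iter using k not_empty by (subst sets_bind[OF sets_kernel[OF k]]) (auto simp: space_pair_measure)
    fix D assume "D \<in> sets (iteration M Zp Zm c)"
    then have D: "D \<in> sets config_space"
      unfolding iter using k not_empty by (subst (asm) sets_bind[OF sets_kernel[OF k]]) (auto simp: space_pair_measure)
    have "emeasure (iteration M Zp Zm c) D = (\<integral>\<^sup>+w. emeasure (?k (?S w)) D \<partial>M)"
    proof -
      have "emeasure (iteration M Zp Zm c) D = (\<integral>\<^sup>+x. emeasure (?k x) D \<partial>distr M ?L ?S)"
        unfolding iter by (rule emeasure_bind[OF _ _ D]) (use k not_empty in \<open>auto simp: space_pair_measure\<close>)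
      also have "\<dots> = (\<integral>\<^sup>+w. emeasure (?k (?S w)) D \<partial>M)"
        using nn_integral_distr[OF S, of "\<lambda>x. emeasure (?k x) D"] measurable_compose[OF k measurable_emeasure_subprob_algebra[OF D]] by simp
      finally show ?thesis .
    qed
    also have "\<dots> = (\<integral>\<^sup>+w. (\<integral>\<^sup>+w'. indicator D (path_step c (sample_path Zp w) (sample_path Zm w')) \<partial>M) \<partial>M)"
    proof (rule nn_integral_cong)
      fix w assume w: "w \<in> space M"
      let ?t = "lap c w"
      have Zm_t [measurable]: "Zm (enn2real ?t) \<in> borel_measurable M" by (intro LM(2)) simp
      have "emeasure (?k (?S w)) D = (\<integral>\<^sup>+zm. indicator D (update c ?t (fst (snd (?S w))) (snd (snd (?S w))) zm) \<partial>step2_law M Zm ?t)"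
        unfolding step2_law_def using D
        by (simp, subst emeasure_bind[where N=config_space]) (auto simp: not_empty)
      also have "\<dots> = (\<integral>\<^sup>+w'. indicator D (path_step c (sample_path Zp w) (sample_path Zm w')) \<partial>M)"
        unfolding step2_law_def using w D
        by (subst nn_integral_distr) (use Zm_t in \<open>auto intro!: nn_integral_cong simp: path_step_def lap_def Let_def passage_sample_path[where X=Zp, OF LP(4)] sample_path_values jump_def\<close>)
      finally show "emeasure (?k (?S w)) D = (\<integral>\<^sup>+w'. indicator D (path_step c (sample_path Zp w) (sample_path Zm w')) \<partial>M)" .
    qed
    \<comment> \<open>Two independent sampling steps correspond to two separate sample points;
      independence of \<open>Zp\<close> and \<open>Zm\<close> merges them into one.\<close>
    also have "\<dots> = (\<integral>\<^sup>+w. indicator D (path_step c (sample_path Zp w) (sample_path Zm w)) \<partial>M)"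
      using indep_processes_nn_integral[OF indep sample_paths_measurable prob_space_axioms,
          where h="\<lambda>p. indicator D (path_step c (fst p) (snd p))"] D
      by (simp add: measurable_compose[OF path_step_measurable borel_measurable_indicator])
    also have "\<dots> = (\<integral>\<^sup>+w. indicator D (step c w) \<partial>M)"
      using True by (intro nn_integral_cong) (simp add: step_eq_path_step)
    also have "\<dots> = emeasure (distr M config_space (step c)) D"
      using nn_integral_distr[of "step c" M config_space "indicator D"] D by simp
    finally show "emeasure (iteration M Zp Zm c) D = emeasure (distr M config_space (step c)) D" .
  qed
qed

lemma iteration_kernel: "iteration M Zp Zm \<in> measurable config_space (subprob_algebra config_space)"
  unfolding iteration_eq_distr[abs_def]
  by (rule measurable_distr2[where M=M])
     (use step_measurable prob_space_axioms in \<open>auto simp: case_prod_beta' space_subprob_algebra intro: prob_space_imp_subprob_space\<close>)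

end

section \<open>The final output determined by a configuration and the paths to come\<close>

definition path_result :: "config \<Rightarrow> (real \<Rightarrow> real) \<Rightarrow> (real \<Rightarrow> real) \<Rightarrow> result" where
  "path_result c f g = (if running c then
     (let t = min (passage (level c) (\<lambda>t\<in>{0..}. f t - g t)) (remaining c); r = enn2real t
      in (elapsed c + t, up_total c + left_value f r, down_total c + right_value g r,
          (right_value f r - left_value f r) - (right_value g r - left_value g r)))
     else config_output c)"

lemma config_output_eq: "config_output c = (elapsed c, up_total c - last_jump c, down_total c, last_jump c)"
  by (cases c) simp

lemma config_output_measurable [measurable]: "config_output \<in> measurable config_space result_space"
  unfolding config_output_eq[abs_def] by measurable

lemma path_result_measurable:
  assumes c [measurable]: "c \<in> measurable N config_space" and f: "f \<in> measurable N paths" and g: "g \<in> measurable N paths"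
  shows "(\<lambda>x. path_result (c x) (f x) (g x)) \<in> measurable N result_space"
proof -
  have "(\<lambda>x. \<lambda>t\<in>{0..}. f x t - g x t) \<in> measurable N paths"
    using path_component_measurable[OF f] path_component_measurable[OF g] by (intro measurable_restrict) auto
  then have [measurable]: "(\<lambda>x. passage (level (c x)) (\<lambda>t\<in>{0..}. f x t - g x t)) \<in> borel_measurable N"
    by (rule passage_measurable[OF _ measurable_compose[OF c config_measurable(6)]])
  have [measurable]: "(\<lambda>x. enn2real (min (passage (level (c x)) (\<lambda>t\<in>{0..}. f x t - g x t)) (remaining (c x)))) \<in> borel_measurable N" (is "?r \<in> _") by measurable
  have [measurable]: "(\<lambda>x. left_value (f x) (?r x)) \<in> borel_measurable N" "(\<lambda>x. left_value (g x) (?r x)) \<in> borel_measurable N"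
    by (intro left_value_measurable f g; measurable)+
  have [measurable]: "(\<lambda>x. right_value (f x) (?r x)) \<in> borel_measurable N" "(\<lambda>x. right_value (g x) (?r x)) \<in> borel_measurable N"
    by (intro right_value_measurable f g; simp)+
  show ?thesis unfolding path_result_def Let_def by measurable
qed

context levy_difference
begin

text \<open>The output that the true process gives when it continues from \<open>c\<close>: at the
  initial configuration this is the random vector in question, at a stopped one the output of the
  procedure. That its law is preserved by an iteration is the heart of the correctness
  proof.\<close>

definition result :: "config \<Rightarrow> 'a \<Rightarrow> result" where
  "result c w = path_result c (sample_path Zp w) (sample_path Zm w)"

definition cap :: "config \<Rightarrow> 'a \<Rightarrow> ennreal" where
  "cap c w = min (first_passage (\<lambda>t. Z t w) (level c)) (remaining c)"

definition continues :: "config \<Rightarrow> 'a \<Rightarrow> bool" where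
  "continues c w \<longleftrightarrow> lap c w < remaining c \<and> Z (enn2real (lap c w)) w < level c"

text \<open>The last jump is irrelevant while the procedure runs. It is set to \<open>0\<close> so that the new configuration is a
  function of the time and the position at which the iteration ends.\<close>

definition restart :: "config \<Rightarrow> 'a \<Rightarrow> config" where
  "restart c w = (let r = enn2real (lap c w) in (True, elapsed c + ennreal r, up_total c + Zp r w, down_total c + Zm r w,
     remaining c - ennreal r, level c - Z r w, 0))"

lemma result_measurable: "(\<lambda>p. result (fst p) (snd p)) \<in> measurable (config_space \<Otimes>\<^sub>M M) result_space"
  unfolding result_def
  by (intro path_result_measurable measurable_compose[OF measurable_snd sample_paths_measurable(1)]
      measurable_compose[OF measurable_snd sample_paths_measurable(2)]) measurable

lemma result_measurable_snd [measurable]: "result c \<in> measurable M result_space"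
  using measurable_compose[OF measurable_Pair1' result_measurable, of c] by simp

lemma result_running:
  assumes "w \<in> space M" "running c"
  shows "result c w = (elapsed c + cap c w, up_total c + left_limit (\<lambda>t. Zp t w) (enn2real (cap c w)),
    down_total c + Zm (enn2real (cap c w)) w, jump (\<lambda>t. Z t w) (enn2real (cap c w)))"
proof -
  have "passage (level c) (\<lambda>t\<in>{0..}. sample_path Zp w t - sample_path Zm w t) = first_passage (\<lambda>t. Z t w) (level c)"
    unfolding passage_cadlag[OF Z_cadlag[OF assms(1)], symmetric] by (intro passage_cong) (auto simp: sample_path_def Z_def)
  moreover have "left_limit (\<lambda>t. Z t w) r = left_limit (\<lambda>t. Zp t w) r - left_limit (\<lambda>t. Zm t w) r" for r
    unfolding Z_def using LP(4)[OF assms(1)] LM(4)[OF assms(1)] by (cases "0 < r") (auto simp: left_limit_diff, simp add: left_limit_def)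
  ultimately show ?thesis
    using assms unfolding result_def path_result_def cap_def Let_def by (simp add: sample_path_values jump_def Z_def)
qed

lemma result_stopped: "\<not> running c \<Longrightarrow> result c w = config_output c"
  by (simp add: result_def path_result_def)

lemma lap_finite: "continues c w \<Longrightarrow> lap c w < \<infinity>"
  unfolding continues_def by (auto intro: less_le_trans)

lemma lap_continues: "continues c w \<Longrightarrow> lap c w = first_passage (\<lambda>t. Zp t w) (level c)"
  unfolding continues_def lap_def by (auto simp: min_def split: if_splits)

lemma step_continues:
  assumes "running c" "continues c w"
  shows "step c w = (case restart c w of (go, T, Hp, Hm, A, b, v) \<Rightarrow> (go, T, Hp, Hm, A, b, jump (\<lambda>t. Zp t w) (enn2real (lap c w))))"
  using assms lap_finite[OF assms(2)] unfolding step_def restart_def continues_def Z_def update_def jump_def Let_def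
  by (auto simp: ennreal_enn2real_if algebra_simps)

lemma step_stops:
  assumes "running c" "\<not> continues c w"
  shows "\<not> running (step c w)" "config_output (step c w) = (elapsed c + lap c w, up_total c + left_limit (\<lambda>t. Zp t w) (enn2real (lap c w)),
    down_total c + Zm (enn2real (lap c w)) w, jump (\<lambda>t. Zp t w) (enn2real (lap c w)))"
  using assms unfolding step_def continues_def Z_def update_def jump_def by auto

lemma path_result_step:
  assumes "running c" "continues c w"
  shows "path_result (step c w) = path_result (restart c w)"
  unfolding step_continues[OF assms] by (auto simp: path_result_def fun_eq_iff restart_def Let_def)

lemma Z_before_lap:
  assumes w: "w \<in> space M" and c: "continues c w" and t: "0 < t" "t \<le> enn2real (lap c w)"
  shows "Z t w \<le> level c"
proof (cases "t = enn2real (lap c w)")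
  case True
  then show ?thesis using c unfolding continues_def by simp
next
  case False
  have "ennreal t < ennreal (enn2real (lap c w))" using False t by (intro ennreal_lessI) auto
  then have "ennreal t < first_passage (\<lambda>t. Zp t w) (level c)" using lap_finite[OF c] lap_continues[OF c] by simp
  from before_first_passage[OF t(1) this] show ?thesis using subordinatorD(3)[OF Zm _ w, of t] t by (simp add: Z_def)
qed

lemma post_path_values:
  assumes X: "cadlag (\<lambda>t. X t w)" and r: "0 \<le> r"
  shows "0 \<le> t \<Longrightarrow> right_value (post_path X r w) t = (X (r + t) w - X r w :: real)"
    "0 < t \<Longrightarrow> left_value (post_path X r w) t = left_limit (\<lambda>t. X t w) (r + t) - X r w"
proof -
  have Y: "cadlag (\<lambda>t. X (r + t) w - X r w)" using cadlag_shift[OF X r] .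
  show "right_value (post_path X r w) t = (X (r + t) w - X r w :: real)" if "0 \<le> t"
    using right_value_cadlag[OF Y that] right_value_cong[OF that, of "post_path X r w" "\<lambda>t. X (r + t) w - X r w"] that
    by (auto simp: post_path_def)
  show "left_value (post_path X r w) t = left_limit (\<lambda>t. X t w) (r + t) - X r w" if "0 < t"
    using left_value_cadlag[OF Y, of t] left_value_cong[of t "post_path X r w" "\<lambda>t. X (r + t) w - X r w"] left_limit_shift[OF X r that] that
    by (auto simp: post_path_def)
qed

lemma restart_first_passage:
  assumes w: "w \<in> space M" and c: "continues c w"
  shows "first_passage (\<lambda>t. Z t w) (level c) = lap c w +
    first_passage (\<lambda>t. Z (enn2real (lap c w) + t) w - Z (enn2real (lap c w)) w) (level (restart c w))"
  using first_passage_shift[of "enn2real (lap c w)" "\<lambda>t. Z t w" "level c"] Z_before_lap[OF w c] lap_finite[OF c]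
  by (simp add: restart_def Let_def)

text \<open>A restart changes neither passage time nor output, by shifting the path. Finiteness is
  required because \<open>enn2real \<infinity>\<close> is 0 and would make the two sides refer to
  different times.\<close>

lemma result_continues:
  assumes w: "w \<in> space M" and c: "running c" "continues c w"
    and fin: "remaining c < \<infinity> \<or> first_passage (\<lambda>t. Z t w) (level c) < \<infinity>"
  shows "path_result (restart c w) (post_path Zp (enn2real (lap c w)) w) (post_path Zm (enn2real (lap c w)) w) = result c w"
proof -
  let ?r = "enn2real (lap c w)"
  have r: "ennreal ?r = lap c w" "0 \<le> ?r" using lap_finite[OF c(2)] by auto
  let ?Y = "\<lambda>t. Z (?r + t) w - Z ?r w"
  let ?p = "first_passage ?Y (level (restart c w))"
  have Y: "cadlag ?Y" using cadlag_shift[OF Z_cadlag[OF w] r(2)] .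
  have lev: "0 < level (restart c w)" and rem: "remaining (restart c w) = remaining c - lap c w"
    using c(2) r unfolding continues_def restart_def Let_def by auto
  have pass: "passage (level (restart c w)) (\<lambda>t\<in>{0..}. post_path Zp ?r w t - post_path Zm ?r w t) = ?p"
    unfolding passage_cadlag[OF Y, symmetric] by (intro passage_cong) (auto simp: post_path_def Z_def)
  define \<sigma> where "\<sigma> = min ?p (remaining (restart c w))"
  have lap_lt: "lap c w < remaining c" using c(2) unfolding continues_def by simp
  have cap: "cap c w = lap c w + \<sigma>"
  proof -
    have rem_eq: "remaining c = lap c w + remaining (restart c w)" unfolding rem using diff_add_cancel_ennreal[OF less_imp_le[OF lap_lt]] by (metis add.commute)
    have add_min: "x + min y z = min (x + y) (x + z)" for x y z :: ennreal
      by (cases "y \<le> z") (auto simp: min_absorb1 min_absorb2 add_left_mono not_le less_imp_le)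
    from arg_cong2[where f=min, OF restart_first_passage[OF w c(2)] rem_eq]
    show ?thesis unfolding cap_def \<sigma>_def by (simp only: add_min)
  qed
  have "cap c w < \<infinity>" using fin unfolding cap_def by (auto simp: min_less_iff_disj)
  then have \<sigma>_fin: "\<sigma> < \<infinity>" unfolding cap by (auto simp: less_top)
  \<comment> \<open>After a restart the level is strictly positive, so the remaining time is too. At
    time 0 of the shifted path the convention for left limits would conceal a jump of the original
    path.\<close>
  have "0 < ?p" using first_passage_pos[OF Y] lev by simp
  moreover have "0 < remaining (restart c w)" unfolding rem using lap_lt by (simp add: diff_gt_0_iff_gt_ennreal)
  ultimately have "0 < \<sigma>" unfolding \<sigma>_def by simp
  with \<sigma>_fin have \<sigma>_pos: "0 < enn2real \<sigma>" by (simp add: enn2real_positive_iff)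
  have real: "enn2real (cap c w) = ?r + enn2real \<sigma>" unfolding cap using \<sigma>_fin lap_finite[OF c(2)]
    by (cases "lap c w"; cases \<sigma>) (auto simp: ennreal_plus[symmetric] simp del: ennreal_plus)
  have "left_limit (\<lambda>t. Z t w) (?r + enn2real \<sigma>) = left_limit (\<lambda>t. Zp t w) (?r + enn2real \<sigma>) - left_limit (\<lambda>t. Zm t w) (?r + enn2real \<sigma>)"
    unfolding Z_def using LP(4)[OF w] LM(4)[OF w] \<sigma>_pos r(2) by (intro left_limit_diff) auto
  moreover have "running (restart c w)" "elapsed (restart c w) = elapsed c + lap c w" "up_total (restart c w) = up_total c + Zp ?r w"
    "down_total (restart c w) = down_total c + Zm ?r w" unfolding restart_def Let_def using r by auto
  ultimately show ?thesis
    unfolding result_running[OF w c(1)] real unfolding path_result_def Let_def pass \<sigma>_def[symmetric] cap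
    using post_path_values[where X=Zp and t="enn2real \<sigma>", OF LP(4)[OF w] r(2)] post_path_values[where X=Zm and t="enn2real \<sigma>", OF LM(4)[OF w] r(2)] \<sigma>_pos
    by (simp add: jump_def Z_def add.assoc)
qed

end

context levy_difference
begin

lemma Z_value_measurable: "T \<in> borel_measurable M \<Longrightarrow> (\<And>w. w \<in> space M \<Longrightarrow> 0 \<le> T w) \<Longrightarrow> (\<lambda>w. Z (T w) w) \<in> borel_measurable M"
  using diff.X_at_measurable[OF refl diff.X_measurable, of T 0] by simp

lemma lap_measurable [measurable]: "lap c \<in> borel_measurable M"
proof -
  have "(\<lambda>w. first_passage (\<lambda>t. Zp t w) (level c)) \<in> borel_measurable M" by (intro pair.optional_time_measurable Zp_optional)
  then show ?thesis unfolding lap_def[abs_def] by measurable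
qed

lemma continues_measurable [measurable]: "Measurable.pred M (continues c)"
proof -
  have [measurable]: "(\<lambda>w. Z (enn2real (lap c w)) w) \<in> borel_measurable M" by (intro Z_value_measurable) auto
  show ?thesis unfolding continues_def[abs_def] by measurable
qed

text \<open>The new configuration depends only on the time and the position of the pair at the end
  of the iteration, so the strong Markov property of the pair applies.\<close>

lemma continue_markov:
  assumes H: "H \<in> borel_measurable (config_space \<Otimes>\<^sub>M (paths \<Otimes>\<^sub>M paths))"
  shows "(\<integral>\<^sup>+w. indicator {w\<in>space M. continues c w} w *
      H (restart c w, post_path Zp (enn2real (lap c w)) w, post_path Zm (enn2real (lap c w)) w) \<partial>M) =
    (\<integral>\<^sup>+w. indicator {w\<in>space M. continues c w} w *
      (\<integral>\<^sup>+w'. H (restart c w, sample_path Zp w', sample_path Zm w') \<partial>M) \<partial>M)"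
proof -
  define S where "S w = first_passage (\<lambda>t. Zp t w) (level c)" for w
  have S: "pair.optional_time S" unfolding S_def by (rule Zp_optional)
  let ?E = "{w\<in>space M. continues c w}"
  have lap: "lap c w = S w" if "continues c w" for w using lap_continues[OF that] by (simp add: S_def)
  have E_eq: "continues c w \<longleftrightarrow> S w < remaining c \<and> Z (enn2real (S w)) w < level c" for w
    unfolding continues_def lap_def S_def by (auto simp: min_def)
  \<comment> \<open>Continuing means that (time, position) lies in this set, and events of this form
    belong to the history where the passage has happened.\<close>
  define B where "B = {p :: real \<times> real \<times> real. ennreal (fst p) < remaining c \<and> fst (snd p) - snd (snd p) < level c}"
  have "{p \<in> space (borel \<Otimes>\<^sub>M borel :: (real \<times> real \<times> real) measure). ennreal (fst p) < remaining c \<and> fst (snd p) - snd (snd p) < level c} \<in> sets (borel \<Otimes>\<^sub>M borel)"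
    by measurable
  then have B: "B \<in> sets (borel \<Otimes>\<^sub>M borel)" by (simp add: space_pair_measure B_def)
  define first :: "(real \<Rightarrow> real \<times> real) \<Rightarrow> real \<Rightarrow> real" where "first f = (\<lambda>t\<in>{0..}. fst (f t))" for f
  define second :: "(real \<Rightarrow> real \<times> real) \<Rightarrow> real \<Rightarrow> real" where "second f = (\<lambda>t\<in>{0..}. snd (f t))" for f
  have comp: "(\<lambda>f. f t) \<in> borel_measurable (paths :: (real \<Rightarrow> real \<times> real) measure)" if "t \<in> {0..}" for t
    using that by (rule measurable_component_singleton)
  have [measurable]: "first \<in> measurable paths paths" "second \<in> measurable paths paths"
    unfolding first_def second_def
    by (intro measurable_restrict measurable_compose[OF comp] borel_measurable_fst_real borel_measurable_snd_real; assumption)+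
  define next_config where "next_config p = (True, elapsed c + ennreal (fst p), up_total c + fst (snd p), down_total c + snd (snd p),
      remaining c - ennreal (fst p), level c - (fst (snd p) - snd (snd p)), 0 :: real)" for p :: "real \<times> real \<times> real"
  have [measurable]: "next_config \<in> measurable (borel \<Otimes>\<^sub>M borel) config_space"
    unfolding next_config_def[abs_def] by measurable
  define h where "h p = H (next_config (fst p), first (snd p), second (snd p))" for p
  have h: "h \<in> borel_measurable ((borel \<Otimes>\<^sub>M borel) \<Otimes>\<^sub>M paths)"
    unfolding h_def[abs_def] by (rule measurable_compose[OF _ H]) measurable
  have paths: "first (post_path (joint Zp Zm) s w) = post_path Zp s w" "second (post_path (joint Zp Zm) s w) = post_path Zm s w"
    "first (sample_path (joint Zp Zm) w) = sample_path Zp w" "second (sample_path (joint Zp Zm) w) = sample_path Zm w" for s w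
    by (auto simp: first_def second_def post_path_def sample_path_def joint_def fun_eq_iff restrict_def)
  have next_eq: "next_config (enn2real (S w), joint Zp Zm (enn2real (S w)) w) = restart c w" if "continues c w" for w
    using lap[OF that] by (simp add: next_config_def restart_def joint_def Z_def Let_def)
  have "(\<integral>\<^sup>+w. indicator ?E w * h ((enn2real (S w), joint Zp Zm (enn2real (S w)) w), post_path (joint Zp Zm) (enn2real (S w)) w) \<partial>M) =
    (\<integral>\<^sup>+w. indicator ?E w * (\<integral>\<^sup>+w'. h ((enn2real (S w), joint Zp Zm (enn2real (S w)) w), sample_path (joint Zp Zm) w') \<partial>M) \<partial>M)"
  proof (rule pair.strong_markov[OF S _ _ _ h])
    show "?E \<in> sets M" by measurable
    show "S w < \<infinity>" if "w \<in> ?E" for w using that lap_finite[of c w] lap[of w] by simp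
    fix t :: real assume t: "0 \<le> t"
    have "?E \<inter> {w\<in>space M. S w < ennreal t} = {w\<in>space M. S w < ennreal t \<and> (enn2real (S w), joint Zp Zm (enn2real (S w)) w) \<in> B}"
    proof -
      have "ennreal (enn2real (S w)) = S w" if "S w < ennreal t" for w using less_trans[OF that ennreal_less_top] by simp
      then show ?thesis unfolding B_def E_eq by (auto simp: joint_def Z_def)
    qed
    then show "?E \<inter> {w\<in>space M. S w < ennreal t} \<in> sets (hist t)"
      using pair.optional_value_event[OF S B t] by simp
  qed
  then show ?thesis
    by (rule trans[OF trans[rotated]]; intro nn_integral_cong)
       (auto simp: indicator_def h_def paths next_eq lap)
qed

end

context infinite_levy_difference
begin

text \<open>When the procedure stops at time \<open>\<tau>\<close>, the jump of \<open>Z\<close> at \<open>\<tau>\<close> is a jump of \<open>Zp\<close> alone, and \<open>Z\<close> goes above its level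
  at \<open>\<tau>\<close> even when it hits that level exactly.\<close>

lemma AE_result_stops:
  assumes c: "running c" "0 < level c" "0 < remaining c"
  shows "AE w in M. \<not> continues c w \<longrightarrow> config_output (step c w) = result c w"
proof -
  \<comment> \<open>Covers an iteration ended by the horizon, which is a fixed time. An infinite
    horizon becomes time 0, where the left limit is the value by convention.\<close>
  have Zm_cap: "AE w in M. left_limit (\<lambda>t. Zm t w) (enn2real (remaining c)) = Zm (enn2real (remaining c)) w"
    using subordinator_no_fixed_jump[OF Zm, of "enn2real (remaining c)"] by (cases "enn2real (remaining c) = 0") (auto simp: left_limit_def less_le)
  show ?thesis
    using Zm_cap AE_passage_at_level[OF c(2)] indep_subordinator_no_common_jump[OF subordinatorD(1)[OF Zp] Zm indep c(2)] AE_space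
  proof eventually_elim
    case (elim w)
    show ?case
    proof
      assume stops: "\<not> continues c w"
      let ?\<theta> = "first_passage (\<lambda>t. Zp t w) (level c)"
      have cap: "cap c w = lap c w \<and> left_limit (\<lambda>t. Zm t w) (enn2real (lap c w)) = Zm (enn2real (lap c w)) w"
      proof (cases "?\<theta> < remaining c")
        case False
        then have "remaining c \<le> first_passage (\<lambda>t. Z t w) (level c)" using first_passage_Z_ge[OF elim(4), of "level c"] by (simp add: not_less)
        then show ?thesis using False elim(1) by (simp add: cap_def lap_def min_absorb2 not_less)
      next
        case True
        then have lap: "lap c w = ?\<theta>" by (simp add: lap_def min_absorb1 less_imp_le)
        then have "level c \<le> Z (enn2real ?\<theta>) w" using stops True by (simp add: continues_def not_less)
        have fin: "?\<theta> < \<infinity>" using True by (rule less_le_trans) simp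
        have "first_passage (\<lambda>t. Z t w) (level c) = ?\<theta>"
        proof (cases "Z (enn2real ?\<theta>) w = level c")
          case True
          then show ?thesis using elim(2) fin by simp
        next
          case False
          have "0 < ?\<theta>" using first_passage_pos[OF LP(4)[OF elim(4)]] LP(3)[OF elim(4)] c(2) by simp
          then have "0 < enn2real ?\<theta>" using fin by (simp add: enn2real_positive_iff)
          moreover have "level c < Z (enn2real ?\<theta>) w" using False \<open>level c \<le> _\<close> by simp
          ultimately have "first_passage (\<lambda>t. Z t w) (level c) \<le> ennreal (enn2real ?\<theta>)" unfolding first_passage_def[of "\<lambda>t. Z t w"] by (intro INF_lower) auto
          then show ?thesis using fin first_passage_Z_ge[OF elim(4), of "level c"] by simp
        qed
        then show ?thesis using elim(3) fin lap True by (simp add: cap_def min_absorb1 less_imp_le)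
      qed
      have "left_limit (\<lambda>t. Z t w) r = left_limit (\<lambda>t. Zp t w) r - left_limit (\<lambda>t. Zm t w) r" for r
        unfolding Z_def using LP(4)[OF elim(4)] LM(4)[OF elim(4)] by (cases "0 < r") (auto simp: left_limit_diff, simp add: left_limit_def)
      then show "config_output (step c w) = result c w"
        unfolding step_stops(2)[OF c(1) stops] result_running[OF elim(4) c(1)] using cap by (simp add: jump_def Z_def)
    qed
  qed
qed

text \<open>On the event of continuing, the path after the iteration may be replaced by an
  independent copy; on its complement the output is already the correct one almost surely.\<close>

lemma result_step:
  assumes c: "running c" "0 < level c" "0 < remaining c"
    and fin: "AE w in M. remaining c < \<infinity> \<or> first_passage (\<lambda>t. Z t w) (level c) < \<infinity>"
    and D [measurable]: "D \<in> sets result_space"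
  shows "(\<integral>\<^sup>+w. (\<integral>\<^sup>+w'. indicator D (result (step c w) w') \<partial>M) \<partial>M) = (\<integral>\<^sup>+w. indicator D (result c w) \<partial>M)"
proof -
  let ?E = "{w\<in>space M. continues c w}"
  have E [measurable]: "?E \<in> sets M" by measurable
  have V_meas: "(\<lambda>w. \<integral>\<^sup>+w'. indicator D (result (step c w) w') \<partial>M) \<in> borel_measurable M"
  proof (intro borel_measurable_nn_integral)
    have "(\<lambda>p. (step c (fst p), snd p)) \<in> measurable (M \<Otimes>\<^sub>M M) (config_space \<Otimes>\<^sub>M M)" by measurable
    from measurable_compose[OF measurable_compose[OF this result_measurable] borel_measurable_indicator[OF D]]
    show "(\<lambda>(w, w'). indicator D (result (step c w) w') :: ennreal) \<in> borel_measurable (M \<Otimes>\<^sub>M M)" by (simp add: case_prod_beta')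
  qed
  define H :: "config \<times> (real \<Rightarrow> real) \<times> (real \<Rightarrow> real) \<Rightarrow> ennreal" where "H p = indicator D (path_result (fst p) (fst (snd p)) (snd (snd p)))" for p
  have H: "H \<in> borel_measurable (config_space \<Otimes>\<^sub>M (paths \<Otimes>\<^sub>M paths))"
    unfolding H_def[abs_def]
    by (rule measurable_compose[OF path_result_measurable borel_measurable_indicator[OF D]]) measurable
  have "(\<integral>\<^sup>+w. indicator D (result c w) \<partial>M) = (\<integral>\<^sup>+w. indicator ?E w * indicator D (result c w) + indicator (space M - ?E) w * indicator D (result c w) \<partial>M)"
    by (intro nn_integral_cong) (auto simp: indicator_def)
  also have "\<dots> = (\<integral>\<^sup>+w. indicator ?E w * indicator D (result c w) \<partial>M) + (\<integral>\<^sup>+w. indicator (space M - ?E) w * indicator D (result c w) \<partial>M)"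
    by (intro nn_integral_add) measurable
  also have "(\<integral>\<^sup>+w. indicator ?E w * indicator D (result c w) \<partial>M) =
    (\<integral>\<^sup>+w. indicator ?E w * H (restart c w, post_path Zp (enn2real (lap c w)) w, post_path Zm (enn2real (lap c w)) w) \<partial>M)"
    by (rule nn_integral_cong_AE, use fin AE_space in eventually_elim)
       (auto simp: indicator_def H_def result_continues[OF _ c(1)])
  also have "\<dots> = (\<integral>\<^sup>+w. indicator ?E w * (\<integral>\<^sup>+w'. indicator D (result (step c w) w') \<partial>M) \<partial>M)"
    unfolding continue_markov[OF H]
    by (intro nn_integral_cong) (auto simp: indicator_def[of ?E] H_def result_def path_result_step[OF c(1)])
  also have "(\<integral>\<^sup>+w. indicator (space M - ?E) w * indicator D (result c w) \<partial>M) =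
    (\<integral>\<^sup>+w. indicator (space M - ?E) w * (\<integral>\<^sup>+w'. indicator D (result (step c w) w') \<partial>M) \<partial>M)"
    by (rule nn_integral_cong_AE, use AE_result_stops[OF c] AE_space in eventually_elim)
       (auto simp: indicator_def[of "_ - _"] result_stopped step_stops[OF c(1)] emeasure_space_1)
  also have "(\<integral>\<^sup>+w. indicator ?E w * (\<integral>\<^sup>+w'. indicator D (result (step c w) w') \<partial>M) \<partial>M) + \<dots> =
    (\<integral>\<^sup>+w. indicator ?E w * (\<integral>\<^sup>+w'. indicator D (result (step c w) w') \<partial>M) +
      indicator (space M - ?E) w * (\<integral>\<^sup>+w'. indicator D (result (step c w) w') \<partial>M) \<partial>M)"
    by (intro nn_integral_add[symmetric] borel_measurable_times_ennreal V_meas) measurable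
  also have "\<dots> = (\<integral>\<^sup>+w. (\<integral>\<^sup>+w'. indicator D (result (step c w) w') \<partial>M) \<partial>M)"
    by (intro nn_integral_cong) (auto simp: indicator_def[of ?E] indicator_def[of "_ - _"])
  finally show ?thesis ..
qed

end

definition discount :: "config \<Rightarrow> ennreal" where
  "discount c = (if running c then ennreal (exp (- enn2real (elapsed c))) else 0)"

lemma discount_measurable [measurable]: "discount \<in> borel_measurable config_space"
  unfolding discount_def[abs_def] by measurable

section \<open>Loss of discount in one iteration\<close>

context levy_difference
begin

lemma discount_step:
  assumes c: "running c" "elapsed c < \<infinity>"
  shows "discount (step c w) = indicator {w. continues c w} w * discount (restart c w)"
    and "continues c w \<Longrightarrow> discount (restart c w) = discount c * ennreal (exp (- enn2real (lap c w)))"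
proof -
  show "discount (step c w) = indicator {w. continues c w} w * discount (restart c w)"
    using step_stops(1)[OF c(1), of w] step_continues[OF c(1), of w]
    by (cases "continues c w") (auto simp: discount_def restart_def Let_def)
  assume "continues c w"
  then show "discount (restart c w) = discount c * ennreal (exp (- enn2real (lap c w)))"
    using c by (simp add: discount_def restart_def Let_def enn2real_plus ennreal_mult[symmetric] exp_add[symmetric])
qed

lemma discount_step_le:
  assumes c: "running c" "elapsed c < \<infinity>" and Y [measurable]: "Y \<in> borel_measurable M"
    and le: "\<And>w. w \<in> space M \<Longrightarrow> continues c w \<Longrightarrow> exp (- enn2real (lap c w)) \<le> Y w"
  shows "(\<integral>\<^sup>+w. discount (step c w) \<partial>M) \<le> discount c * (\<integral>\<^sup>+w. ennreal (Y w) \<partial>M)"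
proof -
  have "(\<integral>\<^sup>+w. discount (step c w) \<partial>M) \<le> (\<integral>\<^sup>+w. discount c * ennreal (Y w) \<partial>M)"
    using le by (intro nn_integral_mono) (auto simp: discount_step[OF c] indicator_def intro!: mult_left_mono ennreal_leI)
  then show ?thesis by (simp add: nn_integral_cmult)
qed

text \<open>Reaching a level of at least \<open>\<epsilon>\<close> takes at least as long as
  reaching \<open>\<epsilon>\<close>, and that time is strictly positive, so the expected discount
  factor is below 1 uniformly over such levels.\<close>

lemma decay_above_level:
  assumes \<epsilon>: "0 < \<epsilon>"
  obtains \<kappa> where "0 \<le> \<kappa>" "\<kappa> < 1"
    "\<And>c. running c \<Longrightarrow> elapsed c < \<infinity> \<Longrightarrow> \<epsilon> \<le> level c \<Longrightarrow> (\<integral>\<^sup>+w. discount (step c w) \<partial>M) \<le> discount c * ennreal \<kappa>"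
proof
  \<comment> \<open>The minimum with 1 keeps the time finite;
    \<open>enn2real \<infinity> = 0\<close> would otherwise turn the smallest factor into 1.\<close>
  define Y where "Y w = exp (- enn2real (min (first_passage (\<lambda>t. Zp t w) \<epsilon>) 1))" for w
  have [measurable]: "(\<lambda>w. first_passage (\<lambda>t. Zp t w) \<epsilon>) \<in> borel_measurable M" by (intro pair.optional_time_measurable Zp_optional)
  have Y [measurable]: "Y \<in> borel_measurable M" unfolding Y_def by measurable
  have Y_int: "integrable M Y" by (intro integrable_const_bound[of _ 1]) (auto simp: Y_def)
  show "0 \<le> expectation Y" by (intro integral_nonneg_AE) (simp add: Y_def)
  have "AE w in M. Y w < 1"
  proof (intro AE_I2)
    fix w assume "w \<in> space M"
    then have "0 < first_passage (\<lambda>t. Zp t w) \<epsilon>" using first_passage_pos[OF LP(4), of w \<epsilon>] LP(3) \<epsilon> by simp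
    then have "0 < enn2real (min (first_passage (\<lambda>t. Zp t w) \<epsilon>) 1)" by (simp add: enn2real_positive_iff min_less_iff_disj)
    then show "Y w < 1" by (simp add: Y_def)
  qed
  then have "expectation Y < expectation (\<lambda>_. 1)" using Y_int by (intro integral_less_AE_space) (auto simp: emeasure_space_1)
  then show "expectation Y < 1" by (simp add: prob_space)
  fix c assume c: "running c" "elapsed c < \<infinity>" "\<epsilon> \<le> level c"
  have "(\<integral>\<^sup>+w. discount (step c w) \<partial>M) \<le> discount c * (\<integral>\<^sup>+w. ennreal (Y w) \<partial>M)"
  proof (rule discount_step_le[OF c(1,2) Y])
    fix w assume "continues c w"
    then have "lap c w < \<infinity>" "min (first_passage (\<lambda>t. Zp t w) \<epsilon>) 1 \<le> lap c w"
      using lap_finite first_passage_mono[OF c(3), of "\<lambda>t. Zp t w"] by (auto simp: lap_continues min_le_iff_disj)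
    then show "exp (- enn2real (lap c w)) \<le> Y w" unfolding Y_def by (simp add: enn2real_mono)
  qed
  also have "(\<integral>\<^sup>+w. ennreal (Y w) \<partial>M) = ennreal (expectation Y)" by (rule nn_integral_eq_integral[OF Y_int]) (simp add: Y_def)
  finally show "(\<integral>\<^sup>+w. discount (step c w) \<partial>M) \<le> discount c * ennreal (expectation Y)" .
qed

text \<open>If the iteration continues, \<open>Zp\<close> has reached the level but \<open>Z\<close>
  is below it, so \<open>Zm\<close> has left 0. On the event that \<open>Zm\<close> rests up to
  \<open>t0\<close> a continuing iteration thus lasts at least \<open>t0\<close>, whatever the
  level.\<close>

lemma decay_if_zero_possible:
  assumes t0: "0 < t0" and zero: "0 < prob {w\<in>space M. Zm t0 w = 0}"
  obtains \<kappa> where "0 \<le> \<kappa>" "\<kappa> < 1"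
    "\<And>c. running c \<Longrightarrow> elapsed c < \<infinity> \<Longrightarrow> (\<integral>\<^sup>+w. discount (step c w) \<partial>M) \<le> discount c * ennreal \<kappa>"
proof
  let ?F = "{w\<in>space M. Zm t0 w = 0}" and ?e = "exp (- t0)"
  let ?Y = "\<lambda>w. 1 - (1 - ?e) * indicat_real ?F w"
  have Zm_t [measurable]: "Zm t0 \<in> borel_measurable M" by (rule LM(2)[OF less_imp_le[OF t0]])
  have Y_int: "integrable M ?Y" using t0 by (intro integrable_const_bound[of _ 1]) (auto simp: indicator_def)
  have EY: "expectation ?Y = 1 - (1 - ?e) * prob ?F"
    by (subst Bochner_Integration.integral_diff) (auto simp: prob_space emeasure_eq_measure)
  show "0 \<le> expectation ?Y" by (intro integral_nonneg_AE) (auto simp: indicator_def)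
  have "0 < (1 - ?e) * prob ?F" using t0 by (intro mult_pos_pos zero) simp
  then show "expectation ?Y < 1" unfolding EY by linarith
  fix c assume c: "running c" "elapsed c < \<infinity>"
  have "(\<integral>\<^sup>+w. discount (step c w) \<partial>M) \<le> discount c * (\<integral>\<^sup>+w. ennreal (?Y w) \<partial>M)"
  proof (rule discount_step_le[OF c])
    fix w assume w: "w \<in> space M" and cont: "continues c w"
    let ?r = "enn2real (lap c w)"
    have "first_passage (\<lambda>t. Zp t w) (level c) = ennreal ?r" using lap_continues[OF cont] lap_finite[OF cont] by simp
    from at_first_passage[OF LP(4)[OF w] this] have "level c \<le> Zp ?r w" by simp
    then have "0 < Zm ?r w" using cont by (simp add: continues_def Z_def)
    then have "t0 \<le> ?r" if "Zm t0 w = 0"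
      using subordinatorD(4)[OF Zm _ _ w, of ?r t0] that by (cases "?r \<le> t0") auto
    then show "exp (- ?r) \<le> ?Y w" by (auto simp: indicator_def)
  qed measurable
  also have "(\<integral>\<^sup>+w. ennreal (?Y w) \<partial>M) = ennreal (expectation ?Y)" using t0 by (intro nn_integral_eq_integral[OF Y_int]) (auto simp: indicator_def)
  finally show "(\<integral>\<^sup>+w. discount (step c w) \<partial>M) \<le> discount c * ennreal (expectation ?Y)" .
qed

text \<open>The threshold \<open>u - 1 / (n + 1)\<close> is negative, so the level counts as
  approached at time 0, with full weight.\<close>

lemma approach_prob_eq_1:
  assumes "0 < u" "u < 1 / real (Suc n)"
  shows "approach_prob n u = 1"
proof -
  have "approach_weight n u (\<lambda>t. Z t w) = 1" if w: "w \<in> space M" for w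
  proof -
    have "approach n u (\<lambda>t. Z t w) = ennreal 0"
      unfolding approach_eq_passage[OF w] using first_passage_0[OF Z_cadlag[OF w]] Z_0[OF w] assms(2) by simp
    from approach_weight_real[OF Z_cadlag[OF w] Z_0[OF w] assms(1) this] show ?thesis using Z_0[OF w] assms(1) by simp
  qed
  then show ?thesis unfolding approach_prob_def by (simp add: prob_space cong: Bochner_Integration.integral_cong)
qed

text \<open>Positivity of \<open>Zm\<close> keeps \<open>Z\<close> strictly below the level until the iteration ends, so that an approach
  during the iteration cannot overshoot.\<close>

lemma approach_weight_restart:
  assumes w: "w \<in> space M" and cont: "continues c w" and pos: "\<And>t. 0 < t \<Longrightarrow> 0 < Zm t w" and lev: "0 < level c"
  shows "exp (- enn2real (lap c w)) * approach_weight n (level (restart c w)) (\<lambda>t. Z (enn2real (lap c w) + t) w - Z (enn2real (lap c w)) w)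
    \<le> approach_weight n (level c) (\<lambda>t. Z t w)"
proof -
  let ?r = "enn2real (lap c w)" and ?\<delta> = "1 / real (Suc n)"
  let ?Y = "\<lambda>t. Z (?r + t) w - Z ?r w"
  have Y: "cadlag ?Y" by (intro cadlag_shift Z_cadlag w) simp
  have lev': "level (restart c w) = level c - Z ?r w" "0 < level c - Z ?r w"
    using cont unfolding restart_def continues_def by (auto simp: Let_def)
  have fp: "first_passage (\<lambda>t. Zp t w) (level c) = ennreal ?r" using lap_continues[OF cont] lap_finite[OF cont] by simp
  have below: "Z t w < level c" if "0 \<le> t" "t \<le> ?r" for t
  proof (cases "t = 0 \<or> t = ?r")
    case True
    then show ?thesis using lev lev' Z_0[OF w] by auto
  next
    case False
    then have t: "0 < t" "ennreal t < ennreal ?r" using that by (auto intro!: ennreal_lessI)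
    have "Zp t w \<le> level c" using before_first_passage[OF t(1), of "\<lambda>t. Zp t w"] t(2) fp by simp
    then show ?thesis using pos[OF t(1)] by (simp add: Z_def)
  qed
  show ?thesis
  \<comment> \<open>The approach of the original level happens before, at, or after the end of the
    iteration. In the first two cases its own discount is at least \<open>exp (- ?r)\<close>; in the
    last one the two approaches coincide.\<close>
  proof (cases "approach n (level c) (\<lambda>t. Z t w) < ennreal ?r")
    case True
    then obtain \<rho> where \<rho>: "approach n (level c) (\<lambda>t. Z t w) = ennreal \<rho>" "0 \<le> \<rho>" "\<rho> < ?r"
      by (cases "approach n (level c) (\<lambda>t. Z t w)") (auto simp: ennreal_less_iff)
    have "approach_weight n (level c) (\<lambda>t. Z t w) = exp (- \<rho>)"
      using approach_weight_real[OF Z_cadlag[OF w] Z_0[OF w] lev \<rho>(1,2)] below[OF \<rho>(2)] \<rho>(3) by simp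
    moreover have "exp (- ?r) * approach_weight n (level (restart c w)) ?Y \<le> exp (- ?r) * 1"
      by (intro mult_left_mono weight_bounds) simp
    ultimately show ?thesis using \<rho>(3) by (smt (verit) exp_le_cancel_iff)
  next
    case False
    then have ge: "ennreal ?r \<le> first_passage (\<lambda>t. Z t w) (level c - ?\<delta>)" using approach_eq_passage[OF w] by simp
    show ?thesis
    proof (cases "approach n (level (restart c w)) ?Y")
      case (real \<rho>)
      have first: "first_passage ?Y (level c - Z ?r w - ?\<delta>) = ennreal \<rho>" using real(2) approach_cadlag[OF Y] lev'(1) by simp
      show ?thesis
      proof (cases "Z ?r w \<le> level c - ?\<delta>")
        case True
        have "first_passage (\<lambda>t. Z t w) (level c - ?\<delta>) = ennreal ?r + first_passage ?Y (level c - ?\<delta> - Z ?r w)"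
        proof (rule first_passage_shift)
          fix t assume t: "0 < t" "t \<le> ?r"
          show "Z t w \<le> level c - ?\<delta>"
          proof (cases "t = ?r")
            case False
            then have "ennreal t < first_passage (\<lambda>t. Z t w) (level c - ?\<delta>)" using t ge by (intro less_le_trans[OF ennreal_lessI]) auto
            then show ?thesis using before_first_passage[OF t(1)] by blast
          qed (use True in simp)
        qed simp
        then have "approach n (level c) (\<lambda>t. Z t w) = ennreal (?r + \<rho>)"
          using first real(1) unfolding approach_eq_passage[OF w] by (simp add: algebra_simps)
        from approach_weight_real[OF Z_cadlag[OF w] Z_0[OF w] lev this]
        have "approach_weight n (level c) (\<lambda>t. Z t w) = (if Z (?r + \<rho>) w < level c then exp (- (?r + \<rho>)) else 0)" using real(1) by simp
        moreover have "approach_weight n (level (restart c w)) ?Y = (if ?Y \<rho> < level c - Z ?r w then exp (- \<rho>) else 0)"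
          using approach_weight_real[OF Y _ _ real(2,1)] lev' by simp
        ultimately show ?thesis by (auto simp: exp_diff exp_minus field_simps exp_add)
      next
        case False
        have "0 < ?r" using first_passage_pos[OF LP(4)[OF w], of "level c"] LP(3)[OF w] lev fp by (simp add: less_le)
        then have "first_passage (\<lambda>t. Z t w) (level c - ?\<delta>) \<le> ennreal ?r" unfolding first_passage_def using False by (intro INF_lower) auto
        then have "approach n (level c) (\<lambda>t. Z t w) = ennreal ?r" using ge approach_eq_passage[OF w] by simp
        from approach_weight_real[OF Z_cadlag[OF w] Z_0[OF w] lev this]
        have "approach_weight n (level c) (\<lambda>t. Z t w) = exp (- ?r)" using lev' by simp
        moreover have "exp (- ?r) * approach_weight n (level (restart c w)) ?Y \<le> exp (- ?r) * 1"
          by (intro mult_left_mono weight_bounds) simp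
        ultimately show ?thesis by simp
      qed
    next
      case top
      then have "approach_weight n (level (restart c w)) ?Y = 0" by (simp add: approach_weight_def)
      then show ?thesis using weight_bounds(3)[of n "level c" "\<lambda>t. Z t w"] by simp
    qed
  qed
qed

text \<open>Pathwise, the discounted approach weight after the restart is at most the one before it.
  The strong Markov property replaces the weight of the continued path by its expectation for the
  new level.\<close>

lemma approach_supermartingale:
  assumes c: "running c" "elapsed c < \<infinity>" "0 < level c" and pos: "AE w in M. \<forall>t>0. 0 < Zm t w"
  shows "(\<integral>\<^sup>+w. discount (step c w) * ennreal (approach_prob n (level (step c w))) \<partial>M) \<le> discount c * ennreal (approach_prob n (level c))"
proof -
  let ?E = "{w\<in>space M. continues c w}"
  define H where "H p = discount (fst p) * ennreal (approach_weight n (level (fst p)) (\<lambda>t\<in>{0..}. fst (snd p) t - snd (snd p) t))"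
    for p :: "config \<times> (real \<Rightarrow> real) \<times> (real \<Rightarrow> real)"
  have H: "H \<in> borel_measurable (config_space \<Otimes>\<^sub>M (paths \<Otimes>\<^sub>M paths))"
  proof -
    have path: "(\<lambda>p. \<lambda>t\<in>{0..}. fst (snd p) t - snd (snd p) t :: real) \<in> measurable (config_space \<Otimes>\<^sub>M (paths \<Otimes>\<^sub>M paths)) paths"
      (is "_ \<in> measurable ?S _")
    proof (rule measurable_restrict)
      fix t :: real assume t: "t \<in> {0..}"
      have "(\<lambda>p. fst (snd p)) \<in> measurable ?S paths" "(\<lambda>p. snd (snd p)) \<in> measurable ?S paths" by measurable
      from path_component_measurable[OF this(1)] path_component_measurable[OF this(2)] t
      show "(\<lambda>p. fst (snd p) t - snd (snd p) t) \<in> borel_measurable ?S" by (intro borel_measurable_diff) auto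
    qed
    have "(\<lambda>p. level (fst p)) \<in> borel_measurable ?S" by measurable
    from approach_weight_measurable[OF path this]
    show ?thesis unfolding H_def[abs_def] by measurable
  qed
  have "(\<integral>\<^sup>+w. discount (step c w) * ennreal (approach_prob n (level (step c w))) \<partial>M) =
    (\<integral>\<^sup>+w. indicator ?E w * (\<integral>\<^sup>+w'. H (restart c w, sample_path Zp w', sample_path Zm w') \<partial>M) \<partial>M)"
  proof (rule nn_integral_cong)
    fix w assume w: "w \<in> space M"
    have "level (step c w) = level (restart c w)" if "continues c w" using step_continues[OF c(1) that] by (cases "restart c w") simp
    moreover have "approach_weight n b (\<lambda>t\<in>{0..}. sample_path Zp w' t - sample_path Zm w' t) = approach_weight n b (\<lambda>t. Z t w')" for b w'
      by (rule approach_weight_cong) (auto simp: sample_path_def Z_def)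
    then have "(\<integral>\<^sup>+w'. H (restart c w, sample_path Zp w', sample_path Zm w') \<partial>M) = discount (restart c w) * ennreal (approach_prob n (level (restart c w)))"
      unfolding H_def by (simp add: nn_integral_cmult nn_approach_prob)
    ultimately show "discount (step c w) * ennreal (approach_prob n (level (step c w))) =
        indicator ?E w * (\<integral>\<^sup>+w'. H (restart c w, sample_path Zp w', sample_path Zm w') \<partial>M)"
      using w by (simp add: discount_step(1)[OF c(1,2)] indicator_def)
  qed
  also have "\<dots> = (\<integral>\<^sup>+w. indicator ?E w * H (restart c w, post_path Zp (enn2real (lap c w)) w, post_path Zm (enn2real (lap c w)) w) \<partial>M)"
    by (rule continue_markov[OF H, symmetric])
  also have "\<dots> \<le> (\<integral>\<^sup>+w. discount c * ennreal (approach_weight n (level c) (\<lambda>t. Z t w)) \<partial>M)"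
  proof (rule nn_integral_mono_AE, use pos AE_space in eventually_elim)
    case (elim w)
    show ?case
    proof (cases "continues c w")
      case True
      let ?r = "enn2real (lap c w)"
      have "approach_weight n b (\<lambda>t\<in>{0..}. post_path Zp ?r w t - post_path Zm ?r w t) = approach_weight n b (\<lambda>t. Z (?r + t) w - Z ?r w)" for b
        by (rule approach_weight_cong) (auto simp: post_path_def Z_def)
      then have "H (restart c w, post_path Zp ?r w, post_path Zm ?r w) =
        discount c * ennreal (exp (- ?r) * approach_weight n (level (restart c w)) (\<lambda>t. Z (?r + t) w - Z ?r w))"
        unfolding H_def by (simp add: discount_step(2)[OF c(1,2) True] ennreal_mult weight_bounds mult.assoc)
      also have "\<dots> \<le> discount c * ennreal (approach_weight n (level c) (\<lambda>t. Z t w))"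
        using elim(1) by (intro mult_left_mono ennreal_leI approach_weight_restart[OF elim(2) True _ c(3)]) auto
      finally show ?thesis using elim(2) True by simp
    qed (simp add: indicator_def)
  qed
  also have "\<dots> = discount c * ennreal (approach_prob n (level c))"
    by (simp add: nn_integral_cmult nn_approach_prob)
  finally show ?thesis .
qed

end

section \<open>Termination and the law of the output\<close>

locale sampling_procedure = infinite_levy_difference M Zp Zm \<nu> d dm
  for M :: "'a measure" and Zp Zm :: "real \<Rightarrow> 'a \<Rightarrow> real" and \<nu> :: "real measure" and d dm :: real +
  fixes a :: real and K :: ennreal and N :: "'w measure" and C :: "nat \<Rightarrow> 'w \<Rightarrow> config"
  assumes a: "0 < a" and K: "0 < K" and run: "procedure_run M Zp Zm a K N C"
    and reaches: "K < \<infinity> \<or> (\<forall>b. AE w in M. first_passage (\<lambda>t. Z t w) b < \<infinity>)"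
begin

sublocale N: prob_space N
  using run unfolding procedure_run_def by blast

lemma C_measurable [measurable]: "C n \<in> measurable N config_space"
  using run unfolding procedure_run_def by blast

lemma C_0: "AE w in N. C 0 w = initial_config a K"
  using run unfolding procedure_run_def by blast

lemma transition_event:
  assumes B: "B \<in> sets config_space" and D: "D \<in> sets config_space"
  shows "emeasure N {w\<in>space N. C n w \<in> B \<and> C (Suc n) w \<in> D} =
    (\<integral>\<^sup>+w. indicator B (C n w) * emeasure M {y\<in>space M. step (C n w) y \<in> D} \<partial>N)"
proof -
  let ?P = "PiM {..n} (\<lambda>_. config_space)"
  let ?B = "{x\<in>space ?P. x n \<in> B}"
  have "(\<lambda>x. x n) \<in> measurable ?P config_space" by (rule measurable_component_singleton) simp
  then have "?B \<in> sets ?P" using B by measurable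
  then have "emeasure N {w\<in>space N. (\<lambda>i\<in>{..n}. C i w) \<in> ?B \<and> C (Suc n) w \<in> D} =
    (\<integral>\<^sup>+w. indicator ?B (\<lambda>i\<in>{..n}. C i w) * emeasure (iteration M Zp Zm (C n w)) D \<partial>N)"
    using run D unfolding procedure_run_def by blast
  moreover have mem: "(\<lambda>i\<in>{..n}. C i w) \<in> ?B \<longleftrightarrow> C n w \<in> B" for w by (auto simp: space_PiM)
  moreover have law: "emeasure (iteration M Zp Zm c) D = emeasure M {y\<in>space M. step c y \<in> D}" for c
    unfolding iteration_eq_distr using D by (subst emeasure_distr) (auto intro!: arg_cong[where f="emeasure M"])
  ultimately show ?thesis by (simp only: indicator_def mem law)
qed

lemma transition:
  assumes h: "h \<in> borel_measurable config_space"
  shows "(\<integral>\<^sup>+w. h (C (Suc n) w) \<partial>N) = (\<integral>\<^sup>+w. (\<integral>\<^sup>+y. h (step (C n w) y) \<partial>M) \<partial>N)"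
proof -
  have kernel: "iteration M Zp Zm \<in> measurable (distr N config_space (C n)) (subprob_algebra config_space)"
    using iteration_kernel by simp
  have "distr N config_space (C (Suc n)) = distr N config_space (C n) \<bind> iteration M Zp Zm"
  proof (rule measure_eqI)
    show sets: "sets (distr N config_space (C (Suc n))) = sets (distr N config_space (C n) \<bind> iteration M Zp Zm)"
      by (subst sets_bind[OF sets_kernel[OF kernel]]) auto
    fix D assume "D \<in> sets (distr N config_space (C (Suc n)))"
    then have D: "D \<in> sets config_space" by simp
    have "emeasure (distr N config_space (C n) \<bind> iteration M Zp Zm) D = (\<integral>\<^sup>+w. emeasure (iteration M Zp Zm (C n w)) D \<partial>N)"
      using nn_integral_distr[OF C_measurable, of "\<lambda>c. emeasure (iteration M Zp Zm c) D" n]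
        measurable_compose[OF kernel measurable_emeasure_subprob_algebra[OF D]]
      by (subst emeasure_bind[OF _ kernel D]) auto
    also have "\<dots> = (\<integral>\<^sup>+w. indicator UNIV (C n w) * emeasure M {y\<in>space M. step (C n w) y \<in> D} \<partial>N)"
      unfolding iteration_eq_distr using D by (intro nn_integral_cong) (simp add: emeasure_distr vimage_def Int_def conj_commute)
    also have "\<dots> = emeasure N {w\<in>space N. C n w \<in> UNIV \<and> C (Suc n) w \<in> D}"
      using sets.top[of config_space] by (intro transition_event[symmetric] D) simp
    also have "\<dots> = emeasure (distr N config_space (C (Suc n))) D"
      using D by (subst emeasure_distr) (auto intro!: arg_cong[where f="emeasure N"])
    finally show "emeasure (distr N config_space (C (Suc n))) D = emeasure (distr N config_space (C n) \<bind> iteration M Zp Zm) D" ..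
  qed
  moreover have "(\<integral>\<^sup>+w. h (C (Suc n) w) \<partial>N) = (\<integral>\<^sup>+c. h c \<partial>distr N config_space (C (Suc n)))"
    using h by (intro nn_integral_distr[symmetric]) auto
  ultimately have "(\<integral>\<^sup>+w. h (C (Suc n) w) \<partial>N) = (\<integral>\<^sup>+c. h c \<partial>(distr N config_space (C n) \<bind> iteration M Zp Zm))" by metis
  also have "\<dots> = (\<integral>\<^sup>+c. (\<integral>\<^sup>+x. h x \<partial>iteration M Zp Zm c) \<partial>distr N config_space (C n))"
    by (rule nn_integral_bind[OF h kernel])
  also have "\<dots> = (\<integral>\<^sup>+w. (\<integral>\<^sup>+x. h x \<partial>iteration M Zp Zm (C n w)) \<partial>N)"
    by (rule nn_integral_distr[OF C_measurable])
       (use measurable_compose[OF iteration_kernel nn_integral_measurable_subprob_algebra[OF h]] in simp)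
  also have "\<dots> = (\<integral>\<^sup>+w. (\<integral>\<^sup>+y. h (step (C n w) y) \<partial>M) \<partial>N)"
    unfolding iteration_eq_distr using h by (intro nn_integral_cong nn_integral_distr) auto
  finally show ?thesis .
qed

text \<open>The invariants of a running configuration under which the one-step results apply. The
  last clause secures a finite end of the process when only the horizon forces it.\<close>

definition admissible :: "config \<Rightarrow> bool" where
  "admissible c \<longleftrightarrow> (running c \<longrightarrow> 0 < level c \<and> 0 < remaining c \<and> elapsed c < \<infinity> \<and> (K < \<infinity> \<longrightarrow> remaining c < \<infinity>))"

lemma admissible_step:
  assumes "admissible c"
  shows "admissible (step c w)"
proof (cases "running c \<and> continues c w")
  case True
  then have "ennreal (enn2real (lap c w)) = lap c w" "lap c w < top" using lap_finite[of c w] by auto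
  with True show ?thesis
    using assms unfolding admissible_def step_continues[OF conjunct1[OF True] conjunct2[OF True]] restart_def Let_def continues_def
    by (auto simp: diff_gt_0_iff_gt_ennreal intro: le_less_trans[OF diff_le_self_ennreal])
next
  case False
  then show ?thesis
    using assms step_stops(1)[of c w] by (auto simp: admissible_def step_def)
qed

lemma AE_admissible: "AE w in N. admissible (C n w)"
proof (induction n)
  case 0
  show ?case using C_0 by eventually_elim (simp add: admissible_def initial_config_def a K)
next
  case (Suc n)
  let ?D = "{c. \<not> admissible c}"
  have "{c\<in>space config_space. \<not> admissible c} \<in> sets config_space" unfolding admissible_def by measurable
  then have D [measurable]: "?D \<in> sets config_space" by simp
  have "(\<integral>\<^sup>+w. indicator ?D (C (Suc n) w) \<partial>N) = (\<integral>\<^sup>+w. (\<integral>\<^sup>+x. indicator ?D (step (C n w) x) \<partial>M) \<partial>N)"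
    by (intro transition) measurable
  also have "\<dots> = (\<integral>\<^sup>+w. 0 \<partial>N)"
    by (rule nn_integral_cong_AE, use Suc in eventually_elim) (simp add: admissible_step)
  finally have "(\<integral>\<^sup>+w. indicator ?D (C (Suc n) w) \<partial>N) = 0" by simp
  then have "AE w in N. indicator ?D (C (Suc n) w) = (0 :: ennreal)" by (subst (asm) nn_integral_0_iff_AE) auto
  then show ?case by eventually_elim (simp add: indicator_def split: if_splits)
qed

text \<open>The probability that the final output lies in \<open>D\<close> when the process
  continues from \<open>c\<close>. Its expectation along the run is constant, which links the run to
  the true law without knowing when it stops.\<close>

definition "value" :: "result set \<Rightarrow> config \<Rightarrow> ennreal" where
  "value D c = (\<integral>\<^sup>+w. indicator D (result c w) \<partial>M)"

lemma value_measurable: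
  assumes D: "D \<in> sets result_space"
  shows "value D \<in> borel_measurable config_space"
  unfolding value_def[abs_def]
  by (intro borel_measurable_nn_integral)
     (use measurable_compose[OF result_measurable borel_measurable_indicator[OF D]] in \<open>simp add: case_prod_beta'\<close>)

lemma value_step:
  assumes c: "admissible c" and D: "D \<in> sets result_space"
  shows "(\<integral>\<^sup>+w. value D (step c w) \<partial>M) = value D c"
proof (cases "running c")
  case True
  then have "AE w in M. remaining c < \<infinity> \<or> first_passage (\<lambda>t. Z t w) (level c) < \<infinity>"
    using reaches c by (auto simp: admissible_def intro: AE_mp)
  then show ?thesis using result_step[OF True _ _ _ D] c True by (simp add: value_def admissible_def)
next
  case False
  then show ?thesis by (simp add: step_def value_def result_stopped emeasure_space_1)
qed

lemma value_constant:
  assumes D: "D \<in> sets result_space"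
  shows "(\<integral>\<^sup>+w. value D (C n w) \<partial>N) = value D (initial_config a K)"
proof (induction n)
  case 0
  have "(\<integral>\<^sup>+w. value D (C 0 w) \<partial>N) = (\<integral>\<^sup>+w. value D (initial_config a K) \<partial>N)"
    by (rule nn_integral_cong_AE, use C_0 in eventually_elim) simp
  then show ?case by (simp add: N.emeasure_space_1)
next
  case (Suc n)
  have "(\<integral>\<^sup>+w. value D (C (Suc n) w) \<partial>N) = (\<integral>\<^sup>+w. (\<integral>\<^sup>+x. value D (step (C n w) x) \<partial>M) \<partial>N)"
    by (intro transition value_measurable D)
  also have "\<dots> = (\<integral>\<^sup>+w. value D (C n w) \<partial>N)"
    by (rule nn_integral_cong_AE, use AE_admissible[of n] in eventually_elim) (rule value_step[OF _ D])
  finally show ?case using Suc by simp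
qed

section \<open>Decay of the discount along the run\<close>

definition running_discount :: "nat \<Rightarrow> real" where
  "running_discount n = enn2real (\<integral>\<^sup>+w. discount (C n w) \<partial>N)"

lemma discount_le_1: "discount c \<le> 1"
  by (simp add: discount_def)

lemma nn_running_discount: "(\<integral>\<^sup>+w. discount (C n w) \<partial>N) = ennreal (running_discount n)"
proof -
  have "(\<integral>\<^sup>+w. discount (C n w) \<partial>N) \<le> (\<integral>\<^sup>+w. 1 \<partial>N)" by (intro nn_integral_mono discount_le_1)
  then have "(\<integral>\<^sup>+w. discount (C n w) \<partial>N) < \<infinity>" by (simp add: N.emeasure_space_1 le_less_trans)
  then show ?thesis by (simp add: running_discount_def)
qed

lemma running_discount_nonneg: "0 \<le> running_discount n"
  by (simp add: running_discount_def)

lemma discount_step_AE: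
  assumes "\<And>c. running c \<Longrightarrow> admissible c \<Longrightarrow> (\<integral>\<^sup>+x. h (step c x) \<partial>M) \<le> g c"
    "\<And>c. \<not> running c \<Longrightarrow> h c = 0" and h: "h \<in> borel_measurable config_space"
  shows "(\<integral>\<^sup>+w. h (C (Suc n) w) \<partial>N) \<le> (\<integral>\<^sup>+w. g (C n w) \<partial>N)"
  unfolding transition[OF h]
proof (rule nn_integral_mono_AE, use AE_admissible[of n] in eventually_elim)
  case (elim w)
  then show ?case using assms(1)[of "C n w"] assms(2)[of "C n w"] by (cases "running (C n w)") (auto simp: step_def)
qed

lemma discount_tendsto_0_zero_possible:
  assumes "0 < t0" "0 < prob {x\<in>space M. Zm t0 x = 0}"
  shows "running_discount \<longlonglongrightarrow> 0"
proof -
  obtain \<kappa> where \<kappa>: "0 \<le> \<kappa>" "\<kappa> < 1"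
    "\<And>c. running c \<Longrightarrow> elapsed c < \<infinity> \<Longrightarrow> (\<integral>\<^sup>+x. discount (step c x) \<partial>M) \<le> discount c * ennreal \<kappa>"
    using decay_if_zero_possible[OF assms] by blast
  have step: "running_discount (Suc n) \<le> running_discount n * \<kappa>" for n
  proof -
    have "(\<integral>\<^sup>+w. discount (C (Suc n) w) \<partial>N) \<le> (\<integral>\<^sup>+w. discount (C n w) * ennreal \<kappa> \<partial>N)"
    proof (rule discount_step_AE)
      show "(\<integral>\<^sup>+x. discount (step c x) \<partial>M) \<le> discount c * ennreal \<kappa>" if "running c" "admissible c" for c
        using that by (intro \<kappa>(3)) (auto simp: admissible_def)
    qed (simp_all add: discount_def)
    also have "\<dots> = ennreal (running_discount n * \<kappa>)"
      using \<kappa>(1) by (simp add: nn_integral_multc nn_running_discount ennreal_mult running_discount_nonneg)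
    finally show ?thesis using \<kappa>(1) running_discount_nonneg[of n] by (simp add: nn_running_discount)
  qed
  have bound: "running_discount n \<le> running_discount 0 * \<kappa> ^ n" for n
  proof (induction n)
    case (Suc n)
    from mult_right_mono[OF this \<kappa>(1)] show ?case using step[of n] by (simp add: algebra_simps)
  qed simp
  have "(\<lambda>n. running_discount 0 * \<kappa> ^ n) \<longlonglongrightarrow> running_discount 0 * 0"
    using \<kappa>(1,2) by (intro tendsto_mult tendsto_const LIMSEQ_realpow_zero)
  then have "(\<lambda>n. running_discount 0 * \<kappa> ^ n) \<longlonglongrightarrow> 0" by simp
  from tendsto_sandwich[OF always_eventually always_eventually tendsto_const[of 0] this] show ?thesis
    using bound running_discount_nonneg by blast
qed

text \<open>The limit of the discounts exists by monotonicity. For each \<open>n\<close> it is at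
  most \<open>approach_prob n a\<close>: levels above \<open>1 / (n + 1)\<close> lose a fixed factor
  and die out, and lower ones are controlled by the approach supermartingale. Letting
  \<open>n\<close> grow leaves the creeping weight of the level \<open>a\<close>, which is
  0.\<close>

lemma discount_tendsto_0_positive:
  assumes pos: "AE x in M. \<forall>t>0. 0 < Zm t x"
  shows "running_discount \<longlonglongrightarrow> 0"
proof -
  have le_approach: "L \<le> approach_prob n a" if lim: "running_discount \<longlonglongrightarrow> L" for L n
  proof -
    define \<epsilon> where "\<epsilon> = 1 / real (Suc n)"
    have "0 < \<epsilon>" unfolding \<epsilon>_def by simp
    then obtain \<kappa> where \<kappa>: "0 \<le> \<kappa>" "\<kappa> < 1"
      "\<And>c. running c \<Longrightarrow> elapsed c < \<infinity> \<Longrightarrow> \<epsilon> \<le> level c \<Longrightarrow> (\<integral>\<^sup>+x. discount (step c x) \<partial>M) \<le> discount c * ennreal \<kappa>"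
      using decay_above_level by blast
    define high where "high c = discount c * indicator {c. \<epsilon> \<le> level c} c" for c
    have high_meas [measurable]: "high \<in> borel_measurable config_space"
    proof -
      have "{c\<in>space config_space. \<epsilon> \<le> level c} \<in> sets config_space" by measurable
      then show ?thesis unfolding high_def[abs_def] by simp
    qed
    define G where "G k = enn2real (\<integral>\<^sup>+w. high (C k w) \<partial>N)" for k
    have G_nonneg: "0 \<le> G k" for k by (simp add: G_def)
    have high_le: "high c \<le> discount c" for c unfolding high_def by (simp add: indicator_def)
    have G: "(\<integral>\<^sup>+w. high (C k w) \<partial>N) = ennreal (G k)" for k
    proof -
      have "(\<integral>\<^sup>+w. high (C k w) \<partial>N) \<le> (\<integral>\<^sup>+w. discount (C k w) \<partial>N)" by (intro nn_integral_mono high_le)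
      also have "\<dots> < top" by (simp add: nn_running_discount)
      finally show ?thesis unfolding G_def by simp
    qed
    \<comment> \<open>Each iteration removes at least the share \<open>1 - \<kappa>\<close> of the
      mass at high levels. Since the total mass converges, the removed amounts tend to 0, and so
      does the mass \<open>G\<close> at high levels.\<close>
    have step: "running_discount (Suc k) + (1 - \<kappa>) * G k \<le> running_discount k" for k
    proof -
      have "(\<integral>\<^sup>+w. discount (C (Suc k) w) \<partial>N) + ennreal (1 - \<kappa>) * (\<integral>\<^sup>+w. high (C k w) \<partial>N) =
        (\<integral>\<^sup>+w. (\<integral>\<^sup>+x. discount (step (C k w) x) \<partial>M) + ennreal (1 - \<kappa>) * high (C k w) \<partial>N)"
      proof -
        have "(\<lambda>p. step (C k (fst p)) (snd p)) \<in> measurable (N \<Otimes>\<^sub>M M) config_space"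
          using measurable_compose[OF _ step_measurable, of "\<lambda>p. (C k (fst p), snd p)" "N \<Otimes>\<^sub>M M"] by simp
        then have "(\<lambda>w. \<integral>\<^sup>+x. discount (step (C k w) x) \<partial>M) \<in> borel_measurable N"
          by (intro borel_measurable_nn_integral) (simp add: case_prod_beta' measurable_compose[OF _ discount_measurable])
        then show ?thesis unfolding transition[OF discount_measurable] by (subst nn_integral_add) (auto simp: nn_integral_cmult)
      qed
      also have "\<dots> \<le> (\<integral>\<^sup>+w. discount (C k w) \<partial>N)"
      proof (rule nn_integral_mono_AE, use AE_admissible[of k] in eventually_elim)
        case (elim w)
        show ?case
        proof (cases "running (C k w)")
          case True
          then have fin: "elapsed (C k w) < \<infinity>" using elim by (simp add: admissible_def)
          show ?thesis
          proof (cases "\<epsilon> \<le> level (C k w)")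
            case high: True
            have "(\<integral>\<^sup>+x. discount (step (C k w) x) \<partial>M) + ennreal (1 - \<kappa>) * high (C k w) \<le> discount (C k w) * ennreal \<kappa> + ennreal (1 - \<kappa>) * discount (C k w)"
              using \<kappa>(3)[OF True fin high] high_le[of "C k w"] by (intro add_mono mult_left_mono) auto
            also have "\<dots> = discount (C k w) * (ennreal \<kappa> + ennreal (1 - \<kappa>))" by (simp add: algebra_simps)
            also have "\<dots> = discount (C k w)" using \<kappa>(1,2) by (simp add: ennreal_plus[symmetric] del: ennreal_plus)
            finally show ?thesis .
          next
            case False
            have "(\<integral>\<^sup>+x. discount (step (C k w) x) \<partial>M) \<le> discount (C k w) * (\<integral>\<^sup>+x. ennreal 1 \<partial>M)"
              by (rule discount_step_le[OF True fin]) auto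
            then show ?thesis using False by (simp add: high_def emeasure_space_1)
          qed
        qed (simp add: step_def high_def discount_def)
      qed
      finally have "ennreal (running_discount (Suc k) + (1 - \<kappa>) * G k) \<le> ennreal (running_discount k)"
        unfolding nn_running_discount G using \<kappa>(2) running_discount_nonneg[of "Suc k"] by (simp add: ennreal_mult G_def)
      then show ?thesis using running_discount_nonneg[of k] by simp
    qed
    have "G \<longlonglongrightarrow> 0"
    proof -
      have "(\<lambda>k. (running_discount k - running_discount (Suc k)) / (1 - \<kappa>)) \<longlonglongrightarrow> (L - L) / (1 - \<kappa>)"
        using \<kappa>(2) by (intro tendsto_divide tendsto_diff tendsto_const lim LIMSEQ_Suc[OF lim]) simp
      then have lim0: "(\<lambda>k. (running_discount k - running_discount (Suc k)) / (1 - \<kappa>)) \<longlonglongrightarrow> 0" by simp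
      have "G k \<le> (running_discount k - running_discount (Suc k)) / (1 - \<kappa>)" for k
        using step[of k] \<kappa>(2) by (simp add: pos_le_divide_eq algebra_simps)
      moreover have "0 \<le> G k" for k by (simp add: G_def)
      ultimately show ?thesis
        using tendsto_sandwich[OF always_eventually always_eventually tendsto_const[of 0] lim0] by blast
    qed
    then have lim': "(\<lambda>k. G k + approach_prob n a) \<longlonglongrightarrow> 0 + approach_prob n a" by (intro tendsto_add tendsto_const)
    have nonneg: "0 \<le> approach_prob n u" for u unfolding approach_prob_def by (intro integral_nonneg_AE) (simp add: weight_bounds)
    have pot_meas [measurable]: "(\<lambda>c. discount c * ennreal (approach_prob n (level c))) \<in> borel_measurable config_space"
    proof -
      have "(\<lambda>p. approach_weight n (level (fst p)) (sample_path Z (snd p))) \<in> borel_measurable (config_space \<Otimes>\<^sub>M M)"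
        by (intro approach_weight_measurable measurable_compose[OF measurable_snd diff.sample_path_measurable]) measurable
      then have "(\<lambda>c. \<integral>\<^sup>+x. ennreal (approach_weight n (level c) (sample_path Z x)) \<partial>M) \<in> borel_measurable config_space"
        by (intro borel_measurable_nn_integral) (simp add: case_prod_beta')
      then have [measurable]: "(\<lambda>c. ennreal (approach_prob n (level c))) \<in> borel_measurable config_space"
        by (simp add: approach_weight_sample_path nn_approach_prob)
      show ?thesis by measurable
    qed
    have pot: "(\<integral>\<^sup>+w. discount (C k w) * ennreal (approach_prob n (level (C k w))) \<partial>N) \<le> ennreal (approach_prob n a)" for k
    proof (induction k)
      case 0
      have "(\<integral>\<^sup>+w. discount (C 0 w) * ennreal (approach_prob n (level (C 0 w))) \<partial>N) = (\<integral>\<^sup>+w. ennreal (approach_prob n a) \<partial>N)"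
        by (rule nn_integral_cong_AE, use C_0 in eventually_elim) (simp add: initial_config_def discount_def)
      then show ?case by (simp add: N.emeasure_space_1)
    next
      case (Suc k)
      have "(\<integral>\<^sup>+w. discount (C (Suc k) w) * ennreal (approach_prob n (level (C (Suc k) w))) \<partial>N) \<le>
        (\<integral>\<^sup>+w. discount (C k w) * ennreal (approach_prob n (level (C k w))) \<partial>N)"
      proof (rule discount_step_AE[OF _ _ pot_meas])
        show "(\<integral>\<^sup>+x. discount (step c x) * ennreal (approach_prob n (level (step c x))) \<partial>M) \<le> discount c * ennreal (approach_prob n (level c))"
          if "running c" "admissible c" for c
          using that by (intro approach_supermartingale[OF _ _ _ pos]) (auto simp: admissible_def)
      qed (simp add: discount_def)
      then show ?case using Suc by (rule order_trans)
    qed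
    \<comment> \<open>Below \<open>\<epsilon>\<close> the approach probability is 1, so there the
      discount is its own discounted approach probability.\<close>
    have "running_discount k \<le> G k + approach_prob n a" for k
    proof -
      have "(\<integral>\<^sup>+w. discount (C k w) \<partial>N) \<le> (\<integral>\<^sup>+w. high (C k w) + discount (C k w) * ennreal (approach_prob n (level (C k w))) \<partial>N)"
      proof (rule nn_integral_mono_AE, use AE_admissible[of k] in eventually_elim)
        case (elim w)
        then show ?case
          using approach_prob_eq_1[of "level (C k w)" n, folded \<epsilon>_def]
          by (cases "running (C k w)"; cases "\<epsilon> \<le> level (C k w)") (auto simp: high_def not_le admissible_def discount_def)
      qed
      also have "\<dots> \<le> ennreal (G k) + ennreal (approach_prob n a)"
        using pot[of k] by (subst nn_integral_add) (auto simp: G intro: add_left_mono)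
      finally have "ennreal (running_discount k) \<le> ennreal (G k + approach_prob n a)"
        unfolding nn_running_discount using nonneg[of a] G_nonneg[of k] by simp
      then show ?thesis using nonneg[of a] G_nonneg[of k] by (subst (asm) ennreal_le_iff) auto
    qed
    then show ?thesis using LIMSEQ_le[OF lim lim'] by auto
  qed
  have "decseq running_discount"
  proof (rule decseq_SucI)
    fix k
    have "(\<integral>\<^sup>+w. discount (C (Suc k) w) \<partial>N) \<le> (\<integral>\<^sup>+w. discount (C k w) \<partial>N)"
    proof (rule discount_step_AE)
      show "(\<integral>\<^sup>+x. discount (step c x) \<partial>M) \<le> discount c" if "running c" "admissible c" for c
        using discount_step_le[of c "\<lambda>_. 1"] that by (simp add: admissible_def emeasure_space_1)
    qed (simp_all add: discount_def)
    then show "running_discount (Suc k) \<le> running_discount k" by (simp add: nn_running_discount running_discount_nonneg)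
  qed
  then obtain L where L: "running_discount \<longlonglongrightarrow> L"
    using decseq_convergent[of running_discount 0] running_discount_nonneg by blast
  have "L \<le> creep_prob a" using le_approach[OF L] by (intro LIMSEQ_le_const[OF approach_prob_tendsto]) auto
  then have "L \<le> 0" using creep_prob_eq_0[OF a] by simp
  moreover have "0 \<le> L" using L running_discount_nonneg by (intro LIMSEQ_le_const) auto
  ultimately show ?thesis using L by simp
qed

lemma discount_tendsto_0: "running_discount \<longlonglongrightarrow> 0"
  by (cases rule: positivity_cases) (auto intro: discount_tendsto_0_positive discount_tendsto_0_zero_possible)

end

section \<open>From decay of the discount to termination and the law of the output\<close>

context sampling_procedure
begin

lemma AE_cap_finite: "AE w in M. cap (initial_config a K) w < \<infinity>"
  using reaches by (auto simp: cap_def initial_config_def min_less_iff_disj intro: AE_mp)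

lemma cap_measurable [measurable]: "cap c \<in> borel_measurable M"
proof -
  have "(\<lambda>w. first_passage (\<lambda>t. Z t w) (level c)) \<in> borel_measurable M" by (intro diff.optional_time_measurable Z_passage_optional)
  then show ?thesis unfolding cap_def[abs_def] by measurable
qed

text \<open>By the constancy of the expected value, the clock of a running procedure is stochastically dominated by \<open>\<tau>\<close>;
  with the decay of the discount this bounds the probability of still running.\<close>

lemma running_prob_le:
  "N.prob {w\<in>space N. running (C n w)} \<le>
    prob {y\<in>space M. ennreal R < cap (initial_config a K) y} + exp R * running_discount n" if R: "0 \<le> R"
proof -
  let ?D = "{x\<in>space result_space. ennreal R < fst x}"
  have D: "?D \<in> sets result_space" by measurable
  have "emeasure N {w\<in>space N. running (C n w)} = (\<integral>\<^sup>+w. indicator {w\<in>space N. running (C n w)} w \<partial>N)"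
    by (rule nn_integral_indicator[symmetric]) measurable
  also have "\<dots> \<le> (\<integral>\<^sup>+w. value ?D (C n w) + ennreal (exp R) * discount (C n w) \<partial>N)"
  proof (rule nn_integral_mono_AE, use AE_admissible[of n] in eventually_elim)
    case (elim w)
    show ?case
    proof (cases "running (C n w)")
      case True
      then obtain T where T: "elapsed (C n w) = ennreal T" "0 \<le> T" using elim by (cases "elapsed (C n w)") (auto simp: admissible_def)
      \<comment> \<open>Either the clock is at most \<open>R\<close> and the discount is at least
        \<open>exp (- R)\<close>, or it has passed \<open>R\<close> and the final time exceeds
        \<open>R\<close> with certainty.\<close>
      have "1 \<le> value ?D (C n w) + ennreal (exp R) * discount (C n w)"
      proof (cases "T \<le> R")
        case le: True
        then have "1 \<le> exp R * exp (- T)" by (simp add: exp_add[symmetric])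
        then have "1 \<le> ennreal (exp R) * discount (C n w)"
          using True T by (simp add: discount_def ennreal_mult[symmetric] ennreal_1[symmetric] ennreal_leI del: ennreal_1)
        then show ?thesis by (rule order_trans) simp
      next
        case False
        then have "ennreal R < ennreal T" using R by (intro ennreal_lessI) auto
        then have "ennreal R < ennreal T + x" for x by (rule less_le_trans) simp
        then have "result (C n w) y \<in> ?D" if "y \<in> space M" for y
          using result_running[OF that True] T by (simp add: space_pair_measure)
        then have "value ?D (C n w) = (\<integral>\<^sup>+y. 1 \<partial>M)" unfolding value_def by (intro nn_integral_cong) simp
        then show ?thesis by (simp add: emeasure_space_1)
      qed
      then show ?thesis by (rule order_trans[rotated]) (simp add: indicator_def)
    qed simp
  qed
  also have "\<dots> = value ?D (initial_config a K) + ennreal (exp R) * ennreal (running_discount n)"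
    using value_constant[OF D, of n] measurable_compose[OF C_measurable value_measurable[OF D]]
    by (subst nn_integral_add) (auto simp: nn_integral_cmult nn_running_discount)
  also have "value ?D (initial_config a K) = (\<integral>\<^sup>+y. indicator {y\<in>space M. ennreal R < cap (initial_config a K) y} y \<partial>M)"
    unfolding value_def
  proof (rule nn_integral_cong)
    fix y assume "y \<in> space M"
    then show "indicator ?D (result (initial_config a K) y) = (indicator {y\<in>space M. ennreal R < cap (initial_config a K) y} y :: ennreal)"
      by (simp add: result_running initial_config_def space_pair_measure indicator_def)
  qed
  also have "\<dots> = emeasure M {y\<in>space M. ennreal R < cap (initial_config a K) y}" by (rule nn_integral_indicator) measurable
  also have "\<dots> + ennreal (exp R) * ennreal (running_discount n) =
      ennreal (prob {y\<in>space M. ennreal R < cap (initial_config a K) y} + exp R * running_discount n)"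
    by (simp add: emeasure_eq_measure ennreal_mult[symmetric] running_discount_nonneg)
  finally show ?thesis
    unfolding N.emeasure_eq_measure using running_discount_nonneg[of n] by (subst (asm) ennreal_le_iff) auto
qed

lemma running_prob_tendsto_0: "(\<lambda>n. N.prob {w\<in>space N. running (C n w)}) \<longlonglongrightarrow> 0"
proof (rule LIMSEQ_I)
  fix e :: real assume e: "0 < e"
  let ?A = "\<lambda>R :: nat. {x\<in>space M. ennreal (real R) < cap (initial_config a K) x}"
  have "(\<lambda>R. prob (?A R)) \<longlonglongrightarrow> prob (\<Inter>R. ?A R)"
  proof (intro finite_Lim_measure_decseq decseq_SucI subsetI)
    fix R x assume "x \<in> ?A (Suc R)"
    moreover have "ennreal (real R) \<le> ennreal (real (Suc R))" by (rule ennreal_leI) simp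
    ultimately show "x \<in> ?A R" using le_less_trans[of "ennreal (real R)" "ennreal (real (Suc R))" "cap (initial_config a K) x"] by (simp del: of_nat_Suc)
  qed auto
  moreover have "prob (\<Inter>R. ?A R) = 0"
  proof -
    have "(\<Inter>R. ?A R) = {x\<in>space M. \<not> cap (initial_config a K) x < \<infinity>}"
    proof safe
      fix x assume "x \<in> (\<Inter>R. ?A R)" "cap (initial_config a K) x < \<infinity>"
      moreover obtain R :: nat where "enn2real (cap (initial_config a K) x) < real R" using reals_Archimedean2 by blast
      then have "ennreal (enn2real (cap (initial_config a K) x)) < ennreal (real R)" by (subst ennreal_less_iff) auto
      ultimately show False by (auto dest: spec[of _ R])
    qed (auto simp: top.not_eq_extremum[symmetric])
    then have "emeasure M (\<Inter>R. ?A R) = 0" using AE_cap_finite by (simp add: emeasure_eq_0_AE)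
    then show ?thesis by (simp add: measure_def)
  qed
  ultimately have "\<forall>\<^sub>F R in sequentially. prob (?A R) < e / 2" using e by (intro order_tendstoD) auto
  then obtain R where R: "prob (?A R) < e / 2" by (auto simp: eventually_sequentially)
  have "(\<lambda>n. exp (real R) * running_discount n) \<longlonglongrightarrow> exp (real R) * 0" by (intro tendsto_mult tendsto_const discount_tendsto_0)
  then have "\<forall>\<^sub>F n in sequentially. exp (real R) * running_discount n < e / 2" by (rule order_tendstoD) (use e in simp)
  then obtain n0 where n0: "\<And>n. n0 \<le> n \<Longrightarrow> exp (real R) * running_discount n < e / 2" by (auto simp: eventually_sequentially)
  have "norm (N.prob {w\<in>space N. running (C n w)} - 0) < e" if "n0 \<le> n" for n
    using running_prob_le[of "real R" n] R n0[OF that] measure_nonneg[of N "{w\<in>space N. running (C n w)}"] by simp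
  then show "\<exists>no. \<forall>n\<ge>no. norm (N.prob {w\<in>space N. running (C n w)} - 0) < e" by blast
qed

lemma AE_stops: "AE w in N. stops C w"
proof -
  have "N.prob {w\<in>space N. \<forall>n. running (C n w)} \<le> N.prob {w\<in>space N. running (C n w)}" for n
    by (rule N.finite_measure_mono) auto
  then have "N.prob {w\<in>space N. \<forall>n. running (C n w)} \<le> 0" using LIMSEQ_le_const[OF running_prob_tendsto_0] by blast
  then have "emeasure N {w\<in>space N. \<forall>n. running (C n w)} = 0" by (simp add: N.emeasure_eq_measure measure_le_0_iff)
  then show ?thesis unfolding stops_def by (intro AE_I'[of "{w\<in>space N. \<forall>n. running (C n w)}"]) (auto simp: null_sets_def)
qed

text \<open>A run prescribes only conditional laws, so that a stopped configuration stays put holds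
  almost surely and has to be derived. If \<open>\<phi>\<close> changed, a rational would separate
  its two values, and each such event is null. Values in \<open>ereal\<close> cover both the real
  and the extended components.\<close>

lemma AE_stopped_constant:
  fixes \<phi> :: "config \<Rightarrow> ereal"
  assumes \<phi> [measurable]: "\<phi> \<in> borel_measurable config_space"
  shows "AE w in N. \<not> running (C n w) \<longrightarrow> \<phi> (C (Suc n) w) = \<phi> (C n w)"
proof -
  have no_crossing: "AE w in N. \<not> (C n w \<in> B \<and> C (Suc n) w \<in> D)"
    if [measurable]: "B \<in> sets config_space" "D \<in> sets config_space"
      and disj: "\<And>c. c \<in> B \<Longrightarrow> \<not> running c \<and> c \<notin> D" for B D
  proof -
    have "emeasure N {w\<in>space N. C n w \<in> B \<and> C (Suc n) w \<in> D} = (\<integral>\<^sup>+w. indicator B (C n w) * emeasure M {y\<in>space M. step (C n w) y \<in> D} \<partial>N)"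
      by (intro transition_event) measurable
    also have "\<dots> = (\<integral>\<^sup>+w. 0 \<partial>N)" by (intro nn_integral_cong) (auto simp: indicator_def step_def dest: disj)
    finally show ?thesis by (intro AE_I'[of "{w\<in>space N. C n w \<in> B \<and> C (Suc n) w \<in> D}"]) (auto simp: null_sets_def)
  qed
  have "{c\<in>space config_space. \<phi> c < x} \<in> sets config_space" "{c\<in>space config_space. x < \<phi> c} \<in> sets config_space"
    "{c\<in>space config_space. \<not> running c \<and> \<phi> c < x} \<in> sets config_space" "{c\<in>space config_space. \<not> running c \<and> x < \<phi> c} \<in> sets config_space" for x
    by measurable
  then have level_sets: "{c. \<phi> c < x} \<in> sets config_space" "{c. x < \<phi> c} \<in> sets config_space"
    "{c. \<not> running c \<and> \<phi> c < x} \<in> sets config_space" "{c. \<not> running c \<and> x < \<phi> c} \<in> sets config_space" for x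
    by simp_all
  have "AE w in N. \<forall>q::rat. \<not> (C n w \<in> {c. \<not> running c \<and> \<phi> c < ereal (of_rat q)} \<and> C (Suc n) w \<in> {c. ereal (of_rat q) < \<phi> c})"
    unfolding AE_all_countable by (intro allI no_crossing level_sets) (auto simp: not_less less_imp_le)
  moreover have "AE w in N. \<forall>q::rat. \<not> (C n w \<in> {c. \<not> running c \<and> ereal (of_rat q) < \<phi> c} \<and> C (Suc n) w \<in> {c. \<phi> c < ereal (of_rat q)})"
    unfolding AE_all_countable by (intro allI no_crossing level_sets) (auto simp: not_less less_imp_le)
  ultimately show ?thesis
  proof eventually_elim
    case (elim w)
    show ?case
    proof (intro impI antisym leI notI)
      assume stopped: "\<not> running (C n w)"
      show False if lt: "\<phi> (C n w) < \<phi> (C (Suc n) w)" using elim(1) stopped ereal_dense3[OF lt] by auto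
      show False if lt: "\<phi> (C (Suc n) w) < \<phi> (C n w)" using elim(2) stopped ereal_dense3[OF lt] by auto
    qed
  qed
qed

lemma AE_stopped_output:
  "AE w in N. \<forall>n. \<not> running (C n w) \<longrightarrow> \<not> running (C (Suc n) w) \<and> config_output (C (Suc n) w) = config_output (C n w)"
  unfolding AE_all_countable
proof
  fix n
  let ?f = "\<lambda>c. enn2ereal (elapsed c)" and ?g = "\<lambda>c. if running c then 1 else 0 :: ereal"
  have "AE w in N. \<not> running (C n w) \<longrightarrow> ?f (C (Suc n) w) = ?f (C n w)" "AE w in N. \<not> running (C n w) \<longrightarrow> ?g (C (Suc n) w) = ?g (C n w)"
    "AE w in N. \<not> running (C n w) \<longrightarrow> ereal (up_total (C (Suc n) w)) = ereal (up_total (C n w))"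
    "AE w in N. \<not> running (C n w) \<longrightarrow> ereal (down_total (C (Suc n) w)) = ereal (down_total (C n w))"
    "AE w in N. \<not> running (C n w) \<longrightarrow> ereal (last_jump (C (Suc n) w)) = ereal (last_jump (C n w))"
    by (rule AE_stopped_constant, measurable)+
  then show "AE w in N. \<not> running (C n w) \<longrightarrow> \<not> running (C (Suc n) w) \<and> config_output (C (Suc n) w) = config_output (C n w)"
  proof eventually_elim
    case (elim w)
    show ?case using elim unfolding config_output_eq by (auto simp: enn2ereal_inject split: if_splits)
  qed
qed

lemma run_output_eq:
  "AE w in N. \<forall>n. \<not> running (C n w) \<longrightarrow> run_output C w = config_output (C n w)"
  using AE_stopped_output
proof eventually_elim
  case (elim w)
  show ?case
  proof (intro allI impI)
    fix n assume n: "\<not> running (C n w)"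
    define L where "L = (LEAST n. \<not> running (C n w))"
    have L: "\<not> running (C L w)" "L \<le> n" unfolding L_def using n LeastI[of "\<lambda>n. \<not> running (C n w)" n] by (auto intro: Least_le)
    have "\<not> running (C n w) \<and> config_output (C n w) = config_output (C L w)"
      using L(2) by (induction rule: dec_induct) (use L(1) elim in auto)
    then show "run_output C w = config_output (C n w)" by (simp add: run_output_def L_def)
  qed
qed

lemma run_output_measurable [measurable]: "run_output C \<in> measurable N result_space"
  unfolding run_output_def[abs_def]
  by (rule measurable_compose_countable[where f="\<lambda>n w. config_output (C n w)"]) measurable

text \<open>Once stopped, \<open>value D\<close> is the indicator that the output lies in
  \<open>D\<close>. Its constant expectation therefore differs from the law of the output by at most
  the probability of still running, which tends to 0.\<close>

lemma distr_run_output: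
  "distr N result_space (run_output C) = distr M result_space (result (initial_config a K))"
proof (rule measure_eqI)
  fix D assume "D \<in> sets (distr N result_space (run_output C))"
  then have D [measurable]: "D \<in> sets result_space" by simp
  let ?P = "N.prob {w\<in>space N. run_output C w \<in> D}" and ?Q = "prob {x\<in>space M. result (initial_config a K) x \<in> D}"
  let ?p = "\<lambda>n. N.prob {w\<in>space N. running (C n w)}"
  have [measurable]: "value D \<in> borel_measurable config_space" by (rule value_measurable[OF D])
  have Q: "(\<integral>\<^sup>+w. value D (C n w) \<partial>N) = ennreal ?Q" for n
  proof -
    have "value D (initial_config a K) = (\<integral>\<^sup>+x. indicator {x\<in>space M. result (initial_config a K) x \<in> D} x \<partial>M)"
      unfolding value_def by (intro nn_integral_cong) (simp add: indicator_def)
    then show ?thesis using value_constant[OF D, of n] by (simp add: emeasure_eq_measure)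
  qed
  have P: "(\<integral>\<^sup>+w. indicator D (run_output C w) \<partial>N) = ennreal ?P"
  proof -
    have "(\<integral>\<^sup>+w. indicator D (run_output C w) \<partial>N) = (\<integral>\<^sup>+w. indicator {w\<in>space N. run_output C w \<in> D} w \<partial>N)"
      by (intro nn_integral_cong) (simp add: indicator_def)
    then show ?thesis by (simp add: N.emeasure_eq_measure)
  qed
  have p: "(\<integral>\<^sup>+w. indicator {w\<in>space N. running (C n w)} w \<partial>N) = ennreal (?p n)" for n by (simp add: N.emeasure_eq_measure)
  have value_le: "value D c \<le> 1" for c
  proof -
    have "value D c \<le> (\<integral>\<^sup>+x. 1 \<partial>M)" unfolding value_def by (intro nn_integral_mono) (simp add: indicator_def)
    then show ?thesis by (simp add: emeasure_space_1)
  qed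
  have value_stopped: "value D (C n w) = indicator D (run_output C w)"
    if "\<not> running (C n w)" "\<forall>n. \<not> running (C n w) \<longrightarrow> run_output C w = config_output (C n w)" for n w
    using that by (simp add: value_def result_stopped emeasure_space_1)
  have "?P \<le> ?Q + ?p n" for n
  proof -
    have "(\<integral>\<^sup>+w. indicator D (run_output C w) \<partial>N) \<le> (\<integral>\<^sup>+w. value D (C n w) + indicator {w\<in>space N. running (C n w)} w \<partial>N)"
    proof (rule nn_integral_mono_AE, use run_output_eq AE_space in eventually_elim)
      case (elim w)
      then show ?case using value_stopped[of n w] by (cases "running (C n w)") (auto simp: indicator_def)
    qed
    also have "\<dots> = ennreal (?Q + ?p n)" by (subst nn_integral_add) (auto simp: Q p)
    finally show ?thesis unfolding P by (subst (asm) ennreal_le_iff) auto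
  qed
  then have PQ: "?P \<le> ?Q" using LIMSEQ_le_const[OF tendsto_add[OF tendsto_const running_prob_tendsto_0], of ?P ?Q] by auto
  have "?Q \<le> ?P + ?p n" for n
  proof -
    have "(\<integral>\<^sup>+w. value D (C n w) \<partial>N) \<le> (\<integral>\<^sup>+w. indicator D (run_output C w) + indicator {w\<in>space N. running (C n w)} w \<partial>N)"
    proof (rule nn_integral_mono_AE, use run_output_eq AE_space in eventually_elim)
      case (elim w)
      then show ?case using value_stopped[of n w] value_le[of "C n w"]
        by (cases "running (C n w)") (auto simp: indicator_def intro: order_trans)
    qed
    also have "\<dots> = ennreal (?P + ?p n)" by (subst nn_integral_add) (auto simp: P p)
    finally show ?thesis unfolding Q by (subst (asm) ennreal_le_iff) auto
  qed
  then have "?Q \<le> ?P" using LIMSEQ_le_const[OF tendsto_add[OF tendsto_const running_prob_tendsto_0], of ?Q ?P] by auto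
  with PQ have "?P = ?Q" by simp
  then show "emeasure (distr N result_space (run_output C)) D = emeasure (distr M result_space (result (initial_config a K))) D"
    by (simp add: emeasure_distr vimage_def Int_def conj_commute N.emeasure_eq_measure emeasure_eq_measure)
qed simp

end

section \<open>Transfer to the given process\<close>

lemma left_limit_cong:
  assumes eq: "\<And>t. 0 \<le> t \<Longrightarrow> f t = g t"
  shows "left_limit f t = left_limit g t"
proof (cases "0 < t")
  case True
  have "\<forall>\<^sub>F s in at_left t. f s = g s" using eventually_at_left_real[OF True] by eventually_elim (simp add: eq)
  then show ?thesis using True by (simp add: left_limit_def Lim_cong)
qed (simp add: left_limit_def eq)

lemma first_passage_finite_if_Limsup:
  assumes "Limsup at_top (\<lambda>t. ereal (f t)) = \<infinity>"
  shows "first_passage f b < \<infinity>"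
proof -
  have "\<exists>t>0. b < f t"
  proof (rule ccontr)
    assume "\<not> (\<exists>t>0. b < f t)"
    then have "\<forall>\<^sub>F t in at_top. ereal (f t) \<le> ereal b"
      by (intro eventually_mono[OF eventually_gt_at_top[of 0]]) (simp, meson not_less)
    then have "Limsup at_top (\<lambda>t. ereal (f t)) \<le> ereal b" by (rule Limsup_bounded)
    then show False using assms by simp
  qed
  then show ?thesis by (simp add: first_passage_finite_iff[simplified])
qed

theorem proposition5p1:
  fixes M :: "'a measure"
    and Z Zp Zm :: "real \<Rightarrow> 'a \<Rightarrow> real"
    and \<nu> :: "real measure"
    and d dm a :: real
    and K :: ennreal
    and N :: "'w measure"
    and C :: "nat \<Rightarrow> 'w \<Rightarrow> config"
    and \<tau> :: "'a \<Rightarrow> ennreal"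
  assumes Z: "levy_process M Z" "bounded_variation_process M Z"
    and Z_char: "drift_levy_measure M Z d \<nu>" "d \<le> 0"
    and \<nu>: "emeasure \<nu> UNIV = \<infinity>" "(\<integral>\<^sup>+ x. ennreal (min \<bar>x\<bar> 1) \<partial>\<nu>) < \<infinity>"
    and decomposition: "\<And>t \<omega>. t \<ge> 0 \<Longrightarrow> \<omega> \<in> space M \<Longrightarrow> Z t \<omega> = Zp t \<omega> - Zm t \<omega>"
    and indep: "indep_processes M Zp Zm"
    and Zp: "subordinator M Zp" "drift_levy_measure M Zp 0 (positive_part_measure \<nu>)"
    and Zm: "subordinator M Zm" "drift_levy_measure M Zm dm (negative_part_measure \<nu>)"
    and a: "a > 0"
    and K: "K > 0"
    and tau: "\<And>\<omega>. \<tau> \<omega> = min (first_passage (\<lambda>t. Z t \<omega>) a) K"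
    and passage: "(AE \<omega> in M. Limsup at_top (\<lambda>t. ereal (Z t \<omega>)) = \<infinity>) \<or> K < \<infinity>"
    and run: "procedure_run M Zp Zm a K N C"
  shows "(AE w in N. stops C w) \<and>
    distr N (borel \<Otimes>\<^sub>M borel \<Otimes>\<^sub>M borel \<Otimes>\<^sub>M borel) (run_output C) =
    distr M (borel \<Otimes>\<^sub>M borel \<Otimes>\<^sub>M borel \<Otimes>\<^sub>M borel)
      (\<lambda>\<omega>. (\<tau> \<omega>,
            left_limit (\<lambda>t. Zp t \<omega>) (enn2real (\<tau> \<omega>)),
            Zm (enn2real (\<tau> \<omega>)) \<omega>,
            jump (\<lambda>t. Z t \<omega>) (enn2real (\<tau> \<omega>))))"
proof -
  interpret D: levy_difference M Zp Zm by unfold_locales (rule Zp Zm indep)+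
  \<comment> \<open>Agreement at nonnegative times on the sample space suffices, as passage times,
    left limits and one-dimensional laws see nothing else.\<close>
  have Z_eq: "D.Z t \<omega> = Z t \<omega>" if "0 \<le> t" "\<omega> \<in> space M" for t \<omega>
    using decomposition[OF that] by (simp add: D.Z_def)
  then have "distr M borel (D.Z t) = distr M borel (Z t)" if "0 \<le> t" for t
    using that by (intro distr_cong) auto
  then have char: "drift_levy_measure M D.Z d \<nu>"
    using Z_char(1) unfolding drift_levy_measure_def by simp
  have fp: "first_passage (\<lambda>t. D.Z t \<omega>) b = first_passage (\<lambda>t. Z t \<omega>) b" if "\<omega> \<in> space M" for \<omega> b
    using Z_eq that by (intro first_passage_cong) auto
  \<comment> \<open>The limit superior is used only through its consequence that every level is
    exceeded in finite time.\<close>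
  have reaches: "K < \<infinity> \<or> (\<forall>b. AE \<omega> in M. first_passage (\<lambda>t. D.Z t \<omega>) b < \<infinity>)"
  proof (cases "K < \<infinity>")
    case False
    with passage have "AE \<omega> in M. Limsup at_top (\<lambda>t. ereal (Z t \<omega>)) = \<infinity>" by simp
    then have "AE \<omega> in M. first_passage (\<lambda>t. D.Z t \<omega>) b < \<infinity>" for b
      using AE_space by eventually_elim (simp add: fp first_passage_finite_if_Limsup[simplified])
    then show ?thesis by blast
  qed simp
  interpret P: sampling_procedure M Zp Zm \<nu> d dm a K N C
    by unfold_locales (rule Zp(2) Zm(2) char \<nu>(1) a K run reaches)+
  have "D.result (initial_config a K) \<omega> = (\<tau> \<omega>, left_limit (\<lambda>t. Zp t \<omega>) (enn2real (\<tau> \<omega>)),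
      Zm (enn2real (\<tau> \<omega>)) \<omega>, jump (\<lambda>t. Z t \<omega>) (enn2real (\<tau> \<omega>)))" if \<omega>: "\<omega> \<in> space M" for \<omega>
  proof -
    have "left_limit (\<lambda>t. D.Z t \<omega>) r = left_limit (\<lambda>t. Z t \<omega>) r" for r
      using Z_eq \<omega> by (intro left_limit_cong) auto
    moreover have "D.cap (initial_config a K) \<omega> = \<tau> \<omega>"
      using fp[OF \<omega>] by (simp add: D.cap_def initial_config_def tau)
    ultimately show ?thesis
      using D.result_running[OF \<omega>, of "initial_config a K"] Z_eq[OF _ \<omega>]
      by (simp add: initial_config_def jump_def)
  qed
  then have "distr M result_space (D.result (initial_config a K)) =
    distr M result_space (\<lambda>\<omega>. (\<tau> \<omega>, left_limit (\<lambda>t. Zp t \<omega>) (enn2real (\<tau> \<omega>)),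
      Zm (enn2real (\<tau> \<omega>)) \<omega>, jump (\<lambda>t. Z t \<omega>) (enn2real (\<tau> \<omega>))))"
    by (intro distr_cong) auto
  then show ?thesis using P.AE_stops P.distr_run_output by simp
qed

end
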